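(* Let $\theta>0$ be fixed, $c_n=\langle n\rangle^{-(\frac12+\theta)}$ for $n\in\mathbb{Z}$, and let $(g_n)_{n\in\mathbb{Z}}$ be i.i.d. standard complex Gaussian random variables. Let $u_0=\sum_nc_ng_ne^{inx}$ and for each $\epsilon>0$ let $u$ be the solution of $$iu_t+\Delta u=\epsilon^2|u|^2u\ \text{ on }\mathbb{T},\qquad u(0,x)=u_0(x),$$ and $$u_{app}(t,x)=e^{-2it\epsilon^2\frac1{2\pi}\|u_0\|_{L^2_x}^2}\sum_{n\in\mathbb{Z}}c_ng_n\,e^{inx}\,e^{it\epsilon^2c_n^2|g_n|^2-itn^2}.$$ Let $T_\epsilon>0$ with $T_\epsilon=O(\epsilon^{-1})$. Then for every sufficiently large constant $C_0$ there exist $s>\frac12$ and $\delta_1>0$ such that, for all sufficiently small $\epsilon>0$, $$-\ln\mathbb{P}\Big(\|u-u_{app}\|_{L^\infty_tH^s([0,T_\epsilon]\times\mathbb{T})}\ge\epsilon^{-\frac12+\delta_1}\Big)\ge C_0\,\epsilon^{-1}.$$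
   Context: $\mathbb{T}=\mathbb{R}/2\pi\mathbb{Z}$, $\Delta=\partial_x^2$, $\langle n\rangle=(1+|n|^2)^{1/2}$, and $\|f\|_{L^2_x}^2=\int_0^{2\pi}|f|^2dx$. $H^s$ is the $L^2$-based Sobolev space on $\mathbb{T}$. A standard complex Gaussian $g$ is a centered circularly symmetric complex Gaussian with $\mathbb{E}|g|^2=1$. The data $u_0$ lies in $L^2(\mathbb{T})$ almost surely, and $u$ is the global solution given by the classical (Bourgain 1993) $L^2$ flow. $T_\epsilon=O(\epsilon^{-1})$ means $T_\epsilon\le K\epsilon^{-1}$ with $K$ independent of $\epsilon$. *)

theory Defs
  imports "HOL-Probability.Probability"
begin

text \<open>Functions on the torus \<open>\<real> / 2\<pi>\<int>\<close> are represented by functions on the reals of which only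
  the restriction to \<open>[0, 2\<pi>]\<close> is ever used.\<close>

definition L2_torus :: "(real \<Rightarrow> complex) \<Rightarrow> bool" where
  "L2_torus f \<longleftrightarrow> set_borel_measurable lborel {0..2*pi} f \<and>
     set_integrable lborel {0..2*pi} (\<lambda>x. (norm (f x))\<^sup>2)"

definition L2_norm :: "(real \<Rightarrow> complex) \<Rightarrow> real" where
  "L2_norm f = sqrt (LINT x:{0..2*pi}|lborel. (norm (f x))\<^sup>2)"

definition fourier_coeff :: "(real \<Rightarrow> complex) \<Rightarrow> int \<Rightarrow> complex" where
  "fourier_coeff f n =
     complex_of_real (1 / (2*pi)) * (LINT x:{0..2*pi}|lborel. f x * cis (- (of_int n * x)))"

definition japanese :: "int \<Rightarrow> real" where
  "japanese n = sqrt (1 + (real_of_int n)\<^sup>2)"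

text \<open>The factor \<open>2\<pi>\<close> makes the norm for \<open>s = 0\<close> equal to the \<open>L\<^sup>2\<close> norm above.
  The norm is infinite for functions outside \<open>H\<^sup>s\<close>. It is only applied to functions in \<open>L\<^sup>2\<close>.\<close>

definition Hs_norm :: "real \<Rightarrow> (real \<Rightarrow> complex) \<Rightarrow> ereal" where
  "Hs_norm s f =
     (if (\<lambda>n. japanese n powr (2 * s) * (norm (fourier_coeff f n))\<^sup>2) summable_on UNIV
      then ereal (sqrt (2*pi * (\<Sum>\<^sub>\<infinity>n. japanese n powr (2 * s) * (norm (fourier_coeff f n))\<^sup>2)))
      else \<infinity>)"

text \<open>The sum of the trigonometric series with coefficients \<open>a\<close>, as a limit in \<open>L\<^sup>2\<close>. It exists iff
  \<open>a\<close> is square summable, and it is then unique up to equality almost everywhere on \<open>[0, 2\<pi>]\<close>.\<close>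

definition trig_series :: "(int \<Rightarrow> complex) \<Rightarrow> real \<Rightarrow> complex" where
  "trig_series a = (SOME f. L2_torus f \<and>
     (\<lambda>N::nat. L2_norm (\<lambda>x. (\<Sum>n\<in>{-int N..int N}. a n * cis (of_int n * x)) - f x))
       \<longlonglongrightarrow> 0)"

text \<open>\<open>u\<close> is the global \<open>L\<^sup>2\<close> solution of \<open>i u\<^sub>t + \<Delta> u = \<epsilon>\<^sup>2 |u|\<^sup>2 u\<close>, \<open>u(0) = f\<close>, for nonnegative times:
  it lies in Bourgain's uniqueness class \<open>C\<^sub>t L\<^sup>2 \<inter> L\<^sup>4\<^sub>l\<^sub>o\<^sub>c\<close> and satisfies the integral equation
  \<open>u(t) = S(t) f - i \<epsilon>\<^sup>2 \<integral>\<^sub>0\<^sup>t S(t - \<tau>) (|u|\<^sup>2 u)(\<tau>) d\<tau>\<close> with \<open>S(t) = exp(it\<Delta>)\<close>, written for each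
  Fourier mode. As \<open>u\<close> is locally in \<open>L\<^sup>4\<close> in space-time, \<open>|u|\<^sup>2 u\<close> is integrable on \<open>[0,t] \<times> [0,2\<pi>]\<close>,
  so that its Fourier coefficients exist for almost every \<open>\<tau>\<close> and are integrable in \<open>\<tau>\<close>.
  The initial condition is the case \<open>t = 0\<close>.\<close>

definition nls_solution :: "real \<Rightarrow> (real \<Rightarrow> complex) \<Rightarrow> (real \<Rightarrow> real \<Rightarrow> complex) \<Rightarrow> bool" where
  "nls_solution \<epsilon> f u \<longleftrightarrow>
     L2_torus f \<and>
     set_borel_measurable lborel ({0..} \<times> {0..2*pi}) (\<lambda>(t, x). u t x) \<and>
     (\<forall>t\<ge>0. L2_torus (u t)) \<and>
     (\<forall>t\<ge>0. ((\<lambda>r. L2_norm (\<lambda>x. u r x - u t x)) \<longlongrightarrow> 0) (at t within {0..})) \<and>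
     (\<forall>t\<ge>0. set_integrable lborel ({0..t} \<times> {0..2*pi}) (\<lambda>(\<tau>, x). norm (u \<tau> x) ^ 4)) \<and>
     (\<forall>t\<ge>0. \<forall>n. fourier_coeff (u t) n =
        cis (- (t * (of_int n)\<^sup>2)) * fourier_coeff f n
        - \<i> * complex_of_real (\<epsilon>\<^sup>2) *
          (LINT \<tau>:{0..t}|lborel. cis (- ((t - \<tau>) * (of_int n)\<^sup>2)) *
             fourier_coeff (\<lambda>x. complex_of_real ((norm (u \<tau> x))\<^sup>2) * u \<tau> x) n))"

definition c_coeff :: "real \<Rightarrow> int \<Rightarrow> real" where
  "c_coeff \<theta> n = japanese n powr (- (1/2 + \<theta>))"

text \<open>In the next two definitions \<open>\<gamma>\<close> is a realization of the Gaussian family.\<close>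

definition initial_data :: "real \<Rightarrow> (int \<Rightarrow> complex) \<Rightarrow> real \<Rightarrow> complex" where
  "initial_data \<theta> \<gamma> = trig_series (\<lambda>n. complex_of_real (c_coeff \<theta> n) * \<gamma> n)"

definition u_app :: "real \<Rightarrow> (int \<Rightarrow> complex) \<Rightarrow> real \<Rightarrow> real \<Rightarrow> real \<Rightarrow> complex" where
  "u_app \<theta> \<gamma> \<epsilon> t x =
     cis (- (2 * t * \<epsilon>\<^sup>2 * (1 / (2*pi)) * (L2_norm (initial_data \<theta> \<gamma>))\<^sup>2)) *
     trig_series (\<lambda>n. complex_of_real (c_coeff \<theta> n) * \<gamma> n *
        cis (t * \<epsilon>\<^sup>2 * (c_coeff \<theta> n)\<^sup>2 * (norm (\<gamma> n))\<^sup>2 - t * (of_int n)\<^sup>2)) x"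

definition Linf_Hs_norm :: "real \<Rightarrow> real \<Rightarrow> (real \<Rightarrow> real \<Rightarrow> complex) \<Rightarrow> ereal" where
  "Linf_Hs_norm s T v = esssup (lebesgue_on {0..T}) (\<lambda>t. Hs_norm s (v t))"

text \<open>Real and imaginary part are independent and centered normal with variance \<open>1/2\<close> each
  (the second parameter of the library's normal density is the standard deviation).\<close>

definition std_complex_gaussian :: "'w measure \<Rightarrow> ('w \<Rightarrow> complex) \<Rightarrow> bool" where
  "std_complex_gaussian M X \<longleftrightarrow>
     prob_space.indep_var M borel (\<lambda>\<omega>. Re (X \<omega>)) borel (\<lambda>\<omega>. Im (X \<omega>)) \<and>
     distributed M lborel (\<lambda>\<omega>. Re (X \<omega>)) (\<lambda>x. ennreal (normal_density 0 (sqrt (1/2)) x)) \<and>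
     distributed M lborel (\<lambda>\<omega>. Im (X \<omega>)) (\<lambda>x. ennreal (normal_density 0 (sqrt (1/2)) x))"

text \<open>The negative logarithm of a probability, with \<open>- ln 0 = \<infinity>\<close> (in the library \<open>ln 0 = 0\<close>).
  Probabilities of events enter the statement as \<open>outer_measure_of M\<close>, which agrees with
  \<open>emeasure M\<close> on \<open>sets M\<close> and with the completed measure on \<open>sets (completion M)\<close>. The solution is
  determined only up to null sets of the probability space and that space need not be complete;
  the measure itself would give the value 0 to an event outside \<open>sets M\<close>.\<close>

definition neg_ln :: "ennreal \<Rightarrow> ereal" where
  "neg_ln p = (if p = 0 then \<infinity> else ereal (- ln (enn2real p)))"

end

theory Submission
  imports Defs
begin

text \<open>
  After the scaling \<open>v = u / R\<close> with \<open>R = A \<epsilon> powr (-1/2)\<close> the coupling constant becomes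
  \<open>\<lambda> = \<epsilon>\<^sup>2 R\<^sup>2 = A\<^sup>2 \<epsilon>\<close> and the times of interest satisfy \<open>\<lambda> t \<le> \<kappa>\<close>. By the Gaussian tail and a union
  bound, all modes of \<open>v(0)\<close> satisfy \<open>\<bar>v\<^sub>n(0)\<bar> \<le> \<langle>n\<rangle> powr (-(1/2 + \<beta>))\<close> outside an event of probability
  at most \<open>exp (-C\<^sub>0/\<epsilon>)\<close>, for \<open>A\<close> large in terms of \<open>C\<^sub>0\<close>; independence is not needed. On this event the
  claim is deterministic.

  The modes \<open>a\<^sub>n = exp(itn\<^sup>2) v\<^sub>n\<close> satisfy \<open>a\<^sub>n' = -i\<lambda> F\<^sub>n\<close>, where \<open>F\<^sub>n\<close> is the sum over \<open>j, k\<close> of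
  \<open>exp(2ijkt) a\<^sub>n\<^sub>+\<^sub>j cnj(a\<^sub>n\<^sub>+\<^sub>j\<^sub>+\<^sub>k) a\<^sub>n\<^sub>+\<^sub>k\<close>. The terms with \<open>jk = 0\<close> sum to \<open>(2m - \<bar>a\<^sub>n\<bar>\<^sup>2) a\<^sub>n\<close> with the mass
  \<open>m\<close>, which produces the phase of the modulated linear flow. The others are integrated by parts in time,
  which gains \<open>1/(jk)\<close> and a factor \<open>\<lambda>\<close>. Applied to the integral of \<open>\<bar>v\<bar>\<^sup>4\<close>, the same integration by
  parts bounds that integral, in place of a Strichartz estimate. The bound \<open>\<bar>a\<^sub>n(t)\<bar> \<le> 3 \<langle>n\<rangle> powr (-(1/2 + \<beta>))\<close>
  persists because the nonresonant contribution is small, and then the boundary and quintic terms of the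
  normal form are \<open>O(\<lambda> \<langle>n\<rangle> powr (-(1 + \<beta>/4)))\<close>. By Gronwall the error has this size too, so that it is
  \<open>O(R \<lambda>) = O(\<epsilon> powr (1/2))\<close> in \<open>H\<^sup>s\<close> for some \<open>s > 1/2\<close>.
\<close>

section \<open>Integration by parts for functions with an integrable density\<close>

text \<open>Two obstacles shape the proof. A solution is only continuous into L^2 and locally L^4,
  so its modes are absolutely continuous with derivatives that are merely integrable in time;
  integration by parts is therefore set up for such functions, and what is known about a derivative
  is an L^1 bound in time. Moreover the interaction sums have to be finite: each normal form is
  computed for frequencies up to \<open>M\<close> with constants independent of \<open>M\<close>,
  and the space-time L^4 bound serves to remove the truncation and to justify conservation of mass.
  The two uses of the normal form differ in what is known about the derivatives. One has only a
  bound uniform in the frequency; it yields decay of the modes, hence decay of the derivatives, on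
  which the other relies. Long times are harmless: the L^1 bound grows like \<open>1 + T\<close> and
  enters the final estimates multiplied by \<lambda>, while \<lambda> T \<le> \<kappa>.\<close>

definition has_density :: "real \<Rightarrow> (real \<Rightarrow> complex) \<Rightarrow> (real \<Rightarrow> complex) \<Rightarrow> bool" where
  "has_density T A \<alpha> \<longleftrightarrow> set_integrable lborel {0..T} \<alpha> \<and>
     (\<forall>t\<in>{0..T}. A t = A 0 + (LINT \<tau>:{0..t}|lborel. \<alpha> \<tau>))"

lemma has_density_continuous:
  assumes "has_density T A \<alpha>"
  shows "continuous_on {0..T} A"
proof -
  have si: "set_integrable lborel {0..T} \<alpha>" using assms by (simp add: has_density_def)
  have eq: "A t = A 0 + integral {0..t} \<alpha>" if "t \<in> {0..T}" for t
  proof -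
    have "set_integrable lborel {0..t} \<alpha>"
      by (rule set_integrable_subset[OF si]) (use that in auto)
    then have "integral {0..t} \<alpha> = (LINT \<tau>:{0..t}|lborel. \<alpha> \<tau>)"
      by (rule set_borel_integral_eq_integral(2)[symmetric])
    then show ?thesis using assms that unfolding has_density_def by metis
  qed
  have "\<alpha> integrable_on {0..T}" using set_borel_integral_eq_integral(1)[OF si] .
  then have "continuous_on {0..T} (\<lambda>t. A 0 + integral {0..t} \<alpha>)"
    by (intro continuous_intros indefinite_integral_continuous_1)
  then show ?thesis by (rule continuous_on_eq) (rule eq[symmetric])
qed

lemma set_integrable_mult_continuous:
  fixes \<alpha> B :: "real \<Rightarrow> complex"
  assumes "set_integrable lborel {0..T} \<alpha>" "continuous_on {0..T} B"
  shows "set_integrable lborel {0..T} (\<lambda>t. \<alpha> t * B t)"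
proof -
  have "bounded (B ` {0..T})"
    by (intro compact_imp_bounded compact_continuous_image assms(2) compact_Icc)
  then obtain K where K: "\<And>t. t \<in> {0..T} \<Longrightarrow> norm (B t) \<le> K"
    unfolding bounded_iff by blast
  have mB: "set_borel_measurable lborel {0..T} B"
    using borel_measurable_continuous_on_indicator[OF _ assms(2)] by (simp add: set_borel_measurable_def)
  have m: "(\<lambda>t. indicator {0..T} t *\<^sub>R (\<alpha> t * B t)) \<in> borel_measurable lborel"
  proof -
    have "(\<lambda>t. (indicator {0..T} t *\<^sub>R \<alpha> t) * (indicator {0..T} t *\<^sub>R B t)) \<in> borel_measurable lborel"
      using assms(1) mB unfolding set_integrable_def set_borel_measurable_def
      by (intro borel_measurable_times) auto
    also have "(\<lambda>t. (indicator {0..T} t *\<^sub>R \<alpha> t) * (indicator {0..T} t *\<^sub>R B t))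
       = (\<lambda>t. indicator {0..T} t *\<^sub>R (\<alpha> t * B t))"
      by (auto simp: indicator_def)
    finally show ?thesis .
  qed
  have i: "integrable lborel (\<lambda>t. norm (indicator {0..T} t *\<^sub>R \<alpha> t) * K)"
    using assms(1) unfolding set_integrable_def by (intro integrable_mult_left integrable_norm)
  show ?thesis unfolding set_integrable_def
  proof (rule Bochner_Integration.integrable_bound[OF i m], rule AE_I2)
    fix t
    show "norm (indicator {0..T} t *\<^sub>R (\<alpha> t * B t)) \<le> norm (norm (indicator {0..T} t *\<^sub>R \<alpha> t) * K)"
    proof (cases "t \<in> {0..T}")
      case True
      have "norm (\<alpha> t) * norm (B t) \<le> norm (\<alpha> t) * K" by (rule mult_left_mono[OF K[OF True]]) simp
      then show ?thesis using True by (simp add: norm_mult)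
    qed simp
  qed
qed

text \<open>Fubini on the square over \<open>{0..t}\<close>, cut along the diagonal: below it the
  inner integral runs over \<open>\<beta>\<close>, above it over \<open>\<alpha>\<close>. This is
  the product rule for indefinite integrals that need not be differentiable.\<close>

lemma integral_product_triangles:
  fixes \<alpha> \<beta> :: "real \<Rightarrow> complex"
  assumes "set_integrable lborel {0..t} \<alpha>" "set_integrable lborel {0..t} \<beta>"
  shows "(LINT \<tau>:{0..t}|lborel. \<alpha> \<tau>) * (LINT \<tau>:{0..t}|lborel. \<beta> \<tau>) =
     (LINT \<tau>:{0..t}|lborel. \<alpha> \<tau> * (LINT \<sigma>:{0..\<tau>}|lborel. \<beta> \<sigma>)) +
     (LINT \<tau>:{0..t}|lborel. \<beta> \<tau> * (LINT \<sigma>:{0..\<tau>}|lborel. \<alpha> \<sigma>))"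
proof -
  define p q where "p = (\<lambda>x. indicator {0..t} x *\<^sub>R \<alpha> x)" and "q = (\<lambda>x. indicator {0..t} x *\<^sub>R \<beta> x)"
  have ip: "integrable lborel p" and iq: "integrable lborel q"
    using assms by (simp_all add: p_def q_def set_integrable_def)
  note [measurable] = borel_measurable_integrable[OF ip] borel_measurable_integrable[OF iq]
  have iK: "integrable (lborel \<Otimes>\<^sub>M lborel) (\<lambda>(x, y). p x * q y)"
  proof (rule lborel_pair.Fubini_integrable)
    show "(\<lambda>(x, y). p x * q y) \<in> borel_measurable (lborel \<Otimes>\<^sub>M lborel)" by measurable
    show "integrable lborel (\<lambda>x. LINT y|lborel. norm (case (x, y) of (x, y) \<Rightarrow> p x * q y))"
      using ip iq by (simp add: norm_mult)
    show "AE x in lborel. integrable lborel (\<lambda>y. case (x, y) of (x, y) \<Rightarrow> p x * q y)"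
      using iq by simp
  qed
  define A where "A = {(x, y). y \<le> (x::real)}"
  have [measurable]: "A \<in> sets (borel \<Otimes>\<^sub>M borel)" "- A \<in> sets (borel \<Otimes>\<^sub>M borel)"
  proof -
    have "A = {z. snd z \<le> fst z}" by (auto simp: A_def)
    then have "closed A" by (simp add: closed_Collect_le continuous_on_fst continuous_on_snd continuous_on_id)
    then have "A \<in> sets borel" by (rule borel_closed)
    then show "A \<in> sets (borel \<Otimes>\<^sub>M borel)" "- A \<in> sets (borel \<Otimes>\<^sub>M borel)"
      by (simp_all only: borel_prod borel_comp)
  qed
  have i1: "integrable (lborel \<Otimes>\<^sub>M lborel) (\<lambda>z. indicator A z *\<^sub>R (case z of (x, y) \<Rightarrow> p x * q y))"
    by (rule integrable_mult_indicator[OF _ iK]) measurable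
  have i2: "integrable (lborel \<Otimes>\<^sub>M lborel) (\<lambda>z. indicator (-A) z *\<^sub>R (case z of (x, y) \<Rightarrow> p x * q y))"
    by (rule integrable_mult_indicator[OF _ iK]) measurable
  have "(LINT x|lborel. p x) * (LINT y|lborel. q y) = (LINT x|lborel. (LINT y|lborel. p x * q y))"
    by simp
  also have "\<dots> = (LINT z|(lborel \<Otimes>\<^sub>M lborel). (case z of (x, y) \<Rightarrow> p x * q y))"
    using lborel_pair.integral_fst'[OF iK] by simp
  also have "\<dots> = (LINT z|(lborel \<Otimes>\<^sub>M lborel). indicator A z *\<^sub>R (case z of (x, y) \<Rightarrow> p x * q y))
      + (LINT z|(lborel \<Otimes>\<^sub>M lborel). indicator (-A) z *\<^sub>R (case z of (x, y) \<Rightarrow> p x * q y))"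
    by (subst Bochner_Integration.integral_add[symmetric, OF i1 i2], rule Bochner_Integration.integral_cong)
      (auto simp: indicator_def)
  also have "(LINT z|(lborel \<Otimes>\<^sub>M lborel). indicator A z *\<^sub>R (case z of (x, y) \<Rightarrow> p x * q y)) =
     (LINT x|lborel. LINT y|lborel. indicator A (x, y) *\<^sub>R (p x * q y))"
    using lborel_pair.integral_fst'[OF i1] by simp
  also have "\<dots> = (LINT \<tau>:{0..t}|lborel. \<alpha> \<tau> * (LINT \<sigma>:{0..\<tau>}|lborel. \<beta> \<sigma>))"
    unfolding set_lebesgue_integral_def
  proof (rule Bochner_Integration.integral_cong[OF refl])
    fix x :: real
    have "(LINT y|lborel. indicator A (x, y) *\<^sub>R (p x * q y)) = (LINT y|lborel. p x * (indicator {0..x} y *\<^sub>R \<beta> y))"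
      by (rule Bochner_Integration.integral_cong) (auto simp: indicator_def A_def p_def q_def)
    also have "\<dots> = indicator {0..t} x *\<^sub>R (\<alpha> x * (LINT y|lborel. indicator {0..x} y *\<^sub>R \<beta> y))"
      by (subst integral_mult_right_zero) (simp add: p_def)
    finally show "(LINT y|lborel. indicator A (x, y) *\<^sub>R (p x * q y)) =
        indicator {0..t} x *\<^sub>R (\<alpha> x * (LINT y|lborel. indicator {0..x} y *\<^sub>R \<beta> y))" .
  qed
  also have "(LINT z|(lborel \<Otimes>\<^sub>M lborel). indicator (-A) z *\<^sub>R (case z of (x, y) \<Rightarrow> p x * q y)) =
     (LINT y|lborel. LINT x|lborel. indicator (-A) (x, y) *\<^sub>R (p x * q y))"
  proof -
    have eq: "(\<lambda>(x, y). indicator (-A) (x, y) *\<^sub>R (p x * q y)) = (\<lambda>z. indicator (-A) z *\<^sub>R (case z of (x, y) \<Rightarrow> p x * q y))"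
      by (rule ext) (auto split: prod.split)
    show ?thesis using lborel_pair.integral_snd[of "\<lambda>x y. indicator (-A) (x, y) *\<^sub>R (p x * q y)"]
      unfolding eq using i2 by metis
  qed
  also have "\<dots> = (LINT \<tau>:{0..t}|lborel. \<beta> \<tau> * (LINT \<sigma>:{0..\<tau>}|lborel. \<alpha> \<sigma>))"
    unfolding set_lebesgue_integral_def
  proof (rule Bochner_Integration.integral_cong[OF refl])
    fix y :: real
    have "(LINT x|lborel. indicator (-A) (x, y) *\<^sub>R (p x * q y)) = (LINT x|lborel. q y * (indicator {0..y} x *\<^sub>R \<alpha> x))"
    \<comment> \<open>The diagonal belongs to \<open>A\<close>, so the two integrands may differ at
      the single point \<open>x = y\<close>.\<close>
    proof (rule integral_cong_AE)
      show "AE x in lborel. indicator (- A) (x, y) *\<^sub>R (p x * q y) = q y * (indicator {0..y} x *\<^sub>R \<alpha> x)"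
        using AE_lborel_singleton[of y]
        by eventually_elim (auto simp: indicator_def A_def p_def q_def)
      show "(\<lambda>x. indicator (- A) (x, y) *\<^sub>R (p x * q y)) \<in> borel_measurable lborel" by measurable
      have "(\<lambda>x. q y * (indicator {0..y} x *\<^sub>R \<alpha> x)) = (\<lambda>x. q y * (indicator {0..y} x *\<^sub>R p x))"
        by (auto simp: indicator_def p_def q_def)
      then show "(\<lambda>x. q y * (indicator {0..y} x *\<^sub>R \<alpha> x)) \<in> borel_measurable lborel" by simp
    qed
    also have "\<dots> = indicator {0..t} y *\<^sub>R (\<beta> y * (LINT x|lborel. indicator {0..y} x *\<^sub>R \<alpha> x))"
      by (subst integral_mult_right_zero) (simp add: q_def)
    finally show "(LINT x|lborel. indicator (-A) (x, y) *\<^sub>R (p x * q y)) =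
        indicator {0..t} y *\<^sub>R (\<beta> y * (LINT x|lborel. indicator {0..y} x *\<^sub>R \<alpha> x))" .
  qed
  finally show ?thesis by (simp add: p_def q_def set_lebesgue_integral_def)
qed

text \<open>Write \<open>A = A 0 + a\<close> and \<open>B = B 0 + b\<close> with indefinite
  integrals \<open>a\<close> and \<open>b\<close>: the terms linear in \<open>a\<close> or
  \<open>b\<close> are immediate, and the product \<open>a t * b t\<close> splits over the two
  triangles.\<close>

lemma has_density_mult:
  assumes A: "has_density T A \<alpha>" and B: "has_density T B \<beta>"
  shows "has_density T (\<lambda>t. A t * B t) (\<lambda>t. \<alpha> t * B t + A t * \<beta> t)"
proof -
  have ia: "set_integrable lborel {0..T} \<alpha>" and ib: "set_integrable lborel {0..T} \<beta>"
    using assms by (auto simp: has_density_def)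
  have iaB: "set_integrable lborel {0..T} (\<lambda>t. \<alpha> t * B t)"
    by (rule set_integrable_mult_continuous[OF ia has_density_continuous[OF B]])
  have iAb: "set_integrable lborel {0..T} (\<lambda>t. A t * \<beta> t)"
    using set_integrable_mult_continuous[OF ib has_density_continuous[OF A]] by (simp add: mult.commute)
  show ?thesis unfolding has_density_def
  proof (intro conjI ballI)
    show "set_integrable lborel {0..T} (\<lambda>t. \<alpha> t * B t + A t * \<beta> t)"
      by (rule set_integral_add(1)[OF iaB iAb])
    fix t assume t: "t \<in> {0..T}"
    have sub: "set_integrable lborel {0..t} g" if "set_integrable lborel {0..T} g" for g :: "real \<Rightarrow> complex"
      by (rule set_integrable_subset[OF that]) (use t in auto)
    define a b where "a = (\<lambda>t. LINT \<tau>:{0..t}|lborel. \<alpha> \<tau>)" and "b = (\<lambda>t. LINT \<tau>:{0..t}|lborel. \<beta> \<tau>)"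
    have At: "a \<tau> = A \<tau> - A 0" and Bt: "b \<tau> = B \<tau> - B 0" if "\<tau> \<in> {0..T}" for \<tau>
      using A B that unfolding has_density_def a_def b_def by (metis add_diff_cancel_left')+
    have e1: "(LINT \<tau>:{0..t}|lborel. \<alpha> \<tau> * B \<tau>) = B 0 * a t + (LINT \<tau>:{0..t}|lborel. \<alpha> \<tau> * b \<tau>)"
    proof -
      have "(LINT \<tau>:{0..t}|lborel. \<alpha> \<tau> * b \<tau>) = (LINT \<tau>:{0..t}|lborel. \<alpha> \<tau> * B \<tau> - B 0 * \<alpha> \<tau>)"
        by (rule set_lebesgue_integral_cong, simp, intro allI impI, subst Bt)
          (use t in simp, simp add: algebra_simps)
      also have "\<dots> = (LINT \<tau>:{0..t}|lborel. \<alpha> \<tau> * B \<tau>) - (LINT \<tau>:{0..t}|lborel. B 0 * \<alpha> \<tau>)"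
        by (intro set_integral_diff set_integrable_mult_right sub[OF iaB] sub[OF ia])
      also have "(LINT \<tau>:{0..t}|lborel. B 0 * \<alpha> \<tau>) = B 0 * a t" by (simp add: a_def)
      finally show ?thesis by simp
    qed
    have e2: "(LINT \<tau>:{0..t}|lborel. A \<tau> * \<beta> \<tau>) = A 0 * b t + (LINT \<tau>:{0..t}|lborel. \<beta> \<tau> * a \<tau>)"
    proof -
      have "(LINT \<tau>:{0..t}|lborel. \<beta> \<tau> * a \<tau>) = (LINT \<tau>:{0..t}|lborel. A \<tau> * \<beta> \<tau> - A 0 * \<beta> \<tau>)"
        by (rule set_lebesgue_integral_cong, simp, intro allI impI, subst At)
          (use t in simp, simp add: algebra_simps)
      also have "\<dots> = (LINT \<tau>:{0..t}|lborel. A \<tau> * \<beta> \<tau>) - (LINT \<tau>:{0..t}|lborel. A 0 * \<beta> \<tau>)"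
        by (intro set_integral_diff set_integrable_mult_right sub[OF iAb] sub[OF ib])
      also have "(LINT \<tau>:{0..t}|lborel. A 0 * \<beta> \<tau>) = A 0 * b t" by (simp add: b_def)
      finally show ?thesis by simp
    qed
    have "(LINT \<tau>:{0..t}|lborel. \<alpha> \<tau> * B \<tau> + A \<tau> * \<beta> \<tau>) =
       (LINT \<tau>:{0..t}|lborel. \<alpha> \<tau> * B \<tau>) + (LINT \<tau>:{0..t}|lborel. A \<tau> * \<beta> \<tau>)"
      by (intro set_integral_add(2) sub[OF iaB] sub[OF iAb])
    also have "\<dots> = B 0 * a t + A 0 * b t + a t * b t"
    proof -
      have "a t * b t = (LINT \<tau>:{0..t}|lborel. \<alpha> \<tau> * b \<tau>) + (LINT \<tau>:{0..t}|lborel. \<beta> \<tau> * a \<tau>)"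
        unfolding a_def b_def by (rule integral_product_triangles[OF sub[OF ia] sub[OF ib]])
      then show ?thesis unfolding e1 e2 by simp
    qed
    finally have *: "(LINT \<tau>:{0..t}|lborel. \<alpha> \<tau> * B \<tau> + A \<tau> * \<beta> \<tau>) = B 0 * a t + A 0 * b t + a t * b t" .
    show "A t * B t = A 0 * B 0 + (LINT \<tau>:{0..t}|lborel. \<alpha> \<tau> * B \<tau> + A \<tau> * \<beta> \<tau>)"
      unfolding * At[OF t] Bt[OF t] by (simp add: algebra_simps)
  qed
qed

lemma has_density_cnj:
  assumes "has_density T A \<alpha>"
  shows "has_density T (\<lambda>t. cnj (A t)) (\<lambda>t. cnj (\<alpha> t))"
  unfolding has_density_def
proof (intro conjI ballI)
  have si: "set_integrable lborel {0..T} \<alpha>" using assms unfolding has_density_def by blast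
  then have "integrable lborel (\<lambda>t. cnj (indicator {0..T} t *\<^sub>R \<alpha> t))"
    unfolding set_integrable_def by (rule integrable_cnj)
  then show "set_integrable lborel {0..T} (\<lambda>t. cnj (\<alpha> t))"
    unfolding set_integrable_def complex_cnj_scaleR .
  fix t assume "t \<in> {0..T}"
  then have *: "A t = A 0 + (LINT \<tau>:{0..t}|lborel. \<alpha> \<tau>)" using assms unfolding has_density_def by blast
  have "(LINT \<tau>:{0..t}|lborel. cnj (\<alpha> \<tau>)) = cnj (LINT \<tau>:{0..t}|lborel. \<alpha> \<tau>)"
    unfolding set_lebesgue_integral_def Bochner_Integration.integral_cnj[symmetric] complex_cnj_scaleR ..
  then show "cnj (A t) = cnj (A 0) + (LINT \<tau>:{0..t}|lborel. cnj (\<alpha> \<tau>))"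
    using arg_cong[OF *, of cnj] by (simp only: complex_cnj_add)
qed

lemma has_density_cis:
  "has_density T (\<lambda>t. cis (\<phi> * t)) (\<lambda>t. \<i> * complex_of_real \<phi> * cis (\<phi> * t))"
proof -
  have c: "continuous_on S (\<lambda>t. \<i> * complex_of_real \<phi> * cis (\<phi> * t))" for S :: "real set"
    by (intro continuous_intros)
  have si: "set_integrable lborel {0..t} (\<lambda>t. \<i> * complex_of_real \<phi> * cis (\<phi> * t))" for t :: real
    using borel_integrable_atLeastAtMost'[OF c, of 0 t] .
  have "((\<lambda>t. \<i> * complex_of_real \<phi> * cis (\<phi> * t)) has_integral (cis (\<phi> * t) - cis (\<phi> * 0))) {0..t}"
    if "0 \<le> t" for t
    by (rule fundamental_theorem_of_calculus[OF that])
      (auto simp: cis_conv_exp intro!: derivative_eq_intros has_vector_derivative_real_field)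
  then have "cis (\<phi> * t) = cis (\<phi> * 0) + (LINT t:{0..t}|lborel. \<i> * complex_of_real \<phi> * cis (\<phi> * t))" if "0 \<le> t" for t
    using that unfolding set_borel_integral_eq_integral(2)[OF si] by (metis diff_add_cancel add.commute integral_unique)
  then show ?thesis using si unfolding has_density_def by (metis atLeastAtMost_iff)
qed

text \<open>Apply the product rule to \<open>cis (\<phi> * t) * P t\<close> and solve for the
  oscillating integral, which carries the factor \<open>\<phi>\<close>. Only the L^1 norm of
  \<open>p\<close> enters, the kind of control available on the derivatives of the modes.\<close>

lemma has_density_oscillation:
  assumes P: "has_density T P p" and "\<phi> \<noteq> 0" and t: "t \<in> {0..T}"
  shows "norm (LINT \<tau>:{0..t}|lborel. cis (\<phi> * \<tau>) * P \<tau>) \<le>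
     (norm (P 0) + norm (P t) + (LINT \<tau>:{0..t}|lborel. norm (p \<tau>))) / \<bar>\<phi>\<bar>"
proof -
  have ip: "set_integrable lborel {0..t} p"
    by (rule set_integrable_subset[OF conjunct1[OF P[unfolded has_density_def]]]) (use t in auto)
  have cP: "continuous_on {0..t} P"
    by (rule continuous_on_subset[OF has_density_continuous[OF P]]) (use t in auto)
  have i1: "set_integrable lborel {0..t} (\<lambda>\<tau>. cis (\<phi> * \<tau>) * P \<tau>)"
    by (intro borel_integrable_atLeastAtMost' continuous_intros cP)
  have i2: "set_integrable lborel {0..t} (\<lambda>\<tau>. cis (\<phi> * \<tau>) * p \<tau>)"
    using set_integrable_mult_continuous[OF ip, of "\<lambda>\<tau>. cis (\<phi> * \<tau>)"]
    by (simp add: mult.commute continuous_intros)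
  have "cis (\<phi> * t) * P t = cis (\<phi> * 0) * P 0 +
      (LINT \<tau>:{0..t}|lborel. \<i> * complex_of_real \<phi> * cis (\<phi> * \<tau>) * P \<tau> + cis (\<phi> * \<tau>) * p \<tau>)"
    using has_density_mult[OF has_density_cis[of T \<phi>] P] t unfolding has_density_def by blast
  also have "(LINT \<tau>:{0..t}|lborel. \<i> * complex_of_real \<phi> * cis (\<phi> * \<tau>) * P \<tau> + cis (\<phi> * \<tau>) * p \<tau>) =
      (LINT \<tau>:{0..t}|lborel. (\<i> * complex_of_real \<phi>) * (cis (\<phi> * \<tau>) * P \<tau>)) + (LINT \<tau>:{0..t}|lborel. cis (\<phi> * \<tau>) * p \<tau>)"
    unfolding mult.assoc[of _ "cis _"] by (intro set_integral_add(2) set_integrable_mult_right i1 i2)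
  finally have "(\<i> * complex_of_real \<phi>) * (LINT \<tau>:{0..t}|lborel. cis (\<phi> * \<tau>) * P \<tau>) =
     cis (\<phi> * t) * P t - P 0 - (LINT \<tau>:{0..t}|lborel. cis (\<phi> * \<tau>) * p \<tau>)" by simp
  from arg_cong[OF this, of norm] have "\<bar>\<phi>\<bar> * norm (LINT \<tau>:{0..t}|lborel. cis (\<phi> * \<tau>) * P \<tau>) =
     norm (cis (\<phi> * t) * P t - P 0 - (LINT \<tau>:{0..t}|lborel. cis (\<phi> * \<tau>) * p \<tau>))"
    by (simp only: norm_mult norm_ii norm_of_real mult_1)
  also have "\<dots> \<le> norm (cis (\<phi> * t) * P t) + norm (P 0) + norm (LINT \<tau>:{0..t}|lborel. cis (\<phi> * \<tau>) * p \<tau>)"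
    using norm_triangle_ineq4[of "cis (\<phi> * t) * P t" "P 0"]
      norm_triangle_ineq4[of "cis (\<phi> * t) * P t - P 0" "LINT \<tau>:{0..t}|lborel. cis (\<phi> * \<tau>) * p \<tau>"] by linarith
  also have "norm (LINT \<tau>:{0..t}|lborel. cis (\<phi> * \<tau>) * p \<tau>) \<le> (LINT \<tau>:{0..t}|lborel. norm (cis (\<phi> * \<tau>) * p \<tau>))"
    by (rule set_integral_norm_bound[OF i2])
  finally show ?thesis using assms(2) by (simp add: norm_mult field_simps)
qed

section \<open>Discrete convolution estimates\<close>

lemma japanese_ge_1: "1 \<le> japanese n"
  by (simp add: japanese_def)

lemma japanese_pos: "0 < japanese n"
  using japanese_ge_1[of n] by linarith

lemma japanese_ge_abs: "\<bar>real_of_int n\<bar> \<le> japanese n"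
  unfolding japanese_def by (rule real_le_rsqrt) simp

text \<open>Triangle inequality in the plane: the bracket is the length of the vector
  \<open>(1, n)\<close>.\<close>

lemma japanese_shift: "japanese n \<le> japanese (n + j) + \<bar>real_of_int j\<bar>"
proof -
  have "1 + (real_of_int n)\<^sup>2 \<le> (japanese (n + j) + \<bar>real_of_int j\<bar>)\<^sup>2"
  proof -
    have "\<bar>real_of_int j\<bar> * \<bar>real_of_int (n + j)\<bar> \<le> \<bar>real_of_int j\<bar> * japanese (n + j)"
      by (intro mult_left_mono japanese_ge_abs) auto
    moreover have "- (real_of_int j * real_of_int (n + j)) \<le> \<bar>real_of_int j\<bar> * \<bar>real_of_int (n + j)\<bar>"
      by (simp only: abs_mult[symmetric] abs_ge_minus_self)
    moreover have "(japanese (n + j))\<^sup>2 = 1 + (real_of_int (n + j))\<^sup>2"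
      unfolding japanese_def by (rule real_sqrt_pow2) simp
    ultimately show ?thesis by (simp add: power2_eq_square algebra_simps)
  qed
  moreover have "0 \<le> japanese (n + j) + \<bar>real_of_int j\<bar>" using japanese_pos[of "n + j"] by linarith
  ultimately show ?thesis unfolding japanese_def[of n] by (rule real_le_lsqrt[rotated])
qed

text \<open>Dividing by \<open>x + y\<close> leaves two fractions in \<open>(0, 1]\<close> with sum
  1, each at most its own power of exponent \<open>r \<le> 1\<close>.\<close>

lemma powr_subadditive:
  fixes x y r :: real
  assumes "0 < x" "0 < y" "0 \<le> r" "r \<le> 1"
  shows "(x + y) powr r \<le> x powr r + y powr r"
proof -
  have p: "z \<le> z powr r" if "0 < z" "z \<le> 1" for z :: real
    using powr_mono'[of r 1 z] that assms by simp
  have "1 = x / (x + y) + y / (x + y)" using assms by (simp add: add_divide_distrib[symmetric])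
  also have "\<dots> \<le> (x / (x + y)) powr r + (y / (x + y)) powr r"
    by (intro add_mono p) (use assms in auto)
  also have "\<dots> = (x powr r + y powr r) / (x + y) powr r"
    using assms by (simp add: powr_divide add_divide_distrib)
  finally show ?thesis using assms by (simp add: field_simps)
qed

text \<open>A negative power of the larger variable is dominated by the same power of the smaller
  one, so one of the two summands on the right already suffices.\<close>

lemma powr_prod_le_sum:
  fixes x y p q :: real
  assumes "0 < x" "0 < y" "0 \<le> p" "0 \<le> q"
  shows "x powr (- p) * y powr (- q) \<le> x powr (- (p + q)) + y powr (- (p + q))"
proof (cases "x \<le> y")
  case True
  have "y powr (- q) \<le> x powr (- q)" using True assms by (intro powr_mono2') auto
  then have "x powr (- p) * y powr (- q) \<le> x powr (- p) * x powr (- q)" by (intro mult_left_mono) auto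
  also have "\<dots> = x powr (- (p + q))" by (simp add: powr_add[symmetric])
  finally show ?thesis using powr_ge_zero[of y "- (p + q)"] by linarith
next
  case False
  have "x powr (- p) \<le> y powr (- p)" using False assms by (intro powr_mono2') auto
  then have "x powr (- p) * y powr (- q) \<le> y powr (- p) * y powr (- q)" by (intro mult_right_mono) auto
  also have "\<dots> = y powr (- (p + q))" by (simp add: powr_add[symmetric])
  finally show ?thesis using powr_ge_zero[of x "- (p + q)"] by linarith
qed

lemma sum_cauchy_schwarz:
  fixes x y :: "'i \<Rightarrow> real"
  shows "(\<Sum>k\<in>D. x k * y k) \<le> sqrt (\<Sum>k\<in>D. (x k)\<^sup>2) * sqrt (\<Sum>k\<in>D. (y k)\<^sup>2)"
proof -
  have "(\<Sum>k\<in>D. x k * y k)\<^sup>2 \<le> (\<Sum>k\<in>D. (x k)\<^sup>2) * (\<Sum>k\<in>D. (y k)\<^sup>2)" by (rule Cauchy_Schwarz_ineq_sum)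
  from real_sqrt_le_mono[OF this]
  have "\<bar>\<Sum>k\<in>D. x k * y k\<bar> \<le> sqrt ((\<Sum>k\<in>D. (x k)\<^sup>2) * (\<Sum>k\<in>D. (y k)\<^sup>2))" by simp
  then show ?thesis by (simp add: real_sqrt_mult)
qed

section \<open>Summation estimates for the kernel \<open>1/|j|\<close> and its relatives\<close>

lemma int_powr_sum_bounded:
  fixes p :: real
  assumes "1 < p"
  shows "\<exists>C>0. \<forall>D. finite D \<and> 0 \<notin> D \<longrightarrow> (\<Sum>k\<in>D. \<bar>real_of_int k\<bar> powr (- p)) \<le> C"
proof -
  define f where "f = (\<lambda>n::nat. real n powr (- p))"
  have sf: "summable f" unfolding f_def using assms by (simp add: summable_real_powr_iff)
  have f0: "0 \<le> f n" for n by (simp add: f_def)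
  have le: "sum f S \<le> suminf f" if "finite S" for S
    by (rule sum_le_suminf[OF sf that]) (simp add: f0)
  have "(\<Sum>k\<in>D. \<bar>real_of_int k\<bar> powr (- p)) \<le> 2 * suminf f + 1" if D: "finite D" "0 \<notin> D" for D
  proof -
    have "D = {k\<in>D. 0 < k} \<union> {k\<in>D. k < 0}" using D(2) by auto (metis linorder_neqE)
    then have "(\<Sum>k\<in>D. \<bar>real_of_int k\<bar> powr (- p)) = (\<Sum>k\<in>{k\<in>D. 0 < k} \<union> {k\<in>D. k < 0}. \<bar>real_of_int k\<bar> powr (- p))"
      by simp
    also have "\<dots> = (\<Sum>k\<in>{k\<in>D. 0 < k}. \<bar>real_of_int k\<bar> powr (- p)) + (\<Sum>k\<in>{k\<in>D. k < 0}. \<bar>real_of_int k\<bar> powr (- p))"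
      using D by (intro sum.union_disjoint) auto
    also have "(\<Sum>k\<in>{k\<in>D. 0 < k}. \<bar>real_of_int k\<bar> powr (- p)) = sum f (nat ` {k\<in>D. 0 < k})"
      by (subst sum.reindex) (auto simp: inj_on_def f_def intro!: sum.cong)
    also have "(\<Sum>k\<in>{k\<in>D. k < 0}. \<bar>real_of_int k\<bar> powr (- p)) = sum f ((\<lambda>k. nat (- k)) ` {k\<in>D. k < 0})"
      by (subst sum.reindex) (auto simp: inj_on_def f_def intro!: sum.cong)
    finally show ?thesis using le[of "nat ` {k\<in>D. 0 < k}"] le[of "(\<lambda>k. nat (- k)) ` {k\<in>D. k < 0}"] D(1) by simp
  qed
  moreover have "0 < 2 * suminf f + 1" using suminf_nonneg[OF sf f0] by linarith
  ultimately show ?thesis by blast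
qed

lemma japanese_powr_sum_bounded:
  fixes p :: real
  assumes "1 < p"
  shows "\<exists>C>0. \<forall>S. finite S \<longrightarrow> (\<Sum>m\<in>S. japanese m powr (- p)) \<le> C"
proof -
  obtain C where C: "0 < C" "\<And>D. finite D \<Longrightarrow> 0 \<notin> D \<Longrightarrow> (\<Sum>k\<in>D. \<bar>real_of_int k\<bar> powr (- p)) \<le> C"
    using int_powr_sum_bounded[OF assms] by auto
  have "(\<Sum>m\<in>S. japanese m powr (- p)) \<le> 1 + C" if S: "finite S" for S
  proof -
    have "(\<Sum>m\<in>S. japanese m powr (- p)) \<le> (\<Sum>m\<in>insert 0 (S - {0}). japanese m powr (- p))"
      using S by (intro sum_mono2) auto
    also have "\<dots> = 1 + (\<Sum>m\<in>S - {0}. japanese m powr (- p))"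
      using S by (subst sum.insert) (auto simp: japanese_def)
    also have "(\<Sum>m\<in>S - {0}. japanese m powr (- p)) \<le> (\<Sum>m\<in>S - {0}. \<bar>real_of_int m\<bar> powr (- p))"
      using assms by (intro sum_mono powr_mono2' japanese_ge_abs) auto
    also have "\<dots> \<le> C" using S by (intro C(2)) auto
    finally show ?thesis by simp
  qed
  then show ?thesis using C(1) by (intro exI[of _ "1 + C"]) auto
qed

text \<open>An l^2 bound for a non-negative sequence, expressed by finite sums. The estimates that
  follow are uniform in the finite sets \<open>D\<close> and \<open>S\<close>, so summability need
  not be discussed before the truncation is removed.\<close>

definition sq_bounded :: "(int \<Rightarrow> real) \<Rightarrow> real \<Rightarrow> bool" where
  "sq_bounded a E \<longleftrightarrow> (\<forall>m. 0 \<le> a m) \<and> (\<forall>S. finite S \<longrightarrow> (\<Sum>m\<in>S. (a m)\<^sup>2) \<le> E\<^sup>2)"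

lemma sq_boundedD:
  assumes "sq_bounded a E"
  shows "0 \<le> a m" "finite S \<Longrightarrow> (\<Sum>m\<in>S. (a m)\<^sup>2) \<le> E\<^sup>2"
  using assms by (auto simp: sq_bounded_def)

lemma sq_bounded_le:
  assumes "sq_bounded a E" "0 \<le> E" shows "a m \<le> E"
  using sq_boundedD(2)[OF assms(1), of "{m}"] assms(2) by (simp add: power2_le_iff_abs_le)

lemma sq_bounded_shift:
  assumes "sq_bounded a E" "inj h" shows "sq_bounded (\<lambda>m. a (h m)) E"
  unfolding sq_bounded_def
proof (intro conjI allI impI)
  show "0 \<le> a (h m)" for m by (rule sq_boundedD(1)[OF assms(1)])
  fix S :: "int set" assume "finite S"
  then show "(\<Sum>m\<in>S. (a (h m))\<^sup>2) \<le> E\<^sup>2"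
    using sq_boundedD(2)[OF assms(1), of "h ` S"] inj_on_subset[OF assms(2)]
    by (simp add: sum.reindex)
qed

text \<open>Cauchy-Schwarz: for \<open>p > 1/2\<close> the kernel is square summable.\<close>

lemma sum_convolution_bounded:
  fixes p :: real
  assumes "1/2 < p"
  shows "\<exists>C>0. \<forall>a E D n. 0 \<le> E \<and> sq_bounded a E \<and> finite D \<and> 0 \<notin> D \<longrightarrow>
    (\<Sum>k\<in>D. a (n + k) * \<bar>real_of_int k\<bar> powr (- p)) \<le> C * E"
proof -
  obtain C where C: "0 < C" "\<And>D. finite D \<Longrightarrow> 0 \<notin> D \<Longrightarrow> (\<Sum>k\<in>D. \<bar>real_of_int k\<bar> powr (- (2 * p))) \<le> C"
    using int_powr_sum_bounded[of "2 * p"] assms by auto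
  have "(\<Sum>k\<in>D. a (n + k) * \<bar>real_of_int k\<bar> powr (- p)) \<le> sqrt C * E"
    if h: "0 \<le> E" "sq_bounded a E" "finite D" "0 \<notin> D" for a E D n
  proof -
    have "(\<Sum>k\<in>D. a (n + k) * \<bar>real_of_int k\<bar> powr (- p)) \<le>
      sqrt (\<Sum>k\<in>D. (a (n + k))\<^sup>2) * sqrt (\<Sum>k\<in>D. (\<bar>real_of_int k\<bar> powr (- p))\<^sup>2)"
      by (rule sum_cauchy_schwarz)
    also have "\<dots> \<le> sqrt (E\<^sup>2) * sqrt C"
    proof (intro mult_mono real_sqrt_le_mono)
      show "(\<Sum>k\<in>D. (a (n + k))\<^sup>2) \<le> E\<^sup>2"
        by (rule sq_boundedD(2)[OF sq_bounded_shift[OF h(2)] h(3)]) (simp add: inj_def)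
      have "(\<Sum>k\<in>D. (\<bar>real_of_int k\<bar> powr (- p))\<^sup>2) = (\<Sum>k\<in>D. \<bar>real_of_int k\<bar> powr (- (2 * p)))"
        by (intro sum.cong refl) (simp add: power2_eq_square powr_add[symmetric])
      also have "\<dots> \<le> C" by (rule C(2)[OF h(3,4)])
      finally show "(\<Sum>k\<in>D. (\<bar>real_of_int k\<bar> powr (- p))\<^sup>2) \<le> C" .
    qed (auto intro: sum_nonneg)
    finally show ?thesis using h(1) by (simp add: mult.commute)
  qed
  then show ?thesis using C(1) by (intro exI[of _ "sqrt C"]) auto
qed

text \<open>The Hilbert transform with its kernel replaced by absolute values; \<open>1/|j|\<close>
  is what remains of an interaction once its phase \<open>2jk\<close> has been integrated. Unlike
  the signed kernel this one is not bounded on l^2 uniformly in \<open>D\<close>, because the sum of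
  \<open>1/|j|\<close> diverges logarithmically. Hence the next estimates spread the kernel over
  several factors.\<close>

definition hilb :: "int set \<Rightarrow> (int \<Rightarrow> real) \<Rightarrow> int \<Rightarrow> real" where
  "hilb D a m = (\<Sum>j\<in>D. a (m + j) / \<bar>real_of_int j\<bar>)"

lemma hilb_nonneg: "(\<And>m. 0 \<le> a m) \<Longrightarrow> 0 \<le> hilb D a m"
  unfolding hilb_def by (intro sum_nonneg divide_nonneg_nonneg) auto

text \<open>Cauchy-Schwarz with the exponent of \<open>1/|j|\<close> split into \<open>5/8\<close>
  and \<open>3/8\<close>: squaring the first gives the summable exponent \<open>5/4\<close>,
  squaring the second leaves \<open>3/4\<close>, still above the threshold \<open>1/2\<close> of
  \<open>sum_convolution_bounded\<close>.\<close>

lemma hilb_square: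
  "\<exists>C>0. \<forall>b D m. finite D \<and> 0 \<notin> D \<longrightarrow>
     (hilb D b m)\<^sup>2 \<le> C * (\<Sum>j\<in>D. (b (m + j))\<^sup>2 * \<bar>real_of_int j\<bar> powr (- (3/4)))"
proof -
  obtain C where C: "0 < C" "\<And>D. finite D \<Longrightarrow> 0 \<notin> D \<Longrightarrow> (\<Sum>k\<in>D. \<bar>real_of_int k\<bar> powr (- (5/4))) \<le> C"
    using int_powr_sum_bounded[of "5/4"] by auto
  have "(hilb D b m)\<^sup>2 \<le> C * (\<Sum>j\<in>D. (b (m + j))\<^sup>2 * \<bar>real_of_int j\<bar> powr (- (3/4)))"
    if h: "finite D" "0 \<notin> D" for b D m
  proof -
    have "hilb D b m = (\<Sum>j\<in>D. \<bar>real_of_int j\<bar> powr (- (5/8)) * (b (m + j) * \<bar>real_of_int j\<bar> powr (- (3/8))))"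
      unfolding hilb_def
    proof (intro sum.cong refl)
      fix j assume "j \<in> D"
      then have "j \<noteq> 0" using h by auto
      then have "\<bar>real_of_int j\<bar> powr (- (5/8)) * \<bar>real_of_int j\<bar> powr (- (3/8)) = 1 / \<bar>real_of_int j\<bar>"
        by (simp add: powr_add[symmetric] powr_minus_divide)
      then show "b (m + j) / \<bar>real_of_int j\<bar> = \<bar>real_of_int j\<bar> powr (- (5/8)) * (b (m + j) * \<bar>real_of_int j\<bar> powr (- (3/8)))"
        by (simp add: mult.left_commute)
    qed
    then have "(hilb D b m)\<^sup>2 \<le> (\<Sum>j\<in>D. (\<bar>real_of_int j\<bar> powr (- (5/8)))\<^sup>2) * (\<Sum>j\<in>D. (b (m + j) * \<bar>real_of_int j\<bar> powr (- (3/8)))\<^sup>2)"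
      by (simp only: Cauchy_Schwarz_ineq_sum)
    also have "(\<Sum>j\<in>D. (\<bar>real_of_int j\<bar> powr (- (5/8)))\<^sup>2) = (\<Sum>j\<in>D. \<bar>real_of_int j\<bar> powr (- (5/4)))"
      by (intro sum.cong refl) (simp add: power2_eq_square powr_add[symmetric])
    also have "(\<Sum>j\<in>D. (b (m + j) * \<bar>real_of_int j\<bar> powr (- (3/8)))\<^sup>2) = (\<Sum>j\<in>D. (b (m + j))\<^sup>2 * \<bar>real_of_int j\<bar> powr (- (3/4)))"
      by (intro sum.cong refl) (simp add: power_mult_distrib power2_eq_square[of "_ powr _"] powr_add[symmetric])
    also have "(\<Sum>j\<in>D. \<bar>real_of_int j\<bar> powr (- (5/4))) * \<dots> \<le> C * \<dots>"
      by (intro mult_right_mono C(2) h sum_nonneg) auto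
    finally show ?thesis .
  qed
  then show ?thesis using C(1) by blast
qed

text \<open>After \<open>hilb_square\<close>, the substitution \<open>l = m + j\<close> puts the
  square on \<open>a l\<close> and leaves an inner sum of \<open>a (l - j)\<close> against the
  kernel of exponent \<open>3/4\<close>, at most a constant times \<open>E\<close>. The l^2 bound of
  the outer sum supplies the other two powers of \<open>E\<close>.\<close>

lemma trilinear_hilb_bounded:
  "\<exists>C>0. \<forall>a E D S. 0 \<le> E \<and> sq_bounded a E \<and> finite D \<and> 0 \<notin> D \<and> finite S \<longrightarrow>
     (\<Sum>m\<in>S. a m * (hilb D a m)\<^sup>2) \<le> C * E ^ 3"
proof -
  obtain C1 where C1: "0 < C1" "\<And>b D m. finite D \<Longrightarrow> 0 \<notin> D \<Longrightarrow>
     (hilb D b m)\<^sup>2 \<le> C1 * (\<Sum>j\<in>D. (b (m + j))\<^sup>2 * \<bar>real_of_int j\<bar> powr (- (3/4)))"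
    using hilb_square by auto
  obtain C2 where C2: "0 < C2" "\<And>a E D n. 0 \<le> E \<Longrightarrow> sq_bounded a E \<Longrightarrow> finite D \<Longrightarrow> 0 \<notin> D \<Longrightarrow>
    (\<Sum>k\<in>D. a (n + k) * \<bar>real_of_int k\<bar> powr (- (3/4))) \<le> C2 * E"
    using sum_convolution_bounded[of "3/4"] by auto
  have "(\<Sum>m\<in>S. a m * (hilb D a m)\<^sup>2) \<le> (C1 * C2) * E ^ 3"
    if h: "0 \<le> E" "sq_bounded a E" "finite D" "0 \<notin> D" "finite S" for a E D S
  proof -
    note a0 = sq_boundedD(1)[OF h(2)]
    define L where "L = (\<lambda>(m, j). m + j) ` (S \<times> D)"
    have fL: "finite L" using h unfolding L_def by auto
    have "(\<Sum>m\<in>S. a m * (hilb D a m)\<^sup>2) \<le> (\<Sum>m\<in>S. a m * (C1 * (\<Sum>j\<in>D. (a (m + j))\<^sup>2 * \<bar>real_of_int j\<bar> powr (- (3/4)))))"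
      by (intro sum_mono mult_left_mono C1(2) a0 h)
    also have "\<dots> = C1 * (\<Sum>(m, j)\<in>S \<times> D. a m * (a (m + j))\<^sup>2 * \<bar>real_of_int j\<bar> powr (- (3/4)))"
      by (simp add: sum.cartesian_product[symmetric] sum_distrib_left mult_ac)
    also have "(\<Sum>(m, j)\<in>S \<times> D. a m * (a (m + j))\<^sup>2 * \<bar>real_of_int j\<bar> powr (- (3/4))) =
       (\<Sum>(l, j)\<in>(\<lambda>(m, j). (m + j, j)) ` (S \<times> D). a (l - j) * (a l)\<^sup>2 * \<bar>real_of_int j\<bar> powr (- (3/4)))"
      by (subst sum.reindex) (auto simp: inj_on_def intro!: sum.cong)
    also have "\<dots> \<le> (\<Sum>(l, j)\<in>L \<times> D. a (l - j) * (a l)\<^sup>2 * \<bar>real_of_int j\<bar> powr (- (3/4)))"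
    proof (rule sum_mono2)
      show "finite (L \<times> D)" using fL h by auto
      show "(\<lambda>(m, j). (m + j, j)) ` (S \<times> D) \<subseteq> L \<times> D" unfolding L_def by force
    qed (auto intro!: mult_nonneg_nonneg a0)
    also have "\<dots> = (\<Sum>l\<in>L. (a l)\<^sup>2 * (\<Sum>j\<in>D. a (l - j) * \<bar>real_of_int j\<bar> powr (- (3/4))))"
      by (simp add: sum.cartesian_product[symmetric] sum_distrib_left mult_ac)
    also have "\<dots> \<le> (\<Sum>l\<in>L. (a l)\<^sup>2 * (C2 * E))"
    proof (intro sum_mono mult_left_mono)
      fix l
      have "sq_bounded (\<lambda>m. a (- m)) E" by (rule sq_bounded_shift[OF h(2)]) (simp add: inj_def)
      from C2(2)[OF h(1) this h(3,4), of "- l"]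
      show "(\<Sum>j\<in>D. a (l - j) * \<bar>real_of_int j\<bar> powr (- (3/4))) \<le> C2 * E" by simp
    qed auto
    also have "\<dots> = (\<Sum>l\<in>L. (a l)\<^sup>2) * (C2 * E)" by (simp add: sum_distrib_right)
    also have "\<dots> \<le> E\<^sup>2 * (C2 * E)"
      by (intro mult_right_mono sq_boundedD(2)[OF h(2) fL]) (use C2(1) h(1) in auto)
    finally show ?thesis using C1(1) by (simp add: power2_eq_square power3_eq_cube mult_ac)
  qed
  then show ?thesis using C1(1) C2(1) by (intro exI[of _ "C1 * C2"]) auto
qed

section \<open>Weights cut off at height \<open>L\<close>, and the sums behind the persistence of
  decay\<close>

definition wt :: "real \<Rightarrow> real \<Rightarrow> int \<Rightarrow> real" where
  "wt L r n = (min (japanese n) L) powr r"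

lemma wt_nonneg: "0 \<le> wt L r n" by (simp add: wt_def)

text \<open>Subadditivity survives the cut-off: \<open>min (japanese n) L\<close> changes by at most
  \<open>|j|\<close> under a shift, whatever \<open>L\<close> is, so the constants that follow do
  not see \<open>L\<close>.\<close>

lemma wt_shift:
  assumes "1 \<le> L" "0 \<le> r" "r \<le> 1" "j \<noteq> 0"
  shows "wt L r n \<le> wt L r (n + j) + \<bar>real_of_int j\<bar> powr r"
proof -
  have p: "0 < min (japanese (n + j)) L" using assms japanese_pos by auto
  have "wt L r n \<le> (min (japanese (n + j)) L + \<bar>real_of_int j\<bar>) powr r"
    unfolding wt_def using japanese_shift[of n j] japanese_pos[of n] assms
    by (intro powr_mono2) (auto simp: min_def)
  also have "\<dots> \<le> wt L r (n + j) + \<bar>real_of_int j\<bar> powr r"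
    unfolding wt_def using assms p by (intro powr_subadditive) auto
  finally show ?thesis .
qed

lemma wt_half: "(wt L (r / 2) n)\<^sup>2 = wt L r n"
  by (simp add: wt_def power2_eq_square powr_add[symmetric])

text \<open>Interpolation: with half the weight, \<open>p m = wt L (s / 2) m * a m\<close> has a
  square of at most \<open>q * a m\<close>, so half a weight costs only the square root of the bound
  \<open>q\<close>, and two such factors together grow linearly in \<open>q\<close>. The second
  claim moves the weight from \<open>n\<close> to \<open>n + j\<close>; the error this causes has
  kernel exponent \<open>1 - s / 2\<close>, which exceeds \<open>1/2\<close>.\<close>

lemma weighted_hilb_bounded:
  fixes s E :: real
  assumes s: "1/2 \<le> s" "s \<le> 5/8" and E: "0 \<le> E"
  shows "\<exists>C>0. \<forall>a D L q n. sq_bounded a E \<and> finite D \<and> 0 \<notin> D \<and> 1 \<le> L \<and> 0 \<le> q \<and>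
      (\<forall>m. wt L s m * a m \<le> q) \<longrightarrow>
      hilb D (\<lambda>m. wt L (s / 2) m * a m) n \<le> C * sqrt (1 + q) \<and>
      wt L (s / 2) n * hilb D a n \<le> C * sqrt (1 + q)"
proof -
  obtain C1 where C1: "0 < C1" "\<And>b D m. finite D \<Longrightarrow> 0 \<notin> D \<Longrightarrow>
     (hilb D b m)\<^sup>2 \<le> C1 * (\<Sum>j\<in>D. (b (m + j))\<^sup>2 * \<bar>real_of_int j\<bar> powr (- (3/4)))"
    using hilb_square by auto
  obtain C2 where C2: "0 < C2" "\<And>a E D n. 0 \<le> E \<Longrightarrow> sq_bounded a E \<Longrightarrow> finite D \<Longrightarrow> 0 \<notin> D \<Longrightarrow>
    (\<Sum>k\<in>D. a (n + k) * \<bar>real_of_int k\<bar> powr (- (3/4))) \<le> C2 * E"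
    using sum_convolution_bounded[of "3/4"] by auto
  obtain C3 where C3: "0 < C3" "\<And>a E D n. 0 \<le> E \<Longrightarrow> sq_bounded a E \<Longrightarrow> finite D \<Longrightarrow> 0 \<notin> D \<Longrightarrow>
    (\<Sum>k\<in>D. a (n + k) * \<bar>real_of_int k\<bar> powr (- (1 - s / 2))) \<le> C3 * E"
    using sum_convolution_bounded[of "1 - s / 2"] s by auto
  define C where "C = sqrt (C1 * C2 * E) + C3 * E + 1"
  have "C > 0" using C3(1) C1(1) C2(1) E by (simp add: C_def add_nonneg_pos)
  moreover have "hilb D (\<lambda>m. wt L (s / 2) m * a m) n \<le> C * sqrt (1 + q)"
      "wt L (s / 2) n * hilb D a n \<le> C * sqrt (1 + q)"
    if h: "sq_bounded a E" "finite D" "0 \<notin> D" "1 \<le> L" "0 \<le> q" "\<And>m. wt L s m * a m \<le> q" for a D L q n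
  proof -
    note a0 = sq_boundedD(1)[OF h(1)]
    define p where "p = (\<lambda>m. wt L (s / 2) m * a m)"
    have p2: "(p m)\<^sup>2 \<le> q * a m" for m
    proof -
      have "(p m)\<^sup>2 = (wt L s m * a m) * a m" by (simp add: p_def power_mult_distrib wt_half) (simp add: power2_eq_square)
      also have "\<dots> \<le> q * a m" by (intro mult_right_mono h a0)
      finally show ?thesis .
    qed
    have "(hilb D p n)\<^sup>2 \<le> C1 * (\<Sum>j\<in>D. (p (n + j))\<^sup>2 * \<bar>real_of_int j\<bar> powr (- (3/4)))"
      by (rule C1(2)[OF h(2,3)])
    also have "\<dots> \<le> C1 * (\<Sum>j\<in>D. q * a (n + j) * \<bar>real_of_int j\<bar> powr (- (3/4)))"
      using C1(1) by (intro mult_left_mono sum_mono mult_right_mono p2) auto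
    also have "\<dots> = C1 * q * (\<Sum>j\<in>D. a (n + j) * \<bar>real_of_int j\<bar> powr (- (3/4)))"
      by (simp add: sum_distrib_left mult_ac)
    also have "\<dots> \<le> C1 * q * (C2 * E)"
      using C1(1) h by (intro mult_left_mono C2(2) E) auto
    also have "\<dots> \<le> C1 * (1 + q) * (C2 * E)"
      using C1(1) C2(1) E by (intro mult_right_mono mult_left_mono) auto
    finally have "hilb D p n \<le> sqrt (C1 * C2 * E * (1 + q))"
      by (intro real_le_rsqrt) (simp add: mult_ac)
    then have A: "hilb D p n \<le> sqrt (C1 * C2 * E) * sqrt (1 + q)" by (simp add: real_sqrt_mult)
    have q1: "1 \<le> sqrt (1 + q)" using h by simp
    have "hilb D p n \<le> C * sqrt (1 + q)"
      by (rule order_trans[OF A]) (use C3(1) E q1 in \<open>auto simp: C_def intro!: mult_right_mono\<close>)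
    then show "hilb D (\<lambda>m. wt L (s / 2) m * a m) n \<le> C * sqrt (1 + q)" by (simp add: p_def)
    have "wt L (s / 2) n * hilb D a n = (\<Sum>j\<in>D. wt L (s / 2) n * (a (n + j) / \<bar>real_of_int j\<bar>))"
      by (simp add: hilb_def sum_distrib_left)
    also have "\<dots> \<le> (\<Sum>j\<in>D. (wt L (s / 2) (n + j) + \<bar>real_of_int j\<bar> powr (s / 2)) * (a (n + j) / \<bar>real_of_int j\<bar>))"
      using h s by (intro sum_mono mult_right_mono wt_shift divide_nonneg_nonneg a0) auto
    also have "\<dots> = (\<Sum>j\<in>D. p (n + j) / \<bar>real_of_int j\<bar> + a (n + j) * \<bar>real_of_int j\<bar> powr (- (1 - s / 2)))"
    proof (intro sum.cong refl)
      fix j assume "j \<in> D"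
      then have "j \<noteq> 0" using h by auto
      then have e: "\<bar>real_of_int j\<bar> powr (- (1 - s / 2)) = \<bar>real_of_int j\<bar> powr (s / 2) / \<bar>real_of_int j\<bar>"
        using powr_diff[of "\<bar>real_of_int j\<bar>" "s / 2" 1] by simp
      show "(wt L (s / 2) (n + j) + \<bar>real_of_int j\<bar> powr (s / 2)) * (a (n + j) / \<bar>real_of_int j\<bar>) =
          p (n + j) / \<bar>real_of_int j\<bar> + a (n + j) * \<bar>real_of_int j\<bar> powr (- (1 - s / 2))"
        unfolding e p_def by (simp add: algebra_simps add_divide_distrib)
    qed
    also have "\<dots> = hilb D p n + (\<Sum>j\<in>D. a (n + j) * \<bar>real_of_int j\<bar> powr (- (1 - s / 2)))"
      by (simp add: hilb_def sum.distrib)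
    also have "\<dots> \<le> sqrt (C1 * C2 * E) * sqrt (1 + q) + C3 * E"
      by (intro add_mono A C3(2) E h)
    also have "\<dots> \<le> sqrt (C1 * C2 * E) * sqrt (1 + q) + C3 * E * sqrt (1 + q)"
      using mult_left_mono[OF q1, of "C3 * E"] C3(1) E by simp
    also have "\<dots> \<le> C * sqrt (1 + q)" using h by (simp add: C_def algebra_simps)
    finally show "wt L (s / 2) n * hilb D a n \<le> C * sqrt (1 + q)" .
  qed
  ultimately show ?thesis by (intro exI[of _ C]) auto
qed

text \<open>These sums remain in the normal form after one of three modes has been bounded in the
  supremum or replaced by its derivative. The weight is divided into halves carried by the two
  remaining factors, each of which contributes \<open>sqrt (1 + q)\<close>. Linear growth in
  \<open>q\<close> is essential: it can be absorbed for every \<open>q\<close> once the coupling is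
  small.\<close>

lemma persistence_sums_bounded:
  fixes s E :: real
  assumes s: "1/2 \<le> s" "s \<le> 5/8" and E: "0 \<le> E"
  shows "\<exists>C>0. \<forall>a D L q n. sq_bounded a E \<and> finite D \<and> 0 \<notin> D \<and> 1 \<le> L \<and> 0 \<le> q \<and>
      (\<forall>m. wt L s m * a m \<le> q) \<longrightarrow>
      wt L s n * (\<Sum>k\<in>D. a (n + k) / \<bar>real_of_int k\<bar> * hilb D a (n + k)) \<le> C * (1 + q) \<and>
      wt L s n * (hilb D a n)\<^sup>2 \<le> C * (1 + q)"
proof -
  obtain C1 where C1: "0 < C1" "\<And>a D L q n. sq_bounded a E \<Longrightarrow> finite D \<Longrightarrow> 0 \<notin> D \<Longrightarrow> 1 \<le> L \<Longrightarrow> 0 \<le> q \<Longrightarrow>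
      (\<And>m. wt L s m * a m \<le> q) \<Longrightarrow> hilb D (\<lambda>m. wt L (s / 2) m * a m) n \<le> C1 * sqrt (1 + q)"
      "\<And>a D L q n. sq_bounded a E \<Longrightarrow> finite D \<Longrightarrow> 0 \<notin> D \<Longrightarrow> 1 \<le> L \<Longrightarrow> 0 \<le> q \<Longrightarrow>
      (\<And>m. wt L s m * a m \<le> q) \<Longrightarrow> wt L (s / 2) n * hilb D a n \<le> C1 * sqrt (1 + q)"
    using weighted_hilb_bounded[OF assms] by blast
  obtain C2 where C2: "0 < C2" "\<And>a E D S. 0 \<le> E \<Longrightarrow> sq_bounded a E \<Longrightarrow> finite D \<Longrightarrow> 0 \<notin> D \<Longrightarrow> finite S \<Longrightarrow>
     (\<Sum>m\<in>S. a m * (hilb D a m)\<^sup>2) \<le> C2 * E ^ 3"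
    using trilinear_hilb_bounded by auto
  obtain C3 where C3: "0 < C3" "\<And>a E D n. 0 \<le> E \<Longrightarrow> sq_bounded a E \<Longrightarrow> finite D \<Longrightarrow> 0 \<notin> D \<Longrightarrow>
    (\<Sum>k\<in>D. a (n + k) * \<bar>real_of_int k\<bar> powr (- (2 - 2 * s))) \<le> C3 * E"
    using sum_convolution_bounded[of "2 - 2 * s"] s by auto
  define C where "C = C1 * C1 + sqrt (C2 * E ^ 3) * sqrt (C3 * E)"
  have "C > 0" using C1(1) C2(1) C3(1) E by (auto simp: C_def intro!: add_pos_nonneg)
  moreover have "wt L s n * (\<Sum>k\<in>D. a (n + k) / \<bar>real_of_int k\<bar> * hilb D a (n + k)) \<le> C * (1 + q)"
      "wt L s n * (hilb D a n)\<^sup>2 \<le> C * (1 + q)"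
    if h: "sq_bounded a E" "finite D" "0 \<notin> D" "1 \<le> L" "0 \<le> q" "\<And>m. wt L s m * a m \<le> q" for a D L q n
  proof -
    note a0 = sq_boundedD(1)[OF h(1)]
    note H0 = hilb_nonneg[of a D, OF a0]
    have sq: "sqrt (1 + q) * sqrt (1 + q) = 1 + q" using h by simp
    have "wt L s n * (hilb D a n)\<^sup>2 = (wt L (s / 2) n * hilb D a n)\<^sup>2" by (simp add: power_mult_distrib wt_half)
    also have "\<dots> \<le> (C1 * sqrt (1 + q))\<^sup>2"
      by (intro power_mono C1(3) h mult_nonneg_nonneg wt_nonneg H0)
    also have "\<dots> = C1 * C1 * (1 + q)" using sq by (simp add: power2_eq_square mult_ac)
    also have "\<dots> \<le> C * (1 + q)" using h C2(1) C3(1) E by (intro mult_right_mono) (auto simp: C_def)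
    finally show "wt L s n * (hilb D a n)\<^sup>2 \<le> C * (1 + q)" .
    define p where "p = (\<lambda>m. wt L (s / 2) m * a m)"
    have p0: "0 \<le> p m" for m unfolding p_def by (intro mult_nonneg_nonneg wt_nonneg a0)
    have pt: "wt L s m * a m * hilb D a m \<le> p m * (C1 * sqrt (1 + q))" for m
    proof -
      have "wt L s m * a m * hilb D a m = p m * (wt L (s / 2) m * hilb D a m)"
        unfolding p_def wt_half[of L s, symmetric] by (simp add: power2_eq_square)
      also have "\<dots> \<le> p m * (C1 * sqrt (1 + q))" by (intro mult_left_mono C1(3) h p0)
      finally show ?thesis .
    qed
    have "wt L s n * (\<Sum>k\<in>D. a (n + k) / \<bar>real_of_int k\<bar> * hilb D a (n + k)) =
        (\<Sum>k\<in>D. wt L s n * (a (n + k) / \<bar>real_of_int k\<bar> * hilb D a (n + k)))"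
      by (simp add: sum_distrib_left)
    also have "\<dots> \<le> (\<Sum>k\<in>D. (wt L s (n + k) + \<bar>real_of_int k\<bar> powr s) * (a (n + k) / \<bar>real_of_int k\<bar> * hilb D a (n + k)))"
      using h s by (intro sum_mono mult_right_mono wt_shift mult_nonneg_nonneg divide_nonneg_nonneg a0 H0) auto
    also have "\<dots> \<le> (\<Sum>k\<in>D. p (n + k) / \<bar>real_of_int k\<bar> * (C1 * sqrt (1 + q)) + a (n + k) * hilb D a (n + k) * \<bar>real_of_int k\<bar> powr (- (1 - s)))"
    proof (intro sum_mono)
      fix k assume "k \<in> D"
      then have "k \<noteq> 0" using h by auto
      then have e: "\<bar>real_of_int k\<bar> powr (- (1 - s)) = \<bar>real_of_int k\<bar> powr s / \<bar>real_of_int k\<bar>"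
        using powr_diff[of "\<bar>real_of_int k\<bar>" "s" 1] by simp
      have "(wt L s (n + k) + \<bar>real_of_int k\<bar> powr s) * (a (n + k) / \<bar>real_of_int k\<bar> * hilb D a (n + k)) =
         (wt L s (n + k) * a (n + k) * hilb D a (n + k)) / \<bar>real_of_int k\<bar> + a (n + k) * hilb D a (n + k) * (\<bar>real_of_int k\<bar> powr s / \<bar>real_of_int k\<bar>)"
        by (simp add: algebra_simps add_divide_distrib)
      also have "\<dots> \<le> (p (n + k) * (C1 * sqrt (1 + q))) / \<bar>real_of_int k\<bar> + a (n + k) * hilb D a (n + k) * (\<bar>real_of_int k\<bar> powr s / \<bar>real_of_int k\<bar>)"
        by (intro add_right_mono divide_right_mono pt) auto
      finally show "(wt L s (n + k) + \<bar>real_of_int k\<bar> powr s) * (a (n + k) / \<bar>real_of_int k\<bar> * hilb D a (n + k)) \<le>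
         p (n + k) / \<bar>real_of_int k\<bar> * (C1 * sqrt (1 + q)) + a (n + k) * hilb D a (n + k) * \<bar>real_of_int k\<bar> powr (- (1 - s))"
        unfolding e by simp
    qed
    also have "\<dots> = hilb D p n * (C1 * sqrt (1 + q)) + (\<Sum>k\<in>D. a (n + k) * hilb D a (n + k) * \<bar>real_of_int k\<bar> powr (- (1 - s)))"
      by (simp add: hilb_def sum.distrib sum_distrib_right)
    also have "\<dots> \<le> (C1 * sqrt (1 + q)) * (C1 * sqrt (1 + q)) + sqrt (C2 * E ^ 3) * sqrt (C3 * E)"
    proof (intro add_mono mult_right_mono)
      show "hilb D p n \<le> C1 * sqrt (1 + q)" unfolding p_def by (rule C1(2)[OF h])
      show "0 \<le> C1 * sqrt (1 + q)" using C1(1) h by simp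
      \<comment> \<open>Splitting \<open>a\<close> into two square roots separates the form of
        \<open>trilinear_hilb_bounded\<close> from a convolution with exponent
        \<open>2 - 2 * s\<close>; the restriction \<open>s \<le> 5/8\<close> keeps this exponent
        above \<open>1/2\<close>.\<close>
      have "(\<Sum>k\<in>D. a (n + k) * hilb D a (n + k) * \<bar>real_of_int k\<bar> powr (- (1 - s))) =
         (\<Sum>k\<in>D. (sqrt (a (n + k)) * hilb D a (n + k)) * (sqrt (a (n + k)) * \<bar>real_of_int k\<bar> powr (- (1 - s))))"
        by (intro sum.cong refl) (use a0 in \<open>simp add: mult_ac\<close>)
      also have "\<dots> \<le> sqrt (\<Sum>k\<in>D. (sqrt (a (n + k)) * hilb D a (n + k))\<^sup>2) * sqrt (\<Sum>k\<in>D. (sqrt (a (n + k)) * \<bar>real_of_int k\<bar> powr (- (1 - s)))\<^sup>2)"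
        by (rule sum_cauchy_schwarz)
      also have "(\<Sum>k\<in>D. (sqrt (a (n + k)) * hilb D a (n + k))\<^sup>2) = (\<Sum>m\<in>(\<lambda>k. n + k) ` D. a m * (hilb D a m)\<^sup>2)"
        using a0 by (subst sum.reindex) (auto simp: power_mult_distrib)
      also have "(\<Sum>k\<in>D. (sqrt (a (n + k)) * \<bar>real_of_int k\<bar> powr (- (1 - s)))\<^sup>2) = (\<Sum>k\<in>D. a (n + k) * \<bar>real_of_int k\<bar> powr (- (2 - 2 * s)))"
        using a0 by (intro sum.cong refl) (simp add: power_mult_distrib power2_eq_square[of "_ powr _"] powr_add[symmetric])
      also have "sqrt (\<Sum>m\<in>(\<lambda>k. n + k) ` D. a m * (hilb D a m)\<^sup>2) * sqrt (\<Sum>k\<in>D. a (n + k) * \<bar>real_of_int k\<bar> powr (- (2 - 2 * s))) \<le>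
          sqrt (C2 * E ^ 3) * sqrt (C3 * E)"
        by (intro mult_mono real_sqrt_le_mono C2(2) C3(2) h E finite_imageI real_sqrt_ge_zero sum_nonneg mult_nonneg_nonneg a0)
          (use C2(1) E in auto)
      finally show "(\<Sum>k\<in>D. a (n + k) * hilb D a (n + k) * \<bar>real_of_int k\<bar> powr (- (1 - s))) \<le> sqrt (C2 * E ^ 3) * sqrt (C3 * E)" .
    qed
    also have "\<dots> \<le> C * (1 + q)"
    proof -
      have "0 \<le> sqrt (C2 * E ^ 3) * sqrt (C3 * E) * q" using C2(1) C3(1) E h by auto
      then show ?thesis using sq by (simp add: C_def algebra_simps)
    qed
    finally show "wt L s n * (\<Sum>k\<in>D. a (n + k) / \<bar>real_of_int k\<bar> * hilb D a (n + k)) \<le> C * (1 + q)" .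
  qed
  ultimately show ?thesis by (intro exI[of _ C]) auto
qed

section \<open>Convolutions of sequences with pointwise decay\<close>

lemma japanese_powr_shift:
  assumes "0 \<le> \<gamma>" "j \<noteq> 0"
  shows "japanese (n + j) powr (- \<gamma>) \<le> 2 powr \<gamma> * japanese n powr (- \<gamma>) * \<bar>real_of_int j\<bar> powr \<gamma>"
proof -
  have j1: "1 \<le> \<bar>real_of_int j\<bar>" using assms(2) by linarith
  have "japanese n \<le> japanese (n + j) + \<bar>real_of_int j\<bar>" by (rule japanese_shift)
  \<comment> \<open>Both terms are at least 1, so their sum is at most twice their product. The loss
    is multiplicative, which allows a negative power of the bracket to be transported from
    \<open>n + j\<close> to \<open>n\<close>.\<close>
  also have "\<dots> \<le> 2 * (japanese (n + j) * \<bar>real_of_int j\<bar>)"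
  proof -
    have "0 \<le> (japanese (n + j) - 1) * \<bar>real_of_int j\<bar>" "0 \<le> japanese (n + j) * (\<bar>real_of_int j\<bar> - 1)"
      using j1 japanese_ge_1[of "n + j"] by (auto intro!: mult_nonneg_nonneg)
    then show ?thesis by (simp add: algebra_simps)
  qed
  finally have "japanese n powr \<gamma> \<le> (2 * (japanese (n + j) * \<bar>real_of_int j\<bar>)) powr \<gamma>"
    using assms japanese_pos[of n] by (intro powr_mono2) auto
  also have "\<dots> = 2 powr \<gamma> * (japanese (n + j) powr \<gamma> * \<bar>real_of_int j\<bar> powr \<gamma>)"
    using japanese_pos[of "n + j"] by (simp add: powr_mult)
  finally have "japanese n powr \<gamma> \<le> 2 powr \<gamma> * (japanese (n + j) powr \<gamma> * \<bar>real_of_int j\<bar> powr \<gamma>)" .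
  moreover have "0 < japanese n powr \<gamma>" "0 < japanese (n + j) powr \<gamma>"
    using japanese_pos[of n] japanese_pos[of "n + j"] by simp_all
  ultimately show ?thesis by (simp add: powr_minus_divide field_simps)
qed

text \<open>The weight \<open>\<alpha>\<close> is distributed by subadditivity on
  \<open>m + j\<close> or on \<open>j\<close>. Either way the exponents add up to
  \<open>p + q - \<alpha> > 1\<close>, and \<open>powr_prod_le_sum\<close> replaces the product by a
  sum of two summable sequences.\<close>

lemma japanese_powr_conv_bounded:
  fixes p q \<alpha> r :: real
  assumes "0 \<le> \<alpha>" "\<alpha> \<le> 1" "\<alpha> \<le> p" "\<alpha> \<le> q" "1 + \<alpha> < p + q"
  shows "\<exists>C>0. \<forall>D m. finite D \<and> 0 \<notin> D \<longrightarrow>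
     (\<Sum>j\<in>D. japanese (m + j) powr (- p) * \<bar>real_of_int j\<bar> powr (- q)) \<le> C * japanese m powr (- \<alpha>)"
proof -
  obtain C1 where C1: "0 < C1" "\<And>D. finite D \<Longrightarrow> 0 \<notin> D \<Longrightarrow> (\<Sum>k\<in>D. \<bar>real_of_int k\<bar> powr (- (p + q - \<alpha>))) \<le> C1"
    using int_powr_sum_bounded[of "p + q - \<alpha>"] assms by auto
  obtain C2 where C2: "0 < C2" "\<And>S. finite S \<Longrightarrow> (\<Sum>m\<in>S. japanese m powr (- (p + q - \<alpha>))) \<le> C2"
    using japanese_powr_sum_bounded[of "p + q - \<alpha>"] assms by auto
  have "(\<Sum>j\<in>D. japanese (m + j) powr (- p) * \<bar>real_of_int j\<bar> powr (- q)) \<le> (2 * (C1 + C2)) * japanese m powr (- \<alpha>)"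
    if D: "finite D" "0 \<notin> D" for D m
  proof -
    have "japanese m powr \<alpha> * (\<Sum>j\<in>D. japanese (m + j) powr (- p) * \<bar>real_of_int j\<bar> powr (- q)) =
      (\<Sum>j\<in>D. japanese m powr \<alpha> * (japanese (m + j) powr (- p) * \<bar>real_of_int j\<bar> powr (- q)))"
      by (simp add: sum_distrib_left)
    also have "\<dots> \<le> (\<Sum>j\<in>D. 2 * (japanese (m + j) powr (- (p + q - \<alpha>)) + \<bar>real_of_int j\<bar> powr (- (p + q - \<alpha>))))"
    proof (intro sum_mono)
      fix j assume "j \<in> D"
      then have j: "j \<noteq> 0" using D by auto
      define x y where "x = japanese (m + j)" and "y = \<bar>real_of_int j\<bar>"
      have xy: "0 < x" "0 < y" using j japanese_pos by (auto simp: x_def y_def)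
      have "japanese m powr \<alpha> \<le> (x + y) powr \<alpha>"
        unfolding x_def y_def using assms japanese_pos[of m] by (intro powr_mono2 japanese_shift) auto
      also have "\<dots> \<le> x powr \<alpha> + y powr \<alpha>" by (intro powr_subadditive xy assms)
      finally have "japanese m powr \<alpha> * (x powr (- p) * y powr (- q)) \<le> (x powr \<alpha> + y powr \<alpha>) * (x powr (- p) * y powr (- q))"
        by (intro mult_right_mono) auto
      also have "\<dots> = x powr (- (p - \<alpha>)) * y powr (- q) + x powr (- p) * y powr (- (q - \<alpha>))"
        by (simp add: powr_diff powr_minus_divide add_divide_distrib distrib_right)
      also have "\<dots> \<le> (x powr (- (p - \<alpha> + q)) + y powr (- (p - \<alpha> + q))) + (x powr (- (p + (q - \<alpha>))) + y powr (- (p + (q - \<alpha>))))"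
        by (intro add_mono powr_prod_le_sum xy) (use assms in auto)
      also have "\<dots> = 2 * (x powr (- (p + q - \<alpha>)) + y powr (- (p + q - \<alpha>)))" by (simp add: algebra_simps)
      finally show "japanese m powr \<alpha> * (japanese (m + j) powr (- p) * \<bar>real_of_int j\<bar> powr (- q)) \<le>
        2 * (japanese (m + j) powr (- (p + q - \<alpha>)) + \<bar>real_of_int j\<bar> powr (- (p + q - \<alpha>)))"
        by (simp only: x_def y_def)
    qed
    also have "\<dots> = 2 * ((\<Sum>j\<in>(\<lambda>j. m + j) ` D. japanese j powr (- (p + q - \<alpha>))) + (\<Sum>j\<in>D. \<bar>real_of_int j\<bar> powr (- (p + q - \<alpha>))))"
      by (subst sum.reindex) (auto simp: sum.distrib sum_distrib_left[symmetric])
    also have "\<dots> \<le> 2 * (C2 + C1)"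
      using D by (intro mult_left_mono add_mono C1(2) C2(2)) auto
    finally show ?thesis using japanese_pos[of m] by (simp add: powr_minus_divide field_simps)
  qed
  then show ?thesis using C1(1) C2(1) by (intro exI[of _ "2 * (C1 + C2)"]) auto
qed

text \<open>One factor, standing for the time derivative of a mode, decays only with exponent
  \<open>\<beta>\<close>; the other two have \<open>1/2 + \<beta>\<close>. From the weak factor the
  exponent \<open>\<gamma>\<close> is transported to \<open>n\<close>, paid for by growing powers of
  \<open>|j|\<close> and \<open>|k|\<close>. The strong factors, convolved with the weakened
  kernels, then yield exponent 1.\<close>

lemma smoothing_sums_bounded:
  fixes \<beta> :: real
  assumes \<beta>: "0 < \<beta>" "\<beta> \<le> 1/2"
  defines "s \<equiv> 1/2 + \<beta>"
  shows "\<exists>C>0. \<forall>D n. finite D \<and> 0 \<notin> D \<longrightarrow>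
     (\<Sum>k\<in>D. \<Sum>j\<in>D. japanese (n + j) powr (- \<beta>) * japanese (n + j + k) powr (- s) * japanese (n + k) powr (- s)
        / (\<bar>real_of_int j\<bar> * \<bar>real_of_int k\<bar>)) \<le> C * japanese n powr (- (1 + \<beta> / 2)) \<and>
     (\<Sum>k\<in>D. \<Sum>j\<in>D. japanese (n + j) powr (- s) * japanese (n + j + k) powr (- \<beta>) * japanese (n + k) powr (- s)
        / (\<bar>real_of_int j\<bar> * \<bar>real_of_int k\<bar>)) \<le> C * japanese n powr (- (1 + \<beta> / 2))"
proof -
  \<comment> \<open>This choice leaves \<open>s + (1 - \<gamma>)\<close> above \<open>3/2\<close>,
    as the exponent \<open>1/2\<close> in the bound for \<open>V\<close> requires.\<close>
  define \<gamma> where "\<gamma> = \<beta> / 2"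
  have g: "0 < \<gamma>" "\<gamma> \<le> 1/4" "\<gamma> \<le> \<beta>" using \<beta> by (auto simp: \<gamma>_def)
  obtain C1 where C1: "0 < C1" "\<And>D m. finite D \<Longrightarrow> 0 \<notin> D \<Longrightarrow>
     (\<Sum>j\<in>D. japanese (m + j) powr (- s) * \<bar>real_of_int j\<bar> powr (- (1 - \<gamma>))) \<le> C1 * japanese m powr (- (1/2))"
    using japanese_powr_conv_bounded[of "1/2" s "1 - \<gamma>"] \<beta> g by (auto simp: s_def \<gamma>_def)
  obtain C2 where C2: "0 < C2" "\<And>D m. finite D \<Longrightarrow> 0 \<notin> D \<Longrightarrow>
     (\<Sum>j\<in>D. japanese (m + j) powr (- (1 + \<beta>)) * \<bar>real_of_int j\<bar> powr (- 1)) \<le> C2 * japanese m powr (- 1)"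
    using japanese_powr_conv_bounded[of 1 "1 + \<beta>" 1] \<beta> g by auto
  define V where "V = (\<lambda>D m. \<Sum>j\<in>D. japanese (m + j) powr (- s) * \<bar>real_of_int j\<bar> powr (- (1 - \<gamma>)))"
  have V0: "0 \<le> V D m" for D m unfolding V_def by (intro sum_nonneg) auto
  have V: "V D m \<le> C1 * japanese m powr (- (1/2))" if "finite D" "0 \<notin> D" for D m
    unfolding V_def by (rule C1(2)[OF that])
  have two: "2 powr \<gamma> \<le> 2" "4 powr \<gamma> \<le> (4::real)" using powr_mono[of \<gamma> 1 "2::real"] powr_mono[of \<gamma> 1 "4::real"] g by auto
  have W: "japanese (n + j) powr (- \<beta>) / \<bar>real_of_int j\<bar> \<le> 2 * japanese n powr (- \<gamma>) * \<bar>real_of_int j\<bar> powr (- (1 - \<gamma>))"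
    if "j \<noteq> 0" for n j
  proof -
    have "japanese (n + j) powr (- \<beta>) \<le> japanese (n + j) powr (- \<gamma>)"
      using g japanese_ge_1 by (intro powr_mono) auto
    also have "\<dots> \<le> 2 powr \<gamma> * japanese n powr (- \<gamma>) * \<bar>real_of_int j\<bar> powr \<gamma>"
      using g that by (intro japanese_powr_shift) auto
    also have "\<dots> \<le> 2 * japanese n powr (- \<gamma>) * \<bar>real_of_int j\<bar> powr \<gamma>"
      by (intro mult_right_mono two) auto
    finally have "japanese (n + j) powr (- \<beta>) / \<bar>real_of_int j\<bar> \<le> 2 * japanese n powr (- \<gamma>) * \<bar>real_of_int j\<bar> powr \<gamma> / \<bar>real_of_int j\<bar>"
      by (rule divide_right_mono) simp
    also have "\<dots> = 2 * japanese n powr (- \<gamma>) * \<bar>real_of_int j\<bar> powr (- (1 - \<gamma>))"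
      using powr_diff[of "\<bar>real_of_int j\<bar>" \<gamma> 1] that by simp
    finally show ?thesis .
  qed
  have W2: "japanese (n + j + k) powr (- \<beta>) / (\<bar>real_of_int j\<bar> * \<bar>real_of_int k\<bar>) \<le>
      4 * japanese n powr (- \<gamma>) * (\<bar>real_of_int j\<bar> powr (- (1 - \<gamma>)) * \<bar>real_of_int k\<bar> powr (- (1 - \<gamma>)))"
    if "j \<noteq> 0" "k \<noteq> 0" for n j k
  proof -
    have "japanese (n + j + k) powr (- \<beta>) \<le> japanese (n + j + k) powr (- \<gamma>)"
      using g japanese_ge_1 by (intro powr_mono) auto
    also have "\<dots> \<le> 2 powr \<gamma> * japanese (n + j) powr (- \<gamma>) * \<bar>real_of_int k\<bar> powr \<gamma>"
      using g that by (intro japanese_powr_shift) auto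
    also have "\<dots> \<le> 2 powr \<gamma> * (2 powr \<gamma> * japanese n powr (- \<gamma>) * \<bar>real_of_int j\<bar> powr \<gamma>) * \<bar>real_of_int k\<bar> powr \<gamma>"
      using g that by (intro mult_right_mono mult_left_mono japanese_powr_shift) auto
    also have "\<dots> = 4 powr \<gamma> * (japanese n powr (- \<gamma>) * \<bar>real_of_int j\<bar> powr \<gamma> * \<bar>real_of_int k\<bar> powr \<gamma>)"
      using powr_mult[of 2 2 \<gamma>] by simp
    also have "\<dots> \<le> 4 * (japanese n powr (- \<gamma>) * \<bar>real_of_int j\<bar> powr \<gamma> * \<bar>real_of_int k\<bar> powr \<gamma>)"
      by (intro mult_right_mono two) auto
    finally have "japanese (n + j + k) powr (- \<beta>) / (\<bar>real_of_int j\<bar> * \<bar>real_of_int k\<bar>) \<le>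
       4 * (japanese n powr (- \<gamma>) * \<bar>real_of_int j\<bar> powr \<gamma> * \<bar>real_of_int k\<bar> powr \<gamma>) / (\<bar>real_of_int j\<bar> * \<bar>real_of_int k\<bar>)"
      by (rule divide_right_mono) simp
    also have "\<dots> = 4 * japanese n powr (- \<gamma>) * (\<bar>real_of_int j\<bar> powr (- (1 - \<gamma>)) * \<bar>real_of_int k\<bar> powr (- (1 - \<gamma>)))"
      using powr_diff[of "\<bar>real_of_int j\<bar>" \<gamma> 1] powr_diff[of "\<bar>real_of_int k\<bar>" \<gamma> 1] that by simp
    finally show ?thesis .
  qed
  define C where "C = 2 * C1 * C2 + 4 * C1 * C1"
  have J: "japanese n powr (- \<gamma>) * japanese n powr (- 1) = japanese n powr (- (1 + \<beta> / 2))" for n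
    unfolding powr_add[symmetric] by (simp add: \<gamma>_def add.commute)
  have "(\<Sum>k\<in>D. \<Sum>j\<in>D. japanese (n + j) powr (- \<beta>) * japanese (n + j + k) powr (- s) * japanese (n + k) powr (- s)
        / (\<bar>real_of_int j\<bar> * \<bar>real_of_int k\<bar>)) \<le> C * japanese n powr (- (1 + \<beta> / 2))"
    if D: "finite D" "0 \<notin> D" for D n
  proof -
    have "(\<Sum>k\<in>D. \<Sum>j\<in>D. japanese (n + j) powr (- \<beta>) * japanese (n + j + k) powr (- s) * japanese (n + k) powr (- s)
        / (\<bar>real_of_int j\<bar> * \<bar>real_of_int k\<bar>)) =
       (\<Sum>k\<in>D. japanese (n + k) powr (- s) / \<bar>real_of_int k\<bar> * (\<Sum>j\<in>D. (japanese (n + j) powr (- \<beta>) / \<bar>real_of_int j\<bar>) * japanese (n + k + j) powr (- s)))"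
      unfolding sum_distrib_left by (intro sum.cong refl) (simp add: add_ac mult_ac)
    also have "\<dots> \<le> (\<Sum>k\<in>D. japanese (n + k) powr (- s) / \<bar>real_of_int k\<bar> *
       (\<Sum>j\<in>D. (2 * japanese n powr (- \<gamma>) * \<bar>real_of_int j\<bar> powr (- (1 - \<gamma>))) * japanese (n + k + j) powr (- s)))"
      by (intro sum_mono mult_left_mono mult_right_mono W) (use D in auto)
    also have "\<dots> = 2 * japanese n powr (- \<gamma>) * (\<Sum>k\<in>D. japanese (n + k) powr (- s) / \<bar>real_of_int k\<bar> * V D (n + k))"
      unfolding V_def sum_distrib_left by (intro sum.cong refl) (simp add: mult_ac)
    also have "\<dots> \<le> 2 * japanese n powr (- \<gamma>) * (\<Sum>k\<in>D. japanese (n + k) powr (- s) / \<bar>real_of_int k\<bar> * (C1 * japanese (n + k) powr (- (1/2))))"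
      by (intro sum_mono mult_left_mono V D) auto
    also have "\<dots> = 2 * C1 * japanese n powr (- \<gamma>) * (\<Sum>k\<in>D. japanese (n + k) powr (- (1 + \<beta>)) * \<bar>real_of_int k\<bar> powr (- 1))"
    proof -
      have "japanese (n + k) powr (- s) * japanese (n + k) powr (- (1/2)) = japanese (n + k) powr (- (1 + \<beta>))" for k
        by (simp add: powr_add[symmetric] s_def)
      moreover have "japanese (n + k) powr (- s) / \<bar>real_of_int k\<bar> * (C1 * japanese (n + k) powr (- (1/2))) =
         C1 * ((japanese (n + k) powr (- s) * japanese (n + k) powr (- (1/2))) * \<bar>real_of_int k\<bar> powr (- 1))" for k
        using powr_minus_divide[of "\<bar>real_of_int k\<bar>" 1] by simp
      ultimately have e: "japanese (n + k) powr (- s) / \<bar>real_of_int k\<bar> * (C1 * japanese (n + k) powr (- (1/2))) =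
         C1 * (japanese (n + k) powr (- (1 + \<beta>)) * \<bar>real_of_int k\<bar> powr (- 1))" for k
        by metis
      show ?thesis unfolding e by (simp only: sum_distrib_left[symmetric] mult_ac)
    qed
    also have "\<dots> \<le> 2 * C1 * japanese n powr (- \<gamma>) * (C2 * japanese n powr (- 1))"
      using C1(1) by (intro mult_left_mono C2(2) D) auto
    also have "\<dots> = 2 * C1 * C2 * japanese n powr (- (1 + \<beta> / 2))" unfolding J[symmetric] by (simp add: mult_ac)
    also have "\<dots> \<le> C * japanese n powr (- (1 + \<beta> / 2))"
      by (intro mult_right_mono) (auto simp: C_def)
    finally show ?thesis .
  qed
  moreover have "(\<Sum>k\<in>D. \<Sum>j\<in>D. japanese (n + j) powr (- s) * japanese (n + j + k) powr (- \<beta>) * japanese (n + k) powr (- s)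
        / (\<bar>real_of_int j\<bar> * \<bar>real_of_int k\<bar>)) \<le> C * japanese n powr (- (1 + \<beta> / 2))"
    if D: "finite D" "0 \<notin> D" for D n
  proof -
    have "(\<Sum>k\<in>D. \<Sum>j\<in>D. japanese (n + j) powr (- s) * japanese (n + j + k) powr (- \<beta>) * japanese (n + k) powr (- s)
        / (\<bar>real_of_int j\<bar> * \<bar>real_of_int k\<bar>)) =
        (\<Sum>k\<in>D. \<Sum>j\<in>D. (japanese (n + j + k) powr (- \<beta>) / (\<bar>real_of_int j\<bar> * \<bar>real_of_int k\<bar>)) * (japanese (n + j) powr (- s) * japanese (n + k) powr (- s)))"
      by (intro sum.cong refl) (simp add: mult_ac)
    also have "\<dots> \<le> (\<Sum>k\<in>D. \<Sum>j\<in>D. (4 * japanese n powr (- \<gamma>) * (\<bar>real_of_int j\<bar> powr (- (1 - \<gamma>)) * \<bar>real_of_int k\<bar> powr (- (1 - \<gamma>)))) * (japanese (n + j) powr (- s) * japanese (n + k) powr (- s)))"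
      by (intro sum_mono mult_right_mono W2) (use D in auto)
    also have "\<dots> = 4 * japanese n powr (- \<gamma>) * (V D n * V D n)"
      unfolding V_def by (simp add: sum_distrib_left sum_distrib_right mult_ac)
    also have "\<dots> \<le> 4 * japanese n powr (- \<gamma>) * ((C1 * japanese n powr (- (1/2))) * (C1 * japanese n powr (- (1/2))))"
      using C1(1) by (intro mult_left_mono mult_mono V V0 D) auto
    also have "\<dots> = 4 * C1 * C1 * (japanese n powr (- \<gamma>) * (japanese n powr (- (1/2)) * japanese n powr (- (1/2))))"
      by (simp add: mult_ac)
    also have "japanese n powr (- (1/2)) * japanese n powr (- (1/2)) = japanese n powr (- 1)"
      unfolding powr_add[symmetric] by simp
    also have "4 * C1 * C1 * (japanese n powr (- \<gamma>) * japanese n powr (- 1)) \<le> C * japanese n powr (- (1 + \<beta> / 2))"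
      unfolding J by (intro mult_right_mono) (use C1(1) C2(1) in \<open>auto simp: C_def\<close>)
    finally show ?thesis .
  qed
  moreover have "0 < C" using C1(1) C2(1) by (simp add: C_def add_pos_pos)
  ultimately show ?thesis by (intro exI[of _ C]) blast
qed

section \<open>Fourier series on the torus\<close>

definition tor :: "real measure" where
  "tor = restrict_space lborel {0..2*pi}"

lemma space_tor [simp]: "space tor = {0..2*pi}"
  by (simp add: tor_def)

lemma finite_measure_tor: "finite_measure tor"
  by (rule finite_measureI) (simp add: tor_def emeasure_restrict_space)

interpretation tor: finite_measure tor by (rule finite_measure_tor)

lemma measure_tor: "measure tor (space tor) = 2 * pi"
  unfolding tor_def by (subst measure_restrict_space) auto

lemma set_borel_measurable_tor:
  fixes f :: "real \<Rightarrow> complex"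
  shows "set_borel_measurable lborel {0..2*pi} f \<longleftrightarrow> f \<in> borel_measurable tor"
  unfolding set_borel_measurable_def tor_def by (subst borel_measurable_restrict_space_iff) auto

lemma set_integrable_tor:
  fixes f :: "real \<Rightarrow> 'b :: {banach, second_countable_topology}"
  shows "set_integrable lborel {0..2*pi} f \<longleftrightarrow> integrable tor f"
  unfolding set_integrable_def tor_def by (subst integrable_restrict_space) auto

lemma set_integral_tor:
  fixes f :: "real \<Rightarrow> 'b :: {banach, second_countable_topology}"
  shows "(LINT x:{0..2*pi}|lborel. f x) = (LINT x|tor. f x)"
  unfolding set_lebesgue_integral_def tor_def by (subst integral_restrict_space) auto

definition square_integrable :: "'a measure \<Rightarrow> ('a \<Rightarrow> complex) \<Rightarrow> bool" where
  "square_integrable M f \<longleftrightarrow> f \<in> borel_measurable M \<and> integrable M (\<lambda>x. (norm (f x))\<^sup>2)"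

lemma L2_torus_iff: "L2_torus f \<longleftrightarrow> square_integrable tor f"
  by (simp add: L2_torus_def square_integrable_def set_borel_measurable_tor set_integrable_tor)

lemma L2_norm_eq: "L2_norm f = sqrt (LINT x|tor. (norm (f x))\<^sup>2)"
  by (simp add: L2_norm_def set_integral_tor)

lemma fourier_coeff_eq: "fourier_coeff f n = complex_of_real (1 / (2*pi)) * (LINT x|tor. f x * cis (- (of_int n * x)))"
  by (simp add: fourier_coeff_def set_integral_tor)

lemma square_integrable_measurable: "square_integrable M f \<Longrightarrow> f \<in> borel_measurable M"
  by (simp add: square_integrable_def)

lemma integrable_dominated:
  fixes f :: "'a \<Rightarrow> 'b :: {banach, second_countable_topology}" and g :: "'a \<Rightarrow> real"
  assumes "integrable M g" "f \<in> borel_measurable M" "\<And>x. x \<in> space M \<Longrightarrow> norm (f x) \<le> g x"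
  shows "integrable M f"
  by (rule Bochner_Integration.integrable_bound[OF assms(1,2)]) (rule AE_I2, rule order_trans[OF assms(3)], auto)

lemma square_integrable_mult:
  assumes "square_integrable M f" "square_integrable M g"
  shows "integrable M (\<lambda>x. norm (f x) * norm (g x))" "integrable M (\<lambda>x. f x * g x)"
proof -
  note [measurable] = square_integrable_measurable[OF assms(1)] square_integrable_measurable[OF assms(2)]
  have i: "integrable M (\<lambda>x. (norm (f x))\<^sup>2 + (norm (g x))\<^sup>2)"
    using assms unfolding square_integrable_def by (intro Bochner_Integration.integrable_add) blast+
  have b: "norm (f x) * norm (g x) \<le> (norm (f x))\<^sup>2 + (norm (g x))\<^sup>2" for x
    using sum_squares_bound[of "norm (f x)" "norm (g x)", unfolded mult.assoc] mult_nonneg_nonneg[OF norm_ge_zero[of "f x"] norm_ge_zero[of "g x"]] by linarith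
  show "integrable M (\<lambda>x. norm (f x) * norm (g x))"
    by (rule integrable_dominated[OF i]) (simp_all add: b)
  show "integrable M (\<lambda>x. f x * g x)"
    by (rule integrable_dominated[OF i]) (simp_all add: b norm_mult)
qed

lemma square_integrable_cnj: "square_integrable M f \<Longrightarrow> square_integrable M (\<lambda>x. cnj (f x))"
  unfolding square_integrable_def by (auto intro: borel_measurable_continuous_onI[THEN measurable_compose[rotated]] continuous_intros)

lemma square_integrable_add:
  assumes "square_integrable M f" "square_integrable M g"
  shows "square_integrable M (\<lambda>x. f x + g x)"
proof -
  note [measurable] = square_integrable_measurable[OF assms(1)] square_integrable_measurable[OF assms(2)]
  have i: "integrable M (\<lambda>x. 2 * (norm (f x))\<^sup>2 + 2 * (norm (g x))\<^sup>2)"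
    using assms by (simp add: square_integrable_def)
  have b: "(norm (f x + g x))\<^sup>2 \<le> 2 * (norm (f x))\<^sup>2 + 2 * (norm (g x))\<^sup>2" for x
  proof -
    have "(norm (f x + g x))\<^sup>2 \<le> (norm (f x) + norm (g x))\<^sup>2" by (intro power_mono norm_triangle_ineq) auto
    then show ?thesis using sum_squares_bound[of "norm (f x)" "norm (g x)"] by (simp add: power2_sum)
  qed
  show ?thesis unfolding square_integrable_def
    by (intro conjI integrable_dominated[OF i]) (auto simp: b)
qed

lemma square_integrable_cmult:
  "square_integrable M f \<Longrightarrow> square_integrable M (\<lambda>x. c * f x)"
  by (auto simp: square_integrable_def norm_mult power_mult_distrib)

lemma square_integrable_diff:
  assumes "square_integrable M f" "square_integrable M g"
  shows "square_integrable M (\<lambda>x. f x - g x)"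
  using square_integrable_add[OF assms(1) square_integrable_cmult[OF assms(2), of "-1"]] by simp

lemma (in finite_measure) square_integrable_bounded:
  assumes "f \<in> borel_measurable M" "\<And>x. x \<in> space M \<Longrightarrow> norm (f x) \<le> B"
  shows "square_integrable M f"
  unfolding square_integrable_def
proof
  note [measurable] = assms(1)
  show "integrable M (\<lambda>x. (norm (f x))\<^sup>2)"
    by (rule integrable_const_bound[of _ "B\<^sup>2"]) (auto intro!: AE_I2 power_mono assms(2))
qed (rule assms(1))

lemma (in finite_measure) integrable_square_integrable:
  assumes "square_integrable M f" shows "integrable M f"
proof -
  have "square_integrable M (\<lambda>x. 1)" by (rule square_integrable_bounded[of _ 1]) auto
  from square_integrable_mult(2)[OF assms this] show ?thesis by simp
qed

lemma integral_cauchy_schwarz: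
  fixes f g :: "'a \<Rightarrow> real"
  assumes [measurable]: "f \<in> borel_measurable M" "g \<in> borel_measurable M"
    and f: "integrable M (\<lambda>x. (f x)\<^sup>2)" and g: "integrable M (\<lambda>x. (g x)\<^sup>2)"
  shows "integrable M (\<lambda>x. \<bar>f x\<bar> * \<bar>g x\<bar>)"
    "(LINT x|M. \<bar>f x\<bar> * \<bar>g x\<bar>) \<le> sqrt (LINT x|M. (f x)\<^sup>2) * sqrt (LINT x|M. (g x)\<^sup>2)"
proof -
  have sf: "square_integrable M (\<lambda>x. complex_of_real (f x))" and sg: "square_integrable M (\<lambda>x. complex_of_real (g x))"
    using f g by (auto simp: square_integrable_def)
  show i: "integrable M (\<lambda>x. \<bar>f x\<bar> * \<bar>g x\<bar>)" using square_integrable_mult(1)[OF sf sg] by simp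
  have "(\<integral>\<^sup>+x. ennreal \<bar>f x\<bar> * ennreal \<bar>g x\<bar> \<partial>M)\<^sup>2 \<le> (\<integral>\<^sup>+x. (ennreal \<bar>f x\<bar>)\<^sup>2 \<partial>M) * (\<integral>\<^sup>+x. (ennreal \<bar>g x\<bar>)\<^sup>2 \<partial>M)"
    by (rule Cauchy_Schwarz_nn_integral) auto
  also have "(\<integral>\<^sup>+x. ennreal \<bar>f x\<bar> * ennreal \<bar>g x\<bar> \<partial>M) = ennreal (LINT x|M. \<bar>f x\<bar> * \<bar>g x\<bar>)"
    using nn_integral_eq_integral[OF i] by (simp add: ennreal_mult)
  also have "(\<integral>\<^sup>+x. (ennreal \<bar>f x\<bar>)\<^sup>2 \<partial>M) = ennreal (LINT x|M. (f x)\<^sup>2)"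
    using nn_integral_eq_integral[OF f] by (simp add: ennreal_power)
  also have "(\<integral>\<^sup>+x. (ennreal \<bar>g x\<bar>)\<^sup>2 \<partial>M) = ennreal (LINT x|M. (g x)\<^sup>2)"
    using nn_integral_eq_integral[OF g] by (simp add: ennreal_power)
  finally have "(LINT x|M. \<bar>f x\<bar> * \<bar>g x\<bar>)\<^sup>2 \<le> (LINT x|M. (f x)\<^sup>2) * (LINT x|M. (g x)\<^sup>2)"
    by (simp add: ennreal_power ennreal_mult[symmetric] ennreal_le_iff)
  from real_sqrt_le_mono[OF this] show "(LINT x|M. \<bar>f x\<bar> * \<bar>g x\<bar>) \<le> sqrt (LINT x|M. (f x)\<^sup>2) * sqrt (LINT x|M. (g x)\<^sup>2)"
    by (simp add: real_sqrt_mult)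
qed

section \<open>Uniqueness of Fourier coefficients\<close>

lemma measurable_tor_continuous: "continuous_on UNIV f \<Longrightarrow> f \<in> borel_measurable tor"
  for f :: "real \<Rightarrow> 'b :: topological_space"
  unfolding tor_def by (intro measurable_restrict_space1) (simp add: borel_measurable_continuous_onI)

lemma measurable_cis_tor [measurable]: "(\<lambda>x. cis (c * x)) \<in> borel_measurable tor"
  by (rule measurable_tor_continuous) (intro continuous_intros)

lemma integral_tor_cis: "(LINT x|tor. cis (of_int n * x)) = (if n = 0 then 2 * pi else 0)"
proof (cases "n = 0")
  case True
  then show ?thesis using measure_tor by (simp add: scaleR_conv_of_real)
next
  case False
  have "cis (of_int n * (2*pi)) = 1"
    using cis_multiple_2pi[of "of_int n"] by (simp add: mult_ac)
  moreover have "cis (of_int n * (2*pi)) = cis (of_int n * 0) + (LINT x:{0..2*pi}|lborel. \<i> * complex_of_real (of_int n) * cis (of_int n * x))"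
    using has_density_cis[of "2*pi" "of_int n"] pi_gt_zero unfolding has_density_def by auto
  ultimately show ?thesis using False by (simp add: set_integral_tor)
qed

text \<open>The functions annihilated together with all their modulations form a module over the
  trigonometric polynomials; Stone-Weierstrass on the unit circle extends this to continuous
  functions of \<open>cis x\<close>.\<close>

lemma integral_continuous_circle_eq_0:
  fixes H :: "complex \<Rightarrow> real"
  assumes f: "integrable tor f" and 0: "\<And>n. (LINT x|tor. f x * cis (of_int n * x)) = 0"
    and H: "continuous_on UNIV H"
  shows "(LINT x|tor. f x * complex_of_real (H (cis x))) = 0"
proof -
  note [measurable] = borel_measurable_integrable[OF f]
  define G where "G = {g :: real \<Rightarrow> complex. continuous_on UNIV g \<and> (\<exists>B. \<forall>x. norm (g x) \<le> B) \<and> (\<forall>n. (LINT x|tor. f x * g x * cis (of_int n * x)) = 0)}"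
  have int: "integrable tor (\<lambda>x. f x * g x * cis (of_int n * x))" if "continuous_on UNIV g" "\<forall>x. norm (g x) \<le> B" for g B and n :: int
  proof -
    note [measurable] = measurable_tor_continuous[OF that(1)]
    have "integrable tor (\<lambda>x. norm (f x) * B)" using f by simp
    then show ?thesis
      by (rule integrable_dominated) (use that(2) in \<open>auto simp: norm_mult intro!: mult_left_mono\<close>)
  qed
  have pG: "(\<lambda>x. complex_of_real (p (cis x)) * g x) \<in> G" if "real_polynomial_function p" "g \<in> G" for p g
    using that
  proof (induction p arbitrary: g rule: real_polynomial_function.induct)
    case (linear h)
    interpret h: bounded_linear h by fact
    define a b where "a = complex_of_real (h 1)" and "b = complex_of_real (h \<i>)"
    \<comment> \<open>On the circle a real linear functional is a combination of
      \<open>cis x\<close> and \<open>cis (- x)\<close>, so multiplication by it shifts the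
      frequency by one in either direction; this is why the induction has to carry all frequencies
      along.\<close>
    have hc: "complex_of_real (h (cis x)) = ((a - \<i> * b) * cis x + (a + \<i> * b) * cis (- x)) / 2" for x
    proof -
      have "cis x = cos x *\<^sub>R 1 + sin x *\<^sub>R \<i>" by (simp add: complex_eq_iff)
      then have "h (cis x) = cos x * h 1 + sin x * h \<i>" by (simp only: h.add h.scaleR real_scaleR_def)
      then have "complex_of_real (h (cis x)) = complex_of_real (cos x) * a + complex_of_real (sin x) * b" by (simp add: a_def b_def)
      also have "\<dots> = ((a - \<i> * b) * cis x + (a + \<i> * b) * cis (- x)) / 2"
        by (simp add: a_def b_def complex_eq_iff algebra_simps)
      finally show ?thesis .
    qed
    obtain B where B: "\<forall>x. norm (g x) \<le> B" and cg: "continuous_on UNIV g"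
      and g0: "\<And>n. (LINT x|tor. f x * g x * cis (of_int n * x)) = 0" using linear(2) by (auto simp: G_def)
    have "(LINT x|tor. f x * (complex_of_real (h (cis x)) * g x) * cis (of_int n * x)) = 0" for n :: int
    proof -
      have "f x * (complex_of_real (h (cis x)) * g x) * cis (of_int n * x) =
         (a - \<i> * b) / 2 * (f x * g x * cis (of_int (n + 1) * x)) + (a + \<i> * b) / 2 * (f x * g x * cis (of_int (n - 1) * x))" for x
      proof -
        have "cis (of_int (n + 1) * x) = cis (of_int n * x) * cis x" "cis (of_int (n - 1) * x) = cis (of_int n * x) * cis (- x)"
          by (simp_all add: cis_mult algebra_simps)
        then show ?thesis unfolding hc by (simp add: field_simps)
      qed
      then have "(LINT x|tor. f x * (complex_of_real (h (cis x)) * g x) * cis (of_int n * x)) =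
        (a - \<i> * b) / 2 * (LINT x|tor. f x * g x * cis (of_int (n + 1) * x)) + (a + \<i> * b) / 2 * (LINT x|tor. f x * g x * cis (of_int (n - 1) * x))"
        using int[OF cg B] by (simp del: of_int_add of_int_diff)
      then show ?thesis by (simp only: g0) simp
    qed
    moreover have "continuous_on UNIV (\<lambda>x. complex_of_real (h (cis x)) * g x)"
      by (intro continuous_intros cg bounded_linear.continuous_on[OF linear(1)])
    moreover have "norm (complex_of_real (h (cis x)) * g x) \<le> onorm h * B" for x
      unfolding norm_mult using onorm[OF linear(1), of "cis x"] B
      by (intro mult_mono) (auto intro: order_trans[OF norm_ge_zero] onorm_pos_le[OF linear(1)])
    ultimately show ?case unfolding G_def by blast
  next
    case (const c)
    then obtain B where B: "\<forall>x. norm (g x) \<le> B" and cg: "continuous_on UNIV g"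
      and g0: "\<And>n. (LINT x|tor. f x * g x * cis (of_int n * x)) = 0" by (auto simp: G_def)
    have "(LINT x|tor. f x * (complex_of_real c * g x) * cis (of_int n * x)) = 0" for n :: int
    proof -
      have "(LINT x|tor. f x * (complex_of_real c * g x) * cis (of_int n * x)) = (LINT x|tor. complex_of_real c * (f x * g x * cis (of_int n * x)))"
        by (intro Bochner_Integration.integral_cong) auto
      then show ?thesis by (simp add: g0)
    qed
    moreover have "norm (complex_of_real c * g x) \<le> \<bar>c\<bar> * B" for x using B by (auto simp: norm_mult intro: mult_left_mono)
    moreover have "continuous_on UNIV (\<lambda>x. complex_of_real c * g x)" by (intro continuous_intros cg)
    ultimately show ?case unfolding G_def by blast
  next
    case (add p q)
    from add.IH(1)[OF add.prems] obtain B1 where 1: "\<forall>x. norm (complex_of_real (p (cis x)) * g x) \<le> B1" "continuous_on UNIV (\<lambda>x. complex_of_real (p (cis x)) * g x)"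
      "\<And>n. (LINT x|tor. f x * (complex_of_real (p (cis x)) * g x) * cis (of_int n * x)) = 0" by (auto simp: G_def)
    from add.IH(2)[OF add.prems] obtain B2 where 2: "\<forall>x. norm (complex_of_real (q (cis x)) * g x) \<le> B2" "continuous_on UNIV (\<lambda>x. complex_of_real (q (cis x)) * g x)"
      "\<And>n. (LINT x|tor. f x * (complex_of_real (q (cis x)) * g x) * cis (of_int n * x)) = 0" by (auto simp: G_def)
    have e: "complex_of_real (p z + q z) * w = complex_of_real (p z) * w + complex_of_real (q z) * w" for z w
      by (simp add: algebra_simps)
    have "(LINT x|tor. f x * (complex_of_real (p (cis x)) * g x + complex_of_real (q (cis x)) * g x) * cis (of_int n * x)) = 0" for n :: int
    proof -
      have "(LINT x|tor. f x * (complex_of_real (p (cis x)) * g x + complex_of_real (q (cis x)) * g x) * cis (of_int n * x)) =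
        (LINT x|tor. f x * (complex_of_real (p (cis x)) * g x) * cis (of_int n * x) + f x * (complex_of_real (q (cis x)) * g x) * cis (of_int n * x))"
        by (intro Bochner_Integration.integral_cong refl) (simp add: algebra_simps)
      also have "\<dots> = 0" using Bochner_Integration.integral_add[OF int[OF 1(2,1)] int[OF 2(2,1)], of n n] 1(3) 2(3) by simp
      finally show ?thesis .
    qed
    moreover have "norm (complex_of_real (p (cis x)) * g x + complex_of_real (q (cis x)) * g x) \<le> B1 + B2" for x
      by (rule norm_triangle_mono) (use 1(1) 2(1) in auto)
    ultimately show ?case unfolding G_def e using continuous_on_add[OF 1(2) 2(2)] by blast
  next
    case (mult p q)
    have e: "complex_of_real (p z * q z) * w = complex_of_real (p z) * (complex_of_real (q z) * w)" for z w by simp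
    show ?case unfolding e by (rule mult.IH(1)[OF mult.IH(2)[OF mult.prems]])
  qed
  have one: "(\<lambda>x. 1) \<in> G" using 0 by (auto simp: G_def intro!: exI[of _ 1])
  have poly: "(LINT x|tor. f x * complex_of_real (p (cis x))) = 0" if "real_polynomial_function p" for p
  proof -
    have "\<forall>n. (LINT x|tor. f x * (complex_of_real (p (cis x)) * 1) * cis (of_int n * x)) = 0" using pG[OF that one] by (simp add: G_def)
    from this[rule_format, of 0] show ?thesis by simp
  qed
  have Hb: "norm (LINT x|tor. f x * complex_of_real (H (cis x))) \<le> e * (LINT x|tor. norm (f x))" if e: "0 < e" for e
  proof -
    obtain p where p: "real_polynomial_function p" "\<And>z. z \<in> sphere 0 1 \<Longrightarrow> \<bar>H z - p z\<bar> < e"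
      using Stone_Weierstrass_real_polynomial_function[OF compact_sphere continuous_on_subset[OF H subset_UNIV] e] by blast
    have cH: "continuous_on UNIV (\<lambda>x. H (cis x))" by (rule continuous_on_compose2[OF H]) (auto intro: continuous_intros)
    have cp: "continuous_on UNIV (\<lambda>x. p (cis x))"
      by (rule continuous_on_compose2[OF continuous_at_imp_continuous_on[of UNIV p]])
        (auto intro: continuous_intros continuous_real_polymonial_function[OF p(1)])
    note [measurable] = measurable_tor_continuous[OF cH] measurable_tor_continuous[OF cp]
    have bp: "\<bar>H (cis x) - p (cis x)\<bar> \<le> e" for x using p(2)[of "cis x"] by simp
    have i1: "integrable tor (\<lambda>x. f x * complex_of_real (H (cis x) - p (cis x)))"
      by (rule integrable_dominated[of _ "\<lambda>x. norm (f x) * e"])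
        (use f bp in \<open>auto simp: norm_mult simp del: of_real_diff intro!: mult_left_mono\<close>)
    have i2: "integrable tor (\<lambda>x. f x * complex_of_real (p (cis x)))"
      using pG[OF p(1) one] int[of "\<lambda>x. complex_of_real (p (cis x))" _ 0] by (auto simp: G_def)
    have "(LINT x|tor. f x * complex_of_real (H (cis x))) = (LINT x|tor. f x * complex_of_real (H (cis x) - p (cis x)) + f x * complex_of_real (p (cis x)))"
      by (intro Bochner_Integration.integral_cong refl) (simp add: algebra_simps)
    also have "\<dots> = (LINT x|tor. f x * complex_of_real (H (cis x) - p (cis x)))"
      using Bochner_Integration.integral_add[OF i1 i2] poly[OF p(1)] by simp
    also have "norm \<dots> \<le> (LINT x|tor. norm (f x * complex_of_real (H (cis x) - p (cis x))))" by (rule integral_norm_bound)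
    also have "\<dots> \<le> (LINT x|tor. e * norm (f x))"
      by (intro integral_mono integrable_norm i1) (use f bp in \<open>auto simp: norm_mult mult.commute[of e] simp del: of_real_diff intro!: mult_left_mono\<close>)
    finally show ?thesis by simp
  qed
  show ?thesis
  proof (rule ccontr)
    assume "(LINT x|tor. f x * complex_of_real (H (cis x))) \<noteq> 0"
    then have pos: "0 < norm (LINT x|tor. f x * complex_of_real (H (cis x)))" (is "0 < ?z") by simp
    define I where "I = (LINT x|tor. norm (f x))"
    have I0: "0 \<le> I" unfolding I_def by simp
    define e where "e = ?z / (2 * (I + 1))"
    have "0 < e" using pos I0 by (simp add: e_def)
    from Hb[OF this] have "?z \<le> e * I" by (simp add: I_def)
    also have "\<dots> \<le> ?z / 2" using I0 by (simp add: e_def field_simps)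
    finally show False using pos by simp
  qed
qed

text \<open>The positive and the negative part of \<open>r\<close>, taken as densities, define
  finite measures that agree on all half lines and are therefore equal. By uniqueness of densities
  the two parts agree almost everywhere, so both vanish.\<close>

lemma integrable_tor_eq_0_AE:
  fixes r :: "real \<Rightarrow> real"
  assumes r: "integrable tor r" and 0: "\<And>a. a \<in> {0..2*pi} \<Longrightarrow> (LINT x|tor. r x * indicator {a<..<2*pi} x) = 0"
  shows "AE x in tor. r x = 0"
proof -
  define q where "q = (\<lambda>x. indicator {0..2*pi} x * r x)"
  have iq: "integrable lborel q"
    using r unfolding q_def tor_def by (subst (asm) integrable_restrict_space) auto
  note [measurable] = borel_measurable_integrable[OF iq]
  have qi: "(LINT x|lborel. q x * indicator {a<..} x) = 0" for a
  proof -
    have ne: "AE x in lborel. x \<noteq> 0 \<and> x \<noteq> 2 * pi \<and> x \<noteq> a"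
      using AE_lborel_singleton[of 0] AE_lborel_singleton[of "2*pi"] AE_lborel_singleton[of a] by eventually_elim auto
    \<comment> \<open>The half line beyond \<open>a\<close> meets the torus in the interval from
      \<open>b\<close> to \<open>2 * pi\<close>, up to end points.\<close>
    define b where "b = max 0 (min a (2 * pi))"
    have "(LINT x|lborel. q x * indicator {a<..} x) = (LINT x|lborel. indicator {0..2*pi} x *\<^sub>R (r x * indicator {b<..<2*pi} x))"
    proof (rule integral_cong_AE)
      show "AE x in lborel. q x * indicator {a<..} x = indicator {0..2*pi} x *\<^sub>R (r x * indicator {b<..<2*pi} x)"
        using ne by eventually_elim (auto simp: q_def b_def indicator_def)
      have "(\<lambda>x. indicator {0..2*pi} x *\<^sub>R (r x * indicator {b<..<2*pi} x)) = (\<lambda>x. q x * indicator {b<..<2*pi} x)"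
        by (auto simp: q_def)
      then show "(\<lambda>x. indicator {0..2*pi} x *\<^sub>R (r x * indicator {b<..<2*pi} x)) \<in> borel_measurable lborel" by simp
    qed measurable
    also have "\<dots> = (LINT x|tor. r x * indicator {b<..<2*pi} x)"
      unfolding tor_def by (subst integral_restrict_space) auto
    also have "\<dots> = 0" by (rule 0) (auto simp: b_def)
    finally show ?thesis .
  qed
  have fin: "(\<integral>\<^sup>+x. ennreal (p x) \<partial>lborel) < \<infinity>" if "p = q \<or> p = (\<lambda>x. - q x)" for p
  proof -
    have "(\<integral>\<^sup>+x. ennreal (p x) \<partial>lborel) \<le> (\<integral>\<^sup>+x. norm (q x) \<partial>lborel)"
      using that by (intro nn_integral_mono) (auto intro!: ennreal_leI)
    also have "\<dots> < \<infinity>" using iq by (simp add: integrable_iff_bounded)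
    finally show ?thesis .
  qed
  have eq: "(\<integral>\<^sup>+x. ennreal (q x) * indicator {a<..} x \<partial>lborel) = (\<integral>\<^sup>+x. ennreal (- q x) * indicator {a<..} x \<partial>lborel)" for a
  proof -
    have i: "integrable lborel (\<lambda>x. q x * indicator {a<..} x)"
      using integrable_mult_indicator[OF _ iq, of "{a<..}"] by (simp add: mult.commute)
    have f: "(\<integral>\<^sup>+x. ennreal (p x) * indicator {a<..} x \<partial>lborel) < \<infinity>" if "p = q \<or> p = (\<lambda>x. - q x)" for p
      by (rule le_less_trans[OF nn_integral_mono fin[OF that]]) (auto simp: indicator_def)
    have e: "ennreal y * indicator {a<..} x = ennreal (y * indicator {a<..} x)" for x y :: real
      by (auto simp: indicator_def)
    have "enn2real (\<integral>\<^sup>+x. ennreal (q x * indicator {a<..} x) \<partial>lborel) - enn2real (\<integral>\<^sup>+x. ennreal (- (q x * indicator {a<..} x)) \<partial>lborel) = 0"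
      using qi[of a] by (simp add: real_lebesgue_integral_def[OF i])
    then have "enn2real (\<integral>\<^sup>+x. ennreal (q x) * indicator {a<..} x \<partial>lborel) = enn2real (\<integral>\<^sup>+x. ennreal (- q x) * indicator {a<..} x \<partial>lborel)"
      unfolding e by simp
    then show ?thesis using f[of q] f[of "\<lambda>x. - q x"] by (metis ennreal_enn2real infinity_ennreal_def)
  qed
  have "density lborel (\<lambda>x. ennreal (q x)) = density lborel (\<lambda>x. ennreal (- q x))"
  proof (rule measure_eqI_lessThan)
    show "emeasure (density lborel (\<lambda>x. ennreal (q x))) {x<..} < \<infinity>" for x
    proof -
      have "emeasure (density lborel (\<lambda>x. ennreal (q x))) {x<..} = (\<integral>\<^sup>+y. ennreal (q y) * indicator {x<..} y \<partial>lborel)"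
        by (rule emeasure_density) auto
      also have "\<dots> \<le> (\<integral>\<^sup>+y. ennreal (q y) \<partial>lborel)" by (intro nn_integral_mono) (auto simp: indicator_def)
      also have "\<dots> < \<infinity>" by (rule fin) simp
      finally show ?thesis .
    qed
    show "emeasure (density lborel (\<lambda>x. ennreal (q x))) {x<..} = emeasure (density lborel (\<lambda>x. ennreal (- q x))) {x<..}" for x
    proof -
      have "emeasure (density lborel (\<lambda>x. ennreal (q x))) {x<..} = (\<integral>\<^sup>+y. ennreal (q y) * indicator {x<..} y \<partial>lborel)"
        by (rule emeasure_density) auto
      moreover have "emeasure (density lborel (\<lambda>x. ennreal (- q x))) {x<..} = (\<integral>\<^sup>+y. ennreal (- q y) * indicator {x<..} y \<partial>lborel)"
        by (rule emeasure_density) auto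
      ultimately show ?thesis using eq by simp
    qed
  qed auto
  then have "AE x in lborel. ennreal (q x) = ennreal (- q x)"
    using fin[of q] by (subst (asm) finite_density_unique) (auto simp: top.not_eq_extremum)
  then have "AE x in lborel. q x = 0"
  proof eventually_elim
    case (elim x)
    then show ?case by (cases "0 \<le> q x") (auto simp: ennreal_neg ennreal_eq_0_iff)
  qed
  then have "AE x in lborel. x \<in> {0..2*pi} \<longrightarrow> r x = 0" by eventually_elim (auto simp: q_def)
  then show ?thesis unfolding tor_def by (subst AE_restrict_space_iff) auto
qed

text \<open>Integrals of \<open>f\<close> against continuous functions of \<open>cis x\<close>
  vanish. The indicator of an arc ending at \<open>2 * pi\<close> is a bounded pointwise limit of
  such functions, so integrals over these arcs vanish too, and they determine an integrable
  function. In L^2 this is the completeness of the exponentials.\<close>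

lemma fourier_uniqueness:
  assumes f: "integrable tor f" and 0: "\<And>n. fourier_coeff f n = 0"
  shows "AE x in tor. f x = 0"
proof -
  note [measurable] = borel_measurable_integrable[OF f]
  have z: "(LINT x|tor. f x * cis (of_int n * x)) = 0" for n
    using 0[of "- n"] by (simp add: fourier_coeff_eq)
  have ind: "(LINT x|tor. f x * indicator {a<..<2*pi} x) = 0" if a: "a \<in> {0..2*pi}" for a
  proof -
    \<comment> \<open>The complementary closed arc. It contains the point 1, where both ends of the
      period meet, so the arc that is tested is open at \<open>2 * pi\<close>.\<close>
    define K where "K = cis ` {0..a}"
    have K: "compact K" unfolding K_def by (intro compact_continuous_image continuous_intros compact_Icc)
    have K0: "K \<noteq> {}" using a by (auto simp: K_def)
    have inK: "cis x \<in> K \<longleftrightarrow> \<not> (a < x \<and> x < 2 * pi)" if x: "x \<in> {0..2*pi}" for x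
    proof
      assume "cis x \<in> K"
      then obtain y where y: "0 \<le> y" "y \<le> a" "cis x = cis y" by (auto simp: K_def)
      show "\<not> (a < x \<and> x < 2 * pi)"
      proof
        assume h: "a < x \<and> x < 2 * pi"
        have "cis (x - y) = 1" using y(3) by (simp add: cis_divide[symmetric])
        then have "cos (x - y) = 1" by (simp add: complex_eq_iff)
        then obtain m :: int where m: "x - y = of_int m * 2 * pi" by (auto simp: cos_one_2pi_int)
        have "\<bar>of_int m * 2 * pi\<bar> < 2 * pi" unfolding m[symmetric] using h x y a by auto
        then have "\<bar>real_of_int m\<bar> < 1" by (simp add: abs_mult)
        then have "m = 0" by linarith
        then have "x = y" using m by simp
        then show False using y h by auto
      qed
    next
      assume h: "\<not> (a < x \<and> x < 2 * pi)"
      show "cis x \<in> K"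
      proof (cases "x \<le> a")
        case True then show ?thesis using x by (auto simp: K_def)
      next
        case False
        then have "x = 2 * pi" using h x by auto
        then have "cis x = cis 0" by simp
        then show ?thesis using a unfolding K_def by (intro image_eqI[of _ _ 0]) auto
      qed
    qed
    \<comment> \<open>Zero on \<open>K\<close>, and at each point off \<open>K\<close> equal to 1
      for all large \<open>k\<close>.\<close>
    define H where "H = (\<lambda>k::nat. \<lambda>z. min 1 (real k * infdist z K))"
    have Hc: "continuous_on UNIV (H k)" for k unfolding H_def by (intro continuous_intros)
    have cH: "continuous_on UNIV (\<lambda>x. H k (cis x))" for k
      by (rule continuous_on_compose2[OF Hc]) (auto intro: continuous_intros)
    note [measurable] = measurable_tor_continuous[OF cH]
    have [measurable]: "(\<lambda>x. indicator {a<..<2*pi} x :: complex) \<in> borel_measurable tor"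
      unfolding tor_def by (intro measurable_restrict_space1) simp
    have H01: "0 \<le> H k z" "H k z \<le> 1" for k z by (auto simp: H_def infdist_nonneg)
    have lim: "(\<lambda>k. f x * complex_of_real (H k (cis x))) \<longlonglongrightarrow> f x * indicator {a<..<2*pi} x" if x: "x \<in> space tor" for x
    proof (cases "cis x \<in> K")
      case True
      then have "H k (cis x) = 0" for k by (simp add: H_def)
      moreover have "indicator {a<..<2*pi} x = (0::complex)" using True inK[of x] x by (auto simp: indicator_def)
      ultimately show ?thesis by simp
    next
      case False
      then have pos: "0 < infdist (cis x) K"
        using in_closed_iff_infdist_zero[OF compact_imp_closed[OF K] K0, of "cis x"] infdist_nonneg[of "cis x" K] by linarith
      obtain k0 where k0: "1 \<le> real k0 * infdist (cis x) K"
        using reals_Archimedean3[OF pos] by (metis less_imp_le)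
      have "\<forall>k\<ge>k0. H k (cis x) = 1"
      proof (intro allI impI)
        fix k assume "k0 \<le> k"
        then have "real k0 * infdist (cis x) K \<le> real k * infdist (cis x) K" using pos by (intro mult_right_mono) auto
        then show "H k (cis x) = 1" using k0 by (simp add: H_def)
      qed
      then have "\<forall>\<^sub>F k in sequentially. f x * complex_of_real (H k (cis x)) = f x * indicator {a<..<2*pi} x"
        using False inK[of x] x by (auto simp: eventually_sequentially indicator_def)
      then show ?thesis by (rule tendsto_eventually)
    qed
    have "(\<lambda>k. LINT x|tor. f x * complex_of_real (H k (cis x))) \<longlonglongrightarrow> (LINT x|tor. f x * indicator {a<..<2*pi} x)"
    proof (rule integral_dominated_convergence[where w = "\<lambda>x. norm (f x)"])
      show "AE x in tor. (\<lambda>k. f x * complex_of_real (H k (cis x))) \<longlonglongrightarrow> f x * indicator {a<..<2*pi} x"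
        by (rule AE_I2) (rule lim)
      show "AE x in tor. norm (f x * complex_of_real (H k (cis x))) \<le> norm (f x)" for k
        using H01[of k] by (auto simp: norm_mult abs_of_nonneg mult_left_le)
    qed (use f in auto)
    then show ?thesis using integral_continuous_circle_eq_0[OF f z Hc] by (simp add: LIMSEQ_const_iff)
  qed
  have ii: "integrable tor (\<lambda>x. f x * indicator {a<..<2*pi} x)" for a
  proof (rule integrable_dominated[OF integrable_norm[OF f]])
    have "(\<lambda>x. indicator {a<..<2*pi} x :: complex) \<in> borel_measurable tor"
      unfolding tor_def by (intro measurable_restrict_space1) simp
    then show "(\<lambda>x. f x * indicator {a<..<2*pi} x) \<in> borel_measurable tor" by (intro borel_measurable_times) auto
  qed (auto simp: indicator_def)
  have "AE x in tor. Re (f x) = 0"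
  proof (rule integrable_tor_eq_0_AE)
    fix a assume "a \<in> {0..2*pi}"
    have "(LINT x|tor. Re (f x) * indicator {a<..<2*pi} x) = (LINT x|tor. Re (f x * indicator {a<..<2*pi} x))"
      by (intro Bochner_Integration.integral_cong) (auto simp: indicator_def)
    also have "\<dots> = 0" using ind[OF \<open>a \<in> _\<close>] integral_Re[OF ii, of a] by simp
    finally show "(LINT x|tor. Re (f x) * indicator {a<..<2*pi} x) = 0" .
  qed (use f in simp)
  moreover have "AE x in tor. Im (f x) = 0"
  proof (rule integrable_tor_eq_0_AE)
    fix a assume "a \<in> {0..2*pi}"
    have "(LINT x|tor. Im (f x) * indicator {a<..<2*pi} x) = (LINT x|tor. Im (f x * indicator {a<..<2*pi} x))"
      by (intro Bochner_Integration.integral_cong) (auto simp: indicator_def)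
    also have "\<dots> = 0" using ind[OF \<open>a \<in> _\<close>] integral_Im[OF ii, of a] by simp
    finally show "(LINT x|tor. Im (f x) * indicator {a<..<2*pi} x) = 0" .
  qed (use f in simp)
  ultimately show ?thesis by eventually_elim (simp add: complex_eq_iff)
qed

section \<open>Partial sums, Parseval's identity and the Riesz-Fischer theorem\<close>

definition psum :: "(int \<Rightarrow> complex) \<Rightarrow> nat \<Rightarrow> real \<Rightarrow> complex" where
  "psum a N x = (\<Sum>n\<in>{-int N..int N}. a n * cis (of_int n * x))"

lemma psum_continuous: "continuous_on UNIV (psum a N)"
  unfolding psum_def by (intro continuous_intros)

lemma psum_bound: "norm (psum a N x) \<le> (\<Sum>n\<in>{-int N..int N}. norm (a n))"
  unfolding psum_def by (rule order_trans[OF norm_sum]) (simp add: norm_mult)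

lemma square_integrable_psum: "square_integrable tor (psum a N)"
  by (rule tor.square_integrable_bounded[OF measurable_tor_continuous[OF psum_continuous] psum_bound])

lemma integrable_fourier:
  assumes "integrable tor f" shows "integrable tor (\<lambda>x. f x * cis (c * x))"
proof -
  note [measurable] = borel_measurable_integrable[OF assms]
  show ?thesis by (rule integrable_dominated[OF integrable_norm[OF assms]]) (auto simp: norm_mult)
qed

lemma fourier_coeff_cmult: "fourier_coeff (\<lambda>x. c * f x) n = c * fourier_coeff f n"
  unfolding fourier_coeff_eq mult.assoc by simp

lemma fourier_coeff_diff:
  assumes "integrable tor f" "integrable tor g"
  shows "fourier_coeff (\<lambda>x. f x - g x) n = fourier_coeff f n - fourier_coeff g n"
proof -
  have "(LINT x|tor. f x * cis (- (of_int n * x)) - g x * cis (- (of_int n * x))) =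
    (LINT x|tor. f x * cis (- (of_int n * x))) - (LINT x|tor. g x * cis (- (of_int n * x)))"
    using Bochner_Integration.integral_diff[OF integrable_fourier[OF assms(1), of "- of_int n"] integrable_fourier[OF assms(2), of "- of_int n"]]
    by simp
  then show ?thesis unfolding fourier_coeff_eq left_diff_distrib by (simp only: right_diff_distrib)
qed

lemma fourier_coeff_norm_le:
  assumes "integrable tor f"
  shows "norm (fourier_coeff f n) \<le> (1 / (2*pi)) * (LINT x|tor. norm (f x))"
proof -
  have "norm (LINT x|tor. f x * cis (- (of_int n * x))) \<le> (LINT x|tor. norm (f x * cis (- (of_int n * x))))"
    by (rule integral_norm_bound)
  then show ?thesis unfolding fourier_coeff_eq by (simp add: norm_mult norm_divide divide_right_mono)
qed

lemma fourier_coeff_psum: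
  "fourier_coeff (psum a N) m = (if m \<in> {-int N..int N} then a m else 0)"
proof -
  have "(LINT x|tor. psum a N x * cis (- (of_int m * x))) = (LINT x|tor. (\<Sum>n\<in>{-int N..int N}. a n * cis (of_int (n - m) * x)))"
    unfolding psum_def sum_distrib_right
    by (intro Bochner_Integration.integral_cong refl sum.cong) (simp add: mult.assoc cis_mult algebra_simps)
  also have "\<dots> = (\<Sum>n\<in>{-int N..int N}. (LINT x|tor. a n * cis (of_int (n - m) * x)))"
    by (rule Bochner_Integration.integral_sum) (intro integrable_mult_right tor.integrable_const_bound[of _ 1], auto)
  also have "\<dots> = (\<Sum>n\<in>{-int N..int N}. if n = m then 2 * pi * a m else 0)"
    by (intro sum.cong refl) (simp add: integral_tor_cis del: of_int_diff)
  also have "\<dots> = (if m \<in> {-int N..int N} then 2 * pi * a m else 0)" by (simp add: sum.delta)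
  finally show ?thesis unfolding fourier_coeff_eq by simp
qed

lemma integral_mult_cnj_psum:
  assumes "integrable tor f"
  shows "(LINT x|tor. f x * cnj (psum a N x)) = 2 * pi * (\<Sum>n\<in>{-int N..int N}. fourier_coeff f n * cnj (a n))"
proof -
  have "(LINT x|tor. f x * cnj (psum a N x)) = (LINT x|tor. (\<Sum>n\<in>{-int N..int N}. cnj (a n) * (f x * cis (- of_int n * x))))"
    unfolding psum_def by (intro Bochner_Integration.integral_cong refl) (simp add: sum_distrib_left mult_ac cis_cnj)
  also have "\<dots> = (\<Sum>n\<in>{-int N..int N}. (LINT x|tor. cnj (a n) * (f x * cis (- of_int n * x))))"
    by (rule Bochner_Integration.integral_sum) (intro integrable_mult_right integrable_fourier assms)
  also have "\<dots> = 2 * pi * (\<Sum>n\<in>{-int N..int N}. fourier_coeff f n * cnj (a n))"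
    unfolding sum_distrib_left fourier_coeff_eq by (intro sum.cong refl) simp
  finally show ?thesis .
qed

lemma integral_norm_psum: "(LINT x|tor. (norm (psum a N x))\<^sup>2) = 2 * pi * (\<Sum>n\<in>{-int N..int N}. (norm (a n))\<^sup>2)"
proof -
  have "complex_of_real (LINT x|tor. (norm (psum a N x))\<^sup>2) = (LINT x|tor. psum a N x * cnj (psum a N x))"
    unfolding integral_complex_of_real[symmetric] by (intro Bochner_Integration.integral_cong refl) (simp only: complex_norm_square)
  also have "\<dots> = 2 * pi * (\<Sum>n\<in>{-int N..int N}. fourier_coeff (psum a N) n * cnj (a n))"
    by (rule integral_mult_cnj_psum[OF tor.integrable_square_integrable[OF square_integrable_psum]])
  also have "\<dots> = 2 * pi * (\<Sum>n\<in>{-int N..int N}. complex_of_real ((norm (a n))\<^sup>2))"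
    by (intro arg_cong2[of _ _ _ _ "(*)"] refl sum.cong) (simp_all add: fourier_coeff_psum complex_norm_square del: of_real_power)
  also have "\<dots> = complex_of_real (2 * pi * (\<Sum>n\<in>{-int N..int N}. (norm (a n))\<^sup>2))" by simp
  finally show ?thesis by (simp only: of_real_eq_iff)
qed

text \<open>Completing the square. When \<open>a\<close> consists of the Fourier coefficients of
  \<open>f\<close> the last sum vanishes, and Bessel's inequality and the tail formula can be read
  off.\<close>

lemma integral_norm_diff_psum:
  assumes f: "square_integrable tor f"
  shows "(LINT x|tor. (norm (f x - psum a N x))\<^sup>2) = (LINT x|tor. (norm (f x))\<^sup>2)
    - 2 * pi * (\<Sum>n\<in>{-int N..int N}. (norm (fourier_coeff f n))\<^sup>2) + 2 * pi * (\<Sum>n\<in>{-int N..int N}. (norm (fourier_coeff f n - a n))\<^sup>2)"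
proof -
  note p = square_integrable_psum[of a N]
  have fi: "integrable tor f" by (rule tor.integrable_square_integrable[OF f])
  have i1: "integrable tor (\<lambda>x. f x * cnj (psum a N x))" by (rule square_integrable_mult(2)[OF f square_integrable_cnj[OF p]])
  have i2: "integrable tor (\<lambda>x. 2 * Re (f x * cnj (psum a N x)))" by (intro integrable_mult_right integrable_Re i1)
  have "(norm (z - w))\<^sup>2 = (norm z)\<^sup>2 - 2 * Re (z * cnj w) + (norm w)\<^sup>2" for z w :: complex
    unfolding cmod_power2 by (simp add: power2_eq_square algebra_simps)
  note sq = this
  have "(LINT x|tor. (norm (f x - psum a N x))\<^sup>2) = (LINT x|tor. (norm (f x))\<^sup>2) - (LINT x|tor. 2 * Re (f x * cnj (psum a N x))) + (LINT x|tor. (norm (psum a N x))\<^sup>2)"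
    unfolding sq using f p i2 by (simp add: square_integrable_def del: integral_mult_right_zero)
  also have "(LINT x|tor. 2 * Re (f x * cnj (psum a N x))) = 2 * Re (LINT x|tor. f x * cnj (psum a N x))"
    using integral_Re[OF i1] by (simp only: integral_mult_right_zero)
  also have "\<dots> = 2 * pi * (\<Sum>n\<in>{-int N..int N}. 2 * Re (fourier_coeff f n * cnj (a n)))"
    unfolding integral_mult_cnj_psum[OF fi] by (simp add: sum_distrib_left algebra_simps)
  finally show ?thesis unfolding integral_norm_psum sq by (simp add: sum.distrib sum_subtractf algebra_simps)
qed

lemma bessel:
  assumes "square_integrable tor f" "finite S"
  shows "2 * pi * (\<Sum>n\<in>S. (norm (fourier_coeff f n))\<^sup>2) \<le> (LINT x|tor. (norm (f x))\<^sup>2)"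
proof -
  define N where "N = nat (Max (insert 0 (abs ` S)))"
  have S: "S \<subseteq> {-int N..int N}"
  proof
    fix n assume "n \<in> S"
    then have "\<bar>n\<bar> \<le> Max (insert 0 (abs ` S))" using assms by (intro Max_ge) auto
    then show "n \<in> {-int N..int N}" unfolding N_def by auto
  qed
  have "0 \<le> (LINT x|tor. (norm (f x - psum (fourier_coeff f) N x))\<^sup>2)" by simp
  then have "2 * pi * (\<Sum>n\<in>{-int N..int N}. (norm (fourier_coeff f n))\<^sup>2) \<le> (LINT x|tor. (norm (f x))\<^sup>2)"
    unfolding integral_norm_diff_psum[OF assms(1)] by simp
  moreover have "(\<Sum>n\<in>S. (norm (fourier_coeff f n))\<^sup>2) \<le> (\<Sum>n\<in>{-int N..int N}. (norm (fourier_coeff f n))\<^sup>2)"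
    using S by (intro sum_mono2) auto
  then have "2 * pi * (\<Sum>n\<in>S. (norm (fourier_coeff f n))\<^sup>2) \<le> 2 * pi * (\<Sum>n\<in>{-int N..int N}. (norm (fourier_coeff f n))\<^sup>2)"
    by (intro mult_left_mono) auto
  ultimately show ?thesis by linarith
qed

lemma integral_norm_psum_diff:
  assumes "M \<le> N"
  shows "(LINT x|tor. (norm (psum a N x - psum a M x))\<^sup>2) =
    2 * pi * ((\<Sum>n\<in>{-int N..int N}. (norm (a n))\<^sup>2) - (\<Sum>n\<in>{-int M..int M}. (norm (a n))\<^sup>2))"
proof -
  define b where "b = (\<lambda>n. if n \<in> {-int M..int M} then 0 else a n)"
  have sub: "{-int M..int M} \<subseteq> {-int N..int N}" using assms by auto
  have split: "(\<Sum>n\<in>{-int N..int N}. g n) - (\<Sum>n\<in>{-int M..int M}. g n) = (\<Sum>n\<in>{-int N..int N}. if n \<in> {-int M..int M} then 0 else g n)"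
    for g :: "int \<Rightarrow> 'b :: real_normed_vector"
  proof -
    have "(\<Sum>n\<in>{-int N..int N}. g n) - (\<Sum>n\<in>{-int M..int M}. g n) = (\<Sum>n\<in>{-int N..int N} - {-int M..int M}. g n)"
      using sum_diff[OF _ sub, of g] by simp
    also have "\<dots> = (\<Sum>n\<in>{-int N..int N} - {-int M..int M}. if n \<in> {-int M..int M} then 0 else g n)"
      by (intro sum.cong) auto
    also have "\<dots> = (\<Sum>n\<in>{-int N..int N}. if n \<in> {-int M..int M} then 0 else g n)"
      by (intro sum.mono_neutral_left) auto
    finally show ?thesis .
  qed
  have "psum a N x - psum a M x = psum b N x" for x
    unfolding psum_def split by (intro sum.cong) (auto simp: b_def)
  then have "(LINT x|tor. (norm (psum a N x - psum a M x))\<^sup>2) = 2 * pi * (\<Sum>n\<in>{-int N..int N}. (norm (b n))\<^sup>2)"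
    by (simp add: integral_norm_psum)
  also have "(\<Sum>n\<in>{-int N..int N}. (norm (b n))\<^sup>2) = (\<Sum>n\<in>{-int N..int N}. if n \<in> {-int M..int M} then 0 else (norm (a n))\<^sup>2)"
    by (intro sum.cong) (auto simp: b_def)
  finally show ?thesis unfolding split .
qed

lemma L1_le_L2_tor:
  assumes "square_integrable tor f"
  shows "(LINT x|tor. norm (f x)) \<le> sqrt (2 * pi) * sqrt (LINT x|tor. (norm (f x))\<^sup>2)"
proof -
  note [measurable] = square_integrable_measurable[OF assms]
  have "(LINT x|tor. \<bar>1\<bar> * \<bar>norm (f x)\<bar>) \<le> sqrt (LINT x|tor. 1\<^sup>2) * sqrt (LINT x|tor. (norm (f x))\<^sup>2)"
    by (rule integral_cauchy_schwarz(2)) (use assms in \<open>auto simp: square_integrable_def\<close>)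
  then show ?thesis using measure_tor by simp
qed

text \<open>Along a fast subsequence the increments are summable in L^1, so the partial sums
  converge almost everywhere; Fatou's lemma turns the Cauchy estimate into L^2 convergence of the
  whole sequence to that limit.\<close>

lemma riesz_fischer:
  assumes a: "\<And>S. finite S \<Longrightarrow> (\<Sum>n\<in>S. (norm (a n))\<^sup>2) \<le> B"
  shows "\<exists>f. square_integrable tor f \<and> (\<lambda>N. LINT x|tor. (norm (psum a N x - f x))\<^sup>2) \<longlonglongrightarrow> 0"
proof -
  define S where "S = (\<lambda>N::nat. \<Sum>n\<in>{-int N..int N}. (norm (a n))\<^sup>2)"
  have Smono: "incseq S" unfolding S_def incseq_def by (auto intro!: sum_mono2)
  have SB: "S N \<le> B" for N unfolding S_def by (rule a) simp
  obtain s where s: "S \<longlonglongrightarrow> s" "\<And>N. S N \<le> s" using incseq_convergent[OF Smono, of B] SB by blast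
  have diff: "(LINT x|tor. (norm (psum a N x - psum a M x))\<^sup>2) \<le> 2 * pi * (s - S M)" if "M \<le> N" for M N
    unfolding integral_norm_psum_diff[OF that] using s(2)[of N] by (auto simp: S_def intro!: mult_left_mono)
  have "\<exists>N. s - S N < (1/4) ^ k" for k :: nat
  proof -
    have "eventually (\<lambda>N. s - (1/4) ^ k < S N) sequentially" by (rule order_tendstoD(1)[OF s(1)]) simp
    then obtain N where "s - (1/4) ^ k < S N" by (auto simp: eventually_sequentially)
    then show ?thesis by (intro exI[of _ N]) simp
  qed
  then obtain r0 where r0: "\<And>k. s - S (r0 k) < (1/4) ^ k" by metis
  \<comment> \<open>Adding up the indices makes \<open>r\<close> increasing and unbounded while
    keeping it above \<open>r0\<close>. The rate \<open>1/4\<close> for squared norms becomes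
    \<open>1/2\<close> for norms.\<close>
  define r where "r = (\<lambda>k. k + (\<Sum>j\<le>k. r0 j))"
  have rmono: "r k \<le> r (Suc k)" for k by (simp add: r_def)
  have rr: "s - S (r k) \<le> (1/4) ^ k" for k
  proof -
    have "r0 k \<le> (\<Sum>j\<le>k. r0 j)" by (rule member_le_sum) auto
    then have "r0 k \<le> r k" by (simp add: r_def)
    then have "S (r0 k) \<le> S (r k)" using Smono by (auto simp: incseq_def)
    then show ?thesis using r0[of k] by linarith
  qed
  define d where "d = (\<lambda>k x. psum a (r (Suc k)) x - psum a (r k) x)"
  have dsq: "square_integrable tor (d k)" for k unfolding d_def by (intro square_integrable_diff square_integrable_psum)
  note [measurable] = square_integrable_measurable[OF dsq] square_integrable_measurable[OF square_integrable_psum]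
  have dint: "integrable tor (d k)" for k by (rule tor.integrable_square_integrable[OF dsq])
  have d1: "(LINT x|tor. norm (d k x)) \<le> 2 * pi * (1/2) ^ k" for k
  proof -
    have "(LINT x|tor. norm (d k x)) \<le> sqrt (2 * pi) * sqrt (LINT x|tor. (norm (d k x))\<^sup>2)" by (rule L1_le_L2_tor[OF dsq])
    also have "\<dots> \<le> sqrt (2 * pi) * sqrt (2 * pi * (1/4) ^ k)"
      by (intro mult_left_mono real_sqrt_le_mono) (use diff[OF rmono[of k]] rr[of k] in \<open>auto simp: d_def intro: order_trans\<close>)
    also have "\<dots> = 2 * pi * (1/2) ^ k"
    proof -
      have "sqrt ((1/4) ^ k) = (1/2) ^ k" by (simp add: real_sqrt_power real_sqrt_divide)
      then have "sqrt (2 * pi * (1/4) ^ k) = sqrt (2 * pi) * (1/2) ^ k" by (simp only: real_sqrt_mult)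
      then show ?thesis by (simp only: mult.assoc[symmetric] real_sqrt_mult_self) simp
    qed
    finally show ?thesis .
  qed
  have "(\<integral>\<^sup>+x. (\<Sum>k. ennreal (norm (d k x))) \<partial>tor) = (\<Sum>k. \<integral>\<^sup>+x. ennreal (norm (d k x)) \<partial>tor)"
    by (rule nn_integral_suminf) measurable
  also have "\<dots> = (\<Sum>k. ennreal (LINT x|tor. norm (d k x)))"
    by (intro suminf_cong nn_integral_eq_integral integrable_norm dint) auto
  also have "\<dots> \<le> (\<Sum>k. ennreal (2 * pi * (1/2) ^ k))"
    by (intro suminf_le ennreal_leI d1) auto
  also have "\<dots> < \<infinity>"
  proof -
    have "summable (\<lambda>k. 2 * pi * (1/2::real) ^ k)" by (intro summable_mult summable_geometric) auto
    then show ?thesis by (subst suminf_ennreal2) auto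
  qed
  finally have "AE x in tor. (\<Sum>k. ennreal (norm (d k x))) \<noteq> \<infinity>"
    by (intro nn_integral_PInf_AE) auto
  then have AEs: "AE x in tor. summable (\<lambda>k. d k x)"
  proof eventually_elim
    case (elim x)
    have "summable (\<lambda>k. norm (d k x))" by (rule summable_suminf_not_top) (use elim in auto)
    then show ?case by (rule summable_norm_cancel)
  qed
  define f where "f = (\<lambda>x. psum a (r 0) x + (\<Sum>k. d k x))"
  have [measurable]: "f \<in> borel_measurable tor" unfolding f_def by measurable
  have lim: "AE x in tor. (\<lambda>k. psum a (r k) x) \<longlonglongrightarrow> f x"
    using AEs
  proof eventually_elim
    case (elim x)
    have "(\<Sum>j<k. d j x) = psum a (r k) x - psum a (r 0) x" for k
      unfolding d_def by (rule sum_lessThan_telescope)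
    moreover have "(\<lambda>k. \<Sum>j<k. d j x) \<longlonglongrightarrow> (\<Sum>k. d k x)" using elim by (rule summable_LIMSEQ)
    ultimately have "(\<lambda>k. psum a (r 0) x + (psum a (r k) x - psum a (r 0) x)) \<longlonglongrightarrow> psum a (r 0) x + (\<Sum>k. d k x)"
      by (intro tendsto_add tendsto_const) simp
    then show ?case by (simp add: f_def)
  qed
  have fatou: "(\<integral>\<^sup>+x. ennreal ((norm (psum a N x - f x))\<^sup>2) \<partial>tor) \<le> ennreal (2 * pi * (s - S N))" for N
  proof -
    have bd: "eventually (\<lambda>k. (LINT x|tor. (norm (psum a N x - psum a (r k) x))\<^sup>2) \<le> 2 * pi * (s - S N)) sequentially"
      using eventually_ge_at_top[of N]
    proof eventually_elim
      case (elim k)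
      then have "N \<le> r k" by (simp add: r_def)
      from diff[OF this] show ?case by (simp add: norm_minus_commute)
    qed
    have "(\<integral>\<^sup>+x. ennreal ((norm (psum a N x - f x))\<^sup>2) \<partial>tor) \<le> (\<integral>\<^sup>+x. liminf (\<lambda>k. ennreal ((norm (psum a N x - psum a (r k) x))\<^sup>2)) \<partial>tor)"
    proof (rule nn_integral_mono_AE, use lim in eventually_elim)
      case (elim x)
      have "(\<lambda>k. ennreal ((norm (psum a N x - psum a (r k) x))\<^sup>2)) \<longlonglongrightarrow> ennreal ((norm (psum a N x - f x))\<^sup>2)"
        using elim by (intro tendsto_intros tendsto_ennrealI)
      from lim_imp_Liminf[OF _ this] show ?case by simp
    qed
    also have "\<dots> \<le> liminf (\<lambda>k. \<integral>\<^sup>+x. ennreal ((norm (psum a N x - psum a (r k) x))\<^sup>2) \<partial>tor)"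
      by (rule nn_integral_liminf) measurable
    also have "\<dots> \<le> liminf (\<lambda>k. ennreal (2 * pi * (s - S N)))"
    proof (rule Liminf_mono, use bd in eventually_elim)
      case (elim k)
      have "square_integrable tor (\<lambda>x. psum a N x - psum a (r k) x)" by (intro square_integrable_diff square_integrable_psum)
      then show ?case using elim by (subst nn_integral_eq_integral) (auto simp: square_integrable_def intro!: ennreal_leI)
    qed
    finally show ?thesis by (simp add: Liminf_const)
  qed
  have pf: "square_integrable tor (\<lambda>x. psum a N x - f x)" for N
    unfolding square_integrable_def
    using le_less_trans[OF fatou[of N]] by (auto simp: integrable_iff_bounded)
  have "square_integrable tor f"
    using square_integrable_diff[OF square_integrable_psum[of a 0] pf[of 0]] by simp
  moreover have "(\<lambda>N. LINT x|tor. (norm (psum a N x - f x))\<^sup>2) \<longlonglongrightarrow> 0"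
  proof (rule tendsto_sandwich[OF _ _ tendsto_const])
    show "\<forall>\<^sub>F N in sequentially. (LINT x|tor. (norm (psum a N x - f x))\<^sup>2) \<le> 2 * pi * (s - S N)"
    proof (intro always_eventually allI)
      fix N
      have "ennreal (LINT x|tor. (norm (psum a N x - f x))\<^sup>2) \<le> ennreal (2 * pi * (s - S N))"
        using fatou[of N] pf[of N] by (subst nn_integral_eq_integral[symmetric]) (auto simp: square_integrable_def)
      then show "(LINT x|tor. (norm (psum a N x - f x))\<^sup>2) \<le> 2 * pi * (s - S N)"
        using s(2)[of N] by (simp add: ennreal_le_iff)
    qed
    have "(\<lambda>N. 2 * pi * (s - S N)) \<longlonglongrightarrow> 2 * pi * (s - s)" by (intro tendsto_intros s(1))
    then show "(\<lambda>N. 2 * pi * (s - S N)) \<longlonglongrightarrow> 0" by simp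
  qed auto
  ultimately show ?thesis by blast
qed

lemma fourier_coeff_square_le:
  assumes "square_integrable tor f"
  shows "2 * pi * (norm (fourier_coeff f n))\<^sup>2 \<le> (LINT x|tor. (norm (f x))\<^sup>2)"
  using bessel[OF assms, of "{n}"] by simp

lemma fourier_coeff_psum_limit:
  assumes f: "square_integrable tor f" and lim: "(\<lambda>N. LINT x|tor. (norm (psum a N x - f x))\<^sup>2) \<longlonglongrightarrow> 0"
  shows "fourier_coeff f n = a n"
proof -
  have "(norm (a n - fourier_coeff f n))\<^sup>2 \<le> 0"
  proof (rule LIMSEQ_le_const[OF lim], intro exI allI impI)
    fix N assume "nat \<bar>n\<bar> \<le> N"
    then have "n \<in> {-int N..int N}" by auto
    then have "fourier_coeff (\<lambda>x. psum a N x - f x) n = a n - fourier_coeff f n"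
      using f by (subst fourier_coeff_diff) (auto simp: fourier_coeff_psum intro!: tor.integrable_square_integrable square_integrable_psum)
    then have "2 * pi * (norm (a n - fourier_coeff f n))\<^sup>2 \<le> (LINT x|tor. (norm (psum a N x - f x))\<^sup>2)"
      using fourier_coeff_square_le[OF square_integrable_diff[OF square_integrable_psum f], of a N n] by simp
    moreover have "1 * (norm (a n - fourier_coeff f n))\<^sup>2 \<le> 2 * pi * (norm (a n - fourier_coeff f n))\<^sup>2"
      using pi_gt3 by (intro mult_right_mono) auto
    ultimately show "(norm (a n - fourier_coeff f n))\<^sup>2 \<le> (LINT x|tor. (norm (psum a N x - f x))\<^sup>2)" by simp
  qed
  then show ?thesis by simp
qed

text \<open>Riesz-Fischer produces some limit of the partial sums with the coefficients of
  \<open>f\<close>; uniqueness identifies it with \<open>f\<close> almost everywhere.\<close>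

lemma fourier_series_L2:
  assumes f: "square_integrable tor f"
  shows "(\<lambda>N. LINT x|tor. (norm (psum (fourier_coeff f) N x - f x))\<^sup>2) \<longlonglongrightarrow> 0"
proof -
  have "(\<Sum>n\<in>S. (norm (fourier_coeff f n))\<^sup>2) \<le> (LINT x|tor. (norm (f x))\<^sup>2) / (2 * pi)" if "finite S" for S
    using bessel[OF f that] by (simp add: field_simps)
  from riesz_fischer[OF this] obtain h where h: "square_integrable tor h"
    "(\<lambda>N. LINT x|tor. (norm (psum (fourier_coeff f) N x - h x))\<^sup>2) \<longlonglongrightarrow> 0" by blast
  note [measurable] = square_integrable_measurable[OF f] square_integrable_measurable[OF h(1)]
    square_integrable_measurable[OF square_integrable_psum]
  have "integrable tor (\<lambda>x. f x - h x)" by (rule tor.integrable_square_integrable[OF square_integrable_diff[OF f h(1)]])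
  moreover have "fourier_coeff (\<lambda>x. f x - h x) n = 0" for n
    using f h by (subst fourier_coeff_diff) (auto simp: fourier_coeff_psum_limit intro!: tor.integrable_square_integrable)
  ultimately have "AE x in tor. f x - h x = 0" by (rule fourier_uniqueness)
  then have e: "(LINT x|tor. (norm (psum (fourier_coeff f) N x - h x))\<^sup>2) = (LINT x|tor. (norm (psum (fourier_coeff f) N x - f x))\<^sup>2)" for N
    by (intro integral_cong_AE) (auto elim!: eventually_mono)
  show ?thesis using h(2) unfolding e .
qed

lemma parseval_tail:
  assumes f: "square_integrable tor f"
  shows "(LINT x|tor. (norm (f x - psum (fourier_coeff f) N x))\<^sup>2) = (LINT x|tor. (norm (f x))\<^sup>2)
    - 2 * pi * (\<Sum>n\<in>{-int N..int N}. (norm (fourier_coeff f n))\<^sup>2)"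
  by (subst integral_norm_diff_psum[OF f]) simp

lemma parseval:
  assumes f: "square_integrable tor f"
  shows "(\<lambda>N. 2 * pi * (\<Sum>n\<in>{-int N..int N}. (norm (fourier_coeff f n))\<^sup>2)) \<longlonglongrightarrow> (LINT x|tor. (norm (f x))\<^sup>2)"
proof -
  have "(\<lambda>N. (LINT x|tor. (norm (f x))\<^sup>2) - (LINT x|tor. (norm (f x - psum (fourier_coeff f) N x))\<^sup>2)) \<longlonglongrightarrow> (LINT x|tor. (norm (f x))\<^sup>2) - 0"
    using fourier_series_L2[OF f] by (intro tendsto_diff tendsto_const) (simp add: norm_minus_commute)
  then show ?thesis unfolding parseval_tail[OF f] by simp
qed

text \<open>By Riesz-Fischer the choice in \<open>trig_series\<close> is made from a non-empty set,
  and L^2 convergence forces the coefficients, whichever representative is chosen.\<close>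

lemma trig_series_props:
  assumes a: "\<And>S. finite S \<Longrightarrow> (\<Sum>n\<in>S. (norm (a n))\<^sup>2) \<le> B"
  shows "square_integrable tor (trig_series a)" "fourier_coeff (trig_series a) n = a n"
proof -
  obtain f where f: "square_integrable tor f" "(\<lambda>N. LINT x|tor. (norm (psum a N x - f x))\<^sup>2) \<longlonglongrightarrow> 0"
    using riesz_fischer[OF a] by blast
  let ?P = "\<lambda>f. L2_torus f \<and> (\<lambda>N::nat. L2_norm (\<lambda>x. (\<Sum>n\<in>{-int N..int N}. a n * cis (of_int n * x)) - f x)) \<longlonglongrightarrow> 0"
  have "(\<lambda>N. sqrt (LINT x|tor. (norm (psum a N x - f x))\<^sup>2)) \<longlonglongrightarrow> sqrt 0"
    by (intro tendsto_real_sqrt f(2))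
  then have "?P f" using f(1) by (simp add: L2_torus_iff L2_norm_eq psum_def)
  then have P: "?P (trig_series a)" unfolding trig_series_def by (rule someI[of ?P])
  then show sq: "square_integrable tor (trig_series a)" by (simp add: L2_torus_iff)
  have "(\<lambda>N. sqrt (LINT x|tor. (norm (psum a N x - trig_series a x))\<^sup>2)) \<longlonglongrightarrow> 0"
    using P by (simp add: L2_norm_eq psum_def)
  then have "(\<lambda>N. (sqrt (LINT x|tor. (norm (psum a N x - trig_series a x))\<^sup>2))\<^sup>2) \<longlonglongrightarrow> 0\<^sup>2"
    by (rule tendsto_power)
  then show "fourier_coeff (trig_series a) n = a n" by (intro fourier_coeff_psum_limit[OF sq]) simp
qed

section \<open>Oscillatory sums and the normal form for the mode equations\<close>

definition ivl :: "real \<Rightarrow> real measure" where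
  "ivl t = restrict_space lborel {0..t}"

lemma space_ivl [simp]: "space (ivl t) = {0..t}"
  by (simp add: ivl_def)

lemma tor_eq_ivl: "tor = ivl (2 * pi)"
  by (simp add: tor_def ivl_def)

lemma finite_measure_ivl: "finite_measure (ivl t)"
  by (rule finite_measureI) (cases "0 \<le> t", auto simp: ivl_def emeasure_restrict_space)

lemma measure_ivl: "0 \<le> t \<Longrightarrow> measure (ivl t) (space (ivl t)) = t"
  unfolding ivl_def by (subst measure_restrict_space) auto

lemma set_integrable_ivl:
  fixes f :: "real \<Rightarrow> 'b :: {banach, second_countable_topology}"
  shows "set_integrable lborel {0..t} f \<longleftrightarrow> integrable (ivl t) f"
  unfolding set_integrable_def ivl_def by (subst integrable_restrict_space) auto

lemma set_integral_ivl:
  fixes f :: "real \<Rightarrow> 'b :: {banach, second_countable_topology}"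
  shows "(LINT x:{0..t}|lborel. f x) = (LINT x|ivl t. f x)"
  unfolding set_lebesgue_integral_def ivl_def by (subst integral_restrict_space) auto

lemma integrable_ivl_mono:
  fixes f :: "real \<Rightarrow> 'b :: {banach, second_countable_topology}"
  assumes "integrable (ivl T) f" "t \<le> T"
  shows "integrable (ivl t) f"
  using assms(1) unfolding set_integrable_ivl[symmetric]
  by (rule set_integrable_subset) (use assms(2) in auto)

lemma integral_ivl_mono:
  fixes f :: "real \<Rightarrow> real"
  assumes "integrable (ivl T) f" "t \<le> T" "\<And>x. x \<in> {0..T} \<Longrightarrow> 0 \<le> f x"
  shows "(LINT x|ivl t. f x) \<le> (LINT x|ivl T. f x)"
proof -
  have i: "integrable lborel (\<lambda>x. indicator {0..T} x *\<^sub>R f x)" and i': "integrable lborel (\<lambda>x. indicator {0..t} x *\<^sub>R f x)"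
    using assms(1) integrable_ivl_mono[OF assms(1,2)] by (auto simp: set_integrable_ivl[symmetric] set_integrable_def)
  show ?thesis unfolding set_integral_ivl[symmetric] set_lebesgue_integral_def
    by (rule integral_mono[OF i' i]) (use assms in \<open>auto simp: indicator_def\<close>)
qed

lemma integrable_ivl_continuous:
  fixes f :: "real \<Rightarrow> 'b :: euclidean_space"
  assumes "continuous_on {0..t} f" shows "integrable (ivl t) f"
  unfolding set_integrable_ivl[symmetric] by (rule borel_integrable_atLeastAtMost'[OF assms])

lemma has_density_ivl:
  "has_density T A \<alpha> \<longleftrightarrow> integrable (ivl T) \<alpha> \<and> (\<forall>t\<in>{0..T}. A t = A 0 + (LINT \<tau>|ivl t. \<alpha> \<tau>))"
  unfolding has_density_def set_integrable_ivl set_integral_ivl ..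

lemma has_density_oscillation_ivl:
  assumes "has_density T P p" "\<phi> \<noteq> 0" "t \<in> {0..T}"
  shows "norm (LINT \<tau>|ivl t. cis (\<phi> * \<tau>) * P \<tau>) \<le> (norm (P 0) + norm (P t) + (LINT \<tau>|ivl t. norm (p \<tau>))) / \<bar>\<phi>\<bar>"
  using has_density_oscillation[OF assms] unfolding set_integral_ivl .

text \<open>A sum over four corners of a parallelogram with one corner missing: centre the sum at the
  corner opposite to the missing one.\<close>

lemma quadrilinear_sums_bounded:
  "\<exists>C>0. \<forall>b E D S. 0 \<le> E \<and> sq_bounded b E \<and> finite D \<and> 0 \<notin> D \<and> uminus ` D = D \<and> finite S \<longrightarrow>
     (\<Sum>n\<in>S. \<Sum>j\<in>D. \<Sum>k\<in>D. b (n + j) * b (n + j + k) * b (n + k) / (\<bar>real_of_int j\<bar> * \<bar>real_of_int k\<bar>)) \<le> C * E ^ 3 \<and>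
     (\<Sum>n\<in>S. \<Sum>j\<in>D. \<Sum>k\<in>D. b n * b (n + j + k) * b (n + k) / (\<bar>real_of_int j\<bar> * \<bar>real_of_int k\<bar>)) \<le> C * E ^ 3 \<and>
     (\<Sum>n\<in>S. \<Sum>j\<in>D. \<Sum>k\<in>D. b n * b (n + j) * b (n + k) / (\<bar>real_of_int j\<bar> * \<bar>real_of_int k\<bar>)) \<le> C * E ^ 3 \<and>
     (\<Sum>n\<in>S. \<Sum>j\<in>D. \<Sum>k\<in>D. b n * b (n + j) * b (n + j + k) / (\<bar>real_of_int j\<bar> * \<bar>real_of_int k\<bar>)) \<le> C * E ^ 3"
proof -
  obtain C where C: "0 < C" "\<And>a E D S. 0 \<le> E \<Longrightarrow> sq_bounded a E \<Longrightarrow> finite D \<Longrightarrow> 0 \<notin> D \<Longrightarrow> finite S \<Longrightarrow>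
     (\<Sum>m\<in>S. a m * (hilb D a m)\<^sup>2) \<le> C * E ^ 3"
    using trilinear_hilb_bounded by auto
  have main: "(\<Sum>n\<in>S. \<Sum>j\<in>D. \<Sum>k\<in>D. u (n + \<sigma> j k) j k) \<le> C * E ^ 3"
    if h: "0 \<le> E" "sq_bounded b E" "finite D" "0 \<notin> D" "finite S"
      and u0: "\<And>m j k. 0 \<le> u m j k" and u: "\<And>m. (\<Sum>j\<in>D. \<Sum>k\<in>D. u m j k) = b m * (hilb D b m)\<^sup>2"
    for b E D S and u :: "int \<Rightarrow> int \<Rightarrow> int \<Rightarrow> real" and \<sigma> :: "int \<Rightarrow> int \<Rightarrow> int"
  proof -
    define S' where "S' = (\<lambda>(n, j, k). n + \<sigma> j k) ` (S \<times> D \<times> D)"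
    have fS: "finite S'" using h by (auto simp: S'_def)
    have "(\<Sum>n\<in>S. \<Sum>j\<in>D. \<Sum>k\<in>D. u (n + \<sigma> j k) j k) = (\<Sum>j\<in>D. \<Sum>k\<in>D. \<Sum>n\<in>S. u (n + \<sigma> j k) j k)"
      by (subst sum.swap) (intro sum.cong refl sum.swap)
    also have "\<dots> \<le> (\<Sum>j\<in>D. \<Sum>k\<in>D. \<Sum>m\<in>S'. u m j k)"
    proof (intro sum_mono)
      fix j k assume jk: "j \<in> D" "k \<in> D"
      have "(\<Sum>n\<in>S. u (n + \<sigma> j k) j k) = (\<Sum>m\<in>(\<lambda>n. n + \<sigma> j k) ` S. u m j k)"
        by (subst sum.reindex) (auto simp: inj_on_def)
      also have "\<dots> \<le> (\<Sum>m\<in>S'. u m j k)"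
        by (rule sum_mono2[OF fS]) (use jk u0 in \<open>force simp: S'_def\<close>)+
      finally show "(\<Sum>n\<in>S. u (n + \<sigma> j k) j k) \<le> (\<Sum>m\<in>S'. u m j k)" .
    qed
    also have "\<dots> = (\<Sum>m\<in>S'. \<Sum>j\<in>D. \<Sum>k\<in>D. u m j k)"
      by (subst (2) sum.swap) (intro sum.cong refl sum.swap)
    also have "\<dots> = (\<Sum>m\<in>S'. b m * (hilb D b m)\<^sup>2)" by (simp only: u)
    also have "\<dots> \<le> C * E ^ 3" by (rule C(2)[OF h(1-4) fS])
    finally show ?thesis .
  qed
  \<comment> \<open>Moving the centre of the sum reverses the sign of some offsets; the symmetry of
    \<open>D\<close> restores the form of \<open>hilb\<close>.\<close>
  have refl': "(\<Sum>k\<in>D. b (m - k) / \<bar>real_of_int k\<bar>) = hilb D b m" if "uminus ` D = D" for b m and D :: "int set"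
  proof -
    have "hilb D b m = (\<Sum>k\<in>uminus ` D. b (m + k) / \<bar>real_of_int k\<bar>)" using that by (simp add: hilb_def)
    also have "\<dots> = (\<Sum>k\<in>D. b (m - k) / \<bar>real_of_int k\<bar>)" by (subst sum.reindex) auto
    finally show ?thesis ..
  qed
  have fac: "(\<Sum>j\<in>D. \<Sum>k\<in>D. b m * (x j / \<bar>real_of_int j\<bar>) * (y k / \<bar>real_of_int k\<bar>)) = b m * (hilb D b m)\<^sup>2"
    if "(\<Sum>j\<in>D. x j / \<bar>real_of_int j\<bar>) = hilb D b m" "(\<Sum>j\<in>D. y j / \<bar>real_of_int j\<bar>) = hilb D b m"
    for b m x y and D :: "int set"
  proof -
    have "b m * (hilb D b m)\<^sup>2 = b m * ((\<Sum>j\<in>D. x j / \<bar>real_of_int j\<bar>) * (\<Sum>j\<in>D. y j / \<bar>real_of_int j\<bar>))"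
      unfolding that by (simp add: power2_eq_square)
    then show ?thesis unfolding sum_product by (simp add: sum_distrib_left mult.assoc)
  qed
  show ?thesis
  proof (intro exI[of _ C] conjI C(1) allI impI; elim conjE)
    fix b E and D S :: "int set" assume h: "0 \<le> E" "sq_bounded b E" "finite D" "0 \<notin> D" "uminus ` D = D" "finite S"
    note b0 = sq_boundedD(1)[OF h(2)]
    note M = main[OF h(1-4,6)]
    have r1: "(\<Sum>j\<in>D. b (m - j) / \<bar>real_of_int j\<bar>) = hilb D b m" for m by (rule refl'[OF h(5)])
    have r2: "(\<Sum>j\<in>D. b (m + j) / \<bar>real_of_int j\<bar>) = hilb D b m" for m by (simp add: hilb_def)
    show "(\<Sum>n\<in>S. \<Sum>j\<in>D. \<Sum>k\<in>D. b (n + j) * b (n + j + k) * b (n + k) / (\<bar>real_of_int j\<bar> * \<bar>real_of_int k\<bar>)) \<le> C * E ^ 3"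
      using M[of "\<lambda>m j k. b m * (b (m - j) / \<bar>real_of_int j\<bar>) * (b (m - k) / \<bar>real_of_int k\<bar>)" "\<lambda>j k. j + k", OF _ fac[OF r1 r1]] b0
      by (simp add: add.assoc mult_ac)
    show "(\<Sum>n\<in>S. \<Sum>j\<in>D. \<Sum>k\<in>D. b n * b (n + j + k) * b (n + k) / (\<bar>real_of_int j\<bar> * \<bar>real_of_int k\<bar>)) \<le> C * E ^ 3"
      using M[of "\<lambda>m j k. b m * (b (m + j) / \<bar>real_of_int j\<bar>) * (b (m - k) / \<bar>real_of_int k\<bar>)" "\<lambda>j k. k", OF _ fac[OF r2 r1]] b0
      by (simp add: add_ac mult_ac)
    show "(\<Sum>n\<in>S. \<Sum>j\<in>D. \<Sum>k\<in>D. b n * b (n + j) * b (n + k) / (\<bar>real_of_int j\<bar> * \<bar>real_of_int k\<bar>)) \<le> C * E ^ 3"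
      using M[of "\<lambda>m j k. b m * (b (m + j) / \<bar>real_of_int j\<bar>) * (b (m + k) / \<bar>real_of_int k\<bar>)" "\<lambda>j k. 0", OF _ fac[OF r2 r2]] b0
      by (simp add: add_ac mult_ac)
    show "(\<Sum>n\<in>S. \<Sum>j\<in>D. \<Sum>k\<in>D. b n * b (n + j) * b (n + j + k) / (\<bar>real_of_int j\<bar> * \<bar>real_of_int k\<bar>)) \<le> C * E ^ 3"
      using M[of "\<lambda>m j k. b m * (b (m - j) / \<bar>real_of_int j\<bar>) * (b (m + k) / \<bar>real_of_int k\<bar>)" "\<lambda>j k. j", OF _ fac[OF r1 r2]] b0
      by (simp add: add_ac mult_ac)
  qed
qed

section \<open>Integration by parts in finite interaction sums\<close>

lemma oscillation_sum_bound:
  assumes I: "finite I" and P: "\<And>i. i \<in> I \<Longrightarrow> has_density T (P i) (p i)" and \<phi>: "\<And>i. i \<in> I \<Longrightarrow> \<phi> i \<noteq> 0"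
    and t: "t \<in> {0..T}"
  shows "norm (LINT \<tau>|ivl t. (\<Sum>i\<in>I. cis (\<phi> i * \<tau>) * P i \<tau>)) \<le>
    (\<Sum>i\<in>I. (norm (P i 0) + norm (P i t)) / \<bar>\<phi> i\<bar>) + (\<Sum>i\<in>I. (LINT \<tau>|ivl T. norm (p i \<tau>)) / \<bar>\<phi> i\<bar>)"
proof -
  have "(LINT \<tau>|ivl t. (\<Sum>i\<in>I. cis (\<phi> i * \<tau>) * P i \<tau>)) = (\<Sum>i\<in>I. LINT \<tau>|ivl t. cis (\<phi> i * \<tau>) * P i \<tau>)"
  proof (rule Bochner_Integration.integral_sum, rule integrable_ivl_continuous)
    fix i assume "i \<in> I"
    then have "continuous_on {0..t} (P i)"
      by (intro continuous_on_subset[OF has_density_continuous[OF P]]) (use t in auto)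
    then show "continuous_on {0..t} (\<lambda>\<tau>. cis (\<phi> i * \<tau>) * P i \<tau>)" by (intro continuous_intros)
  qed
  also have "norm \<dots> \<le> (\<Sum>i\<in>I. (norm (P i 0) + norm (P i t) + (LINT \<tau>|ivl T. norm (p i \<tau>))) / \<bar>\<phi> i\<bar>)"
  proof (intro order_trans[OF norm_sum] sum_mono)
    fix i assume i: "i \<in> I"
    have ip: "integrable (ivl T) (p i)" using P[OF i] by (simp only: has_density_ivl)
    have "(LINT \<tau>|ivl t. norm (p i \<tau>)) \<le> (LINT \<tau>|ivl T. norm (p i \<tau>))"
      by (rule integral_ivl_mono[OF integrable_norm[OF ip]]) (use t in auto)
    then show "norm (LINT \<tau>|ivl t. cis (\<phi> i * \<tau>) * P i \<tau>) \<le> (norm (P i 0) + norm (P i t) + (LINT \<tau>|ivl T. norm (p i \<tau>))) / \<bar>\<phi> i\<bar>"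
      by (intro order_trans[OF has_density_oscillation_ivl[OF P[OF i] \<phi>[OF i] t]] divide_right_mono) auto
  qed
  finally show ?thesis by (simp add: add_divide_distrib sum.distrib)
qed

text \<open>A system whose right-hand side \<open>F\<close> is tied to \<open>a\<close> only through
  the bounds listed. This freedom lets the modes of a solution and their truncations to finitely
  many frequencies be treated alike.\<close>

locale modes =
  fixes lam T E :: real and a F :: "int \<Rightarrow> real \<Rightarrow> complex" and f :: "real \<Rightarrow> real"
  assumes lam: "0 \<le> lam" and T: "0 \<le> T" and E: "0 \<le> E"
    and dens: "\<And>n. has_density T (a n) (\<lambda>t. - (\<i> * complex_of_real lam) * F n t)"
    and F_le: "\<And>n t. t \<in> {0..T} \<Longrightarrow> norm (F n t) \<le> f t"
    and F_int: "\<And>n. integrable (ivl T) (F n)"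
    and f_int: "integrable (ivl T) f"
    and sq: "\<And>t. t \<in> {0..T} \<Longrightarrow> sq_bounded (\<lambda>n. norm (a n t)) E"
begin

lemma f_nonneg: "t \<in> {0..T} \<Longrightarrow> 0 \<le> f t"
  using F_le[of t 0] norm_ge_zero[of "F 0 t"] by linarith

lemma a_continuous: "continuous_on {0..T} (a n)"
  by (rule has_density_continuous[OF dens])

lemma a_continuous': "t \<in> {0..T} \<Longrightarrow> continuous_on {0..t} (a n)"
  by (rule continuous_on_subset[OF a_continuous]) auto

lemma triple_density:
  "\<exists>p. has_density T (\<lambda>t. a n1 t * cnj (a n2 t) * a n3 t) p \<and>
     (\<forall>t\<in>{0..T}. norm (p t) \<le> lam * (norm (F n1 t) * norm (a n2 t) * norm (a n3 t) +
        norm (a n1 t) * norm (F n2 t) * norm (a n3 t) + norm (a n1 t) * norm (a n2 t) * norm (F n3 t)))"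
proof -
  let ?p = "\<lambda>t. (- (\<i> * complex_of_real lam) * F n1 t * cnj (a n2 t) + a n1 t * cnj (- (\<i> * complex_of_real lam) * F n2 t)) * a n3 t
     + (a n1 t * cnj (a n2 t)) * (- (\<i> * complex_of_real lam) * F n3 t)"
  have "has_density T (\<lambda>t. a n1 t * cnj (a n2 t) * a n3 t) ?p"
    by (intro has_density_mult has_density_cnj dens)
  moreover have "norm (?p t) \<le> lam * (norm (F n1 t) * norm (a n2 t) * norm (a n3 t) +
        norm (a n1 t) * norm (F n2 t) * norm (a n3 t) + norm (a n1 t) * norm (a n2 t) * norm (F n3 t))" for t
  proof -
    have "norm (?p t) \<le> (norm (- (\<i> * complex_of_real lam) * F n1 t * cnj (a n2 t)) + norm (a n1 t * cnj (- (\<i> * complex_of_real lam) * F n2 t))) * norm (a n3 t)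
     + norm ((a n1 t * cnj (a n2 t)) * (- (\<i> * complex_of_real lam) * F n3 t))"
      by (intro order_trans[OF norm_triangle_ineq] add_right_mono order_trans[OF norm_mult_ineq] mult_right_mono norm_triangle_ineq) simp
    also have "\<dots> = lam * (norm (F n1 t) * norm (a n2 t) * norm (a n3 t) +
        norm (a n1 t) * norm (F n2 t) * norm (a n3 t) + norm (a n1 t) * norm (a n2 t) * norm (F n3 t))"
      using lam by (simp add: norm_mult algebra_simps)
    finally show ?thesis .
  qed
  ultimately show ?thesis by blast
qed

lemma quadruple_density:
  "\<exists>p. has_density T (\<lambda>t. a n1 t * cnj (a n2 t) * a n3 t * cnj (a n4 t)) p \<and>
     (\<forall>t\<in>{0..T}. norm (p t) \<le> lam * f t * (norm (a n2 t) * norm (a n3 t) * norm (a n4 t) +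
        norm (a n1 t) * norm (a n3 t) * norm (a n4 t) + norm (a n1 t) * norm (a n2 t) * norm (a n4 t)
        + norm (a n1 t) * norm (a n2 t) * norm (a n3 t)))"
proof -
  obtain p where p: "has_density T (\<lambda>t. a n1 t * cnj (a n2 t) * a n3 t) p"
     "\<And>t. t\<in>{0..T} \<Longrightarrow> norm (p t) \<le> lam * (norm (F n1 t) * norm (a n2 t) * norm (a n3 t) +
        norm (a n1 t) * norm (F n2 t) * norm (a n3 t) + norm (a n1 t) * norm (a n2 t) * norm (F n3 t))"
    using triple_density by blast
  let ?q = "\<lambda>t. p t * cnj (a n4 t) + (a n1 t * cnj (a n2 t) * a n3 t) * cnj (- (\<i> * complex_of_real lam) * F n4 t)"
  have "has_density T (\<lambda>t. a n1 t * cnj (a n2 t) * a n3 t * cnj (a n4 t)) ?q"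
    by (intro has_density_mult has_density_cnj dens p)
  moreover have "norm (?q t) \<le> lam * f t * (norm (a n2 t) * norm (a n3 t) * norm (a n4 t) +
        norm (a n1 t) * norm (a n3 t) * norm (a n4 t) + norm (a n1 t) * norm (a n2 t) * norm (a n4 t)
        + norm (a n1 t) * norm (a n2 t) * norm (a n3 t))" if t: "t \<in> {0..T}" for t
  proof -
    note Fl = F_le[OF t]
    have "norm (p t) \<le> lam * (f t * norm (a n2 t) * norm (a n3 t) +
        norm (a n1 t) * f t * norm (a n3 t) + norm (a n1 t) * norm (a n2 t) * f t)"
      by (rule order_trans[OF p(2)[OF t]]) (intro mult_left_mono add_mono mult_right_mono Fl lam mult_nonneg_nonneg norm_ge_zero)
    then have "norm (p t) * norm (a n4 t) \<le> lam * (f t * norm (a n2 t) * norm (a n3 t) +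
        norm (a n1 t) * f t * norm (a n3 t) + norm (a n1 t) * norm (a n2 t) * f t) * norm (a n4 t)"
      by (rule mult_right_mono) simp
    moreover have "norm ((a n1 t * cnj (a n2 t) * a n3 t) * cnj (- (\<i> * complex_of_real lam) * F n4 t)) \<le> lam * f t * (norm (a n1 t) * norm (a n2 t) * norm (a n3 t))"
    proof -
      have "norm ((a n1 t * cnj (a n2 t) * a n3 t) * cnj (- (\<i> * complex_of_real lam) * F n4 t)) = norm (a n1 t) * norm (a n2 t) * norm (a n3 t) * lam * norm (F n4 t)"
        using lam by (simp add: norm_mult)
      also have "\<dots> \<le> norm (a n1 t) * norm (a n2 t) * norm (a n3 t) * lam * f t"
        by (intro mult_left_mono Fl mult_nonneg_nonneg lam norm_ge_zero)
      finally show ?thesis by (simp add: mult_ac)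
    qed
    moreover have "norm (?q t) \<le> norm (p t) * norm (a n4 t) + norm ((a n1 t * cnj (a n2 t) * a n3 t) * cnj (- (\<i> * complex_of_real lam) * F n4 t))"
      by (rule order_trans[OF norm_triangle_ineq]) (simp add: norm_mult)
    ultimately show ?thesis by (simp add: algebra_simps)
  qed
  ultimately show ?thesis by blast
qed

text \<open>Every term gains \<open>1 / (2 |j| |k|)\<close>. At the two end points one of the four
  modes is estimated by \<open>E\<close> and the other three by \<open>K\<close>. In the time
  integral one mode is replaced by its derivative, of size \<open>lam * f\<close>; the four choices
  of that mode times the factor \<open>1/2\<close> give the constant 2.\<close>

lemma quartic_oscillation_bound:
  assumes K: "\<And>b. sq_bounded b E \<Longrightarrow>
     (\<Sum>n\<in>S. \<Sum>j\<in>D. \<Sum>k\<in>D. b (n + j) * b (n + j + k) * b (n + k) / (\<bar>real_of_int j\<bar> * \<bar>real_of_int k\<bar>)) \<le> K \<and>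
     (\<Sum>n\<in>S. \<Sum>j\<in>D. \<Sum>k\<in>D. b n * b (n + j + k) * b (n + k) / (\<bar>real_of_int j\<bar> * \<bar>real_of_int k\<bar>)) \<le> K \<and>
     (\<Sum>n\<in>S. \<Sum>j\<in>D. \<Sum>k\<in>D. b n * b (n + j) * b (n + k) / (\<bar>real_of_int j\<bar> * \<bar>real_of_int k\<bar>)) \<le> K \<and>
     (\<Sum>n\<in>S. \<Sum>j\<in>D. \<Sum>k\<in>D. b n * b (n + j) * b (n + j + k) / (\<bar>real_of_int j\<bar> * \<bar>real_of_int k\<bar>)) \<le> K"
    and D: "finite D" "0 \<notin> D" and S: "finite S" and t: "t \<in> {0..T}"
  shows "norm (LINT \<tau>|ivl t. (\<Sum>n\<in>S. \<Sum>j\<in>D. \<Sum>k\<in>D. cis (2 * of_int j * of_int k * \<tau>) *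
      (a (n + j) \<tau> * cnj (a (n + j + k) \<tau>) * a (n + k) \<tau> * cnj (a n \<tau>)))) \<le> K * (E + 2 * lam * (LINT \<tau>|ivl T. f \<tau>))"
proof -
  define P where "P = (\<lambda>(n, j, k) \<tau>. a (n + j) \<tau> * cnj (a (n + j + k) \<tau>) * a (n + k) \<tau> * cnj (a n \<tau>))"
  define B where "B = (\<lambda>\<tau> (n, j, k). norm (a (n + j + k) \<tau>) * norm (a (n + k) \<tau>) * norm (a n \<tau>) +
        norm (a (n + j) \<tau>) * norm (a (n + k) \<tau>) * norm (a n \<tau>) + norm (a (n + j) \<tau>) * norm (a (n + j + k) \<tau>) * norm (a n \<tau>)
        + norm (a (n + j) \<tau>) * norm (a (n + j + k) \<tau>) * norm (a (n + k) \<tau>))"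
  define \<phi> where "\<phi> = (\<lambda>(n :: int, j, k). 2 * real_of_int j * real_of_int k)"
  have "\<exists>p. has_density T (P i) p \<and> (\<forall>\<tau>\<in>{0..T}. norm (p \<tau>) \<le> lam * f \<tau> * B \<tau> i)" for i
    unfolding P_def B_def using quadruple_density by (cases i) auto
  then obtain p where p: "\<And>i. has_density T (P i) (p i)" "\<And>i \<tau>. \<tau> \<in> {0..T} \<Longrightarrow> norm (p i \<tau>) \<le> lam * f \<tau> * B \<tau> i"
    by metis
  have ip: "integrable (ivl T) (\<lambda>\<tau>. norm (p i \<tau>))" for i using p(1) by (simp only: has_density_ivl integrable_norm)
  define I where "I = S \<times> D \<times> D"
  have I: "finite I" using S D by (simp add: I_def)
  have nest: "(\<Sum>n\<in>S. \<Sum>j\<in>D. \<Sum>k\<in>D. h (n, j, k)) = (\<Sum>i\<in>I. h i)" for h :: "_ \<Rightarrow> 'b :: comm_monoid_add"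
    by (simp add: I_def sum.cartesian_product)
  have "(LINT \<tau>|ivl t. (\<Sum>n\<in>S. \<Sum>j\<in>D. \<Sum>k\<in>D. cis (2 * of_int j * of_int k * \<tau>) *
      (a (n + j) \<tau> * cnj (a (n + j + k) \<tau>) * a (n + k) \<tau> * cnj (a n \<tau>)))) = (LINT \<tau>|ivl t. (\<Sum>i\<in>I. cis (\<phi> i * \<tau>) * P i \<tau>))"
    unfolding nest[symmetric] by (simp add: P_def \<phi>_def)
  also have "norm \<dots> \<le> (\<Sum>i\<in>I. (norm (P i 0) + norm (P i t)) / \<bar>\<phi> i\<bar>) + (\<Sum>i\<in>I. (LINT \<tau>|ivl T. norm (p i \<tau>)) / \<bar>\<phi> i\<bar>)"
    by (rule oscillation_sum_bound[OF I p(1) _ t]) (use D in \<open>auto simp: I_def \<phi>_def\<close>)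
  also have "(\<Sum>i\<in>I. (norm (P i 0) + norm (P i t)) / \<bar>\<phi> i\<bar>) \<le> E * K"
  proof -
    have bd: "(\<Sum>i\<in>I. norm (P i \<tau>) / \<bar>\<phi> i\<bar>) \<le> E * K / 2" if \<tau>: "\<tau> \<in> {0..T}" for \<tau>
    proof -
      define b where "b = (\<lambda>n. norm (a n \<tau>))"
      have sb: "sq_bounded b E" unfolding b_def by (rule sq[OF \<tau>])
      have "(\<Sum>i\<in>I. norm (P i \<tau>) / \<bar>\<phi> i\<bar>) = (\<Sum>n\<in>S. \<Sum>j\<in>D. \<Sum>k\<in>D. b n * (b (n + j) * b (n + j + k) * b (n + k) / (\<bar>real_of_int j\<bar> * \<bar>real_of_int k\<bar>)) / 2)"
        unfolding nest[symmetric] by (intro sum.cong refl) (simp add: P_def \<phi>_def b_def norm_mult abs_mult mult_ac)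
      also have "\<dots> \<le> (\<Sum>n\<in>S. \<Sum>j\<in>D. \<Sum>k\<in>D. E * (b (n + j) * b (n + j + k) * b (n + k) / (\<bar>real_of_int j\<bar> * \<bar>real_of_int k\<bar>)) / 2)"
        by (intro sum_mono divide_right_mono mult_right_mono sq_bounded_le[OF sb E]) (auto simp: b_def)
      also have "\<dots> = (E / 2) * (\<Sum>n\<in>S. \<Sum>j\<in>D. \<Sum>k\<in>D. b (n + j) * b (n + j + k) * b (n + k) / (\<bar>real_of_int j\<bar> * \<bar>real_of_int k\<bar>))"
        by (simp add: sum_distrib_left mult_ac)
      also have "\<dots> \<le> (E / 2) * K" using K[OF sb] E by (intro mult_left_mono) auto
      finally show ?thesis by simp
    qed
    have "(\<Sum>i\<in>I. (norm (P i 0) + norm (P i t)) / \<bar>\<phi> i\<bar>) = (\<Sum>i\<in>I. norm (P i 0) / \<bar>\<phi> i\<bar>) + (\<Sum>i\<in>I. norm (P i t) / \<bar>\<phi> i\<bar>)"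
      by (simp add: add_divide_distrib sum.distrib)
    also have "\<dots> \<le> E * K / 2 + E * K / 2" using T t by (intro add_mono bd) auto
    finally show ?thesis by simp
  qed
  also have "(\<Sum>i\<in>I. (LINT \<tau>|ivl T. norm (p i \<tau>)) / \<bar>\<phi> i\<bar>) = (LINT \<tau>|ivl T. (\<Sum>i\<in>I. norm (p i \<tau>) / \<bar>\<phi> i\<bar>))"
    using ip by (subst Bochner_Integration.integral_sum) auto
  also have "\<dots> \<le> (LINT \<tau>|ivl T. 2 * lam * K * f \<tau>)"
  proof (rule integral_mono)
    fix \<tau> assume "\<tau> \<in> space (ivl T)"
    then have \<tau>: "\<tau> \<in> {0..T}" by simp
    define b where "b = (\<lambda>n. norm (a n \<tau>))"
    have sb: "sq_bounded b E" unfolding b_def by (rule sq[OF \<tau>])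
    have "(\<Sum>i\<in>I. norm (p i \<tau>) / \<bar>\<phi> i\<bar>) \<le> (\<Sum>i\<in>I. lam * f \<tau> * B \<tau> i / \<bar>\<phi> i\<bar>)"
      by (intro sum_mono divide_right_mono p(2)[OF \<tau>]) auto
    also have "\<dots> = (lam * f \<tau> / 2) * (
       (\<Sum>n\<in>S. \<Sum>j\<in>D. \<Sum>k\<in>D. b n * b (n + j + k) * b (n + k) / (\<bar>real_of_int j\<bar> * \<bar>real_of_int k\<bar>)) +
       (\<Sum>n\<in>S. \<Sum>j\<in>D. \<Sum>k\<in>D. b n * b (n + j) * b (n + k) / (\<bar>real_of_int j\<bar> * \<bar>real_of_int k\<bar>)) +
       (\<Sum>n\<in>S. \<Sum>j\<in>D. \<Sum>k\<in>D. b n * b (n + j) * b (n + j + k) / (\<bar>real_of_int j\<bar> * \<bar>real_of_int k\<bar>)) +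
       (\<Sum>n\<in>S. \<Sum>j\<in>D. \<Sum>k\<in>D. b (n + j) * b (n + j + k) * b (n + k) / (\<bar>real_of_int j\<bar> * \<bar>real_of_int k\<bar>)))"
      unfolding nest[symmetric] sum.distrib[symmetric] sum_distrib_left
      by (intro sum.cong refl) (simp add: B_def \<phi>_def b_def abs_mult add_divide_distrib algebra_simps)
    also have "\<dots> \<le> (lam * f \<tau> / 2) * (K + K + K + K)"
      using K[OF sb] by (intro mult_left_mono add_mono) (auto intro!: mult_nonneg_nonneg lam f_nonneg \<tau>)
    finally show "(\<Sum>i\<in>I. norm (p i \<tau>) / \<bar>\<phi> i\<bar>) \<le> 2 * lam * K * f \<tau>" by (simp add: mult_ac)
  qed (use ip f_int in auto)
  finally show ?thesis by (simp add: algebra_simps)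
qed

text \<open>The same computation at fixed \<open>n\<close>, with three modes. The bound
  \<open>f\<close> carries no decay in the frequency, so any decay in \<open>n\<close> has to come
  from the two modes that are not differentiated. Of the three possible pairs, two are exchanged by
  swapping \<open>j\<close> and \<open>k\<close>, which is why \<open>Q\<close> concerns two
  sums.\<close>

lemma normal_form_bound:
  assumes Q: "\<And>\<tau>. \<tau> \<in> {0..T} \<Longrightarrow>
     (\<Sum>j\<in>D. \<Sum>k\<in>D. norm (a (n + j + k) \<tau>) * norm (a (n + k) \<tau>) / (\<bar>real_of_int j\<bar> * \<bar>real_of_int k\<bar>)) \<le> Q \<and>
     (\<Sum>j\<in>D. \<Sum>k\<in>D. norm (a (n + j) \<tau>) * norm (a (n + k) \<tau>) / (\<bar>real_of_int j\<bar> * \<bar>real_of_int k\<bar>)) \<le> Q"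
    and D: "finite D" "0 \<notin> D" and t: "t \<in> {0..T}"
  shows "norm (LINT \<tau>|ivl t. (\<Sum>j\<in>D. \<Sum>k\<in>D. cis (2 * of_int j * of_int k * \<tau>) *
      (a (n + j) \<tau> * cnj (a (n + j + k) \<tau>) * a (n + k) \<tau>))) \<le> Q * (E + 2 * lam * (LINT \<tau>|ivl T. f \<tau>))"
proof -
  define P where "P = (\<lambda>(j, k) \<tau>. a (n + j) \<tau> * cnj (a (n + j + k) \<tau>) * a (n + k) \<tau>)"
  define B where "B = (\<lambda>\<tau> (j, k). norm (a (n + j + k) \<tau>) * norm (a (n + k) \<tau>) +
        norm (a (n + j) \<tau>) * norm (a (n + k) \<tau>) + norm (a (n + j) \<tau>) * norm (a (n + j + k) \<tau>))"
  define \<phi> where "\<phi> = (\<lambda>(j, k). 2 * real_of_int j * real_of_int k)"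
  have "\<exists>p. has_density T (P i) p \<and> (\<forall>\<tau>\<in>{0..T}. norm (p \<tau>) \<le> lam * f \<tau> * B \<tau> i)" for i
  proof (cases i)
    case (Pair j k)
    obtain p where p: "has_density T (P i) p" "\<And>\<tau>. \<tau>\<in>{0..T} \<Longrightarrow> norm (p \<tau>) \<le> lam * (norm (F (n + j) \<tau>) * norm (a (n + j + k) \<tau>) * norm (a (n + k) \<tau>) +
        norm (a (n + j) \<tau>) * norm (F (n + j + k) \<tau>) * norm (a (n + k) \<tau>) + norm (a (n + j) \<tau>) * norm (a (n + j + k) \<tau>) * norm (F (n + k) \<tau>))"
      unfolding Pair P_def prod.case using triple_density by blast
    have "norm (p \<tau>) \<le> lam * f \<tau> * B \<tau> i" if \<tau>: "\<tau> \<in> {0..T}" for \<tau>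
    proof -
      have "norm (p \<tau>) \<le> lam * (f \<tau> * norm (a (n + j + k) \<tau>) * norm (a (n + k) \<tau>) +
        norm (a (n + j) \<tau>) * f \<tau> * norm (a (n + k) \<tau>) + norm (a (n + j) \<tau>) * norm (a (n + j + k) \<tau>) * f \<tau>)"
        by (rule order_trans[OF p(2)[OF \<tau>]]) (intro mult_left_mono add_mono mult_right_mono F_le \<tau> lam mult_nonneg_nonneg norm_ge_zero)
      then show ?thesis by (simp add: Pair B_def algebra_simps)
    qed
    then show ?thesis using p(1) by blast
  qed
  then obtain p where p: "\<And>i. has_density T (P i) (p i)" "\<And>i \<tau>. \<tau> \<in> {0..T} \<Longrightarrow> norm (p i \<tau>) \<le> lam * f \<tau> * B \<tau> i"
    by metis
  have ip: "integrable (ivl T) (\<lambda>\<tau>. norm (p i \<tau>))" for i using p(1) by (simp only: has_density_ivl integrable_norm)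
  define I where "I = D \<times> D"
  have I: "finite I" using D by (simp add: I_def)
  have nest: "(\<Sum>j\<in>D. \<Sum>k\<in>D. h (j, k)) = (\<Sum>i\<in>I. h i)" for h :: "_ \<Rightarrow> 'b :: comm_monoid_add"
    by (simp add: I_def sum.cartesian_product)
  have Q3: "(\<Sum>j\<in>D. \<Sum>k\<in>D. norm (a (n + j) \<tau>) * norm (a (n + j + k) \<tau>) / (\<bar>real_of_int j\<bar> * \<bar>real_of_int k\<bar>)) \<le> Q" if "\<tau> \<in> {0..T}" for \<tau>
  proof -
    have "(\<Sum>j\<in>D. \<Sum>k\<in>D. norm (a (n + j) \<tau>) * norm (a (n + j + k) \<tau>) / (\<bar>real_of_int j\<bar> * \<bar>real_of_int k\<bar>)) =
      (\<Sum>j\<in>D. \<Sum>k\<in>D. norm (a (n + j + k) \<tau>) * norm (a (n + k) \<tau>) / (\<bar>real_of_int j\<bar> * \<bar>real_of_int k\<bar>))"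
      by (subst sum.swap) (simp add: add_ac mult_ac)
    then show ?thesis using Q[OF that] by simp
  qed
  have Q0: "0 \<le> Q" using Q[of 0] T by (intro order_trans[OF _ conjunct1[OF Q[of 0]]] sum_nonneg) auto
  have "(LINT \<tau>|ivl t. (\<Sum>j\<in>D. \<Sum>k\<in>D. cis (2 * of_int j * of_int k * \<tau>) *
      (a (n + j) \<tau> * cnj (a (n + j + k) \<tau>) * a (n + k) \<tau>))) = (LINT \<tau>|ivl t. (\<Sum>i\<in>I. cis (\<phi> i * \<tau>) * P i \<tau>))"
    unfolding nest[symmetric] by (simp add: P_def \<phi>_def)
  also have "norm \<dots> \<le> (\<Sum>i\<in>I. (norm (P i 0) + norm (P i t)) / \<bar>\<phi> i\<bar>) + (\<Sum>i\<in>I. (LINT \<tau>|ivl T. norm (p i \<tau>)) / \<bar>\<phi> i\<bar>)"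
    by (rule oscillation_sum_bound[OF I p(1) _ t]) (use D in \<open>auto simp: I_def \<phi>_def\<close>)
  also have "(\<Sum>i\<in>I. (norm (P i 0) + norm (P i t)) / \<bar>\<phi> i\<bar>) \<le> E * Q"
  proof -
    have bd: "(\<Sum>i\<in>I. norm (P i \<tau>) / \<bar>\<phi> i\<bar>) \<le> E * Q / 2" if \<tau>: "\<tau> \<in> {0..T}" for \<tau>
    proof -
      define b where "b = (\<lambda>n. norm (a n \<tau>))"
      have sb: "sq_bounded b E" unfolding b_def by (rule sq[OF \<tau>])
      have "(\<Sum>i\<in>I. norm (P i \<tau>) / \<bar>\<phi> i\<bar>) = (\<Sum>j\<in>D. \<Sum>k\<in>D. b (n + j) * (b (n + j + k) * b (n + k) / (\<bar>real_of_int j\<bar> * \<bar>real_of_int k\<bar>)) / 2)"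
        unfolding nest[symmetric] by (intro sum.cong refl) (simp add: P_def \<phi>_def b_def norm_mult abs_mult mult_ac)
      also have "\<dots> \<le> (\<Sum>j\<in>D. \<Sum>k\<in>D. E * (b (n + j + k) * b (n + k) / (\<bar>real_of_int j\<bar> * \<bar>real_of_int k\<bar>)) / 2)"
        by (intro sum_mono divide_right_mono mult_right_mono sq_bounded_le[OF sb E]) (auto simp: b_def)
      also have "\<dots> = (E / 2) * (\<Sum>j\<in>D. \<Sum>k\<in>D. b (n + j + k) * b (n + k) / (\<bar>real_of_int j\<bar> * \<bar>real_of_int k\<bar>))"
        by (simp add: sum_distrib_left mult_ac)
      also have "\<dots> \<le> (E / 2) * Q" using Q[OF \<tau>] E by (intro mult_left_mono) (auto simp: b_def)
      finally show ?thesis by simp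
    qed
    have "(\<Sum>i\<in>I. (norm (P i 0) + norm (P i t)) / \<bar>\<phi> i\<bar>) = (\<Sum>i\<in>I. norm (P i 0) / \<bar>\<phi> i\<bar>) + (\<Sum>i\<in>I. norm (P i t) / \<bar>\<phi> i\<bar>)"
      by (simp add: add_divide_distrib sum.distrib)
    also have "\<dots> \<le> E * Q / 2 + E * Q / 2" using T t by (intro add_mono bd) auto
    finally show ?thesis by simp
  qed
  also have "(\<Sum>i\<in>I. (LINT \<tau>|ivl T. norm (p i \<tau>)) / \<bar>\<phi> i\<bar>) = (LINT \<tau>|ivl T. (\<Sum>i\<in>I. norm (p i \<tau>) / \<bar>\<phi> i\<bar>))"
    using ip by (subst Bochner_Integration.integral_sum) auto
  also have "\<dots> \<le> (LINT \<tau>|ivl T. 2 * lam * Q * f \<tau>)"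
  proof (rule integral_mono)
    fix \<tau> assume "\<tau> \<in> space (ivl T)"
    then have \<tau>: "\<tau> \<in> {0..T}" by simp
    define b where "b = (\<lambda>n. norm (a n \<tau>))"
    have "(\<Sum>i\<in>I. norm (p i \<tau>) / \<bar>\<phi> i\<bar>) \<le> (\<Sum>i\<in>I. lam * f \<tau> * B \<tau> i / \<bar>\<phi> i\<bar>)"
      by (intro sum_mono divide_right_mono p(2)[OF \<tau>]) auto
    also have "\<dots> = (lam * f \<tau> / 2) * (
       (\<Sum>j\<in>D. \<Sum>k\<in>D. b (n + j + k) * b (n + k) / (\<bar>real_of_int j\<bar> * \<bar>real_of_int k\<bar>)) +
       (\<Sum>j\<in>D. \<Sum>k\<in>D. b (n + j) * b (n + k) / (\<bar>real_of_int j\<bar> * \<bar>real_of_int k\<bar>)) +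
       (\<Sum>j\<in>D. \<Sum>k\<in>D. b (n + j) * b (n + j + k) / (\<bar>real_of_int j\<bar> * \<bar>real_of_int k\<bar>)))"
      unfolding nest[symmetric] sum.distrib[symmetric] sum_distrib_left
      by (intro sum.cong refl) (simp add: B_def \<phi>_def b_def abs_mult add_divide_distrib algebra_simps)
    also have "\<dots> \<le> (lam * f \<tau> / 2) * (Q + Q + Q)"
      using Q[OF \<tau>] Q3[OF \<tau>] by (intro mult_left_mono add_mono) (auto simp: b_def intro!: mult_nonneg_nonneg lam f_nonneg \<tau>)
    also have "\<dots> \<le> 2 * lam * Q * f \<tau>"
      using mult_nonneg_nonneg[OF mult_nonneg_nonneg[OF lam f_nonneg[OF \<tau>]] Q0] by (simp add: algebra_simps)
    finally show "(\<Sum>i\<in>I. norm (p i \<tau>) / \<bar>\<phi> i\<bar>) \<le> 2 * lam * Q * f \<tau>" .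
  qed (use ip f_int in auto)
  finally show ?thesis by (simp add: algebra_simps)
qed

text \<open>Now the time integral of \<open>F m\<close> decays in \<open>m\<close>, whereas nothing
  of the kind is known at a fixed time. The modes are therefore replaced by their majorants
  \<open>A * w\<close> before the integration in time, which leaves the L^1 norms of
  \<open>F\<close> to be summed with the weight \<open>W\<close>.\<close>

lemma normal_form_bound_smooth:
  fixes w W :: "int \<Rightarrow> real"
  assumes A: "0 \<le> A" and a_le: "\<And>m \<tau>. \<tau> \<in> {0..T} \<Longrightarrow> norm (a m \<tau>) \<le> A * w m"
    and F1: "\<And>m. (LINT \<tau>|ivl T. norm (F m \<tau>)) \<le> \<Phi> * W m"
    and wW: "\<And>m. 0 \<le> w m" "\<And>m. w m \<le> W m"
    and U: "(\<Sum>k\<in>D. \<Sum>j\<in>D. W (n + j) * w (n + j + k) * w (n + k) / (\<bar>real_of_int j\<bar> * \<bar>real_of_int k\<bar>)) \<le> U"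
      "(\<Sum>k\<in>D. \<Sum>j\<in>D. w (n + j) * W (n + j + k) * w (n + k) / (\<bar>real_of_int j\<bar> * \<bar>real_of_int k\<bar>)) \<le> U"
    and D: "finite D" "0 \<notin> D" and t: "t \<in> {0..T}"
  shows "norm (LINT \<tau>|ivl t. (\<Sum>j\<in>D. \<Sum>k\<in>D. cis (2 * of_int j * of_int k * \<tau>) *
      (a (n + j) \<tau> * cnj (a (n + j + k) \<tau>) * a (n + k) \<tau>))) \<le> U * (A ^ 3 + 2 * lam * \<bar>\<Phi>\<bar> * A\<^sup>2)"
proof -
  define P where "P = (\<lambda>(j, k) \<tau>. a (n + j) \<tau> * cnj (a (n + j + k) \<tau>) * a (n + k) \<tau>)"
  define B where "B = (\<lambda>(j, k). W (n + j) * w (n + j + k) * w (n + k) + w (n + j) * W (n + j + k) * w (n + k) + w (n + j) * w (n + j + k) * W (n + k))"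
  define \<phi> where "\<phi> = (\<lambda>(j, k). 2 * real_of_int j * real_of_int k)"
  have W0: "0 \<le> W m" for m using wW[of m] by linarith
  have "\<exists>p. has_density T (P i) p \<and> (LINT \<tau>|ivl T. norm (p \<tau>)) \<le> lam * \<bar>\<Phi>\<bar> * A\<^sup>2 * B i" for i
  proof (cases i)
    case (Pair j k)
    obtain p where p: "has_density T (P i) p" "\<And>\<tau>. \<tau>\<in>{0..T} \<Longrightarrow> norm (p \<tau>) \<le> lam * (norm (F (n + j) \<tau>) * norm (a (n + j + k) \<tau>) * norm (a (n + k) \<tau>) +
        norm (a (n + j) \<tau>) * norm (F (n + j + k) \<tau>) * norm (a (n + k) \<tau>) + norm (a (n + j) \<tau>) * norm (a (n + j + k) \<tau>) * norm (F (n + k) \<tau>))"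
      unfolding Pair P_def prod.case using triple_density by blast
    let ?g = "\<lambda>\<tau>. lam * A\<^sup>2 * (w (n + j + k) * w (n + k) * norm (F (n + j) \<tau>) + w (n + j) * w (n + k) * norm (F (n + j + k) \<tau>) + w (n + j) * w (n + j + k) * norm (F (n + k) \<tau>))"
    have "norm (p \<tau>) \<le> ?g \<tau>" if \<tau>: "\<tau> \<in> {0..T}" for \<tau>
    proof -
      have "norm (p \<tau>) \<le> lam * (norm (F (n + j) \<tau>) * (A * w (n + j + k)) * (A * w (n + k)) +
        (A * w (n + j)) * norm (F (n + j + k) \<tau>) * (A * w (n + k)) + (A * w (n + j)) * (A * w (n + j + k)) * norm (F (n + k) \<tau>))"
        by (rule order_trans[OF p(2)[OF \<tau>]]) (intro mult_left_mono add_mono mult_mono a_le \<tau> order_refl lam mult_nonneg_nonneg norm_ge_zero A wW(1))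
      then show ?thesis by (simp add: algebra_simps power2_eq_square)
    qed
    then have "(LINT \<tau>|ivl T. norm (p \<tau>)) \<le> (LINT \<tau>|ivl T. ?g \<tau>)"
      using p(1) F_int by (intro integral_mono) (auto simp: has_density_def set_integrable_ivl)
    also have "\<dots> = lam * A\<^sup>2 * (w (n + j + k) * w (n + k) * (LINT \<tau>|ivl T. norm (F (n + j) \<tau>)) + w (n + j) * w (n + k) * (LINT \<tau>|ivl T. norm (F (n + j + k) \<tau>))
        + w (n + j) * w (n + j + k) * (LINT \<tau>|ivl T. norm (F (n + k) \<tau>)))"
      using F_int by simp
    also have "\<dots> \<le> lam * A\<^sup>2 * (w (n + j + k) * w (n + k) * (\<bar>\<Phi>\<bar> * W (n + j)) + w (n + j) * w (n + k) * (\<bar>\<Phi>\<bar> * W (n + j + k))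
        + w (n + j) * w (n + j + k) * (\<bar>\<Phi>\<bar> * W (n + k)))"
      by (intro mult_left_mono add_mono order_trans[OF F1] mult_right_mono mult_nonneg_nonneg lam wW(1) W0) auto
    also have "\<dots> = lam * \<bar>\<Phi>\<bar> * A\<^sup>2 * B i" by (simp add: B_def Pair algebra_simps)
    finally show ?thesis using p(1) by blast
  qed
  then obtain p where p: "\<And>i. has_density T (P i) (p i)" "\<And>i. (LINT \<tau>|ivl T. norm (p i \<tau>)) \<le> lam * \<bar>\<Phi>\<bar> * A\<^sup>2 * B i"
    by metis
  define I where "I = D \<times> D"
  have I: "finite I" using D by (simp add: I_def)
  have nest: "(\<Sum>j\<in>D. \<Sum>k\<in>D. h (j, k)) = (\<Sum>i\<in>I. h i)" for h :: "_ \<Rightarrow> 'b :: comm_monoid_add"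
    by (simp add: I_def sum.cartesian_product)
  define U1 where "U1 = (\<Sum>j\<in>D. \<Sum>k\<in>D. W (n + j) * w (n + j + k) * w (n + k) / (\<bar>real_of_int j\<bar> * \<bar>real_of_int k\<bar>))"
  define U2 where "U2 = (\<Sum>j\<in>D. \<Sum>k\<in>D. w (n + j) * W (n + j + k) * w (n + k) / (\<bar>real_of_int j\<bar> * \<bar>real_of_int k\<bar>))"
  define U3 where "U3 = (\<Sum>j\<in>D. \<Sum>k\<in>D. w (n + j) * w (n + j + k) * W (n + k) / (\<bar>real_of_int j\<bar> * \<bar>real_of_int k\<bar>))"
  have U1: "U1 \<le> U" unfolding U1_def by (subst sum.swap) (rule U(1))
  have U2: "U2 \<le> U" unfolding U2_def by (subst sum.swap) (rule U(2))
  have U3: "U3 \<le> U"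
  proof -
    have "U3 = (\<Sum>k\<in>D. \<Sum>j\<in>D. W (n + j) * w (n + j + k) * w (n + k) / (\<bar>real_of_int j\<bar> * \<bar>real_of_int k\<bar>))"
      unfolding U3_def by (simp add: add_ac mult_ac)
    then show ?thesis using U(1) by simp
  qed
  have U0: "0 \<le> U" by (rule order_trans[OF _ U1]) (auto simp: U1_def intro!: sum_nonneg mult_nonneg_nonneg divide_nonneg_nonneg wW(1) W0)
  have "(LINT \<tau>|ivl t. (\<Sum>j\<in>D. \<Sum>k\<in>D. cis (2 * of_int j * of_int k * \<tau>) *
      (a (n + j) \<tau> * cnj (a (n + j + k) \<tau>) * a (n + k) \<tau>))) = (LINT \<tau>|ivl t. (\<Sum>i\<in>I. cis (\<phi> i * \<tau>) * P i \<tau>))"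
    unfolding nest[symmetric] by (simp add: P_def \<phi>_def)
  also have "norm \<dots> \<le> (\<Sum>i\<in>I. (norm (P i 0) + norm (P i t)) / \<bar>\<phi> i\<bar>) + (\<Sum>i\<in>I. (LINT \<tau>|ivl T. norm (p i \<tau>)) / \<bar>\<phi> i\<bar>)"
    by (rule oscillation_sum_bound[OF I p(1) _ t]) (use D in \<open>auto simp: I_def \<phi>_def\<close>)
  also have "(\<Sum>i\<in>I. (norm (P i 0) + norm (P i t)) / \<bar>\<phi> i\<bar>) \<le> A ^ 3 * U"
  proof -
    have bd: "(\<Sum>i\<in>I. norm (P i \<tau>) / \<bar>\<phi> i\<bar>) \<le> A ^ 3 * U / 2" if \<tau>: "\<tau> \<in> {0..T}" for \<tau>
    proof -
      have "(\<Sum>i\<in>I. norm (P i \<tau>) / \<bar>\<phi> i\<bar>) = (\<Sum>j\<in>D. \<Sum>k\<in>D. norm (a (n + j) \<tau>) * norm (a (n + j + k) \<tau>) * norm (a (n + k) \<tau>) / (2 * \<bar>real_of_int j\<bar> * \<bar>real_of_int k\<bar>))"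
        unfolding nest[symmetric] by (intro sum.cong refl) (simp add: P_def \<phi>_def norm_mult abs_mult)
      also have "\<dots> \<le> (\<Sum>j\<in>D. \<Sum>k\<in>D. (A * W (n + j)) * (A * w (n + j + k)) * (A * w (n + k)) / (2 * \<bar>real_of_int j\<bar> * \<bar>real_of_int k\<bar>))"
        by (intro sum_mono divide_right_mono mult_mono order_trans[OF a_le[OF \<tau>] mult_left_mono[OF wW(2) A]] a_le \<tau> mult_nonneg_nonneg A wW(1) W0 norm_ge_zero) auto
      also have "\<dots> = (A ^ 3 / 2) * U1"
        unfolding U1_def sum_distrib_left by (intro sum.cong refl) (simp add: power3_eq_cube mult_ac)
      also have "\<dots> \<le> (A ^ 3 / 2) * U" using A by (intro mult_left_mono U1) auto
      finally show ?thesis by simp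
    qed
    have "(\<Sum>i\<in>I. (norm (P i 0) + norm (P i t)) / \<bar>\<phi> i\<bar>) = (\<Sum>i\<in>I. norm (P i 0) / \<bar>\<phi> i\<bar>) + (\<Sum>i\<in>I. norm (P i t) / \<bar>\<phi> i\<bar>)"
      by (simp add: add_divide_distrib sum.distrib)
    also have "\<dots> \<le> A ^ 3 * U / 2 + A ^ 3 * U / 2" using T t by (intro add_mono bd) auto
    finally show ?thesis by (simp add: mult_ac)
  qed
  also have "(\<Sum>i\<in>I. (LINT \<tau>|ivl T. norm (p i \<tau>)) / \<bar>\<phi> i\<bar>) \<le> (\<Sum>i\<in>I. lam * \<bar>\<Phi>\<bar> * A\<^sup>2 * B i / \<bar>\<phi> i\<bar>)"
    by (intro sum_mono divide_right_mono p(2)) auto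
  also have "\<dots> = (lam * \<bar>\<Phi>\<bar> * A\<^sup>2 / 2) * (U1 + U2 + U3)"
    unfolding nest[symmetric] U1_def U2_def U3_def sum.distrib[symmetric] sum_distrib_left
    by (intro sum.cong refl) (simp add: B_def \<phi>_def abs_mult add_divide_distrib algebra_simps)
  also have "\<dots> \<le> (lam * \<bar>\<Phi>\<bar> * A\<^sup>2 / 2) * (U + U + U)"
    using lam by (intro mult_left_mono add_mono U1 U2 U3) auto
  also have "\<dots> \<le> 2 * lam * \<bar>\<Phi>\<bar> * A\<^sup>2 * U"
    using mult_nonneg_nonneg[OF mult_nonneg_nonneg[OF lam abs_ge_zero[of \<Phi>]] mult_nonneg_nonneg[OF zero_le_power2[of A] U0]] by (simp add: algebra_simps)
  finally show ?thesis by (simp add: algebra_simps)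
qed

end

section \<open>The cubic nonlinearity in Fourier modes\<close>

definition cubic :: "complex \<Rightarrow> complex" where
  "cubic z = complex_of_real ((norm z)\<^sup>2) * z"

lemma cubic_eq: "cubic z = z * cnj z * z"
  by (simp only: cubic_def complex_norm_square)

lemma norm_cubic: "norm (cubic z) = norm z ^ 3"
  by (simp add: cubic_def norm_mult norm_power power2_eq_square power3_eq_cube)

lemma cubic_diff:
  "norm (cubic a - cubic b) \<le> 2 * ((norm a)\<^sup>2 + (norm b)\<^sup>2) * norm (a - b)"
proof -
  have e: "cubic a - cubic b = complex_of_real ((norm a)\<^sup>2) * (a - b) + complex_of_real ((norm a)\<^sup>2 - (norm b)\<^sup>2) * b"
    by (simp add: cubic_def algebra_simps)
  have "norm (cubic a - cubic b) \<le> (norm a)\<^sup>2 * norm (a - b) + \<bar>(norm a)\<^sup>2 - (norm b)\<^sup>2\<bar> * norm b"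
    unfolding e by (rule order_trans[OF norm_triangle_ineq]) (simp add: norm_mult norm_power del: of_real_diff of_real_power)
  also have "\<bar>(norm a)\<^sup>2 - (norm b)\<^sup>2\<bar> = (norm a + norm b) * \<bar>norm a - norm b\<bar>"
    by (simp add: power2_eq_square square_diff_square_factored abs_mult)
  also have "\<dots> \<le> (norm a + norm b) * norm (a - b)" by (intro mult_left_mono norm_triangle_ineq3) auto
  finally have "norm (cubic a - cubic b) \<le> ((norm a)\<^sup>2 + (norm a + norm b) * norm b) * norm (a - b)"
    by (simp add: algebra_simps mult_right_mono)
  also have "\<dots> \<le> (2 * ((norm a)\<^sup>2 + (norm b)\<^sup>2)) * norm (a - b)"
  proof (rule mult_right_mono)
    have "0 \<le> (norm a - norm b)\<^sup>2" by simp
    then have "2 * (norm a * norm b) \<le> (norm a)\<^sup>2 + (norm b)\<^sup>2" by (simp add: power2_eq_square algebra_simps)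
    moreover have "0 \<le> norm a * norm b" "0 \<le> (norm a)\<^sup>2" "0 \<le> (norm b)\<^sup>2" by auto
    ultimately show "(norm a)\<^sup>2 + (norm a + norm b) * norm b \<le> 2 * ((norm a)\<^sup>2 + (norm b)\<^sup>2)"
      by (simp only: power2_eq_square distrib_right distrib_left)
  qed simp
  finally show ?thesis .
qed

lemma continuous_on_cubic: "continuous_on S cubic"
  unfolding cubic_def by (intro continuous_intros)

lemma measurable_cubic [measurable]: "cubic \<in> borel_measurable borel"
  by (rule borel_measurable_continuous_onI[OF continuous_on_cubic])

section \<open>Interactions of finitely many modes\<close>

definition trunc :: "nat \<Rightarrow> (int \<Rightarrow> 'b :: zero) \<Rightarrow> int \<Rightarrow> 'b" where
  "trunc M c m = (if m \<in> {-int M..int M} then c m else 0)"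

lemma cubic_psum_continuous: "continuous_on UNIV (\<lambda>x. cubic (psum c M x))"
  by (rule continuous_on_compose2[OF continuous_on_cubic psum_continuous]) auto

lemma integrable_tor_continuous:
  assumes "continuous_on UNIV (g :: real \<Rightarrow> 'b :: euclidean_space)" shows "integrable tor g"
  unfolding tor_eq_ivl by (rule integrable_ivl_continuous[OF continuous_on_subset[OF assms]]) auto

text \<open>Orthogonality fixes the conjugated frequency as \<open>n1 + n3 - n\<close>. It may fall
  outside the retained range, which \<open>trunc\<close> accounts for.\<close>

lemma fourier_coeff_cubic_psum:
  "fourier_coeff (\<lambda>x. cubic (psum c M x)) n =
    (\<Sum>n1\<in>{-int M..int M}. \<Sum>n3\<in>{-int M..int M}. c n1 * c n3 * cnj (trunc M c (n1 + n3 - n)))"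
proof -
  let ?R = "{-int M..int M}"
  have "cubic (psum c M x) * cis (- (of_int n * x)) =
    (\<Sum>n1\<in>?R. \<Sum>n3\<in>?R. \<Sum>n2\<in>?R. c n1 * c n3 * cnj (c n2) * cis (of_int (n1 + n3 - n2 - n) * x))" for x
  proof -
    have "cubic (psum c M x) = (\<Sum>n1\<in>?R. c n1 * cis (of_int n1 * x)) * ((\<Sum>n3\<in>?R. c n3 * cis (of_int n3 * x)) * (\<Sum>n2\<in>?R. cnj (c n2) * cis (- (of_int n2 * x))))"
      by (simp add: cubic_eq psum_def cis_cnj mult_ac)
    also have "\<dots> = (\<Sum>n1\<in>?R. \<Sum>n3\<in>?R. \<Sum>n2\<in>?R. c n1 * cis (of_int n1 * x) * (c n3 * cis (of_int n3 * x) * (cnj (c n2) * cis (- (of_int n2 * x)))))"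
      unfolding sum_product by (simp add: sum_distrib_left)
    finally have "cubic (psum c M x) * cis (- (of_int n * x)) = (\<Sum>n1\<in>?R. \<Sum>n3\<in>?R. \<Sum>n2\<in>?R. c n1 * cis (of_int n1 * x) * (c n3 * cis (of_int n3 * x) * (cnj (c n2) * cis (- (of_int n2 * x)))) * cis (- (of_int n * x)))"
      by (simp add: sum_distrib_right)
    also have "\<dots> = (\<Sum>n1\<in>?R. \<Sum>n3\<in>?R. \<Sum>n2\<in>?R. c n1 * c n3 * cnj (c n2) * cis (of_int (n1 + n3 - n2 - n) * x))"
    proof (intro sum.cong refl)
      fix n1 n2 n3
      have "cis (of_int (n1 + n3 - n2 - n) * x) = cis (of_int n1 * x) * cis (of_int n3 * x) * cis (- (of_int n2 * x)) * cis (- (of_int n * x))"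
        by (simp add: cis_mult algebra_simps)
      then show "c n1 * cis (of_int n1 * x) * (c n3 * cis (of_int n3 * x) * (cnj (c n2) * cis (- (of_int n2 * x)))) * cis (- (of_int n * x))
         = c n1 * c n3 * cnj (c n2) * cis (of_int (n1 + n3 - n2 - n) * x)" by simp
    qed
    finally show ?thesis .
  qed
  then have "(LINT x|tor. cubic (psum c M x) * cis (- (of_int n * x))) =
     (LINT x|tor. (\<Sum>n1\<in>?R. \<Sum>n3\<in>?R. \<Sum>n2\<in>?R. c n1 * c n3 * cnj (c n2) * cis (of_int (n1 + n3 - n2 - n) * x)))"
    by simp
  also have "\<dots> = (\<Sum>n1\<in>?R. \<Sum>n3\<in>?R. \<Sum>n2\<in>?R. c n1 * c n3 * cnj (c n2) * (LINT x|tor. cis (of_int (n1 + n3 - n2 - n) * x)))"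
  proof -
    have i: "integrable tor (\<lambda>x. z * cis (of_int m * x))" for z and m :: int
      by (rule integrable_tor_continuous) (intro continuous_intros)
    show ?thesis
      by (subst Bochner_Integration.integral_sum, intro Bochner_Integration.integrable_sum i, intro sum.cong refl,
         subst Bochner_Integration.integral_sum, intro Bochner_Integration.integrable_sum i, intro sum.cong refl,
         subst Bochner_Integration.integral_sum, intro i, intro sum.cong refl integral_mult_right_zero)
  qed
  also have "\<dots> = (\<Sum>n1\<in>?R. \<Sum>n3\<in>?R. 2 * pi * (c n1 * c n3 * cnj (trunc M c (n1 + n3 - n))))"
  proof (intro sum.cong refl)
    fix n1 n3
    have "(\<Sum>n2\<in>?R. c n1 * c n3 * cnj (c n2) * (LINT x|tor. cis (of_int (n1 + n3 - n2 - n) * x))) =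
      (\<Sum>n2\<in>?R. if n2 = n1 + n3 - n then 2 * pi * (c n1 * c n3 * cnj (c n2)) else 0)"
      by (intro sum.cong refl) (auto simp: integral_tor_cis simp del: of_int_diff of_int_add)
    also have "\<dots> = 2 * pi * (c n1 * c n3 * cnj (trunc M c (n1 + n3 - n)))"
      by (simp add: sum.delta' trunc_def)
    finally show "(\<Sum>n2\<in>?R. c n1 * c n3 * cnj (c n2) * (LINT x|tor. cis (of_int (n1 + n3 - n2 - n) * x))) = 2 * pi * (c n1 * c n3 * cnj (trunc M c (n1 + n3 - n)))" .
  qed
  finally show ?thesis unfolding fourier_coeff_eq by (simp add: sum_distrib_left[symmetric])
qed

lemma fourier_coeff_cubic_psum_high:
  assumes "3 * int M < \<bar>n\<bar>" shows "fourier_coeff (\<lambda>x. cubic (psum c M x)) n = 0"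
  unfolding fourier_coeff_cubic_psum using assms by (intro sum.neutral ballI) (auto simp: trunc_def)

lemma sum_shift_trunc:
  fixes g :: "int \<Rightarrow> 'b :: comm_monoid_add"
  assumes n: "n \<in> {-int M..int M}" and g: "\<And>m. m \<notin> {-int M..int M} \<Longrightarrow> g m = 0"
  shows "(\<Sum>j\<in>{-(2 * int M)..2 * int M}. g (n + j)) = (\<Sum>m\<in>{-int M..int M}. g m)"
proof -
  have "(\<Sum>j\<in>{-(2 * int M)..2 * int M}. g (n + j)) = (\<Sum>m\<in>(\<lambda>j. n + j) ` {-(2 * int M)..2 * int M}. g m)"
    by (subst sum.reindex) (auto simp: inj_on_def)
  also have "\<dots> = (\<Sum>m\<in>{-int M..int M}. g m)"
  proof (rule sum.mono_neutral_right)
    show "{-int M..int M} \<subseteq> (\<lambda>j. n + j) ` {-(2 * int M)..2 * int M}"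
    proof
      fix m assume "m \<in> {-int M..int M}"
      then show "m \<in> (\<lambda>j. n + j) ` {-(2 * int M)..2 * int M}" using n by (intro image_eqI[of _ _ "m - n"]) auto
    qed
  qed (use g in auto)
  finally show ?thesis .
qed

text \<open>The non-zero differences of two frequencies in \<open>{-int M..int M}\<close>: from a
  retained \<open>n\<close>, the shifts by them reach every other retained frequency.\<close>

definition offsets :: "nat \<Rightarrow> int set" where
  "offsets M = {-(2 * int M)..2 * int M} - {0}"

lemma offsets: "finite (offsets M)" "0 \<notin> offsets M" "uminus ` offsets M = offsets M"
proof -
  show "uminus ` offsets M = offsets M"
  proof (intro antisym subsetI)
    fix x assume "x \<in> offsets M" then show "x \<in> uminus ` offsets M"
      by (intro image_eqI[of _ _ "- x"]) (auto simp: offsets_def)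
  qed (auto simp: offsets_def)
qed (auto simp: offsets_def)

definition nonres :: "nat \<Rightarrow> (int \<Rightarrow> complex) \<Rightarrow> int \<Rightarrow> real \<Rightarrow> complex" where
  "nonres M c n \<tau> = (\<Sum>j\<in>offsets M. \<Sum>k\<in>offsets M. cis (2 * of_int j * of_int k * \<tau>) *
      (trunc M c (n + j) * cnj (trunc M c (n + j + k)) * trunc M c (n + k)))"

text \<open>The phase identity \<open>n\<^sup>2 - (n+j)\<^sup>2 + (n+j+k)\<^sup>2 - (n+k)\<^sup>2 = 2jk\<close>; the terms with \<open>j = 0\<close> or
  \<open>k = 0\<close> are resonant.\<close>

lemma fourier_coeff_cubic_interaction:
  fixes a :: "int \<Rightarrow> complex" and \<tau> :: real
  assumes n: "n \<in> {-int M..int M}"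
  defines "c \<equiv> \<lambda>m. cis (- (\<tau> * (of_int m)\<^sup>2)) * a m"
  shows "cis (\<tau> * (of_int n)\<^sup>2) * fourier_coeff (\<lambda>x. cubic (psum c M x)) n =
     nonres M a n \<tau> + (2 * complex_of_real (\<Sum>m\<in>{-int M..int M}. (norm (a m))\<^sup>2) - complex_of_real ((norm (a n))\<^sup>2)) * a n"
proof -
  let ?R = "{-int M..int M}" and ?D = "{-(2 * int M)..2 * int M}"
  define h where "h = (\<lambda>j k. cis (2 * of_int j * of_int k * \<tau>) * (trunc M a (n + j) * cnj (trunc M a (n + j + k)) * trunc M a (n + k)))"
  have "fourier_coeff (\<lambda>x. cubic (psum c M x)) n = (\<Sum>n1\<in>?R. \<Sum>n3\<in>?R. trunc M c n1 * trunc M c n3 * cnj (trunc M c (n1 + n3 - n)))"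
    unfolding fourier_coeff_cubic_psum by (intro sum.cong refl) (auto simp: trunc_def)
  also have "\<dots> = (\<Sum>j\<in>?D. \<Sum>n3\<in>?R. trunc M c (n + j) * trunc M c n3 * cnj (trunc M c ((n + j) + n3 - n)))"
    by (rule sum_shift_trunc[OF n, symmetric]) (rule sum.neutral, auto simp: trunc_def)
  also have "\<dots> = (\<Sum>j\<in>?D. \<Sum>k\<in>?D. trunc M c (n + j) * trunc M c (n + k) * cnj (trunc M c ((n + j) + (n + k) - n)))"
    by (intro sum.cong refl sum_shift_trunc[OF n, symmetric]) (auto simp: trunc_def)
  finally have "cis (\<tau> * (of_int n)\<^sup>2) * fourier_coeff (\<lambda>x. cubic (psum c M x)) n =
     (\<Sum>j\<in>?D. \<Sum>k\<in>?D. cis (\<tau> * (of_int n)\<^sup>2) * (trunc M c (n + j) * trunc M c (n + k) * cnj (trunc M c ((n + j) + (n + k) - n))))"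
    by (simp add: sum_distrib_left)
  also have "\<dots> = (\<Sum>j\<in>?D. \<Sum>k\<in>?D. h j k)"
  proof (intro sum.cong refl)
    fix j k
    have tc: "trunc M c m = cis (- (\<tau> * (of_int m)\<^sup>2)) * trunc M a m" for m by (simp add: trunc_def c_def)
    have ph: "cis (\<tau> * (of_int n)\<^sup>2) * (cis (- (\<tau> * (of_int (n + j))\<^sup>2)) * cis (- (\<tau> * (of_int (n + k))\<^sup>2)) * cis (\<tau> * (of_int (n + j + k))\<^sup>2)) = cis (2 * of_int j * of_int k * \<tau>)"
      unfolding cis_mult by (rule arg_cong[of _ _ cis]) (simp add: power2_eq_square algebra_simps)
    have e: "(n + j) + (n + k) - n = n + j + k" by simp
    have "cis (\<tau> * (of_int n)\<^sup>2) * (trunc M c (n + j) * trunc M c (n + k) * cnj (trunc M c ((n + j) + (n + k) - n))) =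
      (cis (\<tau> * (of_int n)\<^sup>2) * (cis (- (\<tau> * (of_int (n + j))\<^sup>2)) * cis (- (\<tau> * (of_int (n + k))\<^sup>2)) * cis (\<tau> * (of_int (n + j + k))\<^sup>2))) * (trunc M a (n + j) * cnj (trunc M a (n + j + k)) * trunc M a (n + k))"
      unfolding e tc by (simp add: cis_cnj mult_ac del: of_int_add)
    then show "cis (\<tau> * (of_int n)\<^sup>2) * (trunc M c (n + j) * trunc M c (n + k) * cnj (trunc M c ((n + j) + (n + k) - n))) = h j k"
      unfolding ph h_def .
  qed
  also have "\<dots> = (\<Sum>j\<in>insert 0 (offsets M). \<Sum>k\<in>insert 0 (offsets M). h j k)"
  proof -
    have "?D = insert 0 (offsets M)" by (auto simp: offsets_def)
    then show ?thesis by simp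
  qed
  \<comment> \<open>Inclusion and exclusion: the row \<open>j = 0\<close> and the column
    \<open>k = 0\<close> each contribute the truncated mass times \<open>a n\<close>, and their
    common entry, counted twice, is the self-interaction that has to be subtracted.\<close>
  also have "\<dots> = nonres M a n \<tau> + (\<Sum>k\<in>insert 0 (offsets M). h 0 k) + (\<Sum>j\<in>insert 0 (offsets M). h j 0) - h 0 0"
    using offsets[of M] by (simp add: sum.distrib nonres_def h_def)
  also have "(\<Sum>k\<in>insert 0 (offsets M). h 0 k) = complex_of_real (\<Sum>m\<in>?R. (norm (a m))\<^sup>2) * a n"
  proof -
    have "(\<Sum>k\<in>insert 0 (offsets M). h 0 k) = (\<Sum>k\<in>?D. h 0 k)"
      by (rule arg_cong[of _ _ "sum _"]) (auto simp: offsets_def)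
    also have "\<dots> = (\<Sum>k\<in>?D. complex_of_real ((norm (trunc M a (n + k)))\<^sup>2) * a n)"
      using n by (intro sum.cong refl) (simp add: h_def complex_norm_square trunc_def mult_ac del: of_real_power)
    also have "\<dots> = (\<Sum>m\<in>?R. complex_of_real ((norm (trunc M a m))\<^sup>2) * a n)"
      by (rule sum_shift_trunc[OF n]) (auto simp: trunc_def)
    finally show ?thesis by (simp add: sum_distrib_right trunc_def)
  qed
  also have "(\<Sum>j\<in>insert 0 (offsets M). h j 0) = complex_of_real (\<Sum>m\<in>?R. (norm (a m))\<^sup>2) * a n"
  proof -
    have "(\<Sum>k\<in>insert 0 (offsets M). h k 0) = (\<Sum>k\<in>?D. h k 0)"
      by (rule arg_cong[of _ _ "sum _"]) (auto simp: offsets_def)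
    also have "\<dots> = (\<Sum>k\<in>?D. complex_of_real ((norm (trunc M a (n + k)))\<^sup>2) * a n)"
      using n by (intro sum.cong refl) (simp add: h_def complex_norm_square trunc_def mult_ac del: of_real_power)
    also have "\<dots> = (\<Sum>m\<in>?R. complex_of_real ((norm (trunc M a m))\<^sup>2) * a n)"
      by (rule sum_shift_trunc[OF n]) (auto simp: trunc_def)
    finally show ?thesis by (simp add: sum_distrib_right trunc_def)
  qed
  also have "h 0 0 = complex_of_real ((norm (a n))\<^sup>2) * a n"
    using n by (simp add: h_def trunc_def complex_norm_square mult_ac del: of_real_power)
  finally show ?thesis by (simp add: algebra_simps)
qed

text \<open>The fourth power is the cubic term paired with the function itself, so the pairing with
  a partial sum reduces it to the interaction sums. What does not oscillate is controlled by the
  square of the mass; only the nonresonant part calls for integration in time.\<close>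

lemma integral_psum_power4:
  fixes a :: "int \<Rightarrow> complex" and \<tau> :: real
  defines "c \<equiv> \<lambda>m. cis (- (\<tau> * (of_int m)\<^sup>2)) * a m"
  shows "complex_of_real (LINT x|tor. norm (psum c M x) ^ 4) = 2 * pi * (\<Sum>n\<in>{-int M..int M}. nonres M a n \<tau> * cnj (a n)) +
    complex_of_real (2 * pi * (\<Sum>n\<in>{-int M..int M}. (2 * (\<Sum>m\<in>{-int M..int M}. (norm (a m))\<^sup>2) - (norm (a n))\<^sup>2) * (norm (a n))\<^sup>2))"
proof -
  let ?R = "{-int M..int M}"
  have "complex_of_real (LINT x|tor. norm (psum c M x) ^ 4) = (LINT x|tor. cubic (psum c M x) * cnj (psum c M x))"
  proof -
    have "complex_of_real (norm z ^ 4) = cubic z * cnj z" for z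
    proof -
      have "cubic z * cnj z = complex_of_real ((norm z)\<^sup>2) * complex_of_real ((norm z)\<^sup>2)"
        unfolding cubic_def complex_norm_square by (simp add: mult_ac)
      then show ?thesis by (simp add: power4_eq_xxxx power2_eq_square)
    qed
    then show ?thesis unfolding integral_complex_of_real[symmetric] by simp
  qed
  also have "\<dots> = 2 * pi * (\<Sum>n\<in>?R. fourier_coeff (\<lambda>x. cubic (psum c M x)) n * cnj (c n))"
    by (rule integral_mult_cnj_psum[OF integrable_tor_continuous[OF cubic_psum_continuous]])
  also have "(\<Sum>n\<in>?R. fourier_coeff (\<lambda>x. cubic (psum c M x)) n * cnj (c n)) =
     (\<Sum>n\<in>?R. nonres M a n \<tau> * cnj (a n) + complex_of_real ((2 * (\<Sum>m\<in>?R. (norm (a m))\<^sup>2) - (norm (a n))\<^sup>2) * (norm (a n))\<^sup>2))"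
  proof (intro sum.cong refl)
    fix n assume n: "n \<in> ?R"
    have "fourier_coeff (\<lambda>x. cubic (psum c M x)) n * cnj (c n) = (cis (\<tau> * (of_int n)\<^sup>2) * fourier_coeff (\<lambda>x. cubic (psum c M x)) n) * cnj (a n)"
      by (simp add: c_def cis_cnj mult_ac)
    also have "\<dots> = nonres M a n \<tau> * cnj (a n) + (2 * complex_of_real (\<Sum>m\<in>?R. (norm (a m))\<^sup>2) - complex_of_real ((norm (a n))\<^sup>2)) * (a n * cnj (a n))"
      unfolding c_def fourier_coeff_cubic_interaction[OF n] by (simp add: algebra_simps)
    also have "a n * cnj (a n) = complex_of_real ((norm (a n))\<^sup>2)" by (simp only: complex_norm_square)
    finally show "fourier_coeff (\<lambda>x. cubic (psum c M x)) n * cnj (c n) = nonres M a n \<tau> * cnj (a n) + complex_of_real ((2 * (\<Sum>m\<in>?R. (norm (a m))\<^sup>2) - (norm (a n))\<^sup>2) * (norm (a n))\<^sup>2)"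
      by (simp del: of_real_sum of_real_power)
  qed
  finally show ?thesis by (simp add: sum.distrib distrib_left)
qed

lemma L2_norm_triangle:
  assumes f: "square_integrable tor f" and g: "square_integrable tor g"
  shows "L2_norm (\<lambda>x. f x + g x) \<le> L2_norm f + L2_norm g"
proof -
  note [measurable] = square_integrable_measurable[OF f] square_integrable_measurable[OF g]
  have i: "integrable tor (\<lambda>x. (norm (f x))\<^sup>2)" "integrable tor (\<lambda>x. (norm (g x))\<^sup>2)" using f g by (auto simp: square_integrable_def)
  have fg: "integrable tor (\<lambda>x. norm (f x) * norm (g x))" by (rule square_integrable_mult(1)[OF f g])
  have "(LINT x|tor. (norm (f x + g x))\<^sup>2) \<le> (LINT x|tor. (norm (f x))\<^sup>2 + 2 * (norm (f x) * norm (g x)) + (norm (g x))\<^sup>2)"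
  proof (rule integral_mono)
    show "integrable tor (\<lambda>x. (norm (f x + g x))\<^sup>2)" using square_integrable_add[OF f g] by (simp add: square_integrable_def)
    show "integrable tor (\<lambda>x. (norm (f x))\<^sup>2 + 2 * (norm (f x) * norm (g x)) + (norm (g x))\<^sup>2)"
      by (intro Bochner_Integration.integrable_add integrable_mult_right i fg)
    fix x
    have "(norm (f x + g x))\<^sup>2 \<le> (norm (f x) + norm (g x))\<^sup>2" by (intro power_mono norm_triangle_ineq) auto
    then show "(norm (f x + g x))\<^sup>2 \<le> (norm (f x))\<^sup>2 + 2 * (norm (f x) * norm (g x)) + (norm (g x))\<^sup>2"
      by (simp add: power2_sum)
  qed
  also have "\<dots> = (LINT x|tor. (norm (f x))\<^sup>2) + 2 * (LINT x|tor. norm (f x) * norm (g x)) + (LINT x|tor. (norm (g x))\<^sup>2)"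
    using i fg by simp
  also have "(LINT x|tor. norm (f x) * norm (g x)) \<le> sqrt (LINT x|tor. (norm (f x))\<^sup>2) * sqrt (LINT x|tor. (norm (g x))\<^sup>2)"
    using integral_cauchy_schwarz(2)[of "\<lambda>x. norm (f x)" tor "\<lambda>x. norm (g x)"] i by simp
  also have "(LINT x|tor. (norm (f x))\<^sup>2) + 2 * (sqrt (LINT x|tor. (norm (f x))\<^sup>2) * sqrt (LINT x|tor. (norm (g x))\<^sup>2)) + (LINT x|tor. (norm (g x))\<^sup>2)
     = (L2_norm f + L2_norm g)\<^sup>2"
    by (simp add: L2_norm_eq power2_sum)
  finally have "(LINT x|tor. (norm (f x + g x))\<^sup>2) \<le> (L2_norm f + L2_norm g)\<^sup>2" by simp
  then have "sqrt (LINT x|tor. (norm (f x + g x))\<^sup>2) \<le> L2_norm f + L2_norm g"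
    by (rule real_le_lsqrt[rotated]) (auto simp: L2_norm_eq)
  then show ?thesis by (simp add: L2_norm_eq)
qed

section \<open>Solutions of the equation\<close>

text \<open>Choosing the constant once makes it available to the definitions in the locales below.\<close>

definition "quad_const = (SOME C::real. C > 0 \<and> (\<forall>b E D S. 0 \<le> E \<and> sq_bounded b E \<and> finite D \<and> 0 \<notin> D \<and> uminus ` D = D \<and> finite S \<longrightarrow>
     (\<Sum>n\<in>S. \<Sum>j\<in>D. \<Sum>k\<in>D. b (n + j) * b (n + j + k) * b (n + k) / (\<bar>real_of_int j\<bar> * \<bar>real_of_int k\<bar>)) \<le> C * E ^ 3 \<and>
     (\<Sum>n\<in>S. \<Sum>j\<in>D. \<Sum>k\<in>D. b n * b (n + j + k) * b (n + k) / (\<bar>real_of_int j\<bar> * \<bar>real_of_int k\<bar>)) \<le> C * E ^ 3 \<and>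
     (\<Sum>n\<in>S. \<Sum>j\<in>D. \<Sum>k\<in>D. b n * b (n + j) * b (n + k) / (\<bar>real_of_int j\<bar> * \<bar>real_of_int k\<bar>)) \<le> C * E ^ 3 \<and>
     (\<Sum>n\<in>S. \<Sum>j\<in>D. \<Sum>k\<in>D. b n * b (n + j) * b (n + j + k) / (\<bar>real_of_int j\<bar> * \<bar>real_of_int k\<bar>)) \<le> C * E ^ 3))"

lemmas quad_const = someI_ex[OF quadrilinear_sums_bounded, folded quad_const_def]

text \<open>Strong convergence in \<open>L\<^sup>2\<close> together with a bound in \<open>L\<^sup>4\<close> gives weak convergence in
  \<open>L\<^sup>4\<close>, tested here against \<open>V\<^sup>3\<close>.\<close>

lemma (in finite_measure) integral_cube_mult_tendsto_0:
  fixes V :: "'a \<Rightarrow> real" and r :: "nat \<Rightarrow> 'a \<Rightarrow> real"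
  assumes [measurable]: "V \<in> borel_measurable M" "\<And>N. r N \<in> borel_measurable M"
    and V0: "\<And>x. 0 \<le> V x" and r0: "\<And>N x. 0 \<le> r N x"
    and V4: "integrable M (\<lambda>x. V x ^ 4)" and r4: "\<And>N. integrable M (\<lambda>x. r N x ^ 4)"
    and B: "\<And>N. (LINT x|M. r N x ^ 4) \<le> B"
    and r2: "\<And>N. integrable M (\<lambda>x. (r N x)\<^sup>2)" and lim: "(\<lambda>N. LINT x|M. (r N x)\<^sup>2) \<longlonglongrightarrow> 0"
  shows "\<And>N. integrable M (\<lambda>x. V x ^ 3 * r N x)" "(\<lambda>N. LINT x|M. V x ^ 3 * r N x) \<longlonglongrightarrow> 0"
proof -
  \<comment> \<open>If \<open>\<delta> * y \<le> x\<close> the first summand dominates, otherwise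
    the second.\<close>
  have young: "x ^ 3 * y \<le> x ^ 4 / \<delta> + \<delta> ^ 3 * y ^ 4" if "0 \<le> x" "0 \<le> y" "0 < \<delta>" for x y \<delta> :: real
  proof (cases "\<delta> * y \<le> x")
    case True
    have "x ^ 3 * y = x ^ 3 * (\<delta> * y) / \<delta>" using that by simp
    also have "\<dots> \<le> x ^ 3 * x / \<delta>" using True that by (intro divide_right_mono mult_left_mono) auto
    also have "\<dots> = x ^ 4 / \<delta>" by (simp add: power_numeral_reduce)
    finally show ?thesis using that by (smt (verit) mult_nonneg_nonneg zero_le_power)
  next
    case False
    then have "x ^ 3 \<le> (\<delta> * y) ^ 3" using that by (intro power_mono) auto
    then have "x ^ 3 * y \<le> (\<delta> * y) ^ 3 * y" using that by (intro mult_right_mono) auto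
    also have "\<dots> = \<delta> ^ 3 * y ^ 4" by (simp add: power_mult_distrib power_numeral_reduce)
    finally have "x ^ 3 * y \<le> \<delta> ^ 3 * y ^ 4" .
    moreover have "0 \<le> x ^ 4 / \<delta>" using that by simp
    ultimately show ?thesis by linarith
  qed
  show int: "integrable M (\<lambda>x. V x ^ 3 * r N x)" for N
    by (rule integrable_dominated[of _ "\<lambda>x. V x ^ 4 / 1 + 1 ^ 3 * r N x ^ 4"])
      (use V4 r4 V0 r0 young[where \<delta> = 1] in \<open>auto simp: abs_mult\<close>)
  have B0: "0 \<le> B" using B[of 0] by (rule order_trans[rotated]) simp
  have r1: "integrable M (r N)" for N
  proof -
    have "integrable M (\<lambda>x. 1 + (r N x)\<^sup>2)" using r2 by simp
    then show ?thesis
    proof (rule integrable_dominated)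
      fix x show "norm (r N x) \<le> 1 + (r N x)\<^sup>2"
        using r0[of N x] by (cases "r N x \<le> 1") (auto simp: power2_eq_square add_increasing add_increasing2 intro: order_trans[of _ "r N x * r N x"])
    qed simp
  qed
  have r1lim: "(\<lambda>N. LINT x|M. r N x) \<longlonglongrightarrow> 0"
  proof (rule tendsto_sandwich[OF _ _ tendsto_const])
    show "\<forall>\<^sub>F N in sequentially. 0 \<le> (LINT x|M. r N x)" using r0 by simp
    show "\<forall>\<^sub>F N in sequentially. (LINT x|M. r N x) \<le> sqrt (measure M (space M)) * sqrt (LINT x|M. (r N x)\<^sup>2)"
    proof (intro always_eventually allI)
      fix N
      have "(LINT x|M. \<bar>1\<bar> * \<bar>r N x\<bar>) \<le> sqrt (LINT x|M. 1\<^sup>2) * sqrt (LINT x|M. (r N x)\<^sup>2)"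
        by (rule integral_cauchy_schwarz(2)) (use r2 in auto)
      then show "(LINT x|M. r N x) \<le> sqrt (measure M (space M)) * sqrt (LINT x|M. (r N x)\<^sup>2)" using r0 by simp
    qed
    have "(\<lambda>N. sqrt (measure M (space M)) * sqrt (LINT x|M. (r N x)\<^sup>2)) \<longlonglongrightarrow> sqrt (measure M (space M)) * sqrt 0"
      by (intro tendsto_intros lim)
    then show "(\<lambda>N. sqrt (measure M (space M)) * sqrt (LINT x|M. (r N x)\<^sup>2)) \<longlonglongrightarrow> 0" by simp
  qed
  have tail: "(\<lambda>R::nat. LINT x|M. V x ^ 4 * indicator {x. real R < V x} x) \<longlonglongrightarrow> (LINT x|M. 0)"
  proof (rule integral_dominated_convergence[where w = "\<lambda>x. V x ^ 4"])
    show "AE x in M. (\<lambda>R. V x ^ 4 * indicator {x. real R < V x} x) \<longlonglongrightarrow> 0"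
    proof (rule AE_I2)
      fix x
      obtain n where "V x \<le> real n" using real_arch_simple by blast
      then have "\<forall>\<^sub>F R in sequentially. V x ^ 4 * indicator {x. real R < V x} x = 0"
        by (auto simp: eventually_sequentially indicator_def intro!: exI[of _ n])
      then show "(\<lambda>R. V x ^ 4 * indicator {x. real R < V x} x) \<longlonglongrightarrow> 0" by (rule tendsto_eventually)
    qed
  qed (use V4 in \<open>auto simp: indicator_def\<close>)
  show "(\<lambda>N. LINT x|M. V x ^ 3 * r N x) \<longlonglongrightarrow> 0"
  proof (rule LIMSEQ_I)
    fix e :: real assume e: "0 < e"
    \<comment> \<open>With this \<open>\<delta>\<close> the fourth power of \<open>r\<close>
      contributes less than \<open>e / 3\<close> uniformly in \<open>N\<close>. Then
      \<open>R\<close> is chosen to control the region where \<open>V\<close> is large. Where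
      \<open>V \<le> R\<close> the integrand is at most a constant times \<open>r\<close>, which
      tends to 0 in L^1, so \<open>N\<close> is chosen last.\<close>
    define \<delta> where "\<delta> = min 1 (e / (3 * (B + 1)))"
    have \<delta>: "0 < \<delta>" "\<delta> \<le> 1" "\<delta> * B < e / 3"
    proof -
      show "0 < \<delta>" "\<delta> \<le> 1" using e B0 by (auto simp: \<delta>_def)
      have "\<delta> * B \<le> e / (3 * (B + 1)) * B" using B0 by (intro mult_right_mono) (auto simp: \<delta>_def)
      also have "\<dots> < e / 3" using e B0 by (simp add: field_simps)
      finally show "\<delta> * B < e / 3" .
    qed
    have "\<forall>\<^sub>F R in sequentially. (LINT x|M. V x ^ 4 * indicator {x. real R < V x} x) < \<delta> * e / 3"
      by (rule order_tendstoD(2)[OF tail]) (use \<delta> e in auto)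
    then obtain R :: nat where R: "(LINT x|M. V x ^ 4 * indicator {x. real R < V x} x) < \<delta> * e / 3"
      by (auto simp: eventually_sequentially)
    have "\<forall>\<^sub>F N in sequentially. (LINT x|M. r N x) < e / (3 * (real R ^ 3 + 1))"
      by (rule order_tendstoD(2)[OF r1lim]) (use e in \<open>auto simp: add_nonneg_pos\<close>)
    then obtain N0 where N0: "\<And>N. N \<ge> N0 \<Longrightarrow> (LINT x|M. r N x) < e / (3 * (real R ^ 3 + 1))"
      by (auto simp: eventually_sequentially)
    show "\<exists>N0. \<forall>N\<ge>N0. norm ((LINT x|M. V x ^ 3 * r N x) - 0) < e"
    proof (intro exI[of _ N0] allI impI)
      fix N assume N: "N0 \<le> N"
      have Rp: "0 < real R ^ 3 + 1" by (simp add: add_nonneg_pos)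
      have iV: "integrable M (\<lambda>x. V x ^ 4 * indicator {x. real R < V x} x)"
        by (rule integrable_dominated[OF V4]) (auto simp: indicator_def)
      have "(LINT x|M. V x ^ 3 * r N x) \<le> (LINT x|M. (real R ^ 3 + 1) * r N x + (V x ^ 4 * indicator {x. real R < V x} x) / \<delta> + \<delta> ^ 3 * r N x ^ 4)"
      proof (rule integral_mono[OF int])
        show "integrable M (\<lambda>x. (real R ^ 3 + 1) * r N x + (V x ^ 4 * indicator {x. real R < V x} x) / \<delta> + \<delta> ^ 3 * r N x ^ 4)"
          by (intro Bochner_Integration.integrable_add integrable_mult_right integrable_divide_zero r1 r4 iV)
        fix x
        show "V x ^ 3 * r N x \<le> (real R ^ 3 + 1) * r N x + (V x ^ 4 * indicator {x. real R < V x} x) / \<delta> + \<delta> ^ 3 * r N x ^ 4"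
        proof (cases "real R < V x")
          case True
          have "V x ^ 3 * r N x \<le> V x ^ 4 / \<delta> + \<delta> ^ 3 * r N x ^ 4" by (rule young[OF V0 r0 \<delta>(1)])
          moreover have "0 \<le> (real R ^ 3 + 1) * r N x" using Rp r0 by (intro mult_nonneg_nonneg) auto
          ultimately show ?thesis using True by simp
        next
          case False
          have "V x ^ 3 \<le> real R ^ 3" using False V0[of x] by (intro power_mono) auto
          then have "V x ^ 3 * r N x \<le> (real R ^ 3 + 1) * r N x" using r0 by (intro mult_right_mono) auto
          moreover have "0 \<le> \<delta> ^ 3 * r N x ^ 4" using \<delta> r0 by simp
          ultimately show ?thesis using False by simp
        qed
      qed
      also have "\<dots> = (real R ^ 3 + 1) * (LINT x|M. r N x) + (LINT x|M. V x ^ 4 * indicator {x. real R < V x} x) / \<delta> + \<delta> ^ 3 * (LINT x|M. r N x ^ 4)"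
        using r1 r4 iV by simp
      also have "\<dots> < e / 3 + e / 3 + e / 3"
      proof (intro add_strict_mono)
        show "(real R ^ 3 + 1) * (LINT x|M. r N x) < e / 3" using N0[OF N] Rp by (simp add: field_simps)
        show "(LINT x|M. V x ^ 4 * indicator {x. real R < V x} x) / \<delta> < e / 3" using R \<delta>(1) by (simp add: field_simps)
        have "\<delta> ^ 3 * (LINT x|M. r N x ^ 4) \<le> \<delta> * B"
          using \<delta> B[of N] by (intro mult_mono) (auto simp: power_le_one_iff power3_eq_cube mult_le_one intro: mult_left_le)
        then show "\<delta> ^ 3 * (LINT x|M. r N x ^ 4) < e / 3" using \<delta>(3) by simp
      qed
      finally have "(LINT x|M. V x ^ 3 * r N x) < e" by simp
      moreover have "0 \<le> (LINT x|M. V x ^ 3 * r N x)" using V0 r0 by (intro integral_nonneg_AE AE_I2) auto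
      ultimately show "norm ((LINT x|M. V x ^ 3 * r N x) - 0) < e" by simp
    qed
  qed
qed

locale nls_sol =
  fixes eps T :: real and u0 :: "real \<Rightarrow> complex" and v :: "real \<Rightarrow> real \<Rightarrow> complex"
  assumes sol: "nls_solution eps u0 v" and T_pos: "0 < T"
begin

abbreviation "ST \<equiv> ivl T \<Otimes>\<^sub>M tor"
text \<open>\<open>av n\<close> is the mode \<open>n\<close> in the interaction picture: its derivative is \<open>- \<i> lam Fv n\<close>, which is
  bounded by \<open>lam fv\<close> uniformly in \<open>n\<close>.\<close>

definition "lam = eps\<^sup>2"
definition "av n t = cis (t * (of_int n)\<^sup>2) * fourier_coeff (v t) n"
definition "Fv n t = cis (t * (of_int n)\<^sup>2) * fourier_coeff (\<lambda>x. cubic (v t x)) n"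
definition "fv t = 1 / (2 * pi) * (LINT x|tor. norm (v t x) ^ 3)"
definition "Pv M t = psum (fourier_coeff (v t)) M"

sublocale ivlT: finite_measure "ivl T" by (rule finite_measure_ivl)
sublocale pst: pair_sigma_finite "ivl T" tor ..
sublocale ST: finite_measure ST by (rule finite_measure_pair_measure) unfold_locales

lemma space_ST: "space ST = {0..T} \<times> {0..2*pi}"
  by (simp add: space_pair_measure)

lemma v_sq: "0 \<le> t \<Longrightarrow> square_integrable tor (v t)"
  using sol by (auto simp: nls_solution_def L2_torus_iff)

lemma V_measurable [measurable]: "(\<lambda>z. v (fst z) (snd z)) \<in> borel_measurable ST"
proof -
  define S where "S = {0::real..} \<times> {0..2*pi}"
  have m: "(\<lambda>z. indicator S z *\<^sub>R v (fst z) (snd z)) \<in> borel_measurable borel"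
    using sol by (simp add: nls_solution_def set_borel_measurable_def S_def case_prod_unfold)
  have [measurable]: "fst \<in> measurable ST borel" "snd \<in> measurable ST borel"
  proof -
    have "(\<lambda>x. x) \<in> measurable (ivl T) borel" "(\<lambda>x. x) \<in> measurable tor borel"
      unfolding ivl_def tor_def by (intro measurable_restrict_space1; simp)+
    from measurable_compose[OF measurable_fst this(1)] measurable_compose[OF measurable_snd this(2)]
    show "fst \<in> measurable ST borel" "snd \<in> measurable ST borel" by auto
  qed
  have "(\<lambda>z. (fst z, snd z)) \<in> measurable ST (borel \<Otimes>\<^sub>M borel)" by measurable
  then have id: "(\<lambda>z. z) \<in> measurable ST borel" by (simp add: borel_prod)
  have "(\<lambda>z. indicator S z *\<^sub>R v (fst z) (snd z)) \<in> borel_measurable ST"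
    by (rule measurable_compose[OF id m])
  then show ?thesis
    by (rule measurable_cong[THEN iffD1, rotated]) (auto simp: space_ST S_def indicator_def)
qed

lemma V4_integrable: "integrable ST (\<lambda>z. norm (v (fst z) (snd z)) ^ 4)"
proof -
  let ?S = "{0..T} \<times> {0..2*pi}"
  let ?g = "\<lambda>z. norm (v (fst z) (snd z)) ^ 4"
  have "set_integrable lborel ?S (\<lambda>(\<tau>, x). norm (v \<tau> x) ^ 4)"
    using sol T_pos by (simp add: nls_solution_def)
  then have i: "integrable (lborel \<Otimes>\<^sub>M lborel) (\<lambda>z. indicator ?S z *\<^sub>R ?g z)"
    by (simp add: set_integrable_def lborel_prod case_prod_unfold)
  note [measurable] = borel_measurable_integrable[OF i]
  have "(\<integral>\<^sup>+z. ennreal (?g z) \<partial>ST) = (\<integral>\<^sup>+t. \<integral>\<^sup>+x. ennreal (?g (t, x)) \<partial>tor \<partial>ivl T)"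
    by (rule tor.nn_integral_fst[symmetric]) measurable
  also have "\<dots> = (\<integral>\<^sup>+t. (\<integral>\<^sup>+x. ennreal (?g (t, x)) * indicator {0..2*pi} x \<partial>lborel) * indicator {0..T} t \<partial>lborel)"
    unfolding ivl_def tor_def by (simp add: nn_integral_restrict_space)
  also have "\<dots> = (\<integral>\<^sup>+t. \<integral>\<^sup>+x. ennreal (indicator ?S (t, x) *\<^sub>R ?g (t, x)) \<partial>lborel \<partial>lborel)"
    by (intro nn_integral_cong) (auto simp: indicator_def intro!: nn_integral_cong)
  also have "\<dots> = (\<integral>\<^sup>+z. ennreal (indicator ?S z *\<^sub>R ?g z) \<partial>(lborel \<Otimes>\<^sub>M lborel))"
    by (rule lborel.nn_integral_fst) measurable
  also have "\<dots> < \<infinity>"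
    using i by (simp add: integrable_iff_bounded)
  finally show ?thesis by (simp add: integrable_iff_bounded)
qed

lemma power_le_one_add_power4: "p \<le> 4 \<Longrightarrow> (x::real) \<ge> 0 \<Longrightarrow> x ^ p \<le> 1 + x ^ 4"
proof (cases "x \<le> 1")
  case True
  assume "p \<le> 4" "x \<ge> 0"
  then have "x ^ p \<le> 1" "0 \<le> x ^ 4" using True by (auto intro: power_le_one)
  then show ?thesis by linarith
next
  case False
  assume "p \<le> 4" "x \<ge> 0"
  then have "x ^ p \<le> x ^ 4" using False by (intro power_increasing) auto
  then show ?thesis by linarith
qed

lemma Vp_integrable: "p \<le> 4 \<Longrightarrow> integrable ST (\<lambda>z. norm (v (fst z) (snd z)) ^ p)"
  by (rule integrable_dominated[of _ "\<lambda>z. 1 + norm (v (fst z) (snd z)) ^ 4"])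
    (use V4_integrable in \<open>auto intro!: power_le_one_add_power4\<close>)

lemma cubic_V_integrable: "integrable ST (\<lambda>z. cubic (v (fst z) (snd z)))"
  by (rule integrable_dominated[OF Vp_integrable[of 3]]) (auto simp: norm_cubic)

lemma fv_integrable: "integrable (ivl T) fv"
  using pst.integrable_fst'[OF Vp_integrable[of 3]] unfolding fv_def by simp

lemma fv_integral: "(LINT t|ivl T. fv t) = 1 / (2 * pi) * (LINT z|ST. norm (v (fst z) (snd z)) ^ 3)"
  using pst.integral_fst'[OF Vp_integrable[of 3]] unfolding fv_def by simp

lemma Fv_integrable: "integrable (ivl T) (Fv n)"
proof -
  have [measurable]: "(\<lambda>x. cis (- (of_int n * x))) \<in> borel_measurable tor"
    by (rule measurable_tor_continuous) (intro continuous_intros)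
  have "integrable ST (\<lambda>z. cubic (v (fst z) (snd z)) * cis (- (of_int n * snd z)))"
    by (rule integrable_dominated[OF Vp_integrable[of 3]]) (auto simp: norm_cubic norm_mult)
  from pst.integrable_fst'[OF this]
  have i: "integrable (ivl T) (\<lambda>t. LINT x|tor. cubic (v t x) * cis (- (of_int n * x)))" by simp
  note [measurable] = borel_measurable_integrable[OF i]
  have [measurable]: "(\<lambda>t. cis (t * (of_int n)\<^sup>2)) \<in> borel_measurable (ivl T)"
    unfolding ivl_def by (intro measurable_restrict_space1) (simp add: borel_measurable_continuous_onI continuous_intros)
  have "integrable (ivl T) (\<lambda>t. 1 / (2*pi) * norm (LINT x|tor. cubic (v t x) * cis (- (of_int n * x))))"
    using i by (intro integrable_mult_right integrable_norm)
  then show ?thesis unfolding Fv_def fourier_coeff_eq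
    by (rule integrable_dominated) (auto simp: norm_mult norm_divide)
qed

text \<open>Valid at every \<open>t\<close>: where the cubic term is not integrable, the left side
  is 0 by the default value of the integral.\<close>

lemma Fv_le: "norm (Fv n t) \<le> fv t"
proof -
  have "norm (LINT x|tor. cubic (v t x) * cis (- (of_int n * x))) \<le> (LINT x|tor. norm (cubic (v t x) * cis (- (of_int n * x))))"
    by (rule integral_norm_bound)
  also have "\<dots> = (LINT x|tor. norm (v t x) ^ 3)" by (simp add: norm_mult norm_cubic)
  finally show ?thesis by (simp add: Fv_def fv_def fourier_coeff_eq norm_mult norm_divide divide_right_mono)
qed

text \<open>Undoing the linear phase removes \<open>t\<close> from the integrand of Duhamel's
  formula, so that a plain indefinite integral remains.\<close>

lemma coeff_eq:
  assumes "0 \<le> t"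
  shows "av n t = fourier_coeff u0 n - \<i> * complex_of_real lam * (LINT \<tau>|ivl t. Fv n \<tau>)"
proof -
  have "fourier_coeff (v t) n = cis (- (t * (of_int n)\<^sup>2)) * fourier_coeff u0 n
        - \<i> * complex_of_real lam * (LINT \<tau>:{0..t}|lborel. cis (- ((t - \<tau>) * (of_int n)\<^sup>2)) * fourier_coeff (\<lambda>x. cubic (v \<tau> x)) n)"
    using sol assms unfolding nls_solution_def cubic_def lam_def by blast
  also have "(LINT \<tau>:{0..t}|lborel. cis (- ((t - \<tau>) * (of_int n)\<^sup>2)) * fourier_coeff (\<lambda>x. cubic (v \<tau> x)) n) =
     (LINT \<tau>|ivl t. cis (- (t * (of_int n)\<^sup>2)) * Fv n \<tau>)"
    unfolding set_integral_ivl Fv_def mult.assoc[symmetric] cis_mult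
    by (intro Bochner_Integration.integral_cong refl) (simp add: algebra_simps)
  also have "\<dots> = cis (- (t * (of_int n)\<^sup>2)) * (LINT \<tau>|ivl t. Fv n \<tau>)" by (rule integral_mult_right_zero)
  finally have h: "fourier_coeff (v t) n = cis (- (t * (of_int n)\<^sup>2)) * (fourier_coeff u0 n - \<i> * complex_of_real lam * (LINT \<tau>|ivl t. Fv n \<tau>))"
    by (simp add: algebra_simps)
  show ?thesis unfolding av_def h mult.assoc[symmetric] cis_mult by simp
qed

lemma av_0: "av n 0 = fourier_coeff u0 n"
proof -
  have "(LINT \<tau>|ivl 0. Fv n \<tau>) = 0"
  proof -
    have "(LINT \<tau>|ivl 0. Fv n \<tau>) = (LINT \<tau>:{0}|lborel. Fv n \<tau>)" unfolding set_integral_ivl[symmetric] by simp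
    also have "\<dots> = 0" unfolding set_lebesgue_integral_def
      by (rule integral_eq_zero_AE, rule AE_mp[OF AE_lborel_singleton[of "0::real"]]) (auto simp: indicator_def)
    finally show ?thesis .
  qed
  then show ?thesis using coeff_eq[of 0 n] by simp
qed

lemma av_density: "has_density T (av n) (\<lambda>t. - (\<i> * complex_of_real lam) * Fv n t)"
  unfolding has_density_ivl
proof (intro conjI ballI)
  show "integrable (ivl T) (\<lambda>t. - (\<i> * complex_of_real lam) * Fv n t)" by (intro integrable_mult_right Fv_integrable)
  fix t assume "t \<in> {0..T}"
  then have "av n t = av n 0 - \<i> * complex_of_real lam * (LINT \<tau>|ivl t. Fv n \<tau>)" unfolding av_0 by (intro coeff_eq) auto
  also have "\<dots> = av n 0 + (LINT \<tau>|ivl t. - (\<i> * complex_of_real lam) * Fv n \<tau>)" by simp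
  finally show "av n t = av n 0 + (LINT \<tau>|ivl t. - (\<i> * complex_of_real lam) * Fv n \<tau>)" .
qed

lemma norm_av: "norm (av n t) = norm (fourier_coeff (v t) n)"
  by (simp add: av_def norm_mult)

text \<open>Continuity into L^2 on a compact interval. The bound depends on the solution in an
  uncontrolled way and serves only to get the analysis started.\<close>

lemma L2_bounded: "\<exists>E\<ge>0. \<forall>t\<in>{0..T}. L2_norm (v t) \<le> E"
proof -
  have lip: "\<bar>L2_norm (v r) - L2_norm (v t)\<bar> \<le> L2_norm (\<lambda>x. v r x - v t x)" if "0 \<le> r" "0 \<le> t" for r t
  proof -
    note r = v_sq[OF that(1)] and t = v_sq[OF that(2)]
    have "L2_norm (v r) \<le> L2_norm (v t) + L2_norm (\<lambda>x. v r x - v t x)"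
      using L2_norm_triangle[OF t square_integrable_diff[OF r t]] by simp
    moreover have "L2_norm (v t) \<le> L2_norm (v r) + L2_norm (\<lambda>x. v t x - v r x)"
      using L2_norm_triangle[OF r square_integrable_diff[OF t r]] by simp
    moreover have "L2_norm (\<lambda>x. v t x - v r x) = L2_norm (\<lambda>x. v r x - v t x)"
      by (simp add: L2_norm_def norm_minus_commute)
    ultimately show ?thesis by linarith
  qed
  have "continuous_on {0..T} (\<lambda>t. L2_norm (v t))"
    unfolding continuous_on_def
  proof
    fix t assume t: "t \<in> {0..T}"
    have "((\<lambda>r. L2_norm (\<lambda>x. v r x - v t x)) \<longlongrightarrow> 0) (at t within {0..})" using sol t by (auto simp: nls_solution_def)
    then have *: "((\<lambda>r. L2_norm (\<lambda>x. v r x - v t x)) \<longlongrightarrow> 0) (at t within {0..T})" by (rule tendsto_within_subset) auto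
    have "((\<lambda>r. L2_norm (v r) - L2_norm (v t)) \<longlongrightarrow> 0) (at t within {0..T})"
      by (rule Lim_null_comparison[OF _ *]) (use t lip in \<open>auto simp: eventually_at_filter\<close>)
    then show "((\<lambda>t. L2_norm (v t)) \<longlongrightarrow> L2_norm (v t)) (at t within {0..T})" by (simp add: LIM_zero_iff)
  qed
  then have "bounded ((\<lambda>t. L2_norm (v t)) ` {0..T})" by (intro compact_imp_bounded compact_continuous_image compact_Icc)
  then obtain E where E: "\<And>t. t \<in> {0..T} \<Longrightarrow> norm (L2_norm (v t)) \<le> E" unfolding bounded_iff by blast
  have L0: "0 \<le> L2_norm w" for w by (simp add: L2_norm_eq)
  have le: "L2_norm (v t) \<le> E" if "t \<in> {0..T}" for t using E[OF that] by simp
  have "0 \<le> E" using order_trans[OF L0 le[of 0]] T_pos by simp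
  then show ?thesis using le by blast
qed

lemma sq_bounded_av:
  assumes "0 \<le> t" "L2_norm (v t) \<le> sqrt (2 * pi) * E" "0 \<le> E"
  shows "sq_bounded (\<lambda>n. norm (av n t)) E"
  unfolding sq_bounded_def norm_av
proof (intro conjI allI impI)
  fix S :: "int set" assume S: "finite S"
  have "2 * pi * (\<Sum>n\<in>S. (norm (fourier_coeff (v t) n))\<^sup>2) \<le> (L2_norm (v t))\<^sup>2"
    using bessel[OF v_sq[OF assms(1)] S] by (simp add: L2_norm_eq)
  also have "\<dots> \<le> (sqrt (2 * pi) * E)\<^sup>2" using assms by (intro power_mono) (auto simp: L2_norm_eq)
  also have "\<dots> = 2 * pi * E\<^sup>2" by (simp add: power_mult_distrib)
  finally show "(\<Sum>n\<in>S. (norm (fourier_coeff (v t) n))\<^sup>2) \<le> E\<^sup>2" by simp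
qed simp

end

section \<open>The space-time bound\<close>

text \<open>The factor \<open>sqrt (2 * pi)\<close> makes \<open>E\<close> a bound for the l^2 norm
  of the coefficients. The locale is entered twice: with an arbitrary bound, to prove conservation
  of mass, and again with the \<open>E\<close> that conservation then provides in terms of the
  data.\<close>

locale nls_sol_bound = nls_sol +
  fixes E :: real
  assumes E0: "0 \<le> E" and L2_le: "\<And>t. t \<in> {0..T} \<Longrightarrow> L2_norm (v t) \<le> sqrt (2 * pi) * E"
begin

lemma lam0: "0 \<le> lam" by (simp add: lam_def)

lemma sq_av: "t \<in> {0..T} \<Longrightarrow> sq_bounded (\<lambda>n. norm (av n t)) E"
  by (rule sq_bounded_av) (auto simp: L2_le E0)

sublocale md: modes lam T E av Fv fv
proof (rule modes.intro)
  show "has_density T (av n) (\<lambda>t. - (\<i> * complex_of_real lam) * Fv n t)" for n by (rule av_density)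
  show "norm (Fv n t) \<le> fv t" for n t by (rule Fv_le)
  show "integrable (ivl T) (Fv n)" for n by (rule Fv_integrable)
  show "integrable (ivl T) fv" by (rule fv_integrable)
  show "sq_bounded (\<lambda>n. norm (av n t)) E" if "t \<in> {0..T}" for t by (rule sq_av[OF that])
  show "0 \<le> lam" "0 \<le> T" "0 \<le> E" by (rule lam0, rule less_imp_le[OF T_pos], rule E0)
qed

text \<open>Truncation acts on the modes and on \<open>Fv\<close>, where \<open>Fv\<close> still
  comes from the full nonlinearity and not from that of the truncated function. The retained modes
  are those of the true solution, so no approximate equation enters and the bounds do not depend on
  \<open>M\<close>.\<close>

lemma modes_trunc: "modes lam T E (\<lambda>m t. trunc M (\<lambda>m. av m t) m) (\<lambda>m t. trunc M (\<lambda>m. Fv m t) m) fv"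
proof (rule modes.intro)
  show "has_density T (\<lambda>t. trunc M (\<lambda>m. av m t) n) (\<lambda>t. - (\<i> * complex_of_real lam) * trunc M (\<lambda>m. Fv m t) n)" for n
  proof (cases "n \<in> {-int M..int M}")
    case True
    then show ?thesis using av_density[of n] by (simp add: trunc_def)
  next
    case False
    have "has_density T (\<lambda>t. 0) (\<lambda>t. 0)" by (simp add: has_density_def set_integrable_def set_lebesgue_integral_def)
    moreover have "trunc M c n = 0" for c :: "int \<Rightarrow> complex" using False by (auto simp: trunc_def)
    ultimately show ?thesis by simp
  qed
  show "norm (trunc M (\<lambda>m. Fv m t) n) \<le> fv t" if "t \<in> {0..T}" for n t
    using Fv_le[of n t] md.f_nonneg[OF that] by (auto simp: trunc_def)
  show "integrable (ivl T) (\<lambda>t. trunc M (\<lambda>m. Fv m t) n)" for n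
    using Fv_integrable[of n] by (cases "n \<in> {-int M..int M}") (auto simp: trunc_def)
  show "sq_bounded (\<lambda>n. norm (trunc M (\<lambda>m. av m t) n)) E" if t: "t \<in> {0..T}" for t
    unfolding sq_bounded_def
  proof (intro conjI allI impI)
    fix S :: "int set" assume "finite S"
    have "(\<Sum>m\<in>S. (norm (trunc M (\<lambda>m. av m t) m))\<^sup>2) \<le> (\<Sum>m\<in>S. (norm (av m t))\<^sup>2)"
      by (intro sum_mono) (auto simp: trunc_def)
    also have "\<dots> \<le> E\<^sup>2" by (rule sq_boundedD(2)[OF sq_av[OF t] \<open>finite S\<close>])
    finally show "(\<Sum>m\<in>S. (norm (trunc M (\<lambda>m. av m t) m))\<^sup>2) \<le> E\<^sup>2" .
  qed simp
  show "0 \<le> lam" "0 \<le> T" "0 \<le> E" by (rule lam0, rule less_imp_le[OF T_pos], rule E0)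
qed (rule fv_integrable)

lemma coeff_av: "fourier_coeff (v t) m = cis (- (t * (of_int m)\<^sup>2)) * av m t"
  unfolding av_def mult.assoc[symmetric] cis_mult by simp

lemma Pv_eq: "Pv M t = psum (\<lambda>m. cis (- (t * (of_int m)\<^sup>2)) * av m t) M"
  unfolding Pv_def coeff_av ..

lemma coeff_continuous: "continuous_on {0..T} (\<lambda>t. fourier_coeff (v t) n)"
  unfolding coeff_av by (intro continuous_intros md.a_continuous)

lemma coeff_measurable [measurable]: "(\<lambda>t. fourier_coeff (v t) n) \<in> borel_measurable (ivl T)"
  using borel_measurable_integrable[OF integrable_ivl_continuous[OF coeff_continuous]] .

lemma Pv_measurable [measurable]: "(\<lambda>z. Pv M (fst z) (snd z)) \<in> borel_measurable ST"
proof -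
  have [measurable]: "(\<lambda>z. cis (of_int n * snd z)) \<in> borel_measurable ST" for n
    by (rule measurable_compose[OF measurable_snd]) (rule measurable_cis_tor)
  have [measurable]: "(\<lambda>z. fourier_coeff (v (fst z)) n) \<in> borel_measurable ST" for n
    by (rule measurable_compose[OF measurable_fst coeff_measurable])
  show ?thesis unfolding Pv_def psum_def by measurable
qed

lemma Pv_bound: "t \<in> {0..T} \<Longrightarrow> norm (Pv M t x) \<le> (2 * real M + 1) * E"
proof -
  assume t: "t \<in> {0..T}"
  have "norm (Pv M t x) \<le> (\<Sum>n\<in>{-int M..int M}. norm (fourier_coeff (v t) n))" unfolding Pv_def by (rule psum_bound)
  also have "\<dots> \<le> (\<Sum>n\<in>{-int M..int M}. E)"
    by (intro sum_mono) (use sq_bounded_le[OF sq_av[OF t] E0] in \<open>simp add: norm_av\<close>)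
  finally show ?thesis by (simp add: algebra_simps)
qed

lemma Pv_pow_integrable: "integrable ST (\<lambda>z. norm (Pv M (fst z) (snd z)) ^ p)"
proof (rule ST.integrable_const_bound[of _ "((2 * real M + 1) * E) ^ p"])
  show "AE z in ST. norm (norm (Pv M (fst z) (snd z)) ^ p) \<le> ((2 * real M + 1) * E) ^ p"
    by (rule AE_I2) (auto simp: space_ST intro!: power_mono Pv_bound)
qed measurable

definition "\<Phi> = (LINT t|ivl T. fv t)"
definition "K4 = quad_const * E ^ 3"
text \<open>A majorant for the space-time integral of the fourth power: nonresonant part plus
  resonant part. It contains \<open>\<Phi>\<close>, which is in turn controlled through the fourth
  power; the circle is closed in \<open>Phi_Yb_le\<close>.\<close>

definition "Yb = 2 * pi * (K4 * (E + 2 * lam * \<Phi>) + 2 * E ^ 4 * T)"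

lemma Phi0: "0 \<le> \<Phi>"
  unfolding \<Phi>_def by (intro integral_nonneg_AE AE_I2) (auto intro: md.f_nonneg)

lemma Pv4_le: "(LINT z|ST. norm (Pv M (fst z) (snd z)) ^ 4) \<le> Yb"
proof -
  let ?R = "{-int M..int M}"
  interpret tr: modes lam T E "\<lambda>m t. trunc M (\<lambda>m. av m t) m" "\<lambda>m t. trunc M (\<lambda>m. Fv m t) m" fv by (rule modes_trunc)
  define Z where "Z = (\<lambda>t. \<Sum>n\<in>?R. nonres M (\<lambda>m. av m t) n t * cnj (av n t))"
  define G where "G = (\<lambda>t. \<Sum>n\<in>?R. (2 * (\<Sum>m\<in>?R. (norm (av m t))\<^sup>2) - (norm (av n t))\<^sup>2) * (norm (av n t))\<^sup>2)"
  have y: "(LINT x|tor. norm (Pv M t x) ^ 4) = 2 * pi * Re (Z t) + 2 * pi * G t" for t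
  proof -
    have "complex_of_real (LINT x|tor. norm (Pv M t x) ^ 4) = 2 * pi * Z t + complex_of_real (2 * pi * G t)"
      unfolding Pv_eq Z_def G_def by (rule integral_psum_power4)
    from arg_cong[OF this, of Re] show ?thesis by simp
  qed
  have Zc: "continuous_on {0..T} Z" unfolding Z_def nonres_def
    by (intro continuous_intros tr.a_continuous md.a_continuous)
  have Gc: "continuous_on {0..T} G" unfolding G_def by (intro continuous_intros md.a_continuous)
  have iZ: "integrable (ivl T) Z" and iG: "integrable (ivl T) G" by (intro integrable_ivl_continuous Zc Gc)+
  have "(LINT z|ST. norm (Pv M (fst z) (snd z)) ^ 4) = (LINT t|ivl T. LINT x|tor. norm (Pv M t x) ^ 4)"
    using pst.integral_fst'[OF Pv_pow_integrable[of M 4]] by simp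
  also have "\<dots> = 2 * pi * Re (LINT t|ivl T. Z t) + 2 * pi * (LINT t|ivl T. G t)"
    unfolding y using iZ iG by simp
  also have "\<dots> \<le> 2 * pi * (K4 * (E + 2 * lam * \<Phi>)) + 2 * pi * (2 * E ^ 4 * T)"
  proof (intro add_mono mult_left_mono)
    have "Z t = (\<Sum>n\<in>?R. \<Sum>j\<in>offsets M. \<Sum>k\<in>offsets M. cis (2 * of_int j * of_int k * t) *
      (trunc M (\<lambda>m. av m t) (n + j) * cnj (trunc M (\<lambda>m. av m t) (n + j + k)) * trunc M (\<lambda>m. av m t) (n + k) * cnj (trunc M (\<lambda>m. av m t) n)))" for t
      unfolding Z_def nonres_def sum_distrib_right by (intro sum.cong refl) (simp add: trunc_def)
    then have "(LINT t|ivl T. Z t) = (LINT t|ivl T. (\<Sum>n\<in>?R. \<Sum>j\<in>offsets M. \<Sum>k\<in>offsets M. cis (2 * of_int j * of_int k * t) *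
      (trunc M (\<lambda>m. av m t) (n + j) * cnj (trunc M (\<lambda>m. av m t) (n + j + k)) * trunc M (\<lambda>m. av m t) (n + k) * cnj (trunc M (\<lambda>m. av m t) n))))"
      by (simp only:)
    also have "norm \<dots> \<le> K4 * (E + 2 * lam * (LINT \<tau>|ivl T. fv \<tau>))"
    proof (rule tr.quartic_oscillation_bound)
      fix b assume b: "sq_bounded b E"
      show "(\<Sum>n\<in>?R. \<Sum>j\<in>offsets M. \<Sum>k\<in>offsets M. b (n + j) * b (n + j + k) * b (n + k) / (\<bar>real_of_int j\<bar> * \<bar>real_of_int k\<bar>)) \<le> K4 \<and>
       (\<Sum>n\<in>?R. \<Sum>j\<in>offsets M. \<Sum>k\<in>offsets M. b n * b (n + j + k) * b (n + k) / (\<bar>real_of_int j\<bar> * \<bar>real_of_int k\<bar>)) \<le> K4 \<and>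
       (\<Sum>n\<in>?R. \<Sum>j\<in>offsets M. \<Sum>k\<in>offsets M. b n * b (n + j) * b (n + k) / (\<bar>real_of_int j\<bar> * \<bar>real_of_int k\<bar>)) \<le> K4 \<and>
       (\<Sum>n\<in>?R. \<Sum>j\<in>offsets M. \<Sum>k\<in>offsets M. b n * b (n + j) * b (n + j + k) / (\<bar>real_of_int j\<bar> * \<bar>real_of_int k\<bar>)) \<le> K4"
        unfolding K4_def by (rule conjunct2[OF quad_const, rule_format]) (use E0 b offsets[of M] in simp)
    qed (use offsets[of M] T_pos in auto)
    finally have "norm (LINT t|ivl T. Z t) \<le> K4 * (E + 2 * lam * (LINT \<tau>|ivl T. fv \<tau>))" .
    then show "Re (LINT t|ivl T. Z t) \<le> K4 * (E + 2 * lam * \<Phi>)"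
      using complex_Re_le_cmod[of "LINT t|ivl T. Z t"] by (simp add: \<Phi>_def)
    have "(LINT t|ivl T. G t) \<le> (LINT t|ivl T. 2 * E ^ 4)"
    proof (rule integral_mono[OF iG])
      fix t assume "t \<in> space (ivl T)"
      then have t: "t \<in> {0..T}" by simp
      define S where "S = (\<Sum>m\<in>?R. (norm (av m t))\<^sup>2)"
      have S: "0 \<le> S" "S \<le> E\<^sup>2" unfolding S_def using sq_boundedD(2)[OF sq_av[OF t], of ?R] by (auto intro: sum_nonneg)
      have "G t \<le> (\<Sum>n\<in>?R. 2 * S * (norm (av n t))\<^sup>2)"
        unfolding G_def S_def[symmetric] by (intro sum_mono mult_right_mono) auto
      also have "\<dots> = 2 * S * S" by (simp add: S_def sum_distrib_left)
      also have "\<dots> \<le> 2 * E\<^sup>2 * E\<^sup>2" using S by (intro mult_mono) auto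
      also have "\<dots> = 2 * E ^ 4" by (simp add: power_numeral_reduce)
      finally show "G t \<le> 2 * E ^ 4" .
    qed simp
    also have "\<dots> = 2 * E ^ 4 * T" using measure_ivl[of T] T_pos by simp
    finally show "(LINT t|ivl T. G t) \<le> 2 * E ^ 4 * T" .
  qed auto
  finally show ?thesis by (simp add: Yb_def algebra_simps)
qed

section \<open>Removing the truncation in the fourth-power bound\<close>

definition "Rv M z = norm (v (fst z) (snd z) - Pv M (fst z) (snd z))"

lemma Rv_measurable [measurable]: "Rv M \<in> borel_measurable ST"
  unfolding Rv_def by measurable

lemma Rv_nonneg: "0 \<le> Rv M z" by (simp add: Rv_def)

lemma power4_add_le: "0 \<le> x \<Longrightarrow> 0 \<le> y \<Longrightarrow> (x + y) ^ 4 \<le> 8 * (x ^ 4 + (y :: real) ^ 4)"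
proof -
  have sq: "(a + b)\<^sup>2 \<le> 2 * (a\<^sup>2 + b\<^sup>2)" for a b :: real
    using zero_le_power2[of "a - b"] by (simp add: power2_eq_square algebra_simps)
  have "(x + y) ^ 4 = ((x + y)\<^sup>2)\<^sup>2" by simp
  also have "\<dots> \<le> (2 * (x\<^sup>2 + y\<^sup>2))\<^sup>2" by (intro power_mono sq) auto
  also have "\<dots> = 4 * (x\<^sup>2 + y\<^sup>2)\<^sup>2" by (simp only: power_mult_distrib) simp
  also have "\<dots> \<le> 4 * (2 * ((x\<^sup>2)\<^sup>2 + (y\<^sup>2)\<^sup>2))" by (intro mult_left_mono sq) auto
  finally show ?thesis by simp
qed

lemma Rv4_le: "Rv M z ^ 4 \<le> 8 * (norm (v (fst z) (snd z)) ^ 4 + norm (Pv M (fst z) (snd z)) ^ 4)"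
  unfolding Rv_def by (rule order_trans[OF power_mono[OF norm_triangle_ineq4] power4_add_le]) auto

lemma Rv4_integrable: "integrable ST (\<lambda>z. Rv M z ^ 4)"
  by (rule integrable_dominated[of _ "\<lambda>z. 8 * (norm (v (fst z) (snd z)) ^ 4 + norm (Pv M (fst z) (snd z)) ^ 4)"])
    (use Rv4_le V4_integrable Pv_pow_integrable Rv_nonneg in \<open>auto simp: abs_of_nonneg\<close>)

lemma Rv2_integrable: "integrable ST (\<lambda>z. (Rv M z)\<^sup>2)"
  by (rule integrable_dominated[of _ "\<lambda>z. 1 + Rv M z ^ 4"])
    (use Rv4_integrable Rv_nonneg power_le_one_add_power4[of 2] in auto)

lemma Rv2_fubini: "(LINT z|ST. (Rv M z)\<^sup>2) = (LINT t|ivl T. (LINT x|tor. (norm (v t x - psum (fourier_coeff (v t)) M x))\<^sup>2))"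
  using pst.integral_fst'[OF Rv2_integrable[of M]] by (simp add: Rv_def Pv_def)

lemma Rv2_inner_measurable: "(\<lambda>t. LINT x|tor. (norm (v t x - psum (fourier_coeff (v t)) M x))\<^sup>2) \<in> borel_measurable (ivl T)"
  using borel_measurable_integrable[OF pst.integrable_fst'[OF Rv2_integrable[of M]]] by (simp add: Rv_def Pv_def)

lemma inner_L2_le:
  assumes t: "t \<in> {0..T}"
  shows "(LINT x|tor. (norm (v t x))\<^sup>2) \<le> 2 * pi * E\<^sup>2"
proof -
  have "(LINT x|tor. (norm (v t x))\<^sup>2) = (L2_norm (v t))\<^sup>2" by (simp add: L2_norm_eq)
  also have "\<dots> \<le> (sqrt (2 * pi) * E)\<^sup>2" by (intro power_mono L2_le t) (simp add: L2_norm_eq)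
  finally show ?thesis by (simp add: power_mult_distrib)
qed

lemma Rv2_tendsto: "(\<lambda>M. LINT z|ST. (Rv M z)\<^sup>2) \<longlonglongrightarrow> 0"
proof -
  have "(\<lambda>M. LINT t|ivl T. (LINT x|tor. (norm (v t x - psum (fourier_coeff (v t)) M x))\<^sup>2)) \<longlonglongrightarrow> (LINT t|ivl T. 0)"
  proof (rule integral_dominated_convergence[where w = "\<lambda>t. 2 * pi * E\<^sup>2"])
    show "AE t in ivl T. (\<lambda>M. LINT x|tor. (norm (v t x - psum (fourier_coeff (v t)) M x))\<^sup>2) \<longlonglongrightarrow> 0"
      using fourier_series_L2[OF v_sq] by (intro AE_I2) (auto simp: norm_minus_commute)
    show "AE t in ivl T. norm (LINT x|tor. (norm (v t x - psum (fourier_coeff (v t)) M x))\<^sup>2) \<le> 2 * pi * E\<^sup>2" for M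
    proof (rule AE_I2)
      fix t assume "t \<in> space (ivl T)"
      then have t: "t \<in> {0..T}" by simp
      have "(LINT x|tor. (norm (v t x - psum (fourier_coeff (v t)) M x))\<^sup>2) \<le> (LINT x|tor. (norm (v t x))\<^sup>2)"
        using parseval_tail[OF v_sq, of t M] t by (simp add: sum_nonneg)
      also have "\<dots> \<le> 2 * pi * E\<^sup>2" by (rule inner_L2_le[OF t])
      finally show "norm (LINT x|tor. (norm (v t x - psum (fourier_coeff (v t)) M x))\<^sup>2) \<le> 2 * pi * E\<^sup>2" by simp
    qed
  qed (use Rv2_inner_measurable in auto)
  then show ?thesis unfolding Rv2_fubini by simp
qed

text \<open>At this point \<open>Y\<close> is only known to be finite, not to be bounded in terms of \<open>E\<close>.\<close>

definition "Y = (LINT z|ST. norm (v (fst z) (snd z)) ^ 4)"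

lemma Rv4_integral_le: "(LINT z|ST. Rv M z ^ 4) \<le> 8 * (Y + Yb)"
proof -
  have "(LINT z|ST. Rv M z ^ 4) \<le> (LINT z|ST. 8 * (norm (v (fst z) (snd z)) ^ 4 + norm (Pv M (fst z) (snd z)) ^ 4))"
    by (intro integral_mono Rv4_integrable Rv4_le) (use V4_integrable Pv_pow_integrable in auto)
  also have "\<dots> = 8 * (Y + (LINT z|ST. norm (Pv M (fst z) (snd z)) ^ 4))"
    using V4_integrable Pv_pow_integrable by (simp add: Y_def)
  also have "\<dots> \<le> 8 * (Y + Yb)" using Pv4_le by simp
  finally show ?thesis .
qed

lemma cube_Rv_integrable: "integrable ST (\<lambda>z. norm (v (fst z) (snd z)) ^ 3 * Rv M z)"
    and cube_Rv_tendsto: "(\<lambda>M. LINT z|ST. norm (v (fst z) (snd z)) ^ 3 * Rv M z) \<longlonglongrightarrow> 0"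
  using ST.integral_cube_mult_tendsto_0[of "\<lambda>z. norm (v (fst z) (snd z))" Rv "8 * (Y + Yb)"]
    V4_integrable Rv4_integrable Rv4_integral_le Rv2_integrable Rv2_tendsto Rv_nonneg by auto

text \<open>Convexity takes the place of convergence of the partial sums in L^4: the tangent
  inequality for the fourth power at \<open>|v|\<close> bounds \<open>Y\<close> by the integral for
  \<open>Pv\<close> up to a term linear in the remainder. That term is the remainder tested against
  the cube of \<open>|v|\<close>, which vanishes in the limit.\<close>

lemma Y_le_Yb: "Y \<le> Yb"
proof -
  have le: "Y - 4 * (LINT z|ST. norm (v (fst z) (snd z)) ^ 3 * Rv M z) \<le> Yb" for M
  proof -
    have pw: "x ^ 4 - 4 * (x ^ 3 * r) \<le> y ^ 4" if "0 \<le> x" "0 \<le> y" "x - r \<le> y" "0 \<le> r" for x y r :: real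
    proof -
      have "x ^ 4 + 4 * x ^ 3 * (y - x) \<le> y ^ 4"
      proof -
        have "y ^ 4 - (x ^ 4 + 4 * x ^ 3 * (y - x)) = (y - x)\<^sup>2 * ((y + x)\<^sup>2 + 2 * x\<^sup>2)"
          by (simp add: power_numeral_reduce algebra_simps)
        moreover have "0 \<le> (y - x)\<^sup>2 * ((y + x)\<^sup>2 + 2 * x\<^sup>2)" by (intro mult_nonneg_nonneg add_nonneg_nonneg) auto
        ultimately show ?thesis by linarith
      qed
      moreover have "4 * x ^ 3 * (- r) \<le> 4 * x ^ 3 * (y - x)" using that by (intro mult_left_mono) auto
      moreover have "4 * x ^ 3 * (- r) = - (4 * (x ^ 3 * r))" by simp
      ultimately show ?thesis by linarith
    qed
    have i: "integrable ST (\<lambda>z. norm (v (fst z) (snd z)) ^ 4 - 4 * (norm (v (fst z) (snd z)) ^ 3 * Rv M z))"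
      by (rule Bochner_Integration.integrable_diff[OF V4_integrable integrable_mult_right[OF cube_Rv_integrable]])
    have "Y - 4 * (LINT z|ST. norm (v (fst z) (snd z)) ^ 3 * Rv M z) = (LINT z|ST. norm (v (fst z) (snd z)) ^ 4 - 4 * (norm (v (fst z) (snd z)) ^ 3 * Rv M z))"
      unfolding Y_def Bochner_Integration.integral_diff[OF V4_integrable integrable_mult_right[OF cube_Rv_integrable]]
        integral_mult_right_zero ..
    also have "\<dots> \<le> (LINT z|ST. norm (Pv M (fst z) (snd z)) ^ 4)"
    proof (rule integral_mono[OF i Pv_pow_integrable])
      fix z
      have "norm (v (fst z) (snd z)) - Rv M z \<le> norm (Pv M (fst z) (snd z))"
        unfolding Rv_def using norm_triangle_ineq2[of "v (fst z) (snd z)" "Pv M (fst z) (snd z)"] by linarith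
      then show "norm (v (fst z) (snd z)) ^ 4 - 4 * (norm (v (fst z) (snd z)) ^ 3 * Rv M z) \<le> norm (Pv M (fst z) (snd z)) ^ 4"
        by (intro pw Rv_nonneg) auto
    qed
    also have "\<dots> \<le> Yb" by (rule Pv4_le)
    finally show ?thesis .
  qed
  have "(\<lambda>M. Y - 4 * (LINT z|ST. norm (v (fst z) (snd z)) ^ 3 * Rv M z)) \<longlonglongrightarrow> Y - 4 * 0"
    by (intro tendsto_intros cube_Rv_tendsto)
  then have "Y - 4 * 0 \<le> Yb" by (rule LIMSEQ_le_const2) (use le in auto)
  then show ?thesis by simp
qed

text \<open>The cube is at most the sum of the square and the fourth power; the square is controlled
  at every time by the L^2 bound, which produces the term linear in \<open>T\<close>.\<close>

lemma Phi_le: "\<Phi> \<le> Y + E\<^sup>2 * T"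
proof -
  have i2: "integrable ST (\<lambda>z. (norm (v (fst z) (snd z)))\<^sup>2)" by (rule Vp_integrable) simp
  have Z: "(LINT z|ST. (norm (v (fst z) (snd z)))\<^sup>2) \<le> 2 * pi * E\<^sup>2 * T"
  proof -
    have "(LINT z|ST. (norm (v (fst z) (snd z)))\<^sup>2) = (LINT t|ivl T. (LINT x|tor. (norm (v t x))\<^sup>2))"
      using pst.integral_fst'[OF i2] by simp
    also have "\<dots> \<le> (LINT t|ivl T. 2 * pi * E\<^sup>2)"
      by (rule integral_mono) (use pst.integrable_fst'[OF i2] inner_L2_le in auto)
    also have "\<dots> = 2 * pi * E\<^sup>2 * T" using measure_ivl[of T] T_pos by simp
    finally show ?thesis .
  qed
  have "(LINT z|ST. norm (v (fst z) (snd z)) ^ 3) \<le> (LINT z|ST. norm (v (fst z) (snd z)) ^ 4 + (norm (v (fst z) (snd z)))\<^sup>2)"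
  proof (rule integral_mono)
    fix z
    have c: "x ^ 3 \<le> x ^ 4 + x\<^sup>2" if "0 \<le> x" for x :: real
    proof -
      have "0 \<le> x\<^sup>2 * ((x - 1/2)\<^sup>2 + 3/4)" by (intro mult_nonneg_nonneg add_nonneg_nonneg) auto
      then show ?thesis by (simp add: power_numeral_reduce algebra_simps)
    qed
    show "norm (v (fst z) (snd z)) ^ 3 \<le> norm (v (fst z) (snd z)) ^ 4 + (norm (v (fst z) (snd z)))\<^sup>2" by (rule c) simp
  qed (use Vp_integrable[of 3] V4_integrable i2 in auto)
  also have "\<dots> = Y + (LINT z|ST. (norm (v (fst z) (snd z)))\<^sup>2)" using V4_integrable i2 by (simp add: Y_def)
  also have "\<dots> \<le> Y + 2 * pi * E\<^sup>2 * T" using Z by simp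
  finally have "2 * pi * \<Phi> \<le> Y + 2 * pi * (E\<^sup>2 * T)" unfolding \<Phi>_def fv_integral by simp
  moreover have "Y \<le> 2 * pi * Y"
  proof -
    have "0 \<le> Y" unfolding Y_def by simp
    then have "1 * Y \<le> 2 * pi * Y" using pi_gt3 by (intro mult_right_mono) auto
    then show ?thesis by simp
  qed
  ultimately have "2 * pi * \<Phi> \<le> 2 * pi * (Y + E\<^sup>2 * T)" by (simp add: distrib_left)
  then show ?thesis by simp
qed

end

section \<open>Conservation of mass and the normal form of a solution\<close>

context nls_sol_bound
begin

lemma mass_identity:
  assumes t: "t \<in> {0..T}"
  shows "(norm (av n t))\<^sup>2 = (norm (av n 0))\<^sup>2 + (LINT \<tau>|ivl t. 2 * lam * Im (Fv n \<tau> * cnj (av n \<tau>)))"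
proof -
  have "has_density T (\<lambda>t. av n t * cnj (av n t)) (\<lambda>t. - (\<i> * complex_of_real lam) * Fv n t * cnj (av n t) + av n t * cnj (- (\<i> * complex_of_real lam) * Fv n t))"
    by (intro has_density_mult has_density_cnj av_density)
  then have "av n t * cnj (av n t) = av n 0 * cnj (av n 0) + (LINT \<tau>|ivl t. - (\<i> * complex_of_real lam) * Fv n \<tau> * cnj (av n \<tau>) + av n \<tau> * cnj (- (\<i> * complex_of_real lam) * Fv n \<tau>))"
    using t unfolding has_density_ivl by blast
  also have "(\<lambda>\<tau>. - (\<i> * complex_of_real lam) * Fv n \<tau> * cnj (av n \<tau>) + av n \<tau> * cnj (- (\<i> * complex_of_real lam) * Fv n \<tau>))
     = (\<lambda>\<tau>. complex_of_real (2 * lam * Im (Fv n \<tau> * cnj (av n \<tau>))))"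
    by (rule ext) (simp add: complex_eq_iff algebra_simps)
  finally have "complex_of_real ((norm (av n t))\<^sup>2) = complex_of_real ((norm (av n 0))\<^sup>2 + (LINT \<tau>|ivl t. 2 * lam * Im (Fv n \<tau> * cnj (av n \<tau>))))"
    unfolding complex_norm_square of_real_add integral_complex_of_real .
  then show ?thesis by (simp only: of_real_eq_iff)
qed

lemma Fv_cnj_integrable: "integrable (ivl T) (\<lambda>\<tau>. Fv n \<tau> * cnj (av n \<tau>))"
  using set_integrable_mult_continuous[of T "Fv n" "\<lambda>\<tau>. cnj (av n \<tau>)"] Fv_integrable[of n] md.a_continuous[of n]
  by (simp add: set_integrable_ivl continuous_intros)

text \<open>The cubic term paired with \<open>v\<close> itself is real, so up to sign the imaginary
  part is unchanged when \<open>Pv\<close> is replaced by \<open>v - Pv\<close>: the flux out of the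
  low frequencies is carried by the remainder alone.\<close>

lemma mass_flux_le:
  "AE \<tau> in ivl T. \<bar>Im (\<Sum>n\<in>{-int M..int M}. Fv n \<tau> * cnj (av n \<tau>))\<bar> \<le> (LINT x|tor. norm (v \<tau> x) ^ 3 * Rv M (\<tau>, x))"
  using AE_space pst.AE_integrable_fst'[OF cube_Rv_integrable[of M]] pst.AE_integrable_fst'[OF cubic_V_integrable]
proof eventually_elim
  case (elim \<tau>)
  then have \<tau>: "\<tau> \<in> {0..T}" and i1: "integrable tor (\<lambda>x. norm (v \<tau> x) ^ 3 * Rv M (\<tau>, x))" and i2: "integrable tor (\<lambda>x. cubic (v \<tau> x))" by auto
  have "(\<Sum>n\<in>{-int M..int M}. Fv n \<tau> * cnj (av n \<tau>)) = (\<Sum>n\<in>{-int M..int M}. fourier_coeff (\<lambda>x. cubic (v \<tau> x)) n * cnj (fourier_coeff (v \<tau>) n))"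
    unfolding Fv_def av_def by (intro sum.cong refl) (simp add: cis_cnj cis_mult)
  also have "\<dots> = (LINT x|tor. cubic (v \<tau> x) * cnj (Pv M \<tau> x)) / (2 * pi)"
    unfolding Pv_def integral_mult_cnj_psum[OF i2] by simp
  finally have e: "(\<Sum>n\<in>{-int M..int M}. Fv n \<tau> * cnj (av n \<tau>)) = (LINT x|tor. cubic (v \<tau> x) * cnj (Pv M \<tau> x)) / (2 * pi)" .
  have i3: "integrable tor (\<lambda>x. cubic (v \<tau> x) * cnj (Pv M \<tau> x))"
  proof (rule integrable_dominated[of _ "\<lambda>x. norm (cubic (v \<tau> x)) * ((2 * real M + 1) * E)"])
    show "(\<lambda>x. cubic (v \<tau> x) * cnj (Pv M \<tau> x)) \<in> borel_measurable tor"
      unfolding Pv_def by (intro borel_measurable_times borel_measurable_integrable[OF i2] square_integrable_measurable[OF square_integrable_cnj[OF square_integrable_psum]])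
  qed (use i2 Pv_bound[OF \<tau>] in \<open>auto simp: norm_mult intro!: mult_left_mono\<close>)
  have "\<bar>Im (LINT x|tor. cubic (v \<tau> x) * cnj (Pv M \<tau> x))\<bar> = \<bar>LINT x|tor. Im (cubic (v \<tau> x) * cnj (Pv M \<tau> x))\<bar>"
    using integral_Im[OF i3] by simp
  also have "\<dots> \<le> (LINT x|tor. \<bar>Im (cubic (v \<tau> x) * cnj (Pv M \<tau> x))\<bar>)" by (rule integral_abs_bound)
  also have "\<dots> \<le> (LINT x|tor. norm (v \<tau> x) ^ 3 * Rv M (\<tau>, x))"
  proof (rule integral_mono[OF _ i1])
    show "integrable tor (\<lambda>x. \<bar>Im (cubic (v \<tau> x) * cnj (Pv M \<tau> x))\<bar>)" by (intro integrable_abs integrable_Im i3)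
    fix x
    have "Im (cubic z * cnj w) = - Im (cubic z * cnj (z - w))" for z w
      by (simp add: cubic_eq algebra_simps)
    then have "\<bar>Im (cubic (v \<tau> x) * cnj (Pv M \<tau> x))\<bar> \<le> norm (cubic (v \<tau> x) * cnj (v \<tau> x - Pv M \<tau> x))"
      using abs_Im_le_cmod by (metis abs_minus_cancel)
    then show "\<bar>Im (cubic (v \<tau> x) * cnj (Pv M \<tau> x))\<bar> \<le> norm (v \<tau> x) ^ 3 * Rv M (\<tau>, x)"
      by (simp add: norm_mult norm_cubic Rv_def del: complex_cnj_diff)
  qed
  finally have "\<bar>Im (LINT x|tor. cubic (v \<tau> x) * cnj (Pv M \<tau> x))\<bar> \<le> (LINT x|tor. norm (v \<tau> x) ^ 3 * Rv M (\<tau>, x))" (is "?a \<le> ?b") .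
  moreover have "?a / (2 * pi) \<le> ?a / 1" using pi_gt3 by (intro divide_left_mono) auto
  ultimately show ?case unfolding e by (simp add: Im_divide_of_real)
qed

lemma mass_defect:
  assumes t: "t \<in> {0..T}"
  shows "\<bar>(\<Sum>n\<in>{-int M..int M}. (norm (av n t))\<^sup>2) - (\<Sum>n\<in>{-int M..int M}. (norm (av n 0))\<^sup>2)\<bar> \<le> 2 * lam * (LINT z|ST. norm (v (fst z) (snd z)) ^ 3 * Rv M z)"
proof -
  let ?R = "{-int M..int M}"
  define g where "g = (\<lambda>\<tau>. Im (\<Sum>n\<in>?R. Fv n \<tau> * cnj (av n \<tau>)))"
  have ig: "integrable (ivl T) g" unfolding g_def by (intro integrable_Im Bochner_Integration.integrable_sum Fv_cnj_integrable)
  have in1: "integrable (ivl t) (\<lambda>\<tau>. 2 * lam * Im (Fv n \<tau> * cnj (av n \<tau>)))" for n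
    by (rule integrable_ivl_mono[of T]) (use t in \<open>auto intro!: integrable_mult_right integrable_Im Fv_cnj_integrable simp del: times_complex.simps\<close>)
  have "(\<Sum>n\<in>?R. (norm (av n t))\<^sup>2) - (\<Sum>n\<in>?R. (norm (av n 0))\<^sup>2) = (\<Sum>n\<in>?R. (LINT \<tau>|ivl t. 2 * lam * Im (Fv n \<tau> * cnj (av n \<tau>))))"
    unfolding mass_identity[OF t] by (simp add: sum.distrib)
  also have "\<dots> = (LINT \<tau>|ivl t. (\<Sum>n\<in>?R. 2 * lam * Im (Fv n \<tau> * cnj (av n \<tau>))))"
    by (rule Bochner_Integration.integral_sum[OF in1, symmetric])
  also have "(\<lambda>\<tau>. (\<Sum>n\<in>?R. 2 * lam * Im (Fv n \<tau> * cnj (av n \<tau>)))) = (\<lambda>\<tau>. 2 * lam * g \<tau>)"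
    by (rule ext) (simp only: g_def Im_sum sum_distrib_left)
  finally have "\<bar>(\<Sum>n\<in>?R. (norm (av n t))\<^sup>2) - (\<Sum>n\<in>?R. (norm (av n 0))\<^sup>2)\<bar> = \<bar>LINT \<tau>|ivl t. 2 * lam * g \<tau>\<bar>" by simp
  also have "\<dots> \<le> (LINT \<tau>|ivl t. \<bar>2 * lam * g \<tau>\<bar>)" by (rule integral_abs_bound)
  also have "\<dots> \<le> (LINT \<tau>|ivl T. \<bar>2 * lam * g \<tau>\<bar>)"
    by (rule integral_ivl_mono) (use t ig in auto)
  also have "\<dots> = 2 * lam * (LINT \<tau>|ivl T. \<bar>g \<tau>\<bar>)" using lam0 by (simp add: abs_mult)
  also have "\<dots> \<le> 2 * lam * (LINT \<tau>|ivl T. (LINT x|tor. norm (v \<tau> x) ^ 3 * Rv M (\<tau>, x)))"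
  proof (intro mult_left_mono integral_mono_AE)
    show "integrable (ivl T) (\<lambda>\<tau>. LINT x|tor. norm (v \<tau> x) ^ 3 * Rv M (\<tau>, x))"
      using pst.integrable_fst'[OF cube_Rv_integrable[of M]] by simp
    show "AE \<tau> in ivl T. \<bar>g \<tau>\<bar> \<le> (LINT x|tor. norm (v \<tau> x) ^ 3 * Rv M (\<tau>, x))"
      unfolding g_def by (rule mass_flux_le)
  qed (use ig lam0 in auto)
  also have "(LINT \<tau>|ivl T. (LINT x|tor. norm (v \<tau> x) ^ 3 * Rv M (\<tau>, x))) = (LINT z|ST. norm (v (fst z) (snd z)) ^ 3 * Rv M z)"
    using pst.integral_fst'[OF cube_Rv_integrable[of M]] by simp
  finally show ?thesis .
qed

lemma u0_sq: "square_integrable tor u0"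
  using sol by (auto simp: nls_solution_def L2_torus_iff)

text \<open>The flux through the cut-off tends to 0 because the remainder vanishes weakly against
  the cube of \<open>|v|\<close>. This is where integrability of the fourth power justifies the
  formal cancellation.\<close>

lemma mass_conservation:
  assumes t: "t \<in> {0..T}"
  shows "(LINT x|tor. (norm (v t x))\<^sup>2) = (LINT x|tor. (norm (u0 x))\<^sup>2)"
proof -
  have t0: "0 \<le> t" using t by simp
  let ?R = "\<lambda>M. {-int M..int M}"
  have "(\<lambda>M. 2 * pi * (\<Sum>n\<in>?R M. (norm (av n t))\<^sup>2) - 2 * pi * (\<Sum>n\<in>?R M. (norm (av n 0))\<^sup>2)) \<longlonglongrightarrow> (LINT x|tor. (norm (v t x))\<^sup>2) - (LINT x|tor. (norm (u0 x))\<^sup>2)"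
    using parseval[OF v_sq[OF t0]] parseval[OF u0_sq] unfolding norm_av[of _ t] av_0 by (intro tendsto_diff)
  moreover have "(\<lambda>M. 2 * pi * (\<Sum>n\<in>?R M. (norm (av n t))\<^sup>2) - 2 * pi * (\<Sum>n\<in>?R M. (norm (av n 0))\<^sup>2)) \<longlonglongrightarrow> 0"
  proof (rule Lim_null_comparison)
    show "\<forall>\<^sub>F M in sequentially. norm (2 * pi * (\<Sum>n\<in>?R M. (norm (av n t))\<^sup>2) - 2 * pi * (\<Sum>n\<in>?R M. (norm (av n 0))\<^sup>2)) \<le> 2 * pi * (2 * lam * (LINT z|ST. norm (v (fst z) (snd z)) ^ 3 * Rv M z))"
    proof (intro always_eventually allI)
      fix M
      have "norm (2 * pi * (\<Sum>n\<in>?R M. (norm (av n t))\<^sup>2) - 2 * pi * (\<Sum>n\<in>?R M. (norm (av n 0))\<^sup>2)) =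
         2 * pi * \<bar>(\<Sum>n\<in>?R M. (norm (av n t))\<^sup>2) - (\<Sum>n\<in>?R M. (norm (av n 0))\<^sup>2)\<bar>"
        unfolding right_diff_distrib[symmetric] by (simp add: abs_mult)
      also have "\<dots> \<le> 2 * pi * (2 * lam * (LINT z|ST. norm (v (fst z) (snd z)) ^ 3 * Rv M z))"
        by (intro mult_left_mono mass_defect[OF t]) simp
      finally show "norm (2 * pi * (\<Sum>n\<in>?R M. (norm (av n t))\<^sup>2) - 2 * pi * (\<Sum>n\<in>?R M. (norm (av n 0))\<^sup>2)) \<le> 2 * pi * (2 * lam * (LINT z|ST. norm (v (fst z) (snd z)) ^ 3 * Rv M z))" .
    qed
    have "(\<lambda>M. 2 * pi * (2 * lam * (LINT z|ST. norm (v (fst z) (snd z)) ^ 3 * Rv M z))) \<longlonglongrightarrow> 2 * pi * (2 * lam * 0)"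
      by (intro tendsto_intros cube_Rv_tendsto)
    then show "(\<lambda>M. 2 * pi * (2 * lam * (LINT z|ST. norm (v (fst z) (snd z)) ^ 3 * Rv M z))) \<longlonglongrightarrow> 0" by simp
  qed
  ultimately show ?thesis using LIMSEQ_unique by fastforce
qed

section \<open>The normal form of the full equation\<close>

definition "mass = (L2_norm u0)\<^sup>2 / (2 * pi)"

lemma mass_t: "t \<in> {0..T} \<Longrightarrow> (LINT x|tor. (norm (v t x))\<^sup>2) = 2 * pi * mass"
  using mass_conservation by (simp add: mass_def L2_norm_eq)

text \<open>The cost in \<open>L\<^sup>1\<close> in time of replacing the solution by its frequencies up to \<open>M\<close> in the nonlinearity.\<close>

definition "errM M = 1 / (2 * pi) * (LINT z|ST. norm (cubic (v (fst z) (snd z)) - cubic (Pv M (fst z) (snd z))))"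

lemma cubic_Pv_integrable: "integrable ST (\<lambda>z. cubic (Pv M (fst z) (snd z)))"
  by (rule integrable_dominated[OF Pv_pow_integrable[of M 3]]) (auto simp: norm_cubic)

lemma Fv_approx:
  "(LINT \<tau>|ivl T. norm (Fv n \<tau> - cis (\<tau> * (of_int n)\<^sup>2) * fourier_coeff (\<lambda>x. cubic (Pv M \<tau> x)) n)) \<le> errM M"
proof -
  have i: "integrable ST (\<lambda>z. norm (cubic (v (fst z) (snd z)) - cubic (Pv M (fst z) (snd z))))"
    by (intro integrable_norm Bochner_Integration.integrable_diff cubic_V_integrable cubic_Pv_integrable)
  have le: "AE \<tau> in ivl T. norm (Fv n \<tau> - cis (\<tau> * (of_int n)\<^sup>2) * fourier_coeff (\<lambda>x. cubic (Pv M \<tau> x)) n)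
      \<le> 1 / (2 * pi) * (LINT x|tor. norm (cubic (v \<tau> x) - cubic (Pv M \<tau> x)))"
    using AE_space pst.AE_integrable_fst'[OF cubic_V_integrable]
  proof eventually_elim
    case (elim \<tau>)
    then have i1: "integrable tor (\<lambda>x. cubic (v \<tau> x))" by simp
    have i2: "integrable tor (\<lambda>x. cubic (Pv M \<tau> x))" unfolding Pv_def by (rule integrable_tor_continuous[OF cubic_psum_continuous])
    have "Fv n \<tau> - cis (\<tau> * (of_int n)\<^sup>2) * fourier_coeff (\<lambda>x. cubic (Pv M \<tau> x)) n = cis (\<tau> * (of_int n)\<^sup>2) * fourier_coeff (\<lambda>x. cubic (v \<tau> x) - cubic (Pv M \<tau> x)) n"
      unfolding Fv_def fourier_coeff_diff[OF i1 i2] by (simp add: algebra_simps)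
    also have "norm \<dots> = norm (fourier_coeff (\<lambda>x. cubic (v \<tau> x) - cubic (Pv M \<tau> x)) n)" by (simp add: norm_mult)
    also have "\<dots> \<le> 1 / (2 * pi) * (LINT x|tor. norm (cubic (v \<tau> x) - cubic (Pv M \<tau> x)))"
      by (rule fourier_coeff_norm_le[OF Bochner_Integration.integrable_diff[OF i1 i2]])
    finally show ?case .
  qed
  have "(LINT \<tau>|ivl T. norm (Fv n \<tau> - cis (\<tau> * (of_int n)\<^sup>2) * fourier_coeff (\<lambda>x. cubic (Pv M \<tau> x)) n)) \<le> (LINT \<tau>|ivl T. 1 / (2 * pi) * (LINT x|tor. norm (cubic (v \<tau> x) - cubic (Pv M \<tau> x))))"
    using pst.integrable_fst'[OF i] by (intro integral_mono_AE' le integrable_mult_right) auto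
  also have "\<dots> = errM M" unfolding errM_def using pst.integral_fst'[OF i] by simp
  finally show ?thesis .
qed

lemma Yb0: "0 \<le> Yb"
proof -
  have "0 \<le> Y" unfolding Y_def by simp
  then show ?thesis using Y_le_Yb by linarith
qed

text \<open>The difference of the cubic terms is the remainder times a quadratic factor;
  Cauchy-Schwarz pairs the fourth-power bound with the L^2 norm of the remainder. Besides
  convergence to 0 this gives a rate, from which the decay of \<open>Fv\<close> in the frequency is
  derived.\<close>

lemma errM_le: "errM M \<le> 2 * sqrt Yb * sqrt (LINT z|ST. (Rv M z)\<^sup>2)"
proof -
  have cs: "integrable ST (\<lambda>z. (norm (w z))\<^sup>2 * Rv M z) \<and> (LINT z|ST. (norm (w z))\<^sup>2 * Rv M z) \<le> sqrt Yb * sqrt (LINT z|ST. (Rv M z)\<^sup>2)"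
    if [measurable]: "w \<in> borel_measurable ST" and i: "integrable ST (\<lambda>z. norm (w z) ^ 4)" and le: "(LINT z|ST. norm (w z) ^ 4) \<le> Yb" for w :: "_ \<Rightarrow> complex"
  proof -
    have i': "integrable ST (\<lambda>z. ((norm (w z))\<^sup>2)\<^sup>2)" using i by simp
    have "(LINT z|ST. \<bar>(norm (w z))\<^sup>2\<bar> * \<bar>Rv M z\<bar>) \<le> sqrt (LINT z|ST. ((norm (w z))\<^sup>2)\<^sup>2) * sqrt (LINT z|ST. (Rv M z)\<^sup>2)"
      by (rule integral_cauchy_schwarz(2)) (use i' Rv2_integrable in auto)
    also have "\<dots> \<le> sqrt Yb * sqrt (LINT z|ST. (Rv M z)\<^sup>2)" using le by (intro mult_right_mono real_sqrt_le_mono) auto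
    finally have "(LINT z|ST. (norm (w z))\<^sup>2 * Rv M z) \<le> sqrt Yb * sqrt (LINT z|ST. (Rv M z)\<^sup>2)" by (simp add: Rv_nonneg)
    moreover have "integrable ST (\<lambda>z. \<bar>(norm (w z))\<^sup>2\<bar> * \<bar>Rv M z\<bar>)"
      by (rule integral_cauchy_schwarz(1)) (use i' Rv2_integrable in auto)
    ultimately show ?thesis by (simp add: Rv_nonneg)
  qed
  note c1 = cs[OF V_measurable V4_integrable Y_le_Yb[unfolded Y_def]]
  note c2 = cs[OF Pv_measurable Pv_pow_integrable Pv4_le, of M]
  have "(LINT z|ST. norm (cubic (v (fst z) (snd z)) - cubic (Pv M (fst z) (snd z)))) \<le>
     (LINT z|ST. 2 * ((norm (v (fst z) (snd z)))\<^sup>2 * Rv M z + (norm (Pv M (fst z) (snd z)))\<^sup>2 * Rv M z))"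
  proof (rule integral_mono)
    fix z
    show "norm (cubic (v (fst z) (snd z)) - cubic (Pv M (fst z) (snd z))) \<le> 2 * ((norm (v (fst z) (snd z)))\<^sup>2 * Rv M z + (norm (Pv M (fst z) (snd z)))\<^sup>2 * Rv M z)"
      using cubic_diff[of "v (fst z) (snd z)" "Pv M (fst z) (snd z)"] by (simp add: Rv_def algebra_simps)
  qed (use c1 c2 in \<open>auto intro!: integrable_norm Bochner_Integration.integrable_diff cubic_V_integrable cubic_Pv_integrable\<close>)
  also have "\<dots> = 2 * ((LINT z|ST. (norm (v (fst z) (snd z)))\<^sup>2 * Rv M z) + (LINT z|ST. (norm (Pv M (fst z) (snd z)))\<^sup>2 * Rv M z))"
    using c1 c2 by simp
  also have "\<dots> \<le> 4 * (sqrt Yb * sqrt (LINT z|ST. (Rv M z)\<^sup>2))" using c1 c2 by simp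
  finally have "errM M \<le> 1 / (2 * pi) * (4 * (sqrt Yb * sqrt (LINT z|ST. (Rv M z)\<^sup>2)))"
    unfolding errM_def by (intro mult_left_mono) auto
  also have "\<dots> = (2 * sqrt Yb * sqrt (LINT z|ST. (Rv M z)\<^sup>2)) / pi" by simp
  also have "\<dots> \<le> (2 * sqrt Yb * sqrt (LINT z|ST. (Rv M z)\<^sup>2)) / 1"
    using pi_gt3 Yb0 by (intro divide_left_mono) auto
  finally show ?thesis by simp
qed

lemma errM_nonneg: "0 \<le> errM M" unfolding errM_def by simp

lemma errM_tendsto: "errM \<longlonglongrightarrow> 0"
proof (rule tendsto_sandwich[OF _ _ tendsto_const])
  have "(\<lambda>M. 2 * sqrt Yb * sqrt (LINT z|ST. (Rv M z)\<^sup>2)) \<longlonglongrightarrow> 2 * sqrt Yb * sqrt 0"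
    by (intro tendsto_intros Rv2_tendsto)
  then show "(\<lambda>M. 2 * sqrt Yb * sqrt (LINT z|ST. (Rv M z)\<^sup>2)) \<longlonglongrightarrow> 0" by simp
qed (use errM_le errM_nonneg in auto)

lemma Fv_high_le:
  assumes "3 * int M < \<bar>n\<bar>" shows "(LINT \<tau>|ivl T. norm (Fv n \<tau>)) \<le> errM M"
  using Fv_approx[of n M] fourier_coeff_cubic_psum_high[OF assms] by (simp add: Pv_def)

lemma mass_tail:
  assumes t: "t \<in> {0..T}"
  shows "mass - (\<Sum>m\<in>{-int M..int M}. (norm (av m t))\<^sup>2) = 1 / (2 * pi) * (LINT x|tor. (norm (v t x - psum (fourier_coeff (v t)) M x))\<^sup>2)"
  using parseval_tail[OF v_sq, of t M] mass_t[OF t] t unfolding norm_av by (simp add: field_simps)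

text \<open>For the truncated function the interaction splits exactly, but with the truncated mass.
  Two errors remain, from the replaced nonlinearity and from the missing mass \<open>q\<close>. Both
  vanish as \<open>M\<close> grows, so a bound on the nonresonant integral that is uniform in
  \<open>M\<close> passes to the limit.\<close>

lemma normal_form_limit:
  assumes t: "t \<in> {0..T}"
    and B: "\<And>M. n \<in> {-int M..int M} \<Longrightarrow> norm (LINT \<tau>|ivl t. nonres M (\<lambda>m. av m \<tau>) n \<tau>) \<le> B"
  shows "norm (av n t - av n 0 + \<i> * complex_of_real lam * (LINT \<tau>|ivl t. complex_of_real (2 * mass - (norm (av n \<tau>))\<^sup>2) * av n \<tau>)) \<le> lam * B"
proof -
  define G where "G = (\<lambda>\<tau>. complex_of_real (2 * mass - (norm (av n \<tau>))\<^sup>2) * av n \<tau>)"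
  have ac: "continuous_on {0..t} (av m)" for m by (rule md.a_continuous'[OF t])
  have Gc: "continuous_on {0..t} G" unfolding G_def by (intro continuous_intros ac)
  have main: "norm (av n t - av n 0 + \<i> * complex_of_real lam * (LINT \<tau>|ivl t. G \<tau>)) \<le> lam * (B + errM M + 2 * E * (LINT z|ST. (Rv M z)\<^sup>2))"
    if n: "n \<in> {-int M..int M}" for M
  proof -
    define N where "N = (\<lambda>\<tau>. nonres M (\<lambda>m. av m \<tau>) n \<tau>)"
    define q where "q = (\<lambda>\<tau>. mass - (\<Sum>m\<in>{-int M..int M}. (norm (av m \<tau>))\<^sup>2))"
    define F' where "F' = (\<lambda>\<tau>. cis (\<tau> * (of_int n)\<^sup>2) * fourier_coeff (\<lambda>x. cubic (Pv M \<tau> x)) n)"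
    interpret tr: modes lam T E "\<lambda>m t. trunc M (\<lambda>m. av m t) m" "\<lambda>m t. trunc M (\<lambda>m. Fv m t) m" fv by (rule modes_trunc)
    have Nc: "continuous_on {0..t} N" unfolding N_def nonres_def by (intro continuous_intros tr.a_continuous'[OF t])
    have qc: "continuous_on {0..t} q" unfolding q_def by (intro continuous_intros ac)
    have F': "F' \<tau> = N \<tau> + G \<tau> - complex_of_real (2 * q \<tau>) * av n \<tau>" for \<tau>
      unfolding F'_def Pv_eq fourier_coeff_cubic_interaction[OF n] N_def G_def q_def by (simp add: algebra_simps)
    have F'c: "continuous_on {0..t} F'" unfolding F' by (intro continuous_intros Nc Gc qc ac)
    have iF: "integrable (ivl t) (Fv n)" by (rule integrable_ivl_mono[OF Fv_integrable]) (use t in auto)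
    note ic = integrable_ivl_continuous
    have "av n t = av n 0 - \<i> * complex_of_real lam * (LINT \<tau>|ivl t. Fv n \<tau>)"
      unfolding av_0 by (rule coeff_eq) (use t in auto)
    moreover have "(LINT \<tau>|ivl t. Fv n \<tau>) = (LINT \<tau>|ivl t. Fv n \<tau> - F' \<tau>) + (LINT \<tau>|ivl t. F' \<tau>)"
      using iF ic[OF F'c] by simp
    moreover have "(LINT \<tau>|ivl t. F' \<tau>) = (LINT \<tau>|ivl t. N \<tau>) + (LINT \<tau>|ivl t. G \<tau>) - (LINT \<tau>|ivl t. complex_of_real (2 * q \<tau>) * av n \<tau>)"
    proof -
      have "continuous_on {0..t} (\<lambda>\<tau>. complex_of_real (2 * q \<tau>) * av n \<tau>)" by (intro continuous_intros qc ac)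
      from ic[OF this] ic[OF Nc] ic[OF Gc] show ?thesis unfolding F' by simp
    qed
    ultimately have "av n t - av n 0 + \<i> * complex_of_real lam * (LINT \<tau>|ivl t. G \<tau>) = - (\<i> * complex_of_real lam) *
      ((LINT \<tau>|ivl t. N \<tau>) + (LINT \<tau>|ivl t. Fv n \<tau> - F' \<tau>) - (LINT \<tau>|ivl t. complex_of_real (2 * q \<tau>) * av n \<tau>))"
      by (simp add: algebra_simps)
    then have "norm (av n t - av n 0 + \<i> * complex_of_real lam * (LINT \<tau>|ivl t. G \<tau>)) = lam * norm ((LINT \<tau>|ivl t. N \<tau>) + (LINT \<tau>|ivl t. Fv n \<tau> - F' \<tau>) - (LINT \<tau>|ivl t. complex_of_real (2 * q \<tau>) * av n \<tau>))"
      using lam0 by (simp add: norm_mult)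
    also have "\<dots> \<le> lam * (B + errM M + 2 * E * (LINT z|ST. (Rv M z)\<^sup>2))"
    proof (intro mult_left_mono lam0 order_trans[OF norm_triangle_ineq4] add_mono order_trans[OF norm_triangle_ineq])
      show "norm (LINT \<tau>|ivl t. N \<tau>) \<le> B" unfolding N_def by (rule B[OF n])
      have "norm (LINT \<tau>|ivl t. Fv n \<tau> - F' \<tau>) \<le> (LINT \<tau>|ivl t. norm (Fv n \<tau> - F' \<tau>))" by (rule integral_norm_bound)
      also have "\<dots> \<le> (LINT \<tau>|ivl T. norm (Fv n \<tau> - F' \<tau>))"
      proof (rule integral_ivl_mono)
        have aT: "continuous_on {0..T} (av m)" for m by (rule md.a_continuous)
        have "continuous_on {0..T} F'" unfolding F' N_def G_def q_def nonres_def by (intro continuous_intros aT tr.a_continuous)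
        from ic[OF this] show "integrable (ivl T) (\<lambda>\<tau>. norm (Fv n \<tau> - F' \<tau>))" using Fv_integrable by auto
      qed (use t in auto)
      also have "\<dots> \<le> errM M" unfolding F'_def by (rule Fv_approx)
      finally show "norm (LINT \<tau>|ivl t. Fv n \<tau> - F' \<tau>) \<le> errM M" .
      have q_le: "\<bar>q \<tau>\<bar> \<le> (LINT x|tor. (norm (v \<tau> x - psum (fourier_coeff (v \<tau>)) M x))\<^sup>2)" if \<tau>: "\<tau> \<in> {0..T}" for \<tau>
      proof -
        define w where "w = (LINT x|tor. (norm (v \<tau> x - psum (fourier_coeff (v \<tau>)) M x))\<^sup>2)"
        have "0 \<le> w" unfolding w_def by simp
        moreover have "q \<tau> = w / (2 * pi)" unfolding q_def mass_tail[OF \<tau>] w_def by simp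
        moreover have "w / (2 * pi) \<le> w / 1" using pi_gt3 \<open>0 \<le> w\<close> by (intro divide_left_mono) auto
        ultimately show ?thesis unfolding w_def[symmetric] by simp
      qed
      have iR: "integrable (ivl T) (\<lambda>\<tau>. LINT x|tor. (norm (v \<tau> x - psum (fourier_coeff (v \<tau>)) M x))\<^sup>2)"
        using pst.integrable_fst'[OF Rv2_integrable[of M]] by (simp add: Rv_def Pv_def)
      have "norm (LINT \<tau>|ivl t. complex_of_real (2 * q \<tau>) * av n \<tau>) \<le> (LINT \<tau>|ivl t. norm (complex_of_real (2 * q \<tau>) * av n \<tau>))" by (rule integral_norm_bound)
      also have "\<dots> \<le> (LINT \<tau>|ivl t. 2 * E * (LINT x|tor. (norm (v \<tau> x - psum (fourier_coeff (v \<tau>)) M x))\<^sup>2))"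
      proof (rule integral_mono)
        show "integrable (ivl t) (\<lambda>\<tau>. norm (complex_of_real (2 * q \<tau>) * av n \<tau>))"
          by (intro integrable_norm ic continuous_intros qc ac)
        show "integrable (ivl t) (\<lambda>\<tau>. 2 * E * (LINT x|tor. (norm (v \<tau> x - psum (fourier_coeff (v \<tau>)) M x))\<^sup>2))"
          by (intro integrable_mult_right integrable_ivl_mono[OF iR]) (use t in auto)
        fix \<tau> assume "\<tau> \<in> space (ivl t)"
        then have \<tau>: "\<tau> \<in> {0..T}" using t by auto
        have "norm (complex_of_real (2 * q \<tau>) * av n \<tau>) = 2 * (norm (av n \<tau>) * \<bar>q \<tau>\<bar>)" by (simp add: norm_mult)
        also have "\<dots> \<le> 2 * (E * (LINT x|tor. (norm (v \<tau> x - psum (fourier_coeff (v \<tau>)) M x))\<^sup>2))"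
          by (intro mult_left_mono mult_mono sq_bounded_le[OF sq_av[OF \<tau>] E0] q_le \<tau> E0) auto
        finally show "norm (complex_of_real (2 * q \<tau>) * av n \<tau>) \<le> 2 * E * (LINT x|tor. (norm (v \<tau> x - psum (fourier_coeff (v \<tau>)) M x))\<^sup>2)" by simp
      qed
      also have "\<dots> \<le> (LINT \<tau>|ivl T. 2 * E * (LINT x|tor. (norm (v \<tau> x - psum (fourier_coeff (v \<tau>)) M x))\<^sup>2))"
        by (rule integral_ivl_mono) (use t iR E0 in auto)
      also have "\<dots> = 2 * E * (LINT z|ST. (Rv M z)\<^sup>2)" unfolding Rv2_fubini by simp
      finally show "norm (LINT \<tau>|ivl t. complex_of_real (2 * q \<tau>) * av n \<tau>) \<le> 2 * E * (LINT z|ST. (Rv M z)\<^sup>2)" .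
    qed
    finally show ?thesis .
  qed
  have lim: "(\<lambda>M. lam * (B + errM M + 2 * E * (LINT z|ST. (Rv M z)\<^sup>2))) \<longlonglongrightarrow> lam * (B + 0 + 2 * E * 0)"
    by (intro tendsto_intros errM_tendsto Rv2_tendsto)
  have "norm (av n t - av n 0 + \<i> * complex_of_real lam * (LINT \<tau>|ivl t. G \<tau>)) \<le> lam * (B + 0 + 2 * E * 0)"
    by (rule LIMSEQ_le_const[OF lim], intro exI[of _ "nat \<bar>n\<bar>"] allI impI main) auto
  then show ?thesis by (simp add: G_def)
qed

text \<open>\<open>Yb\<close> contains \<open>4 * pi * K4 * lam * \<Phi>\<close>, while
  \<open>\<Phi>\<close> is at most \<open>Yb\<close> plus a multiple of \<open>T\<close>. For small
  \<open>lam\<close> the term is at most half of \<open>\<Phi>\<close> and is absorbed,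
  \<open>\<Phi>\<close> being a finite number. Linear growth in \<open>1 + T\<close> keeps the
  bounds, multiplied by \<open>lam\<close>, under control on the time scale
  \<open>1 / lam\<close>.\<close>

lemma Phi_Yb_le:
  assumes small: "8 * pi * K4 * lam \<le> 1"
  shows "\<Phi> \<le> 2 * (2 * pi * K4 * E + 4 * pi * E ^ 4 + E\<^sup>2) * (1 + T)"
    "Yb \<le> 2 * (2 * pi * K4 * E + 4 * pi * E ^ 4 + E\<^sup>2) * (1 + T)"
proof -
  have K0: "0 \<le> K4" using quad_const E0 unfolding K4_def by (intro mult_nonneg_nonneg) auto
  have "4 * pi * K4 * lam * \<Phi> \<le> (1 / 2) * \<Phi>" using small by (intro mult_right_mono Phi0) auto
  then have Yb: "Yb \<le> 2 * pi * K4 * E + \<Phi> / 2 + 4 * pi * E ^ 4 * T"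
    unfolding Yb_def by (simp add: algebra_simps)
  then have "\<Phi> \<le> 2 * pi * K4 * E + \<Phi> / 2 + 4 * pi * E ^ 4 * T + E\<^sup>2 * T" using Phi_le Y_le_Yb by linarith
  then have P: "\<Phi> \<le> 2 * (2 * pi * K4 * E + 4 * pi * E ^ 4 * T + E\<^sup>2 * T)" by simp
  define a b c where "a = 2 * pi * K4 * E" and "b = 4 * pi * E ^ 4" and "c = E\<^sup>2"
  have nn: "0 \<le> a" "0 \<le> b" "0 \<le> c" "0 \<le> a * T" "0 \<le> b * T" "0 \<le> c * T"
    using K0 E0 T_pos by (auto simp: a_def b_def c_def)
  have e: "2 * (a + b + c) * (1 + T) = 2 * a + 2 * (a * T) + 2 * b + 2 * (b * T) + 2 * c + 2 * (c * T)"
    by (simp add: algebra_simps)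
  have P': "\<Phi> \<le> 2 * (a + b * T + c * T)" and Y': "Yb \<le> a + \<Phi> / 2 + b * T"
    using P Yb by (simp_all add: a_def b_def c_def)
  have fin: "x \<le> 2 * p + 2 * p' + 2 * q + 2 * q' + 2 * r + 2 * r'" "y \<le> 2 * p + 2 * p' + 2 * q + 2 * q' + 2 * r + 2 * r'"
    if "x \<le> 2 * (p + q' + r')" "y \<le> p + x / 2 + q'" "0 \<le> p" "0 \<le> q" "0 \<le> r" "0 \<le> p'" "0 \<le> q'" "0 \<le> r'" for p q r p' q' r' x y :: real
    using that by argo+
  have "\<Phi> \<le> 2 * (a + b + c) * (1 + T)" unfolding e by (rule fin(1)[OF P' Y' nn])
  moreover have "Yb \<le> 2 * (a + b + c) * (1 + T)" unfolding e by (rule fin(2)[OF P' Y' nn])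
  ultimately show "\<Phi> \<le> 2 * (2 * pi * K4 * E + 4 * pi * E ^ 4 + E\<^sup>2) * (1 + T)"
    "Yb \<le> 2 * (2 * pi * K4 * E + 4 * pi * E ^ 4 + E\<^sup>2) * (1 + T)"
    by (simp_all only: a_def b_def c_def)
qed

end

section \<open>Decay of the modes and comparison with the modulated linear flow\<close>

text \<open>At a maximum point of \<open>exp (- (2 * k * t)) * g t\<close> the hypothesis shows that
  the maximum \<open>m\<close> satisfies \<open>m \<le> c + m / 2\<close>. The doubled rate and the
  factor 2 are the price of an argument without derivatives.\<close>

lemma gronwall_integral:
  fixes g :: "real \<Rightarrow> real"
  assumes T: "0 \<le> T" and g: "continuous_on {0..T} g" "\<And>t. t \<in> {0..T} \<Longrightarrow> 0 \<le> g t"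
    and k: "0 \<le> k" and c: "0 \<le> c"
    and ineq: "\<And>t. t \<in> {0..T} \<Longrightarrow> g t \<le> c + k * (LINT \<tau>|ivl t. g \<tau>)"
    and t: "t \<in> {0..T}"
  shows "g t \<le> 2 * c * exp (2 * k * T)"
proof -
  have "continuous_on {0..T} (\<lambda>t. exp (- (2 * k * t)) * g t)" by (intro continuous_intros g)
  then obtain s where s: "s \<in> {0..T}" "\<And>t. t \<in> {0..T} \<Longrightarrow> exp (- (2 * k * t)) * g t \<le> exp (- (2 * k * s)) * g s"
    using continuous_attains_sup[of "{0..T}" "\<lambda>t. exp (- (2 * k * t)) * g t"] T by auto
  define m where "m = exp (- (2 * k * s)) * g s"
  have m0: "0 \<le> m" using g(2)[OF s(1)] by (simp add: m_def)
  have gm: "g t \<le> m * exp (2 * k * t)" if "t \<in> {0..T}" for t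
  proof -
    have "exp (- (2 * k * t)) * g t \<le> m" using s(2)[OF that] by (simp add: m_def)
    then have "exp (2 * k * t) * (exp (- (2 * k * t)) * g t) \<le> exp (2 * k * t) * m" by (rule mult_left_mono) simp
    moreover have "exp (2 * k * t) * (exp (- (2 * k * t)) * g t) = g t" by (simp add: exp_minus)
    ultimately show ?thesis by (simp only: mult.commute)
  qed
  have cs: "continuous_on {0..s} g" by (rule continuous_on_subset[OF g(1)]) (use s in auto)
  have ie: "integrable (ivl s) (\<lambda>\<tau>. exp (2 * k * \<tau>))" for k :: real by (intro integrable_ivl_continuous continuous_intros)
  have "((\<lambda>\<tau>. k * exp (2 * k * \<tau>)) has_integral (exp (2 * k * s) / 2 - exp (2 * k * 0) / 2)) {0..s}"
    by (rule fundamental_theorem_of_calculus)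
      (use s in \<open>auto intro!: derivative_eq_intros simp: has_real_derivative_iff_has_vector_derivative[symmetric]\<close>)
  then have I: "k * (LINT \<tau>|ivl s. exp (2 * k * \<tau>)) = (exp (2 * k * s) - 1) / 2"
  proof -
    have "set_integrable lborel {0..s} (\<lambda>\<tau>. k * exp (2 * k * \<tau>))" unfolding set_integrable_ivl by (intro integrable_mult_right ie)
    from set_borel_integral_eq_integral(2)[OF this]
    have "(LINT \<tau>|ivl s. k * exp (2 * k * \<tau>)) = integral {0..s} (\<lambda>\<tau>. k * exp (2 * k * \<tau>))" unfolding set_integral_ivl .
    also have "\<dots> = exp (2 * k * s) / 2 - exp (2 * k * 0) / 2" using \<open>(_ has_integral _) _\<close> by (rule integral_unique)
    finally show ?thesis by simp
  qed
  have "g s \<le> c + k * (LINT \<tau>|ivl s. g \<tau>)" by (rule ineq[OF s(1)])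
  also have "\<dots> \<le> c + k * (LINT \<tau>|ivl s. m * exp (2 * k * \<tau>))"
    using s by (intro add_left_mono mult_left_mono k integral_mono integrable_ivl_continuous[OF cs] integrable_mult_right ie gm) auto
  also have "k * (LINT \<tau>|ivl s. m * exp (2 * k * \<tau>)) = m * ((exp (2 * k * s) - 1) / 2)" unfolding I[symmetric] by simp
  finally have "g s \<le> c + m * ((exp (2 * k * s) - 1) / 2)" .
  then have "exp (- (2 * k * s)) * g s \<le> exp (- (2 * k * s)) * (c + m * ((exp (2 * k * s) - 1) / 2))" by (rule mult_left_mono) simp
  also have "\<dots> = exp (- (2 * k * s)) * c + m * (1 - exp (- (2 * k * s))) / 2"
    by (simp add: exp_minus field_simps)
  also have "\<dots> \<le> 1 * c + m * 1 / 2"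
    using k s c m0 by (intro add_mono mult_right_mono divide_right_mono mult_left_mono) auto
  finally have "m \<le> 2 * c" by (simp add: m_def)
  then have "m * exp (2 * k * t) \<le> 2 * c * exp (2 * k * T)"
    using t k m0 by (intro mult_mono) (auto intro: mult_left_mono)
  then show ?thesis using gm[OF t] by linarith
qed

context nls_sol_bound
begin

text \<open>The explicit solution of the resonant system, in which every mode rotates at a rate set
  by the mass and by its own constant modulus. With the linear phase restored it is a mode of the
  modulated flow.\<close>

definition "zv n t = cis (- (lam * (2 * mass - (norm (av n 0))\<^sup>2)) * t) * av n 0"

lemma norm_zv: "norm (zv n t) = norm (av n 0)" by (simp add: zv_def norm_mult)

lemma zv_eq:
  assumes t: "t \<in> {0..T}"
  shows "zv n t = av n 0 - \<i> * complex_of_real lam * (LINT \<tau>|ivl t. complex_of_real (2 * mass - (norm (zv n \<tau>))\<^sup>2) * zv n \<tau>)"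
proof -
  define \<phi> where "\<phi> = - (lam * (2 * mass - (norm (av n 0))\<^sup>2))"
  have "cis (\<phi> * t) = cis (\<phi> * 0) + (LINT \<tau>|ivl t. \<i> * complex_of_real \<phi> * cis (\<phi> * \<tau>))"
    using has_density_cis[of T \<phi>] t unfolding has_density_ivl by blast
  then have "zv n t = av n 0 + (LINT \<tau>|ivl t. \<i> * complex_of_real \<phi> * cis (\<phi> * \<tau>)) * av n 0"
    unfolding zv_def \<phi>_def[symmetric] by (simp add: algebra_simps)
  also have "(LINT \<tau>|ivl t. \<i> * complex_of_real \<phi> * cis (\<phi> * \<tau>)) * av n 0 = (LINT \<tau>|ivl t. - (\<i> * complex_of_real lam) * (complex_of_real (2 * mass - (norm (zv n \<tau>))\<^sup>2) * zv n \<tau>))"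
    unfolding integral_mult_left_zero[symmetric]
    by (intro Bochner_Integration.integral_cong refl) (simp add: norm_zv, simp add: zv_def \<phi>_def algebra_simps)
  finally show ?thesis by simp
qed

lemma mass_le: "mass \<le> E\<^sup>2"
proof -
  have "2 * pi * mass \<le> 2 * pi * E\<^sup>2" using inner_L2_le[of 0] mass_t[of 0] T_pos by simp
  then show ?thesis by simp
qed

lemma mass_nonneg: "0 \<le> mass" by (simp add: mass_def)

text \<open>Subtracting the two integral equations leaves the normal form error
  \<open>\<Gamma>\<close> and a difference of resonant terms. These are Lipschitz on the ball of
  radius \<open>E\<close>; of the constant 6 the mass term contributes 2 and the cubic term
  4.\<close>

lemma modulation_difference:
  assumes n: "\<And>t. t \<in> {0..T} \<Longrightarrow> norm (av n t - av n 0 + \<i> * complex_of_real lam * (LINT \<tau>|ivl t. complex_of_real (2 * mass - (norm (av n \<tau>))\<^sup>2) * av n \<tau>)) \<le> \<Gamma>"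
    and t: "t \<in> {0..T}"
  shows "norm (av n t - zv n t) \<le> 2 * \<Gamma> * exp (2 * (6 * lam * E\<^sup>2) * T)"
proof (rule gronwall_integral[where g = "\<lambda>t. norm (av n t - zv n t)", OF _ _ _ _ _ _ t])
  have zc: "continuous_on S (zv n)" for S unfolding zv_def by (intro continuous_intros)
  show "continuous_on {0..T} (\<lambda>t. norm (av n t - zv n t))" by (intro continuous_intros md.a_continuous zc)
  show "0 \<le> \<Gamma>" using order_trans[OF norm_ge_zero n[OF t]] .
  fix r assume r: "r \<in> {0..T}"
  define A where "A = (\<lambda>w :: complex. complex_of_real (2 * mass - (norm w)\<^sup>2) * w)"
  have Ac: "continuous_on UNIV A" unfolding A_def by (intro continuous_intros)
  have ac: "continuous_on {0..r} (av n)" by (rule md.a_continuous'[OF r])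
  have i1: "integrable (ivl r) (\<lambda>\<tau>. A (av n \<tau>))" and i2: "integrable (ivl r) (\<lambda>\<tau>. A (zv n \<tau>))"
    by (rule integrable_ivl_continuous[OF continuous_on_compose2[OF Ac ac subset_UNIV]],
        rule integrable_ivl_continuous[OF continuous_on_compose2[OF Ac zc subset_UNIV]])
  have e: "av n r - zv n r = (av n r - av n 0 + \<i> * complex_of_real lam * (LINT \<tau>|ivl r. A (av n \<tau>))) - \<i> * complex_of_real lam * (LINT \<tau>|ivl r. A (av n \<tau>) - A (zv n \<tau>))"
  proof -
    have "zv n r = av n 0 - \<i> * complex_of_real lam * (LINT \<tau>|ivl r. A (zv n \<tau>))"
      unfolding A_def by (rule zv_eq[OF r])
    then show ?thesis unfolding Bochner_Integration.integral_diff[OF i1 i2] by (simp add: algebra_simps)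
  qed
  have "norm (av n r - zv n r) \<le> norm (av n r - av n 0 + \<i> * complex_of_real lam * (LINT \<tau>|ivl r. A (av n \<tau>))) + norm (\<i> * complex_of_real lam * (LINT \<tau>|ivl r. A (av n \<tau>) - A (zv n \<tau>)))"
    by (subst e) (rule norm_triangle_ineq4)
  also have "\<dots> \<le> \<Gamma> + 6 * lam * E\<^sup>2 * (LINT \<tau>|ivl r. norm (av n \<tau> - zv n \<tau>))"
  proof (rule add_mono)
    show "norm (av n r - av n 0 + \<i> * complex_of_real lam * (LINT \<tau>|ivl r. A (av n \<tau>))) \<le> \<Gamma>"
      using n[OF r] by (simp only: A_def)
    have "norm (\<i> * complex_of_real lam * (LINT \<tau>|ivl r. A (av n \<tau>) - A (zv n \<tau>))) = lam * norm (LINT \<tau>|ivl r. A (av n \<tau>) - A (zv n \<tau>))"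
      using lam0 by (simp add: norm_mult)
    also have "\<dots> \<le> lam * (LINT \<tau>|ivl r. norm (A (av n \<tau>) - A (zv n \<tau>)))"
      by (intro mult_left_mono integral_norm_bound lam0)
    also have "\<dots> \<le> lam * (LINT \<tau>|ivl r. 6 * E\<^sup>2 * norm (av n \<tau> - zv n \<tau>))"
    proof (intro mult_left_mono integral_mono lam0)
      show "integrable (ivl r) (\<lambda>\<tau>. norm (A (av n \<tau>) - A (zv n \<tau>)))" using i1 i2 by auto
      show "integrable (ivl r) (\<lambda>\<tau>. 6 * E\<^sup>2 * norm (av n \<tau> - zv n \<tau>))"
        by (intro integrable_ivl_continuous continuous_intros ac zc)
      fix \<tau> assume "\<tau> \<in> space (ivl r)"
      then have \<tau>: "\<tau> \<in> {0..T}" using r by auto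
      let ?a = "av n \<tau>" and ?z = "zv n \<tau>"
      have za: "norm ?a \<le> E" "norm ?z \<le> E" using sq_bounded_le[OF sq_av[OF \<tau>] E0] sq_bounded_le[OF sq_av[of 0] E0, of n] T_pos by (auto simp: norm_zv)
      have "A ?a - A ?z = complex_of_real (2 * mass) * (?a - ?z) - (cubic ?a - cubic ?z)"
        by (simp add: A_def cubic_def algebra_simps)
      also have "norm \<dots> \<le> 2 * mass * norm (?a - ?z) + 2 * ((norm ?a)\<^sup>2 + (norm ?z)\<^sup>2) * norm (?a - ?z)"
        by (rule order_trans[OF norm_triangle_ineq4], rule add_mono[OF _ cubic_diff]) (use mass_nonneg in \<open>simp add: norm_mult\<close>)
      also have "\<dots> \<le> 2 * E\<^sup>2 * norm (?a - ?z) + 2 * (E\<^sup>2 + E\<^sup>2) * norm (?a - ?z)"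
        using za by (intro add_mono mult_right_mono mult_left_mono mass_le power_mono) auto
      finally show "norm (A ?a - A ?z) \<le> 6 * E\<^sup>2 * norm (?a - ?z)" by (simp add: algebra_simps)
    qed
    finally show "norm (\<i> * complex_of_real lam * (LINT \<tau>|ivl r. A (av n \<tau>) - A (zv n \<tau>))) \<le> 6 * lam * E\<^sup>2 * (LINT \<tau>|ivl r. norm (av n \<tau> - zv n \<tau>))"
      by simp
  qed
  finally show "norm (av n r - zv n r) \<le> \<Gamma> + 6 * lam * E\<^sup>2 * (LINT \<tau>|ivl r. norm (av n \<tau> - zv n \<tau>))" .
qed (use T_pos lam0 in auto)

text \<open>The weight \<open>wt L s\<close> is the weight \<open>japanese n powr s\<close> cut off at height \<open>L\<close>, which makes the
  supremum finite a priori; the bound does not depend on \<open>L\<close>.\<close>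

lemma persistence:
  assumes s: "1/2 \<le> s" "s \<le> 5/8"
    and Cp: "0 < Cp" "\<And>a D L q n. sq_bounded a E \<Longrightarrow> finite D \<Longrightarrow> 0 \<notin> D \<Longrightarrow> 1 \<le> L \<Longrightarrow> 0 \<le> q \<Longrightarrow>
      (\<And>m. wt L s m * a m \<le> q) \<Longrightarrow>
      wt L s n * (\<Sum>k\<in>D. a (n + k) / \<bar>real_of_int k\<bar> * hilb D a (n + k)) \<le> Cp * (1 + q) \<and>
      wt L s n * (hilb D a n)\<^sup>2 \<le> Cp * (1 + q)"
    and init: "\<And>n. norm (av n 0) \<le> japanese n powr (- s)"
    and small: "2 * exp (2 * (6 * lam * E\<^sup>2) * T) * lam * Cp * (E + 2 * lam * \<Phi>) \<le> 1/2"
    and t: "t \<in> {0..T}"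
  shows "norm (av n t) \<le> 3 * japanese n powr (- s)"
proof -
  have bound: "wt L s n * norm (av n t) \<le> 3" if L: "1 \<le> L" and t: "t \<in> {0..T}" for L n t
  proof -
    define S where "S = {wt L s n * norm (av n t) | n t. t \<in> {0..T}}"
    define q where "q = Sup S"
    have bdd: "bdd_above S"
    proof (rule bdd_aboveI[of _ "L powr s * E"])
      fix x assume "x \<in> S"
      then obtain n t where x: "x = wt L s n * norm (av n t)" "t \<in> {0..T}" by (auto simp: S_def)
      have "wt L s n \<le> L powr s" unfolding wt_def using s L japanese_pos[of n] by (intro powr_mono2) auto
      then show "x \<le> L powr s * E" unfolding x using sq_bounded_le[OF sq_av[OF x(2)] E0] by (intro mult_mono) auto
    qed
    have qle: "wt L s n * norm (av n t) \<le> q" if "t \<in> {0..T}" for n t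
      unfolding q_def by (rule cSup_upper[OF _ bdd]) (use that in \<open>auto simp: S_def\<close>)
    have q0: "0 \<le> q" using order_trans[OF mult_nonneg_nonneg[OF wt_nonneg norm_ge_zero] qle[of 0 0]] T_pos by auto
    \<comment> \<open>As \<open>q\<close> is the supremum over all modes and all times at once, no
      continuity argument in time is called for: the data contribute 1, the remainder at most half
      of \<open>1 + q\<close>, and finiteness of \<open>q\<close> gives
      \<open>q \<le> 3\<close>.\<close>
    have "wt L s n * norm (av n t) \<le> 1 + (1 + q) / 2" if t: "t \<in> {0..T}" for n t
    proof -
      have wpos: "0 < wt L s n" unfolding wt_def using L japanese_pos[of n] by simp
      \<comment> \<open>The estimates of the sums are weighted at \<open>n\<close>, the bound
        required by the normal form is not; hence the division by the weight.\<close>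
      define Q where "Q = Cp * (1 + q) / wt L s n"
      have B: "norm (LINT \<tau>|ivl r. nonres M (\<lambda>m. av m \<tau>) n \<tau>) \<le> Q * (E + 2 * lam * \<Phi>)" if r: "r \<in> {0..T}" for M r
      proof -
        interpret tr: modes lam T E "\<lambda>m t. trunc M (\<lambda>m. av m t) m" "\<lambda>m t. trunc M (\<lambda>m. Fv m t) m" fv by (rule modes_trunc)
        show ?thesis unfolding nonres_def \<Phi>_def
        proof (rule tr.normal_form_bound[OF _ offsets(1,2) r])
          fix \<tau> assume \<tau>: "\<tau> \<in> {0..T}"
          define a where "a = (\<lambda>m. norm (trunc M (\<lambda>m. av m \<tau>) m))"
          have wa: "wt L s m * a m \<le> q" for m
            using qle[OF \<tau>, of m] q0 by (auto simp: a_def trunc_def)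
          have sa: "sq_bounded a E" unfolding a_def by (rule tr.sq[OF \<tau>])
          note P = Cp(2)[OF sa offsets(1,2) L q0 wa, of n M]
          have e1: "(\<Sum>j\<in>offsets M. \<Sum>k\<in>offsets M. a (n + j + k) * a (n + k) / (\<bar>real_of_int j\<bar> * \<bar>real_of_int k\<bar>)) = (\<Sum>k\<in>offsets M. a (n + k) / \<bar>real_of_int k\<bar> * hilb (offsets M) a (n + k))"
            unfolding hilb_def sum_distrib_left by (subst sum.swap) (simp add: add_ac mult_ac)
          have e2: "(\<Sum>j\<in>offsets M. \<Sum>k\<in>offsets M. a (n + j) * a (n + k) / (\<bar>real_of_int j\<bar> * \<bar>real_of_int k\<bar>)) = (hilb (offsets M) a n)\<^sup>2"
            unfolding hilb_def power2_eq_square sum_product by (simp add: mult_ac)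
          have "(\<Sum>j\<in>offsets M. \<Sum>k\<in>offsets M. a (n + j + k) * a (n + k) / (\<bar>real_of_int j\<bar> * \<bar>real_of_int k\<bar>)) \<le> Q"
            "(\<Sum>j\<in>offsets M. \<Sum>k\<in>offsets M. a (n + j) * a (n + k) / (\<bar>real_of_int j\<bar> * \<bar>real_of_int k\<bar>)) \<le> Q"
            unfolding e1 e2 Q_def using P wpos by (simp_all add: field_simps)
          then show "(\<Sum>j\<in>offsets M. \<Sum>k\<in>offsets M. norm (trunc M (\<lambda>m. av m \<tau>) (n + j + k)) * norm (trunc M (\<lambda>m. av m \<tau>) (n + k)) / (\<bar>real_of_int j\<bar> * \<bar>real_of_int k\<bar>)) \<le> Q \<and>
             (\<Sum>j\<in>offsets M. \<Sum>k\<in>offsets M. norm (trunc M (\<lambda>m. av m \<tau>) (n + j)) * norm (trunc M (\<lambda>m. av m \<tau>) (n + k)) / (\<bar>real_of_int j\<bar> * \<bar>real_of_int k\<bar>)) \<le> Q"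
            by (simp add: a_def)
        qed
      qed
      have "norm (av n t - zv n t) \<le> 2 * (lam * (Q * (E + 2 * lam * \<Phi>))) * exp (2 * (6 * lam * E\<^sup>2) * T)"
        by (rule modulation_difference[OF normal_form_limit t]) (use B in auto)
      then have "wt L s n * norm (av n t - zv n t) \<le> wt L s n * (2 * (lam * (Q * (E + 2 * lam * \<Phi>))) * exp (2 * (6 * lam * E\<^sup>2) * T))"
        by (intro mult_left_mono wt_nonneg)
      also have "\<dots> = (2 * exp (2 * (6 * lam * E\<^sup>2) * T) * lam * Cp * (E + 2 * lam * \<Phi>)) * (1 + q)"
        using wpos by (simp add: Q_def)
      also have "\<dots> \<le> 1/2 * (1 + q)" using q0 by (intro mult_right_mono small) auto
      finally have d: "wt L s n * norm (av n t - zv n t) \<le> (1 + q) / 2" by simp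
      have "wt L s n \<le> japanese n powr s" unfolding wt_def using s L japanese_pos[of n] by (intro powr_mono2) auto
      then have "wt L s n * norm (zv n t) \<le> japanese n powr s * japanese n powr (- s)"
        unfolding norm_zv using init[of n] by (intro mult_mono) auto
      also have "\<dots> = 1" using japanese_pos[of n] by (simp add: powr_add[symmetric])
      finally have z: "wt L s n * norm (zv n t) \<le> 1" .
      have "norm (av n t) \<le> norm (zv n t) + norm (av n t - zv n t)" using norm_triangle_ineq[of "zv n t" "av n t - zv n t"] by simp
      then have "wt L s n * norm (av n t) \<le> wt L s n * (norm (zv n t) + norm (av n t - zv n t))" by (intro mult_left_mono wt_nonneg)
      then show ?thesis using d z unfolding distrib_left by linarith
    qed
    then have "q \<le> 1 + (1 + q) / 2"
      unfolding q_def by (intro cSup_least) (use T_pos in \<open>auto simp: S_def intro!: exI[of _ 0]\<close>)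
    then have "q \<le> 3" by (simp add: field_simps)
    then show ?thesis using qle[OF t, of n] by linarith
  qed
  \<comment> \<open>At the height \<open>L = japanese n\<close> the cut-off has no effect at
    \<open>n\<close>.\<close>
  have "wt (japanese n) s n * norm (av n t) \<le> 3" by (rule bound[OF japanese_ge_1 t])
  then have "japanese n powr s * norm (av n t) \<le> 3" by (simp add: wt_def)
  then show ?thesis using japanese_pos[of n] by (simp add: powr_minus_divide field_simps)
qed

end

context nls_sol_bound
begin

section \<open>From decay of the modes to smoothing of the error\<close>

lemma inner_tail_le:
  fixes \<beta> :: real
  assumes \<beta>: "0 < \<beta>" and CJ: "\<And>S. finite S \<Longrightarrow> (\<Sum>m\<in>S. japanese m powr (- (1 + \<beta>))) \<le> CJ"
    and a_le: "\<And>n. norm (av n t) \<le> 3 * japanese n powr (- (1/2 + \<beta>))" and t: "t \<in> {0..T}"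
  shows "(LINT x|tor. (norm (v t x - psum (fourier_coeff (v t)) M x))\<^sup>2) \<le> 18 * pi * CJ * (real M + 1) powr (- \<beta>)"
proof -
  let ?R = "\<lambda>M. {-int M..int M}"
  have vt: "square_integrable tor (v t)" using v_sq t by auto
  define B where "B = 18 * pi * CJ * (real M + 1) powr (- \<beta>)"
  have "2 * pi * (\<Sum>n\<in>?R N. (norm (fourier_coeff (v t) n))\<^sup>2) \<le> 2 * pi * (\<Sum>n\<in>?R M. (norm (fourier_coeff (v t) n))\<^sup>2) + B" if "M \<le> N" for N
  proof -
    have sub: "?R M \<subseteq> ?R N" using that by auto
    have "(\<Sum>n\<in>?R N. (norm (fourier_coeff (v t) n))\<^sup>2) = (\<Sum>n\<in>?R N - ?R M. (norm (av n t))\<^sup>2) + (\<Sum>n\<in>?R M. (norm (fourier_coeff (v t) n))\<^sup>2)"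
      unfolding norm_av by (rule sum.subset_diff[OF sub]) simp
    moreover have "(\<Sum>n\<in>?R N - ?R M. (norm (av n t))\<^sup>2) \<le> (\<Sum>n\<in>?R N - ?R M. 9 * (real M + 1) powr (- \<beta>) * japanese n powr (- (1 + \<beta>)))"
    proof (intro sum_mono)
      fix n assume "n \<in> ?R N - ?R M"
      then have "real M + 1 \<le> \<bar>real_of_int n\<bar>" by auto
      then have J: "real M + 1 \<le> japanese n" using japanese_ge_abs[of n] by linarith
      have "(norm (av n t))\<^sup>2 \<le> (3 * japanese n powr (- (1/2 + \<beta>)))\<^sup>2" by (intro power_mono a_le) simp
      also have "\<dots> = 9 * (japanese n powr (- (1/2 + \<beta>)) * japanese n powr (- (1/2 + \<beta>)))" by (simp add: power2_eq_square)
      \<comment> \<open>Of the exponent \<open>1 + 2 * \<beta>\<close>, the part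
        \<open>1 + \<beta>\<close> is kept for summation and \<open>\<beta>\<close> is traded for a
        power of \<open>M\<close>.\<close>
      also have "\<dots> = 9 * (japanese n powr (- \<beta>) * japanese n powr (- (1 + \<beta>)))" unfolding powr_add[symmetric] by (simp add: add_ac)
      also have "\<dots> \<le> 9 * ((real M + 1) powr (- \<beta>) * japanese n powr (- (1 + \<beta>)))"
        using J \<beta> by (intro mult_left_mono mult_right_mono powr_mono2') auto
      finally show "(norm (av n t))\<^sup>2 \<le> 9 * (real M + 1) powr (- \<beta>) * japanese n powr (- (1 + \<beta>))" by simp
    qed
    moreover have "\<dots> \<le> 9 * (real M + 1) powr (- \<beta>) * CJ"
      unfolding sum_distrib_left[symmetric] by (intro mult_left_mono CJ) auto
    ultimately have "(\<Sum>n\<in>?R N. (norm (fourier_coeff (v t) n))\<^sup>2) \<le> 9 * (real M + 1) powr (- \<beta>) * CJ + (\<Sum>n\<in>?R M. (norm (fourier_coeff (v t) n))\<^sup>2)" by linarith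
    then have "2 * pi * (\<Sum>n\<in>?R N. (norm (fourier_coeff (v t) n))\<^sup>2) \<le> 2 * pi * (9 * (real M + 1) powr (- \<beta>) * CJ + (\<Sum>n\<in>?R M. (norm (fourier_coeff (v t) n))\<^sup>2))"
      by (intro mult_left_mono) auto
    then show ?thesis by (simp add: B_def algebra_simps)
  qed
  then have "(LINT x|tor. (norm (v t x))\<^sup>2) \<le> 2 * pi * (\<Sum>n\<in>?R M. (norm (fourier_coeff (v t) n))\<^sup>2) + B"
    by (intro LIMSEQ_le_const2[OF parseval[OF vt]]) auto
  then show ?thesis unfolding parseval_tail[OF vt] B_def by simp
qed

text \<open>The first summand serves \<open>n = 0\<close>. In the second, the last square root comes
  from the L^2 tail integrated over \<open>{0..T}\<close>, and 12 is the constant 2 of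
  \<open>errM_le\<close> times a 6 from \<open>japanese n \<le> 6 * (real M + 1)\<close>.\<close>

definition "\<Phi>1 CJ = \<Phi> + 12 * sqrt Yb * sqrt (18 * pi * CJ * T)"

text \<open>For \<open>\<bar>n\<bar> > 3 M\<close> the frequencies up to \<open>M\<close> do not contribute to mode \<open>n\<close> of the cubic term, so that
  the tail of \<open>v\<close> controls it.\<close>

lemma Fv_decay:
  fixes \<beta> :: real
  assumes \<beta>: "0 < \<beta>" "\<beta> \<le> 1" and CJ: "\<And>S. finite S \<Longrightarrow> (\<Sum>m\<in>S. japanese m powr (- (1 + \<beta>))) \<le> CJ"
    and a_le: "\<And>n t. t \<in> {0..T} \<Longrightarrow> norm (av n t) \<le> 3 * japanese n powr (- (1/2 + \<beta>))"
  shows "(LINT \<tau>|ivl T. norm (Fv n \<tau>)) \<le> \<Phi>1 CJ * japanese n powr (- (\<beta> / 2))"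
proof (cases "n = 0")
  case True
  have CJ0: "0 \<le> CJ" using CJ[of "{}"] by simp
  have "(LINT \<tau>|ivl T. norm (Fv n \<tau>)) \<le> (LINT \<tau>|ivl T. fv \<tau>)"
    by (intro integral_mono integrable_norm Fv_integrable fv_integrable Fv_le)
  also have "\<dots> \<le> \<Phi>1 CJ" using Yb0 T_pos CJ0 by (simp add: \<Phi>1_def \<Phi>_def)
  finally show ?thesis using True by (simp add: japanese_def)
next
  case False
  have CJ0: "0 \<le> CJ" using CJ[of "{}"] by simp
  \<comment> \<open>The largest \<open>M\<close> with \<open>3 * M < |n|\<close>. None exists for
    \<open>n = 0\<close>, which is why that case falls back on the bound without decay.\<close>
  define M where "M = nat ((\<bar>n\<bar> - 1) div 3)"
  have M: "3 * int M < \<bar>n\<bar>" "\<bar>n\<bar> \<le> 3 * (int M + 1)" using False by (auto simp: M_def)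
  define p where "p = (real M + 1) powr (- \<beta>)"
  have R2: "(LINT z|ST. (Rv M z)\<^sup>2) \<le> 18 * pi * CJ * T * p"
  proof -
    have "(LINT z|ST. (Rv M z)\<^sup>2) \<le> (LINT t|ivl T. 18 * pi * CJ * p)"
      unfolding Rv2_fubini
    proof (rule integral_mono)
      show "integrable (ivl T) (\<lambda>t. LINT x|tor. (norm (v t x - psum (fourier_coeff (v t)) M x))\<^sup>2)"
        using pst.integrable_fst'[OF Rv2_integrable[of M]] by (simp add: Rv_def Pv_def)
      fix t assume "t \<in> space (ivl T)"
      then have t: "t \<in> {0..T}" by simp
      show "(LINT x|tor. (norm (v t x - psum (fourier_coeff (v t)) M x))\<^sup>2) \<le> 18 * pi * CJ * p"
        unfolding p_def by (rule inner_tail_le[OF \<beta>(1) CJ a_le[OF t] t])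
    qed simp
    also have "\<dots> = 18 * pi * CJ * T * p" using measure_ivl[of T] T_pos by simp
    finally show ?thesis .
  qed
  have sp: "sqrt p \<le> 6 * japanese n powr (- (\<beta> / 2))"
  proof -
    have J: "japanese n \<le> 6 * (real M + 1)"
    proof -
      have "japanese n \<le> japanese (n + (- n)) + \<bar>real_of_int (- n)\<bar>" by (rule japanese_shift)
      also have "\<dots> = 1 + \<bar>real_of_int n\<bar>" by (simp add: japanese_def)
      also have "\<dots> \<le> 2 * \<bar>real_of_int n\<bar>" using False by linarith
      also have "\<dots> \<le> 6 * (real M + 1)"
      proof -
        have "real_of_int \<bar>n\<bar> \<le> real_of_int (3 * (int M + 1))" using M(2) by (simp only: of_int_le_iff)
        then show ?thesis by simp
      qed
      finally show ?thesis .
    qed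
    have "sqrt p = (real M + 1) powr (- (\<beta> / 2))"
      by (rule real_sqrt_unique) (auto simp: p_def power2_eq_square powr_add[symmetric])
    also have "\<dots> \<le> (japanese n / 6) powr (- (\<beta> / 2))"
      using J \<beta> japanese_pos[of n] by (intro powr_mono2') auto
    also have "\<dots> = 6 powr (\<beta> / 2) * japanese n powr (- (\<beta> / 2))"
      using japanese_pos[of n] by (simp add: powr_divide powr_minus_divide)
    also have "\<dots> \<le> 6 * japanese n powr (- (\<beta> / 2))"
      using powr_mono[of "\<beta> / 2" 1 "6::real"] \<beta> by (intro mult_right_mono) auto
    finally show ?thesis .
  qed
  have "(LINT \<tau>|ivl T. norm (Fv n \<tau>)) \<le> errM M" by (rule Fv_high_le[OF M(1)])
  also have "\<dots> \<le> 2 * sqrt Yb * sqrt (LINT z|ST. (Rv M z)\<^sup>2)" by (rule errM_le)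
  also have "\<dots> \<le> 2 * sqrt Yb * sqrt (18 * pi * CJ * T * p)"
    using R2 Yb0 by (intro mult_left_mono real_sqrt_le_mono) auto
  also have "\<dots> = 2 * sqrt Yb * sqrt (18 * pi * CJ * T) * sqrt p" by (simp only: real_sqrt_mult mult.assoc)
  also have "\<dots> \<le> 2 * sqrt Yb * sqrt (18 * pi * CJ * T) * (6 * japanese n powr (- (\<beta> / 2)))"
    using Yb0 CJ0 T_pos by (intro mult_left_mono sp) auto
  also have "\<dots> = (12 * sqrt Yb * sqrt (18 * pi * CJ * T)) * japanese n powr (- (\<beta> / 2))" by simp
  also have "\<dots> \<le> \<Phi>1 CJ * japanese n powr (- (\<beta> / 2))"
    using Phi0 by (intro mult_right_mono) (auto simp: \<Phi>1_def)
  finally show ?thesis .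
qed

text \<open>The normal form is used again, with the exponent \<open>\<beta> / 2\<close> that
  \<open>Fv_decay\<close> provides for the derivatives. The modes would allow
  \<open>1/2 + \<beta>\<close> but are used with \<open>1/2 + \<beta> / 2\<close>, to fit
  \<open>smoothing_sums_bounded\<close> at the parameter \<open>\<beta> / 2\<close>. The resulting
  exponent exceeds 1, which leaves room for \<open>s > 1/2\<close>.\<close>

lemma smoothing:
  fixes \<beta> :: real
  assumes \<beta>: "0 < \<beta>" "\<beta> \<le> 1" and CJ: "\<And>S. finite S \<Longrightarrow> (\<Sum>m\<in>S. japanese m powr (- (1 + \<beta>))) \<le> CJ"
    and Cs: "0 < Cs" "\<And>D n. finite D \<Longrightarrow> 0 \<notin> D \<Longrightarrow>
     (\<Sum>k\<in>D. \<Sum>j\<in>D. japanese (n + j) powr (- (\<beta>/2)) * japanese (n + j + k) powr (- (1/2 + \<beta>/2)) * japanese (n + k) powr (- (1/2 + \<beta>/2))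
        / (\<bar>real_of_int j\<bar> * \<bar>real_of_int k\<bar>)) \<le> Cs * japanese n powr (- (1 + \<beta>/2 / 2)) \<and>
     (\<Sum>k\<in>D. \<Sum>j\<in>D. japanese (n + j) powr (- (1/2 + \<beta>/2)) * japanese (n + j + k) powr (- (\<beta>/2)) * japanese (n + k) powr (- (1/2 + \<beta>/2))
        / (\<bar>real_of_int j\<bar> * \<bar>real_of_int k\<bar>)) \<le> Cs * japanese n powr (- (1 + \<beta>/2 / 2))"
    and a_le: "\<And>n t. t \<in> {0..T} \<Longrightarrow> norm (av n t) \<le> 3 * japanese n powr (- (1/2 + \<beta>))"
    and t: "t \<in> {0..T}"
  shows "norm (av n t - zv n t) \<le> 2 * (lam * (Cs * japanese n powr (- (1 + \<beta>/2 / 2)) * (3 ^ 3 + 2 * lam * \<bar>\<Phi>1 CJ\<bar> * 3\<^sup>2))) * exp (2 * (6 * lam * E\<^sup>2) * T)"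
proof (rule modulation_difference[OF normal_form_limit t])
  fix r M assume r: "r \<in> {0..T}"
  interpret tr: modes lam T E "\<lambda>m t. trunc M (\<lambda>m. av m t) m" "\<lambda>m t. trunc M (\<lambda>m. Fv m t) m" fv by (rule modes_trunc)
  have P1: "0 \<le> \<Phi>1 CJ" using Phi0 Yb0 T_pos CJ[of "{}"] by (auto simp: \<Phi>1_def)
  show "norm (LINT \<tau>|ivl r. nonres M (\<lambda>m. av m \<tau>) n \<tau>) \<le> Cs * japanese n powr (- (1 + \<beta>/2 / 2)) * (3 ^ 3 + 2 * lam * \<bar>\<Phi>1 CJ\<bar> * 3\<^sup>2)"
    unfolding nonres_def
  proof (rule tr.normal_form_bound_smooth[where w = "\<lambda>n. japanese n powr (- (1/2 + \<beta>/2))" and W = "\<lambda>n. japanese n powr (- (\<beta>/2))", OF _ _ _ _ _ _ _ offsets(1,2) r])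
    fix m \<tau> assume \<tau>: "\<tau> \<in> {0..T}"
    have "norm (trunc M (\<lambda>m. av m \<tau>) m) \<le> norm (av m \<tau>)" by (simp add: trunc_def)
    also have "\<dots> \<le> 3 * japanese m powr (- (1/2 + \<beta>))" by (rule a_le[OF \<tau>])
    also have "\<dots> \<le> 3 * japanese m powr (- (1/2 + \<beta>/2))" using \<beta> japanese_ge_1[of m] by (intro mult_left_mono powr_mono) auto
    finally show "norm (trunc M (\<lambda>m. av m \<tau>) m) \<le> 3 * japanese m powr (- (1/2 + \<beta>/2))" .
  next
    fix m
    have "(LINT \<tau>|ivl T. norm (trunc M (\<lambda>m. Fv m \<tau>) m)) \<le> (LINT \<tau>|ivl T. norm (Fv m \<tau>))"
      by (intro integral_mono integrable_norm Fv_integrable tr.F_int) (auto simp: trunc_def)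
    also have "\<dots> \<le> \<Phi>1 CJ * japanese m powr (- (\<beta>/2))" by (rule Fv_decay[OF \<beta> CJ a_le])
    finally show "(LINT \<tau>|ivl T. norm (trunc M (\<lambda>m. Fv m \<tau>) m)) \<le> \<Phi>1 CJ * japanese m powr (- (\<beta>/2))" .
  next
    fix m show "japanese m powr (- (1/2 + \<beta>/2)) \<le> japanese m powr (- (\<beta>/2))"
      using japanese_ge_1[of m] by (intro powr_mono) auto
  qed (use Cs(2)[OF offsets(1,2), of n M] in auto)
qed

end

text \<open>The deterministic core, for data of size one. The constants depend on
  \<open>\<beta>\<close> and \<open>\<kappa>\<close> only, so \<open>T\<close> may be as large as
  \<open>\<kappa>\<close> divided by the coupling.\<close>

theorem nls_modulated_approximation:
  fixes \<beta> \<kappa> :: real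
  assumes \<beta>: "0 < \<beta>" "\<beta> \<le> 1/8" and \<kappa>: "0 < \<kappa>"
  shows "\<exists>C>0. \<exists>\<rho>>0. \<forall>eps T u0 v. nls_solution eps u0 v \<and> eps\<^sup>2 \<le> \<rho> \<and> 0 < T \<and> eps\<^sup>2 * T \<le> \<kappa> \<and>
      (\<forall>n. norm (fourier_coeff u0 n) \<le> japanese n powr (- (1/2 + \<beta>))) \<longrightarrow>
      (\<forall>t\<in>{0..T}. \<forall>n. norm (fourier_coeff (v t) n -
         cis (- (t * (of_int n)\<^sup>2) - eps\<^sup>2 * (2 * ((L2_norm u0)\<^sup>2 / (2 * pi)) - (norm (fourier_coeff u0 n))\<^sup>2) * t) * fourier_coeff u0 n)
       \<le> C * eps\<^sup>2 * japanese n powr (- (1 + \<beta> / 4)))"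
proof -
  define s where "s = 1/2 + \<beta>"
  have s: "1/2 \<le> s" "s \<le> 5/8" using \<beta> by (auto simp: s_def)
  obtain CJ where CJ: "0 < CJ" "\<And>S. finite S \<Longrightarrow> (\<Sum>m\<in>S. japanese m powr (- (1 + \<beta>))) \<le> CJ"
    using japanese_powr_sum_bounded[of "1 + \<beta>"] \<beta> by auto
  \<comment> \<open>The pointwise bound on the initial coefficients fixes the mass: their squares
    sum to at most \<open>CJ\<close>.\<close>
  define E where "E = sqrt CJ"
  have E: "0 < E" "E\<^sup>2 = CJ" using CJ(1) by (auto simp: E_def)
  obtain Cp where Cp: "0 < Cp" "\<And>a D L q n. sq_bounded a E \<Longrightarrow> finite D \<Longrightarrow> 0 \<notin> D \<Longrightarrow> 1 \<le> L \<Longrightarrow> 0 \<le> q \<Longrightarrow>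
      (\<And>m. wt L s m * a m \<le> q) \<Longrightarrow>
      wt L s n * (\<Sum>k\<in>D. a (n + k) / \<bar>real_of_int k\<bar> * hilb D a (n + k)) \<le> Cp * (1 + q) \<and>
      wt L s n * (hilb D a n)\<^sup>2 \<le> Cp * (1 + q)"
    using persistence_sums_bounded[OF s less_imp_le[OF E(1)]] by blast
  obtain Cs where Cs: "0 < Cs" "\<And>D n. finite D \<Longrightarrow> 0 \<notin> D \<Longrightarrow>
     (\<Sum>k\<in>D. \<Sum>j\<in>D. japanese (n + j) powr (- (\<beta>/2)) * japanese (n + j + k) powr (- (1/2 + \<beta>/2)) * japanese (n + k) powr (- (1/2 + \<beta>/2))
        / (\<bar>real_of_int j\<bar> * \<bar>real_of_int k\<bar>)) \<le> Cs * japanese n powr (- (1 + \<beta>/2 / 2)) \<and>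
     (\<Sum>k\<in>D. \<Sum>j\<in>D. japanese (n + j) powr (- (1/2 + \<beta>/2)) * japanese (n + j + k) powr (- (\<beta>/2)) * japanese (n + k) powr (- (1/2 + \<beta>/2))
        / (\<bar>real_of_int j\<bar> * \<bar>real_of_int k\<bar>)) \<le> Cs * japanese n powr (- (1 + \<beta>/2 / 2))"
    using smoothing_sums_bounded[of "\<beta>/2"] \<beta> by auto
  define K where "K = quad_const * E ^ 3"
  \<comment> \<open>\<open>P\<close> will bound \<open>lam * \<Phi>\<close> and
    \<open>lam * Yb\<close>, \<open>G\<close> the Gronwall factor, and \<open>Q\<close> the product
    of \<open>lam\<close> with \<open>\<Phi>1\<close>; all three rely on
    \<open>lam * T \<le> \<kappa>\<close>.\<close>
  define P where "P = 2 * (2 * pi * K * E + 4 * pi * E ^ 4 + E\<^sup>2) * (1 + \<kappa>)"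
  define G where "G = exp (12 * E\<^sup>2 * \<kappa>)"
  define Q where "Q = P + 12 * sqrt P * sqrt (18 * pi * CJ * \<kappa>)"
  define C where "C = 2 * Cs * (27 + 18 * Q) * G"
  \<comment> \<open>Three smallness conditions: \<open>lam \<le> 1\<close>, the absorption in
    \<open>Phi_Yb_le\<close>, and the hypothesis of \<open>persistence\<close>.\<close>
  define \<rho> where "\<rho> = min 1 (min (1 / (8 * pi * K)) (1 / (4 * G * Cp * (E + 2 * P))))"
  have K0: "0 < K" using quad_const E by (simp add: K_def)
  have P0: "0 < P" using K0 E \<kappa> unfolding P_def by (intro mult_pos_pos add_pos_pos) auto
  have G0: "0 < G" by (simp add: G_def)
  have Q0: "0 < Q" using P0 CJ(1) \<kappa> by (auto simp: Q_def intro!: add_pos_nonneg)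
  have "0 < C" using Cs(1) Q0 G0 by (simp add: C_def add_pos_pos)
  moreover have "0 < \<rho>" using K0 G0 Cp(1) E P0 by (simp add: \<rho>_def add_pos_pos)
  moreover have "norm (fourier_coeff (v t) n -
         cis (- (t * (of_int n)\<^sup>2) - eps\<^sup>2 * (2 * ((L2_norm u0)\<^sup>2 / (2 * pi)) - (norm (fourier_coeff u0 n))\<^sup>2) * t) * fourier_coeff u0 n)
       \<le> C * eps\<^sup>2 * japanese n powr (- (1 + \<beta> / 4))"
    if h: "nls_solution eps u0 v" "eps\<^sup>2 \<le> \<rho>" "0 < T" "eps\<^sup>2 * T \<le> \<kappa>"
      "\<And>n. norm (fourier_coeff u0 n) \<le> japanese n powr (- (1/2 + \<beta>))" and t: "t \<in> {0..T}"
    for eps T u0 v t n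
  proof -
    interpret N: nls_sol eps T u0 v by unfold_locales (use h in auto)
    have L2u0: "L2_norm u0 \<le> sqrt (2 * pi) * E"
    proof -
      have u0: "square_integrable tor u0" using h(1) by (auto simp: nls_solution_def L2_torus_iff)
      have "2 * pi * (\<Sum>n\<in>{-int M..int M}. (norm (fourier_coeff u0 n))\<^sup>2) \<le> 2 * pi * CJ" for M
      proof -
        have "(\<Sum>n\<in>{-int M..int M}. (norm (fourier_coeff u0 n))\<^sup>2) \<le> (\<Sum>n\<in>{-int M..int M}. japanese n powr (- (1 + \<beta>)))"
        proof (rule sum_mono)
          fix n
          have "(norm (fourier_coeff u0 n))\<^sup>2 \<le> (japanese n powr (- (1/2 + \<beta>)))\<^sup>2" by (intro power_mono h(5)) simp
          also have "\<dots> = japanese n powr (- (1 + 2 * \<beta>))" by (simp add: power2_eq_square powr_add[symmetric])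
          also have "\<dots> \<le> japanese n powr (- (1 + \<beta>))" using \<beta> japanese_ge_1[of n] by (intro powr_mono) auto
          finally show "(norm (fourier_coeff u0 n))\<^sup>2 \<le> japanese n powr (- (1 + \<beta>))" .
        qed
        also have "\<dots> \<le> CJ" by (rule CJ(2)) simp
        finally show ?thesis by simp
      qed
      then have "(LINT x|tor. (norm (u0 x))\<^sup>2) \<le> 2 * pi * CJ"
        by (intro LIMSEQ_le_const2[OF parseval[OF u0]]) auto
      then show ?thesis unfolding L2_norm_eq E_def by (simp add: real_sqrt_mult[symmetric])
    qed
    \<comment> \<open>The uncontrolled bound \<open>E'\<close> gives access to conservation of mass,
      which then makes \<open>E\<close> an admissible bound at all times.\<close>
    obtain E' where E': "0 \<le> E'" "\<And>t. t \<in> {0..T} \<Longrightarrow> L2_norm (v t) \<le> E'" using N.L2_bounded by auto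
    interpret N': nls_sol_bound eps T u0 v "E' / sqrt (2 * pi)"
      by unfold_locales (use E' in auto)
    have cons: "L2_norm (v t) = L2_norm u0" if "t \<in> {0..T}" for t
      using N'.mass_conservation[OF that] by (simp add: L2_norm_eq)
    interpret B: nls_sol_bound eps T u0 v E
      by unfold_locales (use E L2u0 cons in auto)
    have lam: "N.lam = eps\<^sup>2" by (rule N.lam_def)
    have lam01: "0 \<le> N.lam" "N.lam \<le> 1" using h(2) by (auto simp: lam \<rho>_def)
    have KK: "B.K4 = K" by (simp add: B.K4_def K_def)
    have "8 * pi * K * N.lam \<le> 1"
    proof -
      have "N.lam \<le> 1 / (8 * pi * K)" using h(2) by (simp add: lam \<rho>_def)
      then show ?thesis using K0 by (simp add: field_simps)
    qed
    then have small: "8 * pi * B.K4 * N.lam \<le> 1" by (simp add: KK)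
    have lT: "N.lam * (1 + T) \<le> 1 + \<kappa>" using lam01 h(4) by (simp add: lam distrib_left)
    have lamP: "N.lam * x \<le> P" if "x \<le> 2 * (2 * pi * B.K4 * E + 4 * pi * E ^ 4 + E\<^sup>2) * (1 + T)" for x
    proof -
      have "N.lam * x \<le> N.lam * (2 * (2 * pi * K * E + 4 * pi * E ^ 4 + E\<^sup>2) * (1 + T))"
        using that lam01 unfolding KK by (intro mult_left_mono) auto
      also have "\<dots> = 2 * (2 * pi * K * E + 4 * pi * E ^ 4 + E\<^sup>2) * (N.lam * (1 + T))" by simp
      also have "\<dots> \<le> P" unfolding P_def using K0 E by (intro mult_left_mono lT mult_nonneg_nonneg add_nonneg_nonneg) auto
      finally show ?thesis .
    qed
    have lPhi: "N.lam * B.\<Phi> \<le> P" by (rule lamP[OF B.Phi_Yb_le(1)[OF small]])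
    have lYb: "N.lam * B.Yb \<le> P" by (rule lamP[OF B.Phi_Yb_le(2)[OF small]])
    have expG: "exp (2 * (6 * N.lam * E\<^sup>2) * T) \<le> G"
    proof -
      have "2 * (6 * N.lam * E\<^sup>2) * T = 12 * E\<^sup>2 * (N.lam * T)" by simp
      also have "\<dots> \<le> 12 * E\<^sup>2 * \<kappa>" using h(4) by (intro mult_left_mono) (auto simp: lam)
      finally show ?thesis unfolding G_def by simp
    qed
    have a_le: "norm (N.av n t) \<le> 3 * japanese n powr (- (1/2 + \<beta>))" if t: "t \<in> {0..T}" for n t
      unfolding s_def[symmetric]
    proof (rule B.persistence[OF s Cp _ _ t])
      show "norm (N.av n 0) \<le> japanese n powr (- s)" for n using h(5) by (simp add: N.av_0 s_def)
      have eP: "0 \<le> E + 2 * N.lam * B.\<Phi>" "E + 2 * N.lam * B.\<Phi> \<le> E + 2 * P"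
        using lPhi E mult_nonneg_nonneg[OF lam01(1) B.Phi0] by linarith+
      have "2 * exp (2 * (6 * N.lam * E\<^sup>2) * T) * N.lam * Cp * (E + 2 * N.lam * B.\<Phi>) \<le> 2 * G * N.lam * Cp * (E + 2 * P)"
        using Cp(1) lam01 G0 by (intro mult_mono expG eP) auto
      also have "\<dots> \<le> 1/2"
      proof -
        have "N.lam \<le> 1 / (4 * G * Cp * (E + 2 * P))" using h(2) by (simp add: lam \<rho>_def)
        moreover have "0 < 4 * G * Cp * (E + 2 * P)" using G0 Cp(1) E P0 by (intro mult_pos_pos add_pos_pos) auto
        ultimately have "N.lam * (4 * G * Cp * (E + 2 * P)) \<le> 1" by (simp only: pos_le_divide_eq)
        then show ?thesis by (simp add: mult_ac)
      qed
      finally show "2 * exp (2 * (6 * N.lam * E\<^sup>2) * T) * N.lam * Cp * (E + 2 * N.lam * B.\<Phi>) \<le> 1/2" .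
    qed
    have P1: "0 \<le> B.\<Phi>1 CJ" using B.Phi0 B.Yb0 h(3) CJ(1) by (auto simp: B.\<Phi>1_def)
    have lP1: "N.lam * B.\<Phi>1 CJ \<le> Q"
    proof -
      have "N.lam * (sqrt B.Yb * sqrt (18 * pi * CJ * T)) = sqrt (N.lam * B.Yb) * sqrt (18 * pi * CJ * (N.lam * T))"
        using lam01 by (simp add: real_sqrt_mult mult_ac)
      also have "\<dots> \<le> sqrt P * sqrt (18 * pi * CJ * \<kappa>)"
        using lYb h(4) CJ(1) P0 lam01 h(3) by (intro mult_mono real_sqrt_le_mono mult_left_mono) (auto simp: lam)
      finally show ?thesis using lPhi by (simp add: B.\<Phi>1_def Q_def distrib_left)
    qed
    have "norm (N.av n t - B.zv n t) \<le> 2 * (N.lam * (Cs * japanese n powr (- (1 + \<beta>/2 / 2)) * (3 ^ 3 + 2 * N.lam * \<bar>B.\<Phi>1 CJ\<bar> * 3\<^sup>2))) * exp (2 * (6 * N.lam * E\<^sup>2) * T)"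
      by (rule B.smoothing[OF \<beta>(1) _ CJ(2) Cs a_le t]) (use \<beta> in auto)
    also have "\<dots> \<le> 2 * (N.lam * (Cs * japanese n powr (- (1 + \<beta>/2 / 2)) * (27 + 18 * Q))) * G"
      using lP1 P1 Cs(1) lam01 Q0 by (intro mult_mono expG mult_left_mono) (auto intro!: mult_nonneg_nonneg add_nonneg_nonneg)
    also have "\<dots> = C * eps\<^sup>2 * japanese n powr (- (1 + \<beta> / 4))" by (simp add: C_def lam)
    finally have main: "norm (N.av n t - B.zv n t) \<le> C * eps\<^sup>2 * japanese n powr (- (1 + \<beta> / 4))" .
    have z: "cis (- (t * (of_int n)\<^sup>2)) * B.zv n t = cis (- (t * (of_int n)\<^sup>2) - eps\<^sup>2 * (2 * ((L2_norm u0)\<^sup>2 / (2 * pi)) - (norm (fourier_coeff u0 n))\<^sup>2) * t) * fourier_coeff u0 n"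
      unfolding B.zv_def N.av_0 B.mass_def lam mult.assoc[symmetric] cis_mult by simp
    have "fourier_coeff (v t) n - cis (- (t * (of_int n)\<^sup>2)) * B.zv n t = cis (- (t * (of_int n)\<^sup>2)) * (N.av n t - B.zv n t)"
      unfolding B.coeff_av by (simp add: algebra_simps)
    then have "norm (fourier_coeff (v t) n - cis (- (t * (of_int n)\<^sup>2)) * B.zv n t) = norm (N.av n t - B.zv n t)"
      by (simp add: norm_mult)
    then show ?thesis using main unfolding z by simp
  qed
  ultimately show ?thesis by (intro exI[of _ C] conjI exI[of _ \<rho>]) blast+
qed

section \<open>Scaling and the Sobolev norm of the error\<close>

lemma L2_norm_cmult: "L2_norm (\<lambda>x. c * f x) = norm c * L2_norm f"
  by (simp add: L2_norm_def norm_mult power_mult_distrib real_sqrt_mult)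

text \<open>Homogeneity of the cubic term: dividing the solution by \<open>R\<close> multiplies the
  coupling by the square of \<open>R\<close>.\<close>

lemma nls_solution_scale:
  assumes "nls_solution eps f u" and R: "0 < R"
  shows "nls_solution (eps * R) (\<lambda>x. complex_of_real (1 / R) * f x) (\<lambda>t x. complex_of_real (1 / R) * u t x)"
proof -
  let ?c = "complex_of_real (1 / R)"
  have tor: "L2_torus (\<lambda>x. ?c * h x)" if "L2_torus h" for h
    using that unfolding L2_torus_iff by (rule square_integrable_cmult)
  have u: "L2_torus f" "set_borel_measurable lborel ({0..} \<times> {0..2*pi}) (\<lambda>(t, x). u t x)"
    "\<And>t. 0 \<le> t \<Longrightarrow> L2_torus (u t)"
    "\<And>t. 0 \<le> t \<Longrightarrow> ((\<lambda>r. L2_norm (\<lambda>x. u r x - u t x)) \<longlongrightarrow> 0) (at t within {0..})"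
    "\<And>t. 0 \<le> t \<Longrightarrow> set_integrable lborel ({0..t} \<times> {0..2*pi}) (\<lambda>(\<tau>, x). norm (u \<tau> x) ^ 4)"
    "\<And>t n. 0 \<le> t \<Longrightarrow> fourier_coeff (u t) n =
        cis (- (t * (of_int n)\<^sup>2)) * fourier_coeff f n
        - \<i> * complex_of_real (eps\<^sup>2) *
          (LINT \<tau>:{0..t}|lborel. cis (- ((t - \<tau>) * (of_int n)\<^sup>2)) *
             fourier_coeff (\<lambda>x. complex_of_real ((norm (u \<tau> x))\<^sup>2) * u \<tau> x) n)"
    using assms(1) unfolding nls_solution_def by blast+
  have "set_borel_measurable lborel ({0..} \<times> {0..2*pi}) (\<lambda>(t, x). ?c * u t x)"
  proof -
    have "(\<lambda>p. ?c * (indicator ({0..} \<times> {0..2*pi}) p *\<^sub>R (case p of (t, x) \<Rightarrow> u t x))) \<in> borel_measurable lborel"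
      using u(2) unfolding set_borel_measurable_def by (rule borel_measurable_times[OF borel_measurable_const])
    then show ?thesis unfolding set_borel_measurable_def by (simp add: case_prod_unfold)
  qed
  moreover have "((\<lambda>r. L2_norm (\<lambda>x. ?c * u r x - ?c * u t x)) \<longlongrightarrow> 0) (at t within {0..})" if "0 \<le> t" for t
  proof -
    have "((\<lambda>r. norm ?c * L2_norm (\<lambda>x. u r x - u t x)) \<longlongrightarrow> norm ?c * 0) (at t within {0..})"
      by (rule tendsto_mult_left[OF u(4)[OF that]])
    then show ?thesis unfolding right_diff_distrib[symmetric] L2_norm_cmult by simp
  qed
  moreover have "set_integrable lborel ({0..t} \<times> {0..2*pi}) (\<lambda>(\<tau>, x). norm (?c * u \<tau> x) ^ 4)" if "0 \<le> t" for t
  proof -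
    have "set_integrable lborel ({0..t} \<times> {0..2*pi}) (\<lambda>p. norm ?c ^ 4 * (case p of (\<tau>, x) \<Rightarrow> norm (u \<tau> x) ^ 4))"
      by (rule set_integrable_mult_right) (use u(5)[OF that] in simp)
    then show ?thesis unfolding norm_mult power_mult_distrib by (simp only: case_prod_unfold)
  qed
  moreover have "fourier_coeff (\<lambda>x. ?c * u t x) n =
        cis (- (t * (of_int n)\<^sup>2)) * fourier_coeff (\<lambda>x. ?c * f x) n
        - \<i> * complex_of_real ((eps * R)\<^sup>2) *
          (LINT \<tau>:{0..t}|lborel. cis (- ((t - \<tau>) * (of_int n)\<^sup>2)) *
             fourier_coeff (\<lambda>x. complex_of_real ((norm (?c * u \<tau> x))\<^sup>2) * (?c * u \<tau> x)) n)" if "0 \<le> t" for t n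
  proof -
    have "(\<lambda>x. complex_of_real ((norm (?c * u \<tau> x))\<^sup>2) * (?c * u \<tau> x)) =
       (\<lambda>x. ?c ^ 3 * (complex_of_real ((norm (u \<tau> x))\<^sup>2) * u \<tau> x))" for \<tau>
      using R by (simp add: norm_mult norm_divide power_mult_distrib power_divide power3_eq_cube power2_eq_square mult_ac)
    then have cube: "fourier_coeff (\<lambda>x. complex_of_real ((norm (?c * u \<tau> x))\<^sup>2) * (?c * u \<tau> x)) n =
        ?c ^ 3 * fourier_coeff (\<lambda>x. complex_of_real ((norm (u \<tau> x))\<^sup>2) * u \<tau> x) n" for \<tau>
      by (simp only: fourier_coeff_cmult)
    let ?I = "LINT \<tau>:{0..t}|lborel. cis (- ((t - \<tau>) * (of_int n)\<^sup>2)) *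
             fourier_coeff (\<lambda>x. complex_of_real ((norm (u \<tau> x))\<^sup>2) * u \<tau> x) n"
    have "(LINT \<tau>:{0..t}|lborel. cis (- ((t - \<tau>) * (of_int n)\<^sup>2)) *
             fourier_coeff (\<lambda>x. complex_of_real ((norm (?c * u \<tau> x))\<^sup>2) * (?c * u \<tau> x)) n) = ?c ^ 3 * ?I"
      unfolding cube mult.left_commute[of _ "?c ^ 3"] by (rule set_integral_mult_right)
    moreover have "complex_of_real ((eps * R)\<^sup>2) * ?c ^ 3 = ?c * complex_of_real (eps\<^sup>2)"
      using R by (simp add: power_mult_distrib power2_eq_square power3_eq_cube field_simps)
    ultimately show ?thesis unfolding fourier_coeff_cmult u(6)[OF that]
      by (simp add: right_diff_distrib mult_ac) (simp add: mult.assoc[symmetric])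
  qed
  ultimately show ?thesis using tor[OF u(1)] tor[OF u(3)] unfolding nls_solution_def by blast
qed

lemma nls_modulated_approximation_scaled:
  fixes \<beta> \<kappa> :: real
  assumes \<beta>: "0 < \<beta>" "\<beta> \<le> 1/8" and \<kappa>: "0 < \<kappa>"
  obtains C \<rho> where "0 < C" "0 < \<rho>"
    "\<And>eps R T f u t n. \<lbrakk>nls_solution eps f u; 0 < R; (eps * R)\<^sup>2 \<le> \<rho>; 0 < T; (eps * R)\<^sup>2 * T \<le> \<kappa>;
       \<And>n. norm (fourier_coeff f n) \<le> R * japanese n powr (- (1/2 + \<beta>)); t \<in> {0..T}\<rbrakk> \<Longrightarrow>
       norm (fourier_coeff (u t) n - cis (- (t * (of_int n)\<^sup>2) - eps\<^sup>2 * (2 * ((L2_norm f)\<^sup>2 / (2 * pi)) - (norm (fourier_coeff f n))\<^sup>2) * t) * fourier_coeff f n)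
       \<le> R * C * (eps * R)\<^sup>2 * japanese n powr (- (1 + \<beta> / 4))"
proof -
  obtain C \<rho> where C: "0 < C" "0 < \<rho>" and *: "\<And>eps T u0 v. nls_solution eps u0 v \<and> eps\<^sup>2 \<le> \<rho> \<and> 0 < T \<and> eps\<^sup>2 * T \<le> \<kappa> \<and>
      (\<forall>n. norm (fourier_coeff u0 n) \<le> japanese n powr (- (1/2 + \<beta>))) \<longrightarrow>
      (\<forall>t\<in>{0..T}. \<forall>n. norm (fourier_coeff (v t) n -
         cis (- (t * (of_int n)\<^sup>2) - eps\<^sup>2 * (2 * ((L2_norm u0)\<^sup>2 / (2 * pi)) - (norm (fourier_coeff u0 n))\<^sup>2) * t) * fourier_coeff u0 n)
       \<le> C * eps\<^sup>2 * japanese n powr (- (1 + \<beta> / 4)))"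
    using nls_modulated_approximation[OF assms] by metis
  show ?thesis
  proof (rule that[OF C])
    fix eps R T f u t n
    assume h: "nls_solution eps f u" "0 < R" "(eps * R)\<^sup>2 \<le> \<rho>" "0 < T" "(eps * R)\<^sup>2 * T \<le> \<kappa>"
       "\<And>n. norm (fourier_coeff f n) \<le> R * japanese n powr (- (1/2 + \<beta>))" "t \<in> {0..T}"
    let ?c = "complex_of_real (1 / R)"
    have "norm (fourier_coeff (\<lambda>x. ?c * f x) n) \<le> japanese n powr (- (1/2 + \<beta>))" for n
      using h(6)[of n] h(2) unfolding fourier_coeff_cmult norm_mult by (simp add: norm_divide pos_divide_le_eq mult.commute)
    then have "norm (fourier_coeff (\<lambda>x. ?c * u t x) n -
         cis (- (t * (of_int n)\<^sup>2) - (eps * R)\<^sup>2 * (2 * ((L2_norm (\<lambda>x. ?c * f x))\<^sup>2 / (2 * pi)) - (norm (fourier_coeff (\<lambda>x. ?c * f x) n))\<^sup>2) * t) * fourier_coeff (\<lambda>x. ?c * f x) n)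
       \<le> C * (eps * R)\<^sup>2 * japanese n powr (- (1 + \<beta> / 4))"
      using *[of "eps * R" "\<lambda>x. ?c * f x" "\<lambda>t x. ?c * u t x" T] nls_solution_scale[OF h(1,2)] h(3-5,7) by blast
    moreover have "(eps * R)\<^sup>2 * (2 * ((L2_norm (\<lambda>x. ?c * f x))\<^sup>2 / (2 * pi)) - (norm (fourier_coeff (\<lambda>x. ?c * f x) n))\<^sup>2)
        = eps\<^sup>2 * (2 * ((L2_norm f)\<^sup>2 / (2 * pi)) - (norm (fourier_coeff f n))\<^sup>2)"
    proof -
      have "norm ?c = 1 / R" using h(2) by (simp add: norm_divide)
      then show ?thesis using h(2)
        unfolding L2_norm_cmult fourier_coeff_cmult norm_mult \<open>norm ?c = 1 / R\<close> by (simp add: power_mult_distrib power_divide field_simps)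
    qed
    ultimately have "norm (?c * (fourier_coeff (u t) n -
         cis (- (t * (of_int n)\<^sup>2) - eps\<^sup>2 * (2 * ((L2_norm f)\<^sup>2 / (2 * pi)) - (norm (fourier_coeff f n))\<^sup>2) * t) * fourier_coeff f n))
       \<le> C * (eps * R)\<^sup>2 * japanese n powr (- (1 + \<beta> / 4))"
      by (simp only: fourier_coeff_cmult right_diff_distrib mult.left_commute[of ?c])
    moreover have c: "norm ?c = 1 / R" using h(2) by (simp add: norm_divide)
    ultimately show "norm (fourier_coeff (u t) n -
         cis (- (t * (of_int n)\<^sup>2) - eps\<^sup>2 * (2 * ((L2_norm f)\<^sup>2 / (2 * pi)) - (norm (fourier_coeff f n))\<^sup>2) * t) * fourier_coeff f n)
       \<le> R * C * (eps * R)\<^sup>2 * japanese n powr (- (1 + \<beta> / 4))"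
      using h(2) unfolding norm_mult c by (simp add: pos_divide_le_eq mult_ac)
  qed
qed

text \<open>Turns an unordered sum into the limit of a sequence, the form in which measurability
  passes to the sum.\<close>

lemma has_sum_int_symmetric:
  fixes f :: "int \<Rightarrow> 'a::{topological_space, comm_monoid_add}"
  assumes "(f has_sum S) UNIV"
  shows "(\<lambda>N. \<Sum>n\<in>{-int N..int N}. f n) \<longlonglongrightarrow> S"
proof -
  have "filterlim (\<lambda>N. {-int N..int N}) (finite_subsets_at_top UNIV) sequentially"
    unfolding filterlim_finite_subsets_at_top
  proof (intro allI impI)
    fix X :: "int set" assume X: "finite X \<and> X \<subseteq> UNIV"
    then obtain B where B: "\<And>x. x \<in> X \<Longrightarrow> \<bar>x\<bar> \<le> B" using bdd_above_finite[of "abs ` X"] unfolding bdd_above_def by auto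
    show "\<forall>\<^sub>F N in sequentially. finite {-int N..int N} \<and> X \<subseteq> {-int N..int N} \<and> {-int N..int N} \<subseteq> UNIV"
      using eventually_ge_at_top[of "nat B"]
    proof eventually_elim
      case (elim N)
      have "x \<in> {-int N..int N}" if "x \<in> X" for x using B[OF that] elim by auto
      then show ?case by auto
    qed
  qed
  then show ?thesis using assms unfolding has_sum_def by (auto dest: filterlim_compose)
qed

text \<open>A pointwise bound in \<open>t\<close> is not enough: the essential supremum of a
  non-measurable function is infinite by convention, so the norm must also be shown to be measurable
  in \<open>t\<close>.\<close>

lemma Linf_Hs_norm_le:
  assumes bound: "\<And>t n. t \<in> {0..T} \<Longrightarrow> norm (fourier_coeff (w t) n) \<le> D * japanese n powr (- q)"
    and meas: "\<And>n. (\<lambda>t. fourier_coeff (w t) n) \<in> borel_measurable (lebesgue_on {0..T})"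
    and CJ: "\<And>S. finite S \<Longrightarrow> (\<Sum>m\<in>S. japanese m powr (2 * s - 2 * q)) \<le> CJ" and D: "0 \<le> D"
  shows "Linf_Hs_norm s T w \<le> ereal (D * sqrt (2 * pi * CJ))"
proof -
  define f where "f t n = japanese n powr (2 * s) * (norm (fourier_coeff (w t) n))\<^sup>2" for t n
  have f0: "0 \<le> f t n" for t n by (simp add: f_def)
  have sum_le: "sum (f t) S \<le> D\<^sup>2 * CJ" if t: "t \<in> {0..T}" and S: "finite S" for t S
  proof -
    have "f t n \<le> D\<^sup>2 * japanese n powr (2 * s - 2 * q)" for n
    proof -
      have "f t n \<le> japanese n powr (2 * s) * (D * japanese n powr (- q))\<^sup>2"
        unfolding f_def by (intro mult_left_mono power_mono bound t) auto
      also have "\<dots> = D\<^sup>2 * (japanese n powr (2 * s) * (japanese n powr (- q) * japanese n powr (- q)))"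
        by (simp add: power2_eq_square)
      finally show ?thesis unfolding powr_add[symmetric] by simp
    qed
    then have "sum (f t) S \<le> D\<^sup>2 * (\<Sum>n\<in>S. japanese n powr (2 * s - 2 * q))"
      unfolding sum_distrib_left by (intro sum_mono)
    also have "\<dots> \<le> D\<^sup>2 * CJ" by (intro mult_left_mono CJ S) simp
    finally show ?thesis .
  qed
  have summable: "f t summable_on UNIV" if "t \<in> {0..T}" for t
    using sum_le[OF that] f0 by (intro nonneg_bdd_above_summable_on bdd_aboveI2) auto
  have Hs: "Hs_norm s (w t) = ereal (sqrt (2 * pi * (\<Sum>\<^sub>\<infinity>n. f t n)))" if "t \<in> {0..T}" for t
    using summable[OF that] unfolding Hs_norm_def f_def by simp
  have le: "Hs_norm s (w t) \<le> ereal (D * sqrt (2 * pi * CJ))" if t: "t \<in> {0..T}" for t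
  proof -
    have "(\<Sum>\<^sub>\<infinity>n. f t n) \<le> D\<^sup>2 * CJ" by (intro infsum_le_finite_sums summable sum_le t)
    then have "sqrt (2 * pi * (\<Sum>\<^sub>\<infinity>n. f t n)) \<le> sqrt (2 * pi * (D\<^sup>2 * CJ))" by simp
    also have "\<dots> = D * sqrt (2 * pi * CJ)" using D by (simp add: real_sqrt_mult)
    finally show ?thesis unfolding Hs[OF t] by simp
  qed
  have "(\<lambda>t. \<Sum>\<^sub>\<infinity>n. f t n) \<in> borel_measurable (lebesgue_on {0..T})"
  proof (rule borel_measurable_LIMSEQ_real)
    fix t assume "t \<in> space (lebesgue_on {0..T})"
    then show "(\<lambda>N. \<Sum>n\<in>{-int N..int N}. f t n) \<longlonglongrightarrow> (\<Sum>\<^sub>\<infinity>n. f t n)"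
      by (intro has_sum_int_symmetric has_sum_infsum summable) simp
  next
    fix N
    show "(\<lambda>t. \<Sum>n\<in>{-int N..int N}. f t n) \<in> borel_measurable (lebesgue_on {0..T})"
      unfolding f_def using meas by measurable
  qed
  then have "(\<lambda>t. ereal (sqrt (2 * pi * (\<Sum>\<^sub>\<infinity>n. f t n)))) \<in> borel_measurable (lebesgue_on {0..T})"
    by measurable
  then have "(\<lambda>t. Hs_norm s (w t)) \<in> borel_measurable (lebesgue_on {0..T})"
    by (rule measurable_cong[THEN iffD1, rotated]) (simp add: Hs)
  then show ?thesis unfolding Linf_Hs_norm_def by (rule esssup_I) (auto intro!: AE_I2 le)
qed

lemma fourier_coeff_initial_data:
  assumes sq: "\<And>S. finite S \<Longrightarrow> (\<Sum>n\<in>S. (c_coeff \<theta> n * norm (\<gamma> n))\<^sup>2) \<le> B"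
  shows "fourier_coeff (initial_data \<theta> \<gamma>) n = complex_of_real (c_coeff \<theta> n) * \<gamma> n"
  unfolding initial_data_def by (rule trig_series_props[of _ B]) (use sq in \<open>simp add: norm_mult c_coeff_def\<close>)

text \<open>Matches the phase of \<open>u_app\<close> with that of the resonant system:
  \<open>(c_coeff \<theta> n)\<^sup>2 * (norm (\<gamma> n))\<^sup>2\<close> is the squared modulus
  of the initial coefficient, and the global factor carries the mass.\<close>

lemma fourier_coeff_u_app:
  assumes sq: "\<And>S. finite S \<Longrightarrow> (\<Sum>n\<in>S. (c_coeff \<theta> n * norm (\<gamma> n))\<^sup>2) \<le> B"
  shows "square_integrable tor (u_app \<theta> \<gamma> eps t)"
    "fourier_coeff (u_app \<theta> \<gamma> eps t) n = cis (- (t * (of_int n)\<^sup>2) - eps\<^sup>2 * (2 * ((L2_norm (initial_data \<theta> \<gamma>))\<^sup>2 / (2 * pi)) - (norm (fourier_coeff (initial_data \<theta> \<gamma>) n))\<^sup>2) * t) * fourier_coeff (initial_data \<theta> \<gamma>) n"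
proof -
  define a where "a n = complex_of_real (c_coeff \<theta> n) * \<gamma> n * cis (t * eps\<^sup>2 * (c_coeff \<theta> n)\<^sup>2 * (norm (\<gamma> n))\<^sup>2 - t * (of_int n)\<^sup>2)" for n
  define c where "c = cis (- (2 * t * eps\<^sup>2 * (1 / (2*pi)) * (L2_norm (initial_data \<theta> \<gamma>))\<^sup>2))"
  have u: "u_app \<theta> \<gamma> eps t = (\<lambda>x. c * trig_series a x)" unfolding u_app_def a_def c_def ..
  have a: "(\<Sum>n\<in>S. (norm (a n))\<^sup>2) \<le> B" if "finite S" for S
    using sq[OF that] by (simp add: a_def norm_mult c_coeff_def)
  show "square_integrable tor (u_app \<theta> \<gamma> eps t)"
    unfolding u by (intro square_integrable_cmult trig_series_props[OF a])
  have "fourier_coeff (u_app \<theta> \<gamma> eps t) n = c * a n"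
    unfolding u fourier_coeff_cmult by (simp only: trig_series_props(2)[OF a])
  also have "\<dots> = (c * cis (t * eps\<^sup>2 * (c_coeff \<theta> n)\<^sup>2 * (norm (\<gamma> n))\<^sup>2 - t * (of_int n)\<^sup>2)) * (complex_of_real (c_coeff \<theta> n) * \<gamma> n)"
    by (simp add: a_def)
  also have "c * cis (t * eps\<^sup>2 * (c_coeff \<theta> n)\<^sup>2 * (norm (\<gamma> n))\<^sup>2 - t * (of_int n)\<^sup>2) =
      cis (- (t * (of_int n)\<^sup>2) - eps\<^sup>2 * (2 * ((L2_norm (initial_data \<theta> \<gamma>))\<^sup>2 / (2 * pi)) - (norm (complex_of_real (c_coeff \<theta> n) * \<gamma> n))\<^sup>2) * t)"
    unfolding c_def cis_mult by (rule arg_cong[where f = cis]) (simp add: norm_mult power_mult_distrib algebra_simps)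
  finally show "fourier_coeff (u_app \<theta> \<gamma> eps t) n = cis (- (t * (of_int n)\<^sup>2) - eps\<^sup>2 * (2 * ((L2_norm (initial_data \<theta> \<gamma>))\<^sup>2 / (2 * pi)) - (norm (fourier_coeff (initial_data \<theta> \<gamma>) n))\<^sup>2) * t) * fourier_coeff (initial_data \<theta> \<gamma>) n"
    by (simp only: fourier_coeff_initial_data[OF sq])
qed

lemma continuous_on_fourier_coeff_nls:
  assumes "nls_solution eps f u" "0 < T"
  shows "continuous_on {0..T} (\<lambda>t. fourier_coeff (u t) n)"
proof -
  interpret nls_sol eps T f u by unfold_locales (use assms in auto)
  have "continuous_on {0..T} (\<lambda>t. cis (- (t * (of_int n)\<^sup>2)) * av n t)"
    by (intro continuous_intros has_density_continuous[OF av_density])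
  then show ?thesis unfolding av_def mult.assoc[symmetric] cis_mult by simp
qed

lemma nls_u_app_close:
  fixes \<theta> \<kappa> :: real
  assumes \<theta>: "0 < \<theta>" and \<kappa>: "0 < \<kappa>"
  obtains s C \<rho> where "1/2 < s" "0 < C" "0 < \<rho>"
    "\<And>eps R T \<gamma> u. \<lbrakk>nls_solution eps (initial_data \<theta> \<gamma>) u; 0 < R; (eps * R)\<^sup>2 \<le> \<rho>; 0 < T; (eps * R)\<^sup>2 * T \<le> \<kappa>;
       \<And>n. norm (\<gamma> n) \<le> R * japanese n powr (\<theta> / 2)\<rbrakk> \<Longrightarrow>
       Linf_Hs_norm s T (\<lambda>t x. u t x - u_app \<theta> \<gamma> eps t x) \<le> ereal (C * R * (eps * R)\<^sup>2)"
proof -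
  define \<beta> where "\<beta> = min (\<theta> / 2) (1/8)"
  have \<beta>: "0 < \<beta>" "\<beta> \<le> 1/8" "\<beta> \<le> \<theta> / 2" using \<theta> by (auto simp: \<beta>_def)
  obtain C \<rho> where C: "0 < C" "0 < \<rho>" and close:
    "\<And>eps R T f u t n. \<lbrakk>nls_solution eps f u; 0 < R; (eps * R)\<^sup>2 \<le> \<rho>; 0 < T; (eps * R)\<^sup>2 * T \<le> \<kappa>;
       \<And>n. norm (fourier_coeff f n) \<le> R * japanese n powr (- (1/2 + \<beta>)); t \<in> {0..T}\<rbrakk> \<Longrightarrow>
       norm (fourier_coeff (u t) n - cis (- (t * (of_int n)\<^sup>2) - eps\<^sup>2 * (2 * ((L2_norm f)\<^sup>2 / (2 * pi)) - (norm (fourier_coeff f n))\<^sup>2) * t) * fourier_coeff f n)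
       \<le> R * C * (eps * R)\<^sup>2 * japanese n powr (- (1 + \<beta> / 4))"
    using nls_modulated_approximation_scaled[OF \<beta>(1,2) \<kappa>] by metis
  \<comment> \<open>The error has exponent \<open>1 + \<beta> / 4\<close>, so every \<open>s\<close>
    below \<open>1/2 + \<beta> / 4\<close> is possible. The midpoint is taken; the other half of the
    margin makes the sum over the modes converge.\<close>
  define s where "s = 1/2 + \<beta> / 8"
  obtain CJ where CJ: "0 < CJ" "\<And>S. finite S \<Longrightarrow> (\<Sum>m\<in>S. japanese m powr (- (1 + \<beta> / 4))) \<le> CJ"
    using japanese_powr_sum_bounded[of "1 + \<beta> / 4"] \<beta> by auto
  obtain CI where CI: "0 < CI" "\<And>S. finite S \<Longrightarrow> (\<Sum>m\<in>S. japanese m powr (- (1 + 2 * \<beta>))) \<le> CI"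
    using japanese_powr_sum_bounded[of "1 + 2 * \<beta>"] \<beta> by auto
  show ?thesis
  proof (rule that[of s "C * sqrt (2 * pi * CJ)" \<rho>])
    show "1/2 < s" using \<beta> by (simp add: s_def)
    show "0 < C * sqrt (2 * pi * CJ)" using C CJ by simp
    show "0 < \<rho>" by fact
    fix eps R T \<gamma> u
    assume sol: "nls_solution eps (initial_data \<theta> \<gamma>) u" and R: "0 < R" and small: "(eps * R)\<^sup>2 \<le> \<rho>"
      and T: "0 < T" "(eps * R)\<^sup>2 * T \<le> \<kappa>" and \<gamma>: "\<And>n. norm (\<gamma> n) \<le> R * japanese n powr (\<theta> / 2)"
    have coeff: "c_coeff \<theta> n * norm (\<gamma> n) \<le> R * japanese n powr (- (1/2 + \<beta>))" for n
    proof -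
      have "c_coeff \<theta> n * norm (\<gamma> n) \<le> japanese n powr (- (1/2 + \<theta>)) * (R * japanese n powr (\<theta> / 2))"
        unfolding c_coeff_def by (intro mult_left_mono \<gamma>) simp
      also have "\<dots> = R * (japanese n powr (- (1/2 + \<theta>)) * japanese n powr (\<theta> / 2))" by simp
      also have "\<dots> \<le> R * japanese n powr (- (1/2 + \<beta>))"
        unfolding powr_add[symmetric] using R \<beta> japanese_ge_1[of n] by (intro mult_left_mono powr_mono) auto
      finally show ?thesis .
    qed
    have sq: "(\<Sum>n\<in>S. (c_coeff \<theta> n * norm (\<gamma> n))\<^sup>2) \<le> R\<^sup>2 * CI" if S: "finite S" for S
    proof -
      have "(c_coeff \<theta> n * norm (\<gamma> n))\<^sup>2 \<le> R\<^sup>2 * japanese n powr (- (1 + 2 * \<beta>))" for n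
      proof -
        have "(c_coeff \<theta> n * norm (\<gamma> n))\<^sup>2 \<le> (R * japanese n powr (- (1/2 + \<beta>)))\<^sup>2"
          by (intro power_mono coeff) (simp add: c_coeff_def)
        also have "\<dots> = R\<^sup>2 * japanese n powr (- (1 + 2 * \<beta>))" by (simp add: power2_eq_square powr_add[symmetric])
        finally show ?thesis .
      qed
      then have "(\<Sum>n\<in>S. (c_coeff \<theta> n * norm (\<gamma> n))\<^sup>2) \<le> R\<^sup>2 * (\<Sum>n\<in>S. japanese n powr (- (1 + 2 * \<beta>)))"
        unfolding sum_distrib_left by (intro sum_mono)
      also have "\<dots> \<le> R\<^sup>2 * CI" by (intro mult_left_mono CI S) simp
      finally show ?thesis .
    qed
    have f_le: "norm (fourier_coeff (initial_data \<theta> \<gamma>) n) \<le> R * japanese n powr (- (1/2 + \<beta>))" for n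
      using coeff[of n] by (simp add: fourier_coeff_initial_data[OF sq] norm_mult c_coeff_def)
    have app: "fourier_coeff (u_app \<theta> \<gamma> eps t) n = cis (- (t * (of_int n)\<^sup>2) - eps\<^sup>2 * (2 * ((L2_norm (initial_data \<theta> \<gamma>))\<^sup>2 / (2 * pi)) - (norm (fourier_coeff (initial_data \<theta> \<gamma>) n))\<^sup>2) * t) * fourier_coeff (initial_data \<theta> \<gamma>) n" for t n
      by (rule fourier_coeff_u_app(2)) (rule sq)
    have diff: "fourier_coeff (\<lambda>x. u t x - u_app \<theta> \<gamma> eps t x) n = fourier_coeff (u t) n - fourier_coeff (u_app \<theta> \<gamma> eps t) n"
      if "t \<in> {0..T}" for t n
    proof -
      have "square_integrable tor (u t)" using sol that by (auto simp: nls_solution_def L2_torus_iff)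
      then show ?thesis by (intro fourier_coeff_diff tor.integrable_square_integrable fourier_coeff_u_app(1)[OF sq])
    qed
    have "Linf_Hs_norm s T (\<lambda>t x. u t x - u_app \<theta> \<gamma> eps t x) \<le> ereal (R * C * (eps * R)\<^sup>2 * sqrt (2 * pi * CJ))"
    proof (rule Linf_Hs_norm_le)
      show "norm (fourier_coeff (\<lambda>x. u t x - u_app \<theta> \<gamma> eps t x) n) \<le> R * C * (eps * R)\<^sup>2 * japanese n powr (- (1 + \<beta> / 4))"
        if "t \<in> {0..T}" for t n
        using close[OF sol R small T f_le that] unfolding diff[OF that] app .
      show "(\<lambda>t. fourier_coeff (\<lambda>x. u t x - u_app \<theta> \<gamma> eps t x) n) \<in> borel_measurable (lebesgue_on {0..T})" for n
      proof (rule continuous_imp_measurable_on_sets_lebesgue)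
        have "continuous_on {0..T} (\<lambda>t. fourier_coeff (u t) n - fourier_coeff (u_app \<theta> \<gamma> eps t) n)"
          unfolding app
          by (intro continuous_intros continuous_on_fourier_coeff_nls[OF sol T(1)])
        then show "continuous_on {0..T} (\<lambda>t. fourier_coeff (\<lambda>x. u t x - u_app \<theta> \<gamma> eps t x) n)"
          by (rule continuous_on_eq) (simp add: diff)
      qed simp
      show "(\<Sum>m\<in>S. japanese m powr (2 * s - 2 * (1 + \<beta> / 4))) \<le> CJ" if "finite S" for S
        using CJ(2)[OF that] by (simp add: s_def algebra_simps)
      show "0 \<le> R * C * (eps * R)\<^sup>2" using R C by simp
    qed
    then show "Linf_Hs_norm s T (\<lambda>t x. u t x - u_app \<theta> \<gamma> eps t x) \<le> ereal (C * sqrt (2 * pi * CJ) * R * (eps * R)\<^sup>2)"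
      by (simp add: mult_ac)
  qed
qed

section \<open>Gaussian data\<close>

text \<open>A density of variance \<open>1/2\<close> decays like \<open>exp (- x\<^sup>2)\<close>:
  half of this exponent pays for the tail, the other half is a standard normal density up to the
  ratio \<open>sqrt 2\<close> of the normalizing constants.\<close>

lemma normal_tail:
  assumes X: "distributed M lborel X (\<lambda>x. ennreal (normal_density 0 (sqrt (1/2)) x))"
  shows "emeasure M {\<omega> \<in> space M. y < (X \<omega>)\<^sup>2} \<le> ennreal (sqrt 2 * exp (- (y / 2)))"
proof -
  have "emeasure M {\<omega> \<in> space M. y < (X \<omega>)\<^sup>2} = emeasure M (X -` {x. y < x\<^sup>2} \<inter> space M)"
    by (rule arg_cong[where f = "emeasure M"]) auto
  also have "\<dots> = (\<integral>\<^sup>+x. ennreal (normal_density 0 (sqrt (1/2)) x) * indicator {x. y < x\<^sup>2} x \<partial>lborel)"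
    by (rule distributed_emeasure[OF X]) simp
  also have "\<dots> \<le> (\<integral>\<^sup>+x. ennreal (sqrt 2 * exp (- (y / 2))) * ennreal (std_normal_density x) \<partial>lborel)"
  proof (rule nn_integral_mono)
    fix x
    show "ennreal (normal_density 0 (sqrt (1/2)) x) * indicator {x. y < x\<^sup>2} x \<le> ennreal (sqrt 2 * exp (- (y / 2))) * ennreal (std_normal_density x)"
    proof (cases "y < x\<^sup>2")
      case True
      have "exp (- x\<^sup>2) \<le> exp (- (y / 2)) * exp (- x\<^sup>2 / 2)"
        unfolding exp_add[symmetric] using True by simp
      then have "normal_density 0 (sqrt (1/2)) x \<le> sqrt 2 * exp (- (y / 2)) * std_normal_density x"
        by (simp add: normal_density_def real_sqrt_mult field_simps)
      then show ?thesis using True by (simp add: ennreal_mult[symmetric] ennreal_leI)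
    qed simp
  qed
  also have "\<dots> = ennreal (sqrt 2 * exp (- (y / 2))) * (\<integral>\<^sup>+x. ennreal (std_normal_density x) \<partial>lborel)"
    by (rule nn_integral_cmult) simp
  also have "(\<integral>\<^sup>+x. ennreal (std_normal_density x) \<partial>lborel) = 1"
  proof -
    interpret prob_space "density lborel (\<lambda>x. ennreal (std_normal_density x))"
      by (rule prob_space_normal_density) simp
    show ?thesis using emeasure_space_1 by (simp add: emeasure_density)
  qed
  finally show ?thesis by simp
qed

text \<open>The real or the imaginary part must have a square above \<open>x\<^sup>2 / 2\<close>;
  together with the halved exponent in \<open>normal_tail\<close> this accounts for the factor
  \<open>1/4\<close>.\<close>

lemma std_complex_gaussian_tail:
  assumes X: "std_complex_gaussian M X" and x: "0 \<le> x"
  shows "emeasure M {\<omega> \<in> space M. x < norm (X \<omega>)} \<le> ennreal (2 * sqrt 2 * exp (- (x\<^sup>2 / 4)))"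
proof -
  have d: "distributed M lborel (\<lambda>\<omega>. Re (X \<omega>)) (\<lambda>x. ennreal (normal_density 0 (sqrt (1/2)) x))"
    "distributed M lborel (\<lambda>\<omega>. Im (X \<omega>)) (\<lambda>x. ennreal (normal_density 0 (sqrt (1/2)) x))"
    using X by (auto simp: std_complex_gaussian_def)
  have [measurable]: "(\<lambda>\<omega>. Re (X \<omega>)) \<in> borel_measurable M" "(\<lambda>\<omega>. Im (X \<omega>)) \<in> borel_measurable M"
    using d[THEN distributed_measurable] by simp_all
  let ?A = "\<lambda>Y. {\<omega> \<in> space M. x\<^sup>2 / 2 < (Y \<omega>)\<^sup>2}"
  have "{\<omega> \<in> space M. x < norm (X \<omega>)} \<subseteq> ?A (\<lambda>\<omega>. Re (X \<omega>)) \<union> ?A (\<lambda>\<omega>. Im (X \<omega>))"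
  proof
    fix \<omega> assume \<omega>: "\<omega> \<in> {\<omega> \<in> space M. x < norm (X \<omega>)}"
    then have "x\<^sup>2 < (norm (X \<omega>))\<^sup>2" using x by (intro power_strict_mono) auto
    then show "\<omega> \<in> ?A (\<lambda>\<omega>. Re (X \<omega>)) \<union> ?A (\<lambda>\<omega>. Im (X \<omega>))" using \<omega> by (auto simp: cmod_power2)
  qed
  then have "emeasure M {\<omega> \<in> space M. x < norm (X \<omega>)} \<le> emeasure M (?A (\<lambda>\<omega>. Re (X \<omega>)) \<union> ?A (\<lambda>\<omega>. Im (X \<omega>)))"
    by (intro emeasure_mono) measurable
  also have "\<dots> \<le> emeasure M (?A (\<lambda>\<omega>. Re (X \<omega>))) + emeasure M (?A (\<lambda>\<omega>. Im (X \<omega>)))"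
    by (intro emeasure_subadditive) measurable
  also have "\<dots> \<le> ennreal (sqrt 2 * exp (- (x\<^sup>2 / 2 / 2))) + ennreal (sqrt 2 * exp (- (x\<^sup>2 / 2 / 2)))"
    by (intro add_mono normal_tail d)
  also have "\<dots> = ennreal (2 * sqrt 2 * exp (- (x\<^sup>2 / 4)))" by (subst ennreal_plus[symmetric]) auto
  finally show ?thesis .
qed

lemma exp_decay_power:
  fixes x :: real
  assumes "0 < x"
  shows "exp (- x) \<le> fact k / x ^ k"
proof -
  have "x ^ k / fact k \<le> exp x"
  proof -
    have "(\<Sum>n\<in>{k}. inverse (fact n) * x ^ n) \<le> (\<Sum>n. inverse (fact n) * x ^ n)"
      using assms by (intro sum_le_suminf summable_exp) auto
    then show ?thesis by (simp add: exp_def divide_inverse mult.commute)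
  qed
  then show ?thesis using assms by (simp add: exp_minus field_simps)
qed

text \<open>As the bracket power is at least 1, the exponent dominates \<open>C0\<close> plus that
  power, each over \<open>\<epsilon>\<close>. The first part is the target; the second makes the sum
  converge and, through a positive power of \<open>\<epsilon>\<close>, beats the constants. This is
  what the \<open>+ 1\<close> is for.\<close>

lemma gaussian_tail_sum:
  fixes \<theta> C0 :: real
  assumes \<theta>: "0 < \<theta>" and C0: "0 \<le> C0"
  shows "\<forall>\<^sub>F \<epsilon> in at_right 0. \<forall>S. finite S \<longrightarrow> (\<Sum>n\<in>S. 2 * sqrt 2 * exp (- ((C0 + 1) * japanese n powr \<theta> / \<epsilon>))) \<le> exp (- (C0 / \<epsilon>))"
proof -
  obtain CJ where CJ: "0 < CJ" "\<And>S. finite S \<Longrightarrow> (\<Sum>m\<in>S. japanese m powr (- 2)) \<le> CJ"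
    using japanese_powr_sum_bounded[of 2] by auto
  \<comment> \<open>The order \<open>k\<close> is large enough for the bound
    \<open>exp_decay_power\<close> to reach the summable exponent 2 after multiplication by
    \<open>\<theta>\<close>.\<close>
  obtain k :: nat where "2 / \<theta> + 1 < real k" using reals_Archimedean2 by blast
  then have "\<theta> * (2 / \<theta> + 1) < \<theta> * real k" using \<theta> by (intro mult_strict_left_mono)
  then have k2: "2 < \<theta> * real k" using \<theta> by (simp add: distrib_left)
  then have k: "2 \<le> \<theta> * real k" "1 \<le> k" by (auto intro!: Suc_leI gr0I)
  let ?c = "2 * sqrt 2 * fact k * CJ"
  have "((\<lambda>\<epsilon>. ?c * \<epsilon> ^ k) \<longlongrightarrow> ?c * 0 ^ k) (at_right 0)" by (intro tendsto_intros)
  then have "\<forall>\<^sub>F \<epsilon> in at_right 0. ?c * \<epsilon> ^ k < 1" using k(2) by (auto simp: order_tendsto_iff power_0_left)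
  then show ?thesis using eventually_at_right_less[of 0]
  proof eventually_elim
    case (elim \<epsilon>)
    have summand: "2 * sqrt 2 * exp (- ((C0 + 1) * japanese n powr \<theta> / \<epsilon>)) \<le> exp (- (C0 / \<epsilon>)) * (2 * sqrt 2 * fact k * \<epsilon> ^ k) * japanese n powr (- 2)" for n
    proof -
      let ?J = "japanese n powr \<theta>"
      have J: "1 \<le> ?J" using \<theta> japanese_ge_1[of n] by (simp add: ge_one_powr_ge_zero)
      have "exp (- ((C0 + 1) * ?J / \<epsilon>)) = exp (- (C0 * ?J / \<epsilon>)) * exp (- (?J / \<epsilon>))"
        by (simp add: exp_add[symmetric] add_divide_distrib distrib_right)
      also have "\<dots> \<le> exp (- (C0 / \<epsilon>)) * (fact k / (?J / \<epsilon>) ^ k)"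
      proof (intro mult_mono exp_decay_power)
        have "C0 * 1 \<le> C0 * ?J" using J C0 by (intro mult_left_mono)
        then show "exp (- (C0 * ?J / \<epsilon>)) \<le> exp (- (C0 / \<epsilon>))" using elim by (simp add: divide_right_mono)
        show "0 < ?J / \<epsilon>" using J elim by (intro divide_pos_pos) linarith+
      qed auto
      also have "fact k / (?J / \<epsilon>) ^ k = fact k * \<epsilon> ^ k * japanese n powr (- (\<theta> * real k))"
        using japanese_pos[of n] by (simp add: power_divide powr_realpow[symmetric] powr_powr powr_minus field_simps)
      also have "\<dots> \<le> fact k * \<epsilon> ^ k * japanese n powr (- 2)"
        using elim k japanese_ge_1[of n] by (intro mult_left_mono powr_mono) auto
      finally show ?thesis by (simp add: mult_ac)
    qed
    show ?case
    proof (intro allI impI)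
      fix S :: "int set" assume S: "finite S"
      have "(\<Sum>n\<in>S. 2 * sqrt 2 * exp (- ((C0 + 1) * japanese n powr \<theta> / \<epsilon>))) \<le> (\<Sum>n\<in>S. exp (- (C0 / \<epsilon>)) * (2 * sqrt 2 * fact k * \<epsilon> ^ k) * japanese n powr (- 2))"
        by (intro sum_mono summand)
      also have "\<dots> \<le> exp (- (C0 / \<epsilon>)) * (2 * sqrt 2 * fact k * \<epsilon> ^ k) * CJ"
        unfolding sum_distrib_left[symmetric] using elim by (intro mult_left_mono CJ S) auto
      also have "\<dots> = exp (- (C0 / \<epsilon>)) * (?c * \<epsilon> ^ k)" by simp
      also have "\<dots> \<le> exp (- (C0 / \<epsilon>))" using elim by (simp add: mult_left_le)
      finally show "(\<Sum>n\<in>S. 2 * sqrt 2 * exp (- ((C0 + 1) * japanese n powr \<theta> / \<epsilon>))) \<le> exp (- (C0 / \<epsilon>))" .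
    qed
  qed
qed

lemma emeasure_UN_int_le:
  fixes B :: "int \<Rightarrow> 'w set"
  assumes B: "\<And>n. B n \<in> sets M" and b: "\<And>n. emeasure M (B n) \<le> ennreal (b n)" "\<And>n. 0 \<le> b n"
    and sum: "\<And>S. finite S \<Longrightarrow> sum b S \<le> c"
  shows "emeasure M (\<Union>n. B n) \<le> ennreal c"
proof -
  have "(\<Union>n. B n) = (\<Union>k. B (int_decode k))" by (metis UN_extend_simps(10) surj_int_decode)
  also have "emeasure M \<dots> \<le> (\<Sum>k. emeasure M (B (int_decode k)))"
    using B by (intro emeasure_subadditive_countably) auto
  also have "\<dots> \<le> ennreal c"
  proof (rule suminf_le_const)
    fix N
    have "(\<Sum>k<N. emeasure M (B (int_decode k))) \<le> (\<Sum>k<N. ennreal (b (int_decode k)))" by (intro sum_mono b)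
    also have "\<dots> = ennreal (\<Sum>k<N. b (int_decode k))" by (rule sum_ennreal) (rule b)
    also have "(\<Sum>k<N. b (int_decode k)) = sum b (int_decode ` {..<N})"
      by (subst sum.reindex) (auto intro: inj_on_subset[OF inj_int_decode])
    also have "ennreal \<dots> \<le> ennreal c" by (intro ennreal_leI sum) simp
    finally show "(\<Sum>k<N. emeasure M (B (int_decode k))) \<le> ennreal c" .
  qed simp
  finally show ?thesis .
qed

lemma neg_ln_ge:
  assumes "p \<le> ennreal (exp (- x))"
  shows "ereal x \<le> neg_ln p"
proof (cases "p = 0")
  case False
  have "enn2real p \<le> exp (- x)" using assms by (simp add: enn2real_leI)
  moreover have "p < \<top>" using assms by (auto intro: le_less_trans)
  then have "0 < enn2real p" using False by (simp add: enn2real_positive_iff less_top zero_less_iff_neq_zero)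
  ultimately have "ln (enn2real p) \<le> - x" using ln_mono[of "enn2real p" "exp (- x)"] by simp
  then show ?thesis using False by (simp add: neg_ln_def)
qed (simp add: neg_ln_def)

theorem lemma3p3:
  fixes M :: "'w measure"
    and g :: "int \<Rightarrow> 'w \<Rightarrow> complex"
    and u :: "real \<Rightarrow> 'w \<Rightarrow> real \<Rightarrow> real \<Rightarrow> complex"
    and T :: "real \<Rightarrow> real"
    and \<theta> K :: real
  assumes "prob_space M"
    and "\<theta> > 0"
    and "prob_space.indep_vars M (\<lambda>_. borel) g UNIV"
    and "\<And>n. std_complex_gaussian M (g n)"
    and "\<And>\<epsilon>. \<epsilon> > 0 \<Longrightarrow>
           AE \<omega> in M. nls_solution \<epsilon> (initial_data \<theta> (\<lambda>n. g n \<omega>)) (u \<epsilon> \<omega>)"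
    and "\<And>\<epsilon>. \<epsilon> > 0 \<Longrightarrow> T \<epsilon> > 0"
    and "\<And>\<epsilon>. \<epsilon> > 0 \<Longrightarrow> T \<epsilon> \<le> K / \<epsilon>"
  shows "\<forall>\<^sub>F C\<^sub>0 :: real in at_top. \<exists>s>1/2. \<exists>\<delta>\<^sub>1>0. \<forall>\<^sub>F \<epsilon> in at_right 0.
           neg_ln (outer_measure_of M
             {\<omega> \<in> space M.
                Linf_Hs_norm s (T \<epsilon>) (\<lambda>t x. u \<epsilon> \<omega> t x - u_app \<theta> (\<lambda>n. g n \<omega>) \<epsilon> t x)
                  \<ge> ereal (\<epsilon> powr (- 1/2 + \<delta>\<^sub>1))})
           \<ge> ereal (C\<^sub>0 / \<epsilon>)"
proof (rule eventually_mono[OF eventually_ge_at_top[of 0]])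
  fix C0 :: real assume C0: "0 \<le> C0"
  \<comment> \<open>The scaling constant, with \<open>a = R\<^sup>2 * \<epsilon>\<close> further on.
    The 4 undoes the factor \<open>1/4\<close> in the Gaussian tail, and \<open>C0 + 1\<close> is
    the constant that \<open>gaussian_tail_sum\<close> asks for.\<close>
  define a where "a = 4 * (C0 + 1)"
  have a: "0 < a" using C0 by (simp add: a_def)
  \<comment> \<open>Bounds \<open>a * \<epsilon> * T \<epsilon>\<close>, the rescaled coupling times
    the time, and is positive whatever \<open>K\<close> is.\<close>
  define \<kappa> where "\<kappa> = a * (\<bar>K\<bar> + 1)"
  have \<kappa>: "0 < \<kappa>" using a by (simp add: \<kappa>_def add_nonneg_pos)
  obtain s C \<rho> where s: "1/2 < s" and C: "0 < C" and \<rho>: "0 < \<rho>" and close: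
    "\<And>eps R T \<gamma> u. \<lbrakk>nls_solution eps (initial_data \<theta> \<gamma>) u; 0 < R; (eps * R)\<^sup>2 \<le> \<rho>; 0 < T; (eps * R)\<^sup>2 * T \<le> \<kappa>;
       \<And>n. norm (\<gamma> n) \<le> R * japanese n powr (\<theta> / 2)\<rbrakk> \<Longrightarrow>
       Linf_Hs_norm s T (\<lambda>t x. u t x - u_app \<theta> \<gamma> eps t x) \<le> ereal (C * R * (eps * R)\<^sup>2)"
    using nls_u_app_close[OF assms(2) \<kappa>] by blast
  have ev1: "\<forall>\<^sub>F \<epsilon> in at_right 0. a * \<epsilon> < \<rho>"
  proof -
    have "((\<lambda>\<epsilon>. a * \<epsilon>) \<longlongrightarrow> a * 0) (at_right 0)" by (intro tendsto_intros)
    then show ?thesis using \<rho> by (auto simp: order_tendsto_iff)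
  qed
  have ev2: "\<forall>\<^sub>F \<epsilon> in at_right 0. C * sqrt a * a * sqrt \<epsilon> < 1"
  proof -
    have "((\<lambda>\<epsilon>. C * sqrt a * a * sqrt \<epsilon>) \<longlongrightarrow> C * sqrt a * a * sqrt 0) (at_right 0)" by (intro tendsto_intros)
    then show ?thesis by (auto simp: order_tendsto_iff)
  qed
  \<comment> \<open>The choice \<open>\<delta>\<^sub>1 = 1/2\<close> makes the threshold the
    constant 1, while on the good event the error is of order
    \<open>sqrt \<epsilon>\<close>.\<close>
  have "\<forall>\<^sub>F \<epsilon> in at_right 0. neg_ln (outer_measure_of M
             {\<omega> \<in> space M.
                Linf_Hs_norm s (T \<epsilon>) (\<lambda>t x. u \<epsilon> \<omega> t x - u_app \<theta> (\<lambda>n. g n \<omega>) \<epsilon> t x)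
                  \<ge> ereal (\<epsilon> powr (- 1/2 + 1/2))})
           \<ge> ereal (C0 / \<epsilon>)"
    using eventually_at_right_less[of 0] ev1 ev2 gaussian_tail_sum[OF assms(2) C0]
  proof eventually_elim
    case (elim \<epsilon>)
    \<comment> \<open>The amplitude granted to the data: large enough for its complement to have
      probability at most \<open>exp (- (C0 / \<epsilon>))\<close>, small enough for the rescaled
      coupling \<open>a * \<epsilon>\<close> to tend to 0.\<close>
    define R where "R = sqrt (a / \<epsilon>)"
    have R: "0 < R" "R\<^sup>2 = a / \<epsilon>" using a elim by (auto simp: R_def)
    have eR: "(\<epsilon> * R)\<^sup>2 = a * \<epsilon>"
      using elim by (simp add: power_mult_distrib R(2)) (simp add: power2_eq_square)
    have CR: "C * R * (\<epsilon> * R)\<^sup>2 < 1"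
    proof -
      have "R * \<epsilon> = sqrt a * sqrt \<epsilon>"
        using elim by (simp add: R_def real_sqrt_divide real_div_sqrt field_simps)
      then have "C * R * (\<epsilon> * R)\<^sup>2 = C * sqrt a * a * sqrt \<epsilon>" unfolding eR by (simp add: mult_ac)
      then show ?thesis using elim(3) by (simp only:)
    qed
    have small: "(\<epsilon> * R)\<^sup>2 \<le> \<rho>" unfolding eR using elim by simp
    have T: "(\<epsilon> * R)\<^sup>2 * T \<epsilon> \<le> \<kappa>"
    proof -
      have "(\<epsilon> * R)\<^sup>2 * T \<epsilon> \<le> a * \<epsilon> * (K / \<epsilon>)"
        unfolding eR using elim a assms(7) by (intro mult_left_mono) auto
      also have "\<dots> = a * K" using elim by simp
      also have "\<dots> \<le> \<kappa>" unfolding \<kappa>_def using a by (intro mult_left_mono) auto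
      finally show ?thesis .
    qed
    \<comment> \<open>A measurable null set around the failures of the equation. Together with the
      tail events it gives a measurable cover of the bad event, whose own measurability is thereby
      left open; the outer measure is monotone.\<close>
    obtain N where N: "{\<omega> \<in> space M. \<not> nls_solution \<epsilon> (initial_data \<theta> (\<lambda>n. g n \<omega>)) (u \<epsilon> \<omega>)} \<subseteq> N" "N \<in> sets M" "emeasure M N = 0"
      using AE_E[OF assms(5)[of \<epsilon>]] elim by metis
    define B where "B n = {\<omega> \<in> space M. R * japanese n powr (\<theta> / 2) < norm (g n \<omega>)}" for n
    have [measurable]: "g n \<in> borel_measurable M" for n
      using assms(3) unfolding prob_space.indep_vars_def[OF assms(1)] by auto
    have B: "B n \<in> sets M" for n unfolding B_def by measurable
    have "emeasure M (B n) \<le> ennreal (2 * sqrt 2 * exp (- ((C0 + 1) * japanese n powr \<theta> / \<epsilon>)))" for n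
    proof -
      have "(R * japanese n powr (\<theta> / 2))\<^sup>2 = a / \<epsilon> * japanese n powr \<theta>"
        unfolding power_mult_distrib R(2) by (simp add: power2_eq_square powr_add[symmetric])
      moreover have "a / 4 = C0 + 1" by (simp add: a_def)
      then have "a / \<epsilon> * japanese n powr \<theta> / 4 = (C0 + 1) * japanese n powr \<theta> / \<epsilon>"
        by (metis times_divide_eq_left divide_divide_eq_left mult.commute)
      ultimately have "(R * japanese n powr (\<theta> / 2))\<^sup>2 / 4 = (C0 + 1) * japanese n powr \<theta> / \<epsilon>" by simp
      then show ?thesis unfolding B_def
        using std_complex_gaussian_tail[OF assms(4), of "R * japanese n powr (\<theta> / 2)" n] R by simp
    qed
    then have tail: "emeasure M (\<Union>n. B n) \<le> ennreal (exp (- (C0 / \<epsilon>)))"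
      using elim by (intro emeasure_UN_int_le[OF B]) auto
    have "{\<omega> \<in> space M. Linf_Hs_norm s (T \<epsilon>) (\<lambda>t x. u \<epsilon> \<omega> t x - u_app \<theta> (\<lambda>n. g n \<omega>) \<epsilon> t x)
                  \<ge> ereal (\<epsilon> powr (- 1/2 + 1/2))} \<subseteq> N \<union> (\<Union>n. B n)"
    proof
      fix \<omega> assume \<omega>: "\<omega> \<in> {\<omega> \<in> space M. Linf_Hs_norm s (T \<epsilon>) (\<lambda>t x. u \<epsilon> \<omega> t x - u_app \<theta> (\<lambda>n. g n \<omega>) \<epsilon> t x)
                  \<ge> ereal (\<epsilon> powr (- 1/2 + 1/2))}"
      show "\<omega> \<in> N \<union> (\<Union>n. B n)"
      proof (rule ccontr)
        assume c: "\<omega> \<notin> N \<union> (\<Union>n. B n)"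
        have sol: "nls_solution \<epsilon> (initial_data \<theta> (\<lambda>n. g n \<omega>)) (u \<epsilon> \<omega>)" using c \<omega> N(1) by auto
        have "norm (g n \<omega>) \<le> R * japanese n powr (\<theta> / 2)" for n using c \<omega> by (auto simp: B_def not_less)
        then have "Linf_Hs_norm s (T \<epsilon>) (\<lambda>t x. u \<epsilon> \<omega> t x - u_app \<theta> (\<lambda>n. g n \<omega>) \<epsilon> t x) \<le> ereal (C * R * (\<epsilon> * R)\<^sup>2)"
          using elim by (intro close[OF sol R(1) small assms(6) T])
        also have "\<dots> < ereal (\<epsilon> powr (- 1/2 + 1/2))" using CR elim by simp
        finally show False using \<omega> by (auto simp only: mem_Collect_eq not_le[symmetric])
      qed
    qed
    then have sub: "outer_measure_of M {\<omega> \<in> space M. Linf_Hs_norm s (T \<epsilon>) (\<lambda>t x. u \<epsilon> \<omega> t x - u_app \<theta> (\<lambda>n. g n \<omega>) \<epsilon> t x)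
                  \<ge> ereal (\<epsilon> powr (- 1/2 + 1/2))} \<le> outer_measure_of M (N \<union> (\<Union>n. B n))"
      by (rule outer_measure_of_mono)
    have "outer_measure_of M (N \<union> (\<Union>n. B n)) \<le> emeasure M N + emeasure M (\<Union>n. B n)"
    proof -
      have U: "(\<Union>n. B n) \<in> sets M" using B by (intro sets.countable_UN) auto
      then show ?thesis using N(2) by (simp add: emeasure_subadditive)
    qed
    then have "outer_measure_of M (N \<union> (\<Union>n. B n)) \<le> ennreal (exp (- (C0 / \<epsilon>)))"
      using tail unfolding N(3) add_0 by (rule order_trans)
    with sub show ?case by (rule neg_ln_ge[OF order_trans])
  qed
  then show "\<exists>s>1/2. \<exists>\<delta>\<^sub>1>0. \<forall>\<^sub>F \<epsilon> in at_right 0.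
           neg_ln (outer_measure_of M
             {\<omega> \<in> space M.
                Linf_Hs_norm s (T \<epsilon>) (\<lambda>t x. u \<epsilon> \<omega> t x - u_app \<theta> (\<lambda>n. g n \<omega>) \<epsilon> t x)
                  \<ge> ereal (\<epsilon> powr (- 1/2 + \<delta>\<^sub>1))})
           \<ge> ereal (C0 / \<epsilon>)"
    using s half_gt_zero[OF zero_less_one] by blast
qed

end
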